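(* Let $\gamma>2$ and let $V\in L^2_{\mathrm{loc}}(\mathbb{R})$ be complex valued with $\operatorname{Re}V\ge0$ and, for some $c>0$, $|V(x)|+1\ge c\langle x\rangle^\gamma$ for a.e. $x\in\mathbb{R}$. Let $w(x)=\exp(\langle x\rangle^\alpha)$ or $w(x)=\exp(-\langle x\rangle^\alpha)$, $x\in\mathbb{R}$, with $0<\alpha<1+\frac\gamma2$. Assume there exists $\Phi:\mathbb{R}\to[-1,1]$ such that (a) $\Phi'\in L^1_{\mathrm{loc}}(\mathbb{R})$ and for every $\varepsilon>0$ there is $C_{\Phi,\varepsilon}\ge0$ with $|\Phi'|\le\varepsilon|V|^{1/2}+C_{\Phi,\varepsilon}$ a.e.; (b) there is $0\le R\in L^1_{\mathrm{loc}}(\mathbb{R})$ with $\Phi\operatorname{Im}V\ge|\operatorname{Im}V|-R$ a.e., and for every $\varepsilon>0$ there is $C_{R,\varepsilon}\ge0$ such that for all $f\in C_0^\infty(\mathbb{R})$ $$\|R^{1/2}f\|_w^2\le\varepsilon\|f'\|_w^2+\varepsilon\||V|^{1/2}f\|_w^2+C_{R,\varepsilon}\|f\|_w^2.$$ Then the operator $T_w=-\partial_x^2+V$ in $L^2_w(\mathbb{R})$ with domain $\operatorname{Dom}(T_w)=\{f\in\mathcal{V}_{w,0}:-f''+Vf\in L^2_w(\mathbb{R})\}$ is densely defined with compact resolvent, and the linear span of its root functions (generalised eigenfunctions) is dense in $L^2_w(\mathbb{R})$.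
   Context: $\langle x\rangle=(1+|x|^2)^{1/2}$. $L^2_w(\mathbb{R})$ is the Hilbert space of measurable $f$ with $\|f\|_w^2=\int_{\mathbb{R}}|f|^2w\,dx<\infty$. $\mathcal{V}_{w,0}$ is the closure of $C_0^\infty(\mathbb{R})$ in the Hilbert space $\mathcal{V}_w=\{f\in L^2_w(\mathbb{R}):f'\in L^1_{\mathrm{loc}}(\mathbb{R}),\ |V|^{1/2}|f|+|f'|\in L^2_w(\mathbb{R})\}$ with norm $\|f\|_{\mathcal{V}_w}^2=\|f'\|_w^2+\||V|^{1/2}f\|_w^2+\|f\|_w^2$. The action of $T_w$ is in the sense of distributions. Root functions are the nonzero elements of $\ker(T_w-\lambda)^k$, $k\in\mathbb{N}$, $\lambda$ an eigenvalue of $T_w$. *)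

theory Defs
  imports "HOL-Analysis.Analysis"
begin

text \<open>
  Elements of function spaces are represented by functions on the real line; all notions below are
  insensitive to changes on Lebesgue null sets, and equality of classes is written out as
  equality almost everywhere.
\<close>

definition japanese_bracket :: "real \<Rightarrow> real" where
  "japanese_bracket x = sqrt (1 + x\<^sup>2)"

definition vderiv :: "(real \<Rightarrow> 'a::real_normed_vector) \<Rightarrow> real \<Rightarrow> 'a" where
  "vderiv f = (\<lambda>x. vector_derivative f (at x))"

definition test_functions :: "(real \<Rightarrow> 'a::real_normed_vector) set" where
  "test_functions =
     {f. (\<forall>k. (vderiv ^^ k) f differentiable_on UNIV) \<and> compact (closure {x. f x \<noteq> 0})}"

definition locally_integrable ::
    "(real \<Rightarrow> 'a::{banach, second_countable_topology}) \<Rightarrow> bool" where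
  "locally_integrable f \<longleftrightarrow> (\<forall>K. compact K \<longrightarrow> set_integrable lebesgue K f)"

definition locally_square_integrable ::
    "(real \<Rightarrow> 'a::{banach, second_countable_topology}) \<Rightarrow> bool" where
  "locally_square_integrable f \<longleftrightarrow>
     f \<in> borel_measurable lebesgue \<and> locally_integrable (\<lambda>x. (norm (f x))\<^sup>2)"

text \<open>\<open>g\<close> is the distributional derivative of \<open>f\<close>, and both are locally integrable.\<close>

definition weak_derivative ::
    "(real \<Rightarrow> 'a::{real_normed_field, banach, second_countable_topology}) \<Rightarrow> (real \<Rightarrow> 'a) \<Rightarrow> bool" where
  "weak_derivative f g \<longleftrightarrow>
     locally_integrable f \<and> locally_integrable g \<and>
     (\<forall>\<phi>\<in>test_functions.
        (LINT x|lebesgue. f x * vderiv \<phi> x) = - (LINT x|lebesgue. g x * \<phi> x))"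

text \<open>The weak derivative is unique up to a null set, so that the choice does not matter
  inside integrals.\<close>

definition wderiv ::
    "(real \<Rightarrow> 'a::{real_normed_field, banach, second_countable_topology}) \<Rightarrow> real \<Rightarrow> 'a" where
  "wderiv f = (SOME g. weak_derivative f g)"


definition L2w :: "(real \<Rightarrow> real) \<Rightarrow> (real \<Rightarrow> 'a::{banach, second_countable_topology}) set" where
  "L2w w = {f \<in> borel_measurable lebesgue. integrable lebesgue (\<lambda>x. (norm (f x))\<^sup>2 * w x)}"

text \<open>Only meaningful for members of \<open>L2w w\<close>: a divergent integral is \<open>0\<close> by convention.\<close>

definition normw :: "(real \<Rightarrow> real) \<Rightarrow> (real \<Rightarrow> 'a::{banach, second_countable_topology}) \<Rightarrow> real" where
  "normw w f = sqrt (LINT x|lebesgue. (norm (f x))\<^sup>2 * w x)"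

definition Vw :: "(real \<Rightarrow> real) \<Rightarrow> (real \<Rightarrow> complex) \<Rightarrow> (real \<Rightarrow> complex) set" where
  "Vw w V = {f \<in> L2w w. \<exists>f'. weak_derivative f f' \<and>
     (\<lambda>x. sqrt (cmod (V x)) * cmod (f x) + cmod (f' x)) \<in> L2w w}"

definition norm_Vw :: "(real \<Rightarrow> real) \<Rightarrow> (real \<Rightarrow> complex) \<Rightarrow> (real \<Rightarrow> complex) \<Rightarrow> real" where
  "norm_Vw w V f =
     sqrt ((normw w (wderiv f))\<^sup>2 + (normw w (\<lambda>x. sqrt (cmod (V x)) *\<^sub>R f x))\<^sup>2 + (normw w f)\<^sup>2)"

definition Vw0 :: "(real \<Rightarrow> real) \<Rightarrow> (real \<Rightarrow> complex) \<Rightarrow> (real \<Rightarrow> complex) set" where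
  "Vw0 w V = {f \<in> Vw w V. \<forall>\<epsilon>>0. \<exists>\<phi>\<in>test_functions. norm_Vw w V (\<lambda>x. f x - \<phi> x) < \<epsilon>}"

text \<open>The identity \<open>- f'' + V f = g\<close> of distributions.\<close>

definition schroedinger_eq ::
    "(real \<Rightarrow> complex) \<Rightarrow> (real \<Rightarrow> complex) \<Rightarrow> (real \<Rightarrow> complex) \<Rightarrow> bool" where
  "schroedinger_eq V f g \<longleftrightarrow>
     (\<forall>\<phi>\<in>test_functions.
        - (LINT x|lebesgue. f x * vderiv (vderiv \<phi>) x) + (LINT x|lebesgue. V x * f x * \<phi> x)
          = (LINT x|lebesgue. g x * \<phi> x))"


text \<open>
  An operator in \<open>L2w w\<close> is given by its graph, a relation on functions containing all
  representatives of its pairs.  The domain of the operator is the \<open>Domain\<close> of the relation.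
\<close>

type_synonym op_graph = "((real \<Rightarrow> complex) \<times> (real \<Rightarrow> complex)) set"

definition schroedinger_op :: "(real \<Rightarrow> real) \<Rightarrow> (real \<Rightarrow> complex) \<Rightarrow> op_graph" where
  "schroedinger_op w V = {(f, g). f \<in> Vw0 w V \<and> g \<in> L2w w \<and> schroedinger_eq V f g}"

definition op_shift :: "op_graph \<Rightarrow> complex \<Rightarrow> op_graph" where
  "op_shift T z = {(f, \<lambda>x. g x - z * f x) | f g. (f, g) \<in> T}"

definition dense_in_L2w :: "(real \<Rightarrow> real) \<Rightarrow> (real \<Rightarrow> complex) set \<Rightarrow> bool" where
  "dense_in_L2w w S \<longleftrightarrow>
     S \<subseteq> L2w w \<and> (\<forall>f\<in>L2w w. \<forall>\<epsilon>>0. \<exists>g\<in>S. normw w (\<lambda>x. f x - g x) < \<epsilon>)"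

definition resolvent :: "op_graph \<Rightarrow> complex \<Rightarrow> op_graph" where
  "resolvent T z = (op_shift T z)\<inverse>"

text \<open>\<open>T - z\<close> maps its domain bijectively onto \<open>L2w w\<close>, with bounded inverse.\<close>

definition resolvent_set :: "(real \<Rightarrow> real) \<Rightarrow> op_graph \<Rightarrow> complex set" where
  "resolvent_set w T = {z.
     Domain (resolvent T z) = L2w w \<and>
     (\<forall>g f h. (g, f) \<in> resolvent T z \<and> (g, h) \<in> resolvent T z \<longrightarrow> (AE x in lebesgue. f x = h x)) \<and>
     (\<exists>C. \<forall>(g, f)\<in>resolvent T z. normw w f \<le> C * normw w g)}"

text \<open>Images of bounded sequences have convergent subsequences.\<close>

definition compact_op :: "(real \<Rightarrow> real) \<Rightarrow> op_graph \<Rightarrow> bool" where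
  "compact_op w A \<longleftrightarrow>
     (\<forall>g f :: nat \<Rightarrow> real \<Rightarrow> complex. \<forall>C.
        (\<forall>n. (g n, f n) \<in> A \<and> normw w (g n) \<le> C) \<longrightarrow>
        (\<exists>h\<in>L2w w. \<exists>r :: nat \<Rightarrow> nat. strict_mono r \<and>
           (\<lambda>n. normw w (\<lambda>x. f (r n) x - h x)) \<longlonglongrightarrow> 0))"

definition has_compact_resolvent :: "(real \<Rightarrow> real) \<Rightarrow> op_graph \<Rightarrow> bool" where
  "has_compact_resolvent w T \<longleftrightarrow>
     resolvent_set w T \<noteq> {} \<and> (\<forall>z\<in>resolvent_set w T. compact_op w (resolvent T z))"

definition eigenvalues :: "op_graph \<Rightarrow> complex set" where
  "eigenvalues T = {z. \<exists>f h. (f, h) \<in> op_shift T z \<and>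
     \<not> (AE x in lebesgue. f x = 0) \<and> (AE x in lebesgue. h x = 0)}"

definition root_functions :: "op_graph \<Rightarrow> (real \<Rightarrow> complex) set" where
  "root_functions T = {f. \<not> (AE x in lebesgue. f x = 0) \<and>
     (\<exists>z\<in>eigenvalues T. \<exists>k h. (f, h) \<in> op_shift T z ^^ k \<and> (AE x in lebesgue. h x = 0))}"

definition linear_span :: "(real \<Rightarrow> complex) set \<Rightarrow> (real \<Rightarrow> complex) set" where
  "linear_span S = {(\<lambda>x. \<Sum>i<n. a i * f i x) | (n :: nat) a f. \<forall>i<n. f i \<in> S}"

end

theory Submission
  imports Defs "HOL-Complex_Analysis.Complex_Analysis" "HOL-Library.Diagonal_Subsequence"
    "HOL-Real_Asymp.Real_Asymp" "Jordan_Normal_Form.Determinant"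
begin

text \<open>Conjugation by the square root of \<open>w\<close> turns the problem into one in \<open>L\<^sup>2\<close>. Multiplying test functions by
 \<open>1 + i \<delta> \<Phi>\<close> makes the form of \<open>T\<^sub>w + z\<close> coercive for large \<open>z\<close>, so Lax-Milgram yields the resolvent \<open>K\<close>. Piecewise
 constant approximation on \<open>N\<close> intervals gives \<open>\<bar>(K x, y)\<bar> \<le> C N\<^sup>-\<^sup>q \<bar>x\<bar> \<bar>y\<bar>\<close> for \<open>x\<close>, \<open>y\<close> orthogonal to an \<open>N\<close>-dimensional
 space, with \<open>q = 2 \<gamma> / (\<gamma> + 2) > 1\<close>; in particular \<open>K\<close> is compact. If \<open>n\<close> is orthogonal to all root functions, then with
 \<open>A\<close> the adjoint of \<open>K\<close> the function \<open>(1 - z A)\<^sup>-\<^sup>1 n\<close> is entire, of growth order below what the sector around the positive axis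
 tolerates, and bounded outside that sector because of the multiplier. Phragmen-Lindelof and
 Liouville make it constant, so that \<open>A n = 0\<close> and \<open>n = 0\<close>.\<close>

section \<open>Compact maps on Hilbert spaces\<close>

text \<open>Only the half-plane condition on \<open>Re V\<close> is available, so the resolvent is
  controlled outside sectors whose half-angle \<open>b\<close> is slightly above pi/2. An entire
  function bounded there is constant if its order is below pi/(2 b), that is, essentially below 1.
  The order obtained is 1/q, and q > 1 says exactly \<gamma> > 2. The multiplier plays two competing
  roles: \<delta> > 0 is there because the real part of the plain form does not see
  \<open>Im V\<close>, whereas \<open>b\<close> close to pi/2 demands a small \<delta>. Hence
  \<delta> is fixed after \<open>b\<close>, and the shift \<open>z\<close> after \<delta>. The
  weight enters through its logarithmic derivative, of the size of the bracket to the power \<alpha>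
  - 1; as \<alpha> - 1 < \<gamma>/2, it is below \<epsilon> |V|^(1/2) + C for every \<epsilon>, so
  with either sign in the exponent it is a small perturbation of the form. The exponent q is twice
  the exponent q/2 with which the form domain is approximated in L2: that one estimate is used once
  for each argument of (K x, y).\<close>

lemma Riesz_on_subspace:
 fixes S :: "'a::{real_inner,complete_space} set"
 assumes S: "closed S" "subspace S" and f: "bounded_linear f"
 shows "\<exists>u\<in>S. \<forall>v\<in>S. f v = inner u v"
proof -
 interpret f: bounded_linear f by fact
 obtain C where C: "\<And>x. norm (f x)\<le>norm x * C" "C>0" using f.pos_bounded by blast
 \<comment> \<open>The Ritz functional: its minimiser over \<open>S\<close> represents
   \<open>f\<close>, the first-order condition being the identity wanted.\<close>
 define J where "J v = (norm v)\<^sup>2-2 * f v" for v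
 have Jlow: "J v\<ge>- C\<^sup>2" for v
 proof -
  have "f v\<le>norm v * C" using C(1)[of v] by (simp add: abs_le_iff)
  moreover have "(norm v-C)\<^sup>2\<ge>0" by simp
  ultimately show ?thesis unfolding J_def by (simp add: power2_diff algebra_simps)
 qed
 have ne: "S\<noteq>{}" using S(2) subspace_0 by blast
 have bdd: "bdd_below (J ` S)" using Jlow by (intro bdd_belowI2)
 define m where "m = Inf (J ` S)"
 have m: "m\<le>J v" if "v\<in>S" for v unfolding m_def using bdd that by (intro cInf_lower) auto
 have "\<exists>v\<in>S. J v<m + 1/real (Suc n)" for n
 proof -
  have "\<exists>y\<in>J ` S. y<m + 1/real (Suc n)" unfolding m_def by (rule cInf_lessD) (use ne in auto)
  thus ?thesis by auto
 qed
 then obtain v where v: "\<And>n. v n\<in>S" "\<And>n. J (v n)<m + 1/real (Suc n)" by metis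
 \<comment> \<open>The parallelogram identity turns near-minimality at two points into closeness,
   since their midpoint lies in \<open>S\<close> and costs at least \<open>m\<close>.\<close>
 have par: "(norm (x-y))\<^sup>2\<le>2 * (J x + J y-2 * m)" if "x\<in>S" "y\<in>S" for x y
 proof -
  have "(1/2) *\<^sub>R (x + y)\<in>S" using S(2) that by (simp add: subspace_add subspace_scale)
  from m[OF this] have "m\<le>(norm ((1/2) *\<^sub>R (x + y)))\<^sup>2-(f x + f y)" by (simp add: J_def f.scaleR f.add add_divide_distrib del: norm_scaleR)
  also have "(norm ((1/2) *\<^sub>R (x + y)))\<^sup>2 = (norm (x+y))\<^sup>2/4" by (simp add: power_divide)
  finally have "4 * m\<le>(norm (x+y))\<^sup>2-4 * (f x + f y)" by simp
  moreover have "(norm (x+y))\<^sup>2 + (norm (x-y))\<^sup>2 = 2 * (norm x)\<^sup>2 + 2 * (norm y)\<^sup>2" by (simp add: power2_norm_eq_inner inner_diff inner_add inner_commute algebra_simps)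
  ultimately show ?thesis unfolding J_def by (simp add: algebra_simps)
 qed
 have "Cauchy v"
 proof (rule CauchyI)
  fix e :: real assume e: "e>0"
  obtain M :: nat where M: "4/e\<^sup>2<real M" using reals_Archimedean2 by blast
  show "\<exists>M. \<forall>m\<ge>M. \<forall>n\<ge>M. norm (v m-v n)<e"
  proof (intro exI allI impI)
   fix i j assume ij: "i\<ge>M" "j\<ge>M"
   have M0: "real M>0" using M e by (smt (verit) divide_pos_pos zero_less_power)
   have "(norm (v i-v j))\<^sup>2\<le>2 * (J (v i) + J (v j)-2 * m)" by (rule par) (auto simp: v)
   also have "\<dots><2 * (1/real (Suc i) + 1/real (Suc j))" using v(2)[of i] v(2)[of j] by simp
   also have "\<dots>\<le>2 * (1/real M + 1/real M)" using ij M0 by (intro mult_left_mono add_mono divide_left_mono) auto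
   also have "\<dots><e\<^sup>2" using M e M0 by (simp add: field_simps)
   finally show "norm (v i-v j)<e" using e by (simp add: power_less_imp_less_base)
  qed
 qed
 then obtain u where u: "v\<longlonglongrightarrow>u" using Cauchy_convergent convergent_def by blast
 have uS: "u\<in>S" using S(1) u v(1) closed_sequentially by blast
 have "(\<lambda>n. J (v n))\<longlonglongrightarrow>J u" unfolding J_def by (intro tendsto_intros u f.tendsto)
 moreover have "(\<lambda>n. m + 1/real (Suc n))\<longlonglongrightarrow>m + 0" using LIMSEQ_inverse_real_of_nat by (intro tendsto_intros) (simp add: inverse_eq_divide)
 ultimately have Ju: "J u\<le>m" using v(2) by (intro LIMSEQ_le[of "\<lambda>n. J (v n)"]) (auto intro: less_imp_le)
 have "f x = inner u x" if x: "x\<in>S" for x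
 proof -
  define d where "d = inner u x-f x"
  \<comment> \<open>Minimality along the line \<open>u + t x\<close>: a quadratic in
    \<open>t\<close> without constant term that is never negative, so its linear coefficient must
    vanish.\<close>
  have *: "0\<le>2 * t * d + t\<^sup>2 * (norm x)\<^sup>2" for t
  proof -
   have "u + t *\<^sub>R x\<in>S" using S(2) uS x by (simp add: subspace_add subspace_scale)
   from m[OF this] Ju have "J u\<le>J (u + t *\<^sub>R x)" by simp
   thus ?thesis unfolding J_def d_def by (simp add: power2_norm_eq_inner inner_add inner_commute f.add f.scaleR algebra_simps power2_eq_square[of t])
  qed
  have "d = 0"
  proof (rule ccontr)
   assume "d\<noteq>0"
   \<comment> \<open>The summand 1 keeps \<open>q\<close> positive also for
     \<open>x = 0\<close>.\<close>
   define q where "q = (norm x)\<^sup>2 + 1"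
   have q: "q>0" unfolding q_def by (simp add: add_nonneg_pos)
   have "0\<le>2 * (- d/q) * d + (- d/q)\<^sup>2 * (norm x)\<^sup>2" by (rule *)
   also have "\<dots>\<le>2 * (- d/q) * d + (- d/q)\<^sup>2 * q" by (intro add_left_mono mult_left_mono) (auto simp: q_def)
   also have "\<dots> =-d\<^sup>2/q" using q by (simp add: field_simps power2_eq_square)
   also have "\<dots><0" using \<open>d \<noteq> 0\<close> q by simp
   finally show False by simp
  qed
  thus ?thesis by (simp add: d_def)
 qed
 thus ?thesis using uS by blast
qed

definition proj :: "'a::{real_inner,complete_space} set\<Rightarrow>'a\<Rightarrow>'a" where
 "proj S x = (SOME u. u\<in>S\<and>(\<forall>v\<in>S. inner (x-u) v = 0))"

lemma proj_props:
 fixes S :: "'a::{real_inner,complete_space} set"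
 assumes S: "closed S" "subspace S"
 shows "proj S x\<in>S" "v\<in>S\<Longrightarrow>inner (x-proj S x) v = 0"
proof -
 have "\<exists>u\<in>S. \<forall>v\<in>S. inner x v = inner u v" by (rule Riesz_on_subspace[OF S bounded_linear_inner_right])
 hence "\<exists>u. u\<in>S\<and>(\<forall>v\<in>S. inner (x-u) v = 0)" by (auto simp: inner_diff)
 from someI_ex[OF this] show "proj S x\<in>S" "v\<in>S\<Longrightarrow>inner (x-proj S x) v = 0" unfolding proj_def by auto
qed

lemma proj_unique:
 fixes S :: "'a::{real_inner,complete_space} set"
 assumes S: "closed S" "subspace S" and u: "u\<in>S" "\<And>v. v\<in>S\<Longrightarrow>inner (x-u) v = 0"
 shows "proj S x = u"
proof -
 have "u-proj S x\<in>S" using proj_props[OF S] u S(2) subspace_diff by blast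
 hence "inner (x-proj S x) (u-proj S x) = 0" "inner (x-u) (u-proj S x) = 0" using proj_props[OF S] u by auto
 hence "inner (u-proj S x) (u-proj S x) = 0" by (simp add: inner_diff)
 thus ?thesis by simp
qed

lemma proj_id: "closed S\<Longrightarrow>subspace S\<Longrightarrow>u\<in>S\<Longrightarrow>proj S u = u" by (rule proj_unique) auto

lemma norm_proj:
 assumes S: "closed S" "subspace S"
 shows "(norm x)\<^sup>2 = (norm (proj S x))\<^sup>2 + (norm (x-proj S x))\<^sup>2"
proof -
 have "inner (x-proj S x) (proj S x) = 0" using proj_props[OF S] by blast
 thus ?thesis by (simp add: power2_norm_eq_inner inner_diff inner_commute algebra_simps)
qed

lemma norm_proj_le: "closed S\<Longrightarrow>subspace S\<Longrightarrow>norm (proj S x)\<le>norm x" using norm_proj[of S x] by (smt (verit) norm_ge_zero power2_le_imp_le zero_le_power2)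

lemma bounded_linear_proj:
 assumes S: "closed S" "subspace S"
 shows "bounded_linear (proj S)"
proof (rule bounded_linear_intro[where K=1])
 fix x y r
 note p = proj_props[OF S]
 show "proj S (x + y) = proj S x + proj S y"
 proof (rule proj_unique[OF S])
  show "proj S x + proj S y\<in>S" using p S(2) subspace_add by blast
  fix v assume "v\<in>S"
  hence "inner (x-proj S x) v = 0" "inner (y-proj S y) v = 0" using p by auto
  thus "inner (x + y-(proj S x + proj S y)) v = 0" by (simp add: inner_diff inner_add)
 qed
 show "proj S (r *\<^sub>R x) = r *\<^sub>R proj S x"
 proof (rule proj_unique[OF S])
  show "r *\<^sub>R proj S x\<in>S" using p S(2) subspace_scale by blast
  fix v assume "v\<in>S"
  hence "inner (x-proj S x) v = 0" using p by auto
  thus "inner (r *\<^sub>R x-r *\<^sub>R proj S x) v = 0" by (simp add: inner_diff)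
 qed
 show "norm (proj S x)\<le>norm x * 1" using norm_proj_le[OF S] by simp
qed

text \<open>With \<open>A\<close> representing the form, \<open>u - \<rho> (A u - r)\<close> is a
  contraction of \<open>S\<close>; the value \<open>\<rho> = c/C\<^sup>2\<close> minimises the
  factor \<open>1 - 2 \<rho> c + \<rho>\<^sup>2 C\<^sup>2\<close>. Everything is real bilinear: the
  complex form will enter through its real part, and complex linearity of the solution map is
  recovered from invariance under multiplication by \<i>.\<close>

theorem Lax_Milgram_on_subspace:
 fixes S :: "'a::{real_inner,complete_space} set"
 assumes S: "closed S" "subspace S" and B: "bounded_bilinear B" and c: "c>0"
  and coer: "\<And>u. u\<in>S\<Longrightarrow>B u u\<ge>c * (norm u)\<^sup>2" and f: "bounded_linear f"
 shows "\<exists>u\<in>S. \<forall>v\<in>S. B u v = f v"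
proof -
 interpret B: bounded_bilinear B by fact
 obtain C0 where C0: "\<And>x y. norm (B x y)\<le>norm x * norm y * C0" using B.bounded by blast
 \<comment> \<open>At least \<open>c\<close>, so that the contraction factor is the square root of a
   nonnegative number.\<close>
 define C where "C = max C0 (max c 1)"
 have C: "norm (B x y)\<le>norm x * norm y * C" for x y using C0[of x y] by (rule order_trans) (auto simp: C_def intro!: mult_left_mono)
 have C1: "C\<ge>c" "C>0" by (auto simp: C_def)
 have "\<exists>a. a\<in>S\<and>(\<forall>v\<in>S. B u v = inner a v)" for u using Riesz_on_subspace[OF S B.bounded_linear_right, of u] by blast
 then obtain A where A: "\<And>u. A u\<in>S" "\<And>u v. v\<in>S\<Longrightarrow>B u v = inner (A u) v" by metis
 obtain r where r: "r\<in>S" "\<And>v. v\<in>S\<Longrightarrow>f v = inner r v" using Riesz_on_subspace[OF S f] by blast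
 define \<rho> where "\<rho> = c/C\<^sup>2"
 define T where "T u = u-\<rho> *\<^sub>R (A u-r)" for u
 have TS: "T u\<in>S" if "u\<in>S" for u using that A r S(2) by (simp add: T_def subspace_diff subspace_scale)
 have contr: "dist (T x) (T y)\<le>sqrt (1-c\<^sup>2/C\<^sup>2) * dist x y" if "x\<in>S" "y\<in>S" for x y
 proof -
  define w where "w = x-y"
  have wS: "w\<in>S" using that S(2) by (simp add: w_def subspace_diff)
  define z where "z = A x-A y"
  have zS: "z\<in>S" using A S(2) by (simp add: z_def subspace_diff)
  have Bz: "B w v = inner z v" if "v\<in>S" for v by (simp add: w_def z_def B.diff_left inner_diff flip: A(2)[OF that])
  have nz: "norm z\<le>C * norm w"
  proof -
   have "norm z * norm z = B w z" using Bz[OF zS] by (simp add: power2_norm_eq_inner[symmetric] power2_eq_square)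
   also have "\<dots>\<le>norm w * norm z * C" using C[of w z] by (simp add: abs_le_iff)
   finally have "norm z * norm z\<le>norm z * (C * norm w)" by (simp add: mult_ac)
   thus ?thesis using C1 by (cases "norm z = 0") (auto simp: mult_le_cancel_left)
  qed
  have Tw: "T x-T y = w-\<rho> *\<^sub>R z" by (simp add: T_def w_def z_def algebra_simps)
  have "(norm (T x-T y))\<^sup>2 = (norm w)\<^sup>2-2 * \<rho> * inner z w + \<rho>\<^sup>2 * (norm z)\<^sup>2"
   unfolding Tw by (simp add: power2_norm_eq_inner inner_diff inner_commute algebra_simps power2_eq_square[of \<rho>])
  also have "\<dots>\<le>(norm w)\<^sup>2-2 * \<rho> * (c * (norm w)\<^sup>2) + \<rho>\<^sup>2 * (C * norm w)\<^sup>2"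
  proof -
   have "\<rho>\<ge>0" using c by (simp add: \<rho>_def)
   moreover have "inner z w\<ge>c * (norm w)\<^sup>2" using coer[OF wS] Bz[OF wS] by simp
   ultimately have "2 * \<rho> * (c * (norm w)\<^sup>2)\<le>2 * \<rho> * inner z w" by (intro mult_left_mono) auto
   moreover have "\<rho>\<^sup>2 * (norm z)\<^sup>2\<le>\<rho>\<^sup>2 * (C * norm w)\<^sup>2" by (intro mult_left_mono power_mono nz) auto
   ultimately show ?thesis by linarith
  qed
  also have "\<dots> = (1-c\<^sup>2/C\<^sup>2) * (norm w)\<^sup>2" using C1(2) by (simp add: \<rho>_def field_simps power2_eq_square)
  finally have "(norm (T x-T y))\<^sup>2\<le>(1-c\<^sup>2/C\<^sup>2) * (norm w)\<^sup>2" .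
  hence "sqrt ((norm (T x-T y))\<^sup>2)\<le>sqrt ((1-c\<^sup>2/C\<^sup>2) * (norm w)\<^sup>2)" by (rule real_sqrt_le_mono)
  thus ?thesis by (simp add: dist_norm w_def real_sqrt_mult)
 qed
 have "\<exists>!x\<in>S. T x = x"
 proof (rule Banach_fix[where c="sqrt (1-c\<^sup>2/C\<^sup>2)"])
  show "complete S" using S(1) by (simp add: complete_eq_closed)
  show "S\<noteq>{}" using S(2) subspace_0 by blast
  have "c\<^sup>2\<le>C\<^sup>2" using C1 c by (intro power_mono) auto
  thus "0\<le>sqrt (1-c\<^sup>2/C\<^sup>2)" using C1 by simp
  show "sqrt (1-c\<^sup>2/C\<^sup>2)<1" using c C1 by (simp add: real_sqrt_lt_1_iff)
  show "T ` S\<subseteq>S" using TS by auto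
 qed (use contr in auto)
 then obtain u where u: "u\<in>S" "T u = u" by blast
 have "\<rho>\<noteq>0" using c C1 by (simp add: \<rho>_def)
 hence "A u = r" using u(2) by (simp add: T_def)
 thus ?thesis using u(1) A(2) r(2) by metis
qed

section \<open>Compact maps: adjoints, the Fredholm alternative and finite ascent\<close>

definition compact_map :: "('a::real_normed_vector\<Rightarrow>'b::real_normed_vector)\<Rightarrow>bool" where
 "compact_map T\<longleftrightarrow>bounded_linear T \<and>
   (\<forall>x::nat\<Rightarrow>'a. bounded (range x)\<longrightarrow>(\<exists>l r. strict_mono r\<and>(\<lambda>n. T (x (r n)))\<longlonglongrightarrow>l))"

lemma compact_mapD:
 assumes "compact_map T" "bounded (range x)"
 obtains l r where "strict_mono (r::nat\<Rightarrow>nat)" "(\<lambda>n. T (x (r n)))\<longlonglongrightarrow>l" using assms unfolding compact_map_def by blast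

lemma compact_map_bounded_linear: "compact_map T\<Longrightarrow>bounded_linear T" by (simp add: compact_map_def)

lemma compact_map_comp_left:
 fixes T :: "'a::real_normed_vector\<Rightarrow>'b::real_normed_vector"
 assumes "bounded_linear S" "compact_map T"
 shows "compact_map (\<lambda>x. S (T x))" unfolding compact_map_def
proof (intro conjI allI impI)
 show "bounded_linear (\<lambda>x. S (T x))" using assms by (auto intro: bounded_linear_compose compact_map_bounded_linear)
 fix x :: "nat\<Rightarrow>'a" assume "bounded (range x)"
 then obtain l r where "strict_mono r" "(\<lambda>n. T (x (r n)))\<longlonglongrightarrow>l" using assms(2) compact_mapD by blast
 thus "\<exists>l r. strict_mono r\<and>(\<lambda>n. S (T (x (r n))))\<longlonglongrightarrow>l" using bounded_linear.tendsto[OF assms(1)] by blast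
qed

lemma compact_map_comp_right:
 fixes S :: "'c::real_normed_vector\<Rightarrow>'a::real_normed_vector"
 assumes "compact_map T" "bounded_linear S"
 shows "compact_map (\<lambda>x. T (S x))" unfolding compact_map_def
proof (intro conjI allI impI)
 show "bounded_linear (\<lambda>x. T (S x))" using assms by (auto intro: bounded_linear_compose compact_map_bounded_linear)
 fix x :: "nat\<Rightarrow>'c" assume "bounded (range x)"
 hence "bounded (range (\<lambda>n. S (x n)))" using bounded_linear_image[OF _ assms(2), of "range x"] by (simp add: image_image)
 then obtain l r where "strict_mono r" "(\<lambda>n. T (S (x (r n))))\<longlonglongrightarrow>l" using assms(1) compact_mapD by blast
 thus "\<exists>l r. strict_mono r\<and>(\<lambda>n. T (S (x (r n))))\<longlonglongrightarrow>l" by blast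
qed

lemma compact_map_add:
 fixes S T :: "'a::real_normed_vector\<Rightarrow>'b::real_normed_vector"
 assumes "compact_map S" "compact_map T"
 shows "compact_map (\<lambda>x. S x + T x)" unfolding compact_map_def
proof (intro conjI allI impI)
 show "bounded_linear (\<lambda>x. S x + T x)" using assms by (auto intro: bounded_linear_add compact_map_bounded_linear)
 fix x :: "nat\<Rightarrow>'a" assume b: "bounded (range x)"
 then obtain l r where r: "strict_mono r" "(\<lambda>n. S (x (r n)))\<longlonglongrightarrow>l" using assms(1) compact_mapD by blast
 have "bounded (range (\<lambda>n. x (r n)))" using b by (rule bounded_subset) auto
 then obtain m q where q: "strict_mono q" "(\<lambda>n. T (x (r (q n))))\<longlonglongrightarrow>m" using assms(2) compact_mapD by blast
 have "(\<lambda>n. S (x (r (q n))))\<longlonglongrightarrow>l" using LIMSEQ_subseq_LIMSEQ[OF r(2) q(1)] by (simp add: o_def)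
 hence "(\<lambda>n. S (x ((r\<circ>q) n)) + T (x ((r\<circ>q) n)))\<longlonglongrightarrow>l + m" using q(2) by (auto intro: tendsto_add)
 thus "\<exists>l r. strict_mono r\<and>(\<lambda>n. S (x (r n)) + T (x (r n)))\<longlonglongrightarrow>l" using strict_mono_o[OF r(1) q(1)] by blast
qed

lemma compact_map_uminus: "compact_map T\<Longrightarrow>compact_map (\<lambda>x.-T x)" by (rule compact_map_comp_left[of uminus]) (auto intro: bounded_linear_minus bounded_linear_ident)

lemma ex_adjoint:
 fixes K :: "'a::{real_inner,complete_space}\<Rightarrow>'a"
 assumes K: "bounded_linear K"
 obtains K' where "bounded_linear K'" "\<And>x y. inner (K x) y = inner x (K' y)"
proof -
 interpret K: bounded_linear K by fact
 have "\<exists>z. \<forall>x. inner (K x) y = inner x z" for y using Riesz_on_subspace[of UNIV "\<lambda>x. inner (K x) y"]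
   bounded_linear_compose[OF bounded_linear_inner_left K, of y] by (auto simp: inner_commute)
 then obtain K' where K': "\<And>x y. inner (K x) y = inner x (K' y)" by metis
 obtain C where C: "\<And>x. norm (K x)\<le>norm x * C" "C>0" using K.pos_bounded by blast
 have "bounded_linear K'"
 proof (rule bounded_linear_intro[where K=C])
  show "K' (x + y) = K' x + K' y" for x y by (simp add: vector_eq_ldot[symmetric] inner_add flip: K')
  show "K' (r *\<^sub>R x) = r *\<^sub>R K' x" for r x by (simp add: vector_eq_ldot[symmetric] flip: K')
  show "norm (K' x)\<le>norm x * C" for x
  proof -
   have "norm (K' x) * norm (K' x) = inner (K (K' x)) x" by (simp add: K' power2_norm_eq_inner[symmetric] power2_eq_square)
   also have "\<dots>\<le>norm (K (K' x)) * norm x" by (rule norm_cauchy_schwarz)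
   also have "\<dots>\<le>norm (K' x) * C * norm x" by (intro mult_right_mono C) auto
   finally have "norm (K' x) * norm (K' x)\<le>norm (K' x) * (norm x * C)" by (simp add: mult_ac)
   thus ?thesis using C(2) by (cases "norm (K' x) = 0") (auto simp: mult_le_cancel_left)
  qed
 qed
 thus ?thesis using that K' by blast
qed

text \<open>By the adjoint relation the square of the norm of T' (y_i - y_j) is (T T' (y_i - y_j),
  y_i - y_j), and \<open>T T'\<close> is compact. Along a bounded sequence, convergence of
  \<open>T T' y\<close> therefore makes \<open>T' y\<close> Cauchy.\<close>

lemma compact_map_adjoint:
 fixes T :: "'a::{real_inner,complete_space}\<Rightarrow>'a"
 assumes T: "compact_map T" and T': "bounded_linear T'"
  and adj: "\<And>x y. inner (T x) y = inner x (T' y)"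
 shows "compact_map T'" unfolding compact_map_def
proof (intro conjI allI impI)
 show "bounded_linear T'" by fact
 fix x :: "nat\<Rightarrow>'a" assume "bounded (range x)"
 then obtain b where b: "\<And>n. norm (x n)\<le>b" by (auto simp: bounded_iff)
 have "compact_map (\<lambda>x. T (T' x))" by (rule compact_map_comp_right[OF T T'])
 then obtain l r where r: "strict_mono r" "(\<lambda>n. T (T' (x (r n))))\<longlonglongrightarrow>l" using \<open>bounded (range x)\<close> compact_mapD by blast
 interpret T: bounded_linear T using T by (rule compact_map_bounded_linear)
 interpret T': bounded_linear T' by fact
 define y where "y n = x (r n)" for n
 have y: "norm (y i-y j)\<le>2 * b" for i j using norm_triangle_ineq4[of "y i" "y j"] b[of "r i"] b[of "r j"] by (simp add: y_def)
 have b0: "b\<ge>0" using b[of 0] norm_ge_zero order_trans by blast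
 have key: "(norm (T' (y i)-T' (y j)))\<^sup>2\<le>norm (T (T' (y i))-T (T' (y j))) * (2 * b)" for i j
 proof -
  have "(norm (T' (y i)-T' (y j)))\<^sup>2 = inner (T (T' (y i))-T (T' (y j))) (y i-y j)" by (simp add: adj power2_norm_eq_inner flip: T.diff T'.diff)
  also have "\<dots>\<le>norm (T (T' (y i))-T (T' (y j))) * norm (y i-y j)" by (rule norm_cauchy_schwarz)
  also have "\<dots>\<le>norm (T (T' (y i))-T (T' (y j))) * (2 * b)" by (intro mult_left_mono y) auto
  finally show ?thesis .
 qed
 have "Cauchy (\<lambda>n. T (T' (y n)))" using r(2) LIMSEQ_imp_Cauchy unfolding y_def by blast
 have "Cauchy (\<lambda>n. T' (y n))"
 proof (rule CauchyI)
  fix e :: real assume e: "e>0"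
  have "e\<^sup>2/(2 * b + 1)>0" using e b0 by simp
  then obtain M where M: "\<And>i j. i\<ge>M\<Longrightarrow>j\<ge>M\<Longrightarrow>norm (T (T' (y i))-T (T' (y j)))<e\<^sup>2/(2 * b + 1)" using CauchyD[OF \<open>Cauchy (\<lambda>n. T (T' (y n)))\<close>] by blast
  have "norm (T' (y i)-T' (y j))<e" if "i\<ge>M" "j\<ge>M" for i j
  proof -
   have "(norm (T' (y i)-T' (y j)))\<^sup>2\<le>norm (T (T' (y i))-T (T' (y j))) * (2 * b)" by (rule key)
   also have "\<dots>\<le>(e\<^sup>2/(2 * b + 1)) * (2 * b)" using M[OF that] b0 by (intro mult_right_mono) auto
   also have "\<dots><e\<^sup>2" using e b0 by (simp add: field_simps)
   finally show ?thesis using e by (simp add: power_less_imp_less_base)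
  qed
  thus "\<exists>M. \<forall>m\<ge>M. \<forall>n\<ge>M. norm (T' (y m)-T' (y n))<e" by blast
 qed
 then obtain m where "(\<lambda>n. T' (y n))\<longlonglongrightarrow>m" using Cauchy_convergent convergent_def by blast
 thus "\<exists>l r. strict_mono r\<and>(\<lambda>n. T' (x (r n)))\<longlonglongrightarrow>l" using r(1) unfolding y_def by blast
qed

text \<open>The bound from below on the complement of the kernel makes \<open>inner (B x) (B y)\<close> coercive
 there, so that \<open>B' B\<close> maps onto it.\<close>

lemma orthogonal_kernel_in_range_adjoint:
 fixes T :: "'a::{real_inner,complete_space}\<Rightarrow>'a"
 assumes T: "compact_map T" and B: "\<And>x. B x = x-T x"
  and adj: "\<And>x y. inner (B x) y = inner x (C y)"
  and n: "\<And>x. B x = 0\<Longrightarrow>inner n x = 0"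
 shows "\<exists>u. n = C u"
proof -
 interpret T: bounded_linear T using T by (rule compact_map_bounded_linear)
 have blB: "bounded_linear B" unfolding B[abs_def] by (intro bounded_linear_sub bounded_linear_ident T.bounded_linear_axioms)
 interpret B: bounded_linear B by fact
 define Z where "Z = {x. B x = 0}"
 define S where "S = {x. \<forall>z\<in>Z. inner x z = 0}"
 have Z: "closed Z" "subspace Z" unfolding Z_def by (intro closed_Collect_eq linear_continuous_on blB continuous_on_const)
   (auto simp: subspace_def B.add B.scaleR B.zero)
 have S: "closed S" "subspace S"
 proof -
  have "S = (\<Inter>z\<in>Z. {x. inner x z = 0})" by (auto simp: S_def)
  thus "closed S" by (auto intro!: closed_INT closed_Collect_eq continuous_intros)
 qed (auto simp: subspace_def S_def inner_add)
 \<comment> \<open>Otherwise \<open>B\<close> nearly annihilates unit vectors of \<open>S\<close>;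
   compactness of \<open>T\<close> makes a subsequence converge, and its limit is a unit vector
   lying both in the kernel and in its orthogonal complement.\<close>
 have "\<exists>c>0. \<forall>u\<in>S. norm (B u)\<ge>c * norm u"
 proof (rule ccontr)
  assume neg: "\<not> ?thesis"
  have "\<exists>u\<in>S. norm u = 1\<and>norm (B u)<1/real (Suc k)" for k
  proof -
   define d where "d = 1/real (Suc k)"
   have "d>0" by (simp add: d_def)
   hence "\<exists>u\<in>S. norm (B u)<d * norm u" using neg by (meson not_le)
   then obtain u where u: "u\<in>S" "norm (B u)<d * norm u" by blast
   hence u0: "norm u>0" by (cases "u = 0") (auto simp: B.zero)
   have "(1/norm u) *\<^sub>R u\<in>S" using u(1) S(2) by (simp add: subspace_scale)
   moreover have "norm ((1/norm u) *\<^sub>R u) = 1" using u0 by simp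
   moreover have "norm (B ((1/norm u) *\<^sub>R u))<1/real (Suc k)" using u(2) u0 unfolding d_def[symmetric] by (simp add: B.scaleR field_simps)
   ultimately show ?thesis by blast
  qed
  then obtain u where u: "\<And>k. u k\<in>S" "\<And>k. norm (u k) = 1" "\<And>k. norm (B (u k))<1/real (Suc k)" by metis
  have "bounded (range u)" using u(2) by (auto simp: bounded_iff intro!: exI[of _ 1])
  then obtain l r where r: "strict_mono r" "(\<lambda>n. T (u (r n)))\<longlonglongrightarrow>l" using T compact_mapD by blast
  have lim: "(\<lambda>k. 1/real (Suc k))\<longlonglongrightarrow>0" using LIMSEQ_inverse_real_of_nat by (simp add: inverse_eq_divide)
  have "\<forall>k. norm (B (u k))\<le>1/real (Suc k)" using u(3) less_imp_le by blast
  hence B0: "(\<lambda>k. B (u k))\<longlonglongrightarrow>0" by (intro Lim_null_comparison[OF always_eventually lim])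
  have Bu: "(\<lambda>k. B (u (r k)))\<longlonglongrightarrow>0" using LIMSEQ_subseq_LIMSEQ[OF B0 r(1)] by (simp add: o_def)
  have "(\<lambda>k. B (u (r k)) + T (u (r k)))\<longlonglongrightarrow>0 + l" by (intro tendsto_add Bu r)
  hence ul: "(\<lambda>k. u (r k))\<longlonglongrightarrow>l" by (simp add: B)
  have "l\<in>S" by (rule closed_sequentially[OF S(1) u(1) ul])
  moreover have "B l = 0" by (rule LIMSEQ_unique[OF B.tendsto[OF ul] Bu])
  ultimately have "inner l l = 0" by (auto simp: S_def Z_def)
  moreover have "norm l = 1" using tendsto_norm[OF ul] u(2) by (simp add: LIMSEQ_const_iff)
  ultimately show False by simp
 qed
 then obtain c where c: "c>0" "\<And>u. u\<in>S\<Longrightarrow>norm (B u)\<ge>c * norm u" by blast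
 have "\<exists>u\<in>S. \<forall>v\<in>S. inner (B u) (B v) = inner n v"
 proof (rule Lax_Milgram_on_subspace[OF S, where c="c\<^sup>2"])
  show "bounded_bilinear (\<lambda>u v. inner (B u) (B v))" using bounded_bilinear.comp[OF bounded_bilinear_inner blB blB] by simp
  show "c\<^sup>2 * (norm u)\<^sup>2\<le>inner (B u) (B u)" if "u\<in>S" for u using power_mono[OF c(2)[OF that], of 2] c(1) by (simp add: power2_norm_eq_inner power_mult_distrib)
 qed (use c bounded_linear_inner_right in auto)
 then obtain u where u: "u\<in>S" "\<And>v. v\<in>S\<Longrightarrow>inner (B u) (B v) = inner n v" by blast
 have "inner (C (B u)) v = inner n v" for v
 proof -
  \<comment> \<open>The kernel component of \<open>v\<close> is invisible to \<open>n\<close> by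
    hypothesis and to \<open>B\<close> by definition, so an identity tested on \<open>S\<close>
    holds for all \<open>v\<close>.\<close>
  define k where "k = proj Z v"
  have k: "k\<in>Z" "v-k\<in>S" using proj_props[OF Z] by (auto simp: k_def S_def)
  have "inner n v = inner n (v-k)" using n k(1) by (simp add: Z_def inner_diff)
  also have "\<dots> = inner (B u) (B (v-k))" using u(2)[OF k(2)] by simp
  also have "\<dots> = inner (B u) (B v)" using k(1) by (simp add: B.diff Z_def)
  also have "\<dots> = inner (C (B u)) v" using adj[of v "B u"] by (simp add: inner_commute)
  finally show ?thesis by simp
 qed
 hence "n = C (B u)" by (metis vector_eq_ldot inner_commute)
 thus ?thesis by blast
qed

text \<open>Riesz's argument: if the kernels of the powers of \<open>B = 1 - T\<close> grew for
  ever, unit vectors in each kernel orthogonal to the preceding one would have images under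
  \<open>T\<close> at mutual distance at least 1, although \<open>T\<close> is compact.\<close>

lemma compact_map_finite_ascent:
 fixes T :: "'a::{real_inner,complete_space}\<Rightarrow>'a"
 assumes T: "compact_map T" and B: "\<And>x. B x = x-T x"
 shows "\<exists>j. \<forall>x. (B ^^ Suc j) x = 0\<longrightarrow>(B ^^ j) x = 0"
proof (rule ccontr)
 assume "\<not> ?thesis"
 then obtain x where x: "\<And>j. (B ^^ Suc j) (x j) = 0" "\<And>j. (B ^^ j) (x j)\<noteq>0" by metis
 interpret T: bounded_linear T using T by (rule compact_map_bounded_linear)
 have blB: "bounded_linear B" unfolding B[abs_def] by (intro bounded_linear_sub bounded_linear_ident T.bounded_linear_axioms)
 have blBj: "bounded_linear (B ^^ j)" for j by (induction j) (auto simp: o_def intro: bounded_linear_compose[OF blB] bounded_linear_ident[unfolded id_def[symmetric]])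
 define Z where "Z j = {x. (B ^^ j) x = 0}" for j
 have Z: "closed (Z j)" "subspace (Z j)" for j using blBj[of j] unfolding Z_def by (auto intro!: closed_Collect_eq linear_continuous_on continuous_on_const
   simp: subspace_def linear_simps)
 have Zmono: "Z i\<subseteq>Z j" if "i\<le>j" for i j
 proof -
  have "(B ^^ j) = (B ^^ (j-i))\<circ>(B ^^ i)" using that by (simp flip: funpow_add)
  thus ?thesis using linear_simps(3)[OF blBj[of "j-i"]] by (auto simp: Z_def)
 qed
 define y where "y j = x j-proj (Z j) (x j)" for j
 have y0: "y j\<noteq>0" for j
 proof
  assume "y j = 0"
  hence "x j\<in>Z j" using proj_props(1)[OF Z, of j "x j"] by (simp add: y_def)
  thus False using x by (simp add: Z_def)
 qed
 have xZ: "x j\<in>Z (Suc j)" for j using x(1) by (simp add: Z_def)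
 have yZ: "y j\<in>Z (Suc j)" for j unfolding y_def using xZ proj_props(1)[OF Z, of j "x j"] Zmono[of j "Suc j"] Z(2)[of "Suc j"] by (auto intro: subspace_diff)
 define m where "m j = (1/norm (y j)) *\<^sub>R y j" for j
 have m1: "norm (m j) = 1" for j using y0 by (simp add: m_def)
 have mZ: "m j\<in>Z (Suc j)" for j using yZ Z(2) by (simp add: m_def subspace_scale)
 have morth: "inner (m j) v = 0" if "v\<in>Z j" for j v using proj_props(2)[OF Z that, of "x j"] by (simp add: m_def y_def)
 have BZ: "B v\<in>Z j" if "v\<in>Z (Suc j)" for v j using that by (simp add: Z_def funpow_swap1)
 have sep: "norm (T (m i)-T (m j))\<ge>1" if "j<i" for i j
 proof -
  \<comment> \<open>A vector of the kernel with index \<open>i\<close>: the difference of the two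
    images is \<open>m i - v\<close>, and \<open>m i\<close> is orthogonal to that kernel.\<close>
  define v where "v = B (m i) + T (m j)"
  have "B (m i)\<in>Z i" using BZ mZ by blast
  moreover have "T (m j)\<in>Z i"
  proof -
   have "T (m j) = m j-B (m j)" by (simp add: B)
   moreover have "m j\<in>Z i" using mZ Zmono[of "Suc j" i] that by auto
   moreover have "B (m j)\<in>Z i" using BZ[OF mZ] Zmono[of j i] that by auto
   ultimately show ?thesis using Z(2) subspace_diff by metis
  qed
  ultimately have "v\<in>Z i" using Z(2) subspace_add v_def by blast
  hence o: "inner (m i) v = 0" by (rule morth)
  have "T (m i)-T (m j) = m i-v" by (simp add: v_def B)
  hence "(norm (T (m i)-T (m j)))\<^sup>2 = (norm (m i))\<^sup>2 + (norm v)\<^sup>2" using o by (simp add: power2_norm_eq_inner inner_diff inner_commute)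
  hence "(norm (T (m i)-T (m j)))\<^sup>2\<ge>1\<^sup>2" using m1 by simp
  thus ?thesis by (rule power2_le_imp_le) auto
 qed
 have "bounded (range m)" using m1 by (auto simp: bounded_iff intro!: exI[of _ 1])
 then obtain l r where r: "strict_mono r" "(\<lambda>n. T (m (r n)))\<longlonglongrightarrow>l" using T compact_mapD by blast
 from CauchyD[OF LIMSEQ_imp_Cauchy[OF r(2)], of 1] obtain M where
  "\<And>i j. i\<ge>M\<Longrightarrow>j\<ge>M\<Longrightarrow>norm (T (m (r i))-T (m (r j)))<1" by auto
 from this[of "Suc M" M] sep[of "r M" "r (Suc M)"] r(1) show False by (simp add: strict_mono_def not_less)
qed

text \<open>With \<open>C = 1 - T'\<close>, orthogonality to the kernel of \<open>B ^^ j\<close>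
  places \<open>n\<close> in the range of \<open>C ^^ j\<close>, say \<open>n = (C ^^ j) u\<close>.
  Then \<open>(C ^^ Suc j) u = C n = 0\<close>, and for \<open>j\<close> at least the ascent of
  \<open>C\<close> this forces \<open>n = 0\<close>. Later this excludes poles: the adjoint has no
  eigenvector orthogonal to all root spaces.\<close>

lemma adjoint_kernel_orthogonal_root_spaces:
 fixes T :: "'a::{real_inner,complete_space}\<Rightarrow>'a"
 assumes T: "compact_map T" and T': "bounded_linear T'"
  and adj: "\<And>x y. inner (T x) y = inner x (T' y)"
  and B: "\<And>x. B x = x-T x"
  and n: "T' n = n" "\<And>j x. (B ^^ j) x = 0\<Longrightarrow>inner n x = 0"
 shows "n = 0"
proof -
 have cT': "compact_map T'" by (rule compact_map_adjoint[OF T T' adj])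
 define C where "C x = x-T' x" for x
 have "\<exists>j. \<forall>x. (C ^^ Suc j) x = 0\<longrightarrow>(C ^^ j) x = 0" by (rule compact_map_finite_ascent[OF cT' C_def])
 then obtain j where j: "\<And>x. (C ^^ Suc j) x = 0\<Longrightarrow>(C ^^ j) x = 0" by blast
 have adjB: "inner (B x) y = inner x (C y)" for x y by (simp add: B C_def inner_diff adj)
 have adjBj: "inner ((B ^^ j) x) y = inner x ((C ^^ j) y)" for x y j
 proof (induction j arbitrary: x y)
  case (Suc j)
  have "inner ((B ^^ Suc j) x) y = inner ((B ^^ j) x) (C y)" by (simp add: adjB)
  also have "\<dots> = inner x ((C ^^ Suc j) y)" using Suc by (simp add: funpow_swap1)
  finally show ?case .
 qed simp
 \<comment> \<open>Every power of \<open>1 - T\<close> is again the identity minus a compact map, so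
   the range statement applies to it.\<close>
 have "\<exists>Tj. compact_map Tj\<and>(\<forall>x. (B ^^ j) x = x-Tj x)" for j
 proof (induction j)
  case 0
  have "compact_map (\<lambda>x::'a. 0::'a)" by (auto simp: compact_map_def strict_mono_Suc_iff intro!: exI[of _ id])
  thus ?case by (auto intro!: exI[of _ "\<lambda>x. 0"])
 next
  case (Suc j)
  then obtain Tj where Tj: "compact_map Tj" "\<And>x. (B ^^ j) x = x-Tj x" by blast
  interpret T: bounded_linear T using T by (rule compact_map_bounded_linear)
  have "compact_map (\<lambda>x. (Tj x + T x) + (- T (Tj x)))" by (intro compact_map_add compact_map_uminus Tj T compact_map_comp_left[OF T.bounded_linear_axioms])
  moreover have "(B ^^ Suc j) x = x-((Tj x + T x) + (- T (Tj x)))" for x by (simp add: Tj(2) B T.diff)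
  ultimately show ?case by blast
 qed
 then obtain Tj where Tj: "compact_map Tj" "\<And>x. (B ^^ j) x = x-Tj x" by blast
 obtain u where u: "n = (C ^^ j) u" using orthogonal_kernel_in_range_adjoint[OF Tj(1) Tj(2) adjBj n(2)[of j]] by blast
 have "(C ^^ Suc j) u = 0" using u n(1) by (simp add: C_def)
 thus ?thesis using j u by simp
qed

section \<open>Finite-rank perturbation of small maps\<close>

text \<open>A complex structure is an isometry \<open>imul\<close> of a real Hilbert space with
  square -1. Projections, Riesz representation, Lax-Milgram and the compactness results then apply
  as they stand, and complex linearity is commutation with \<open>imul\<close>.\<close>

class complex_hilbert = real_inner + complete_space +
 fixes imul :: "'a\<Rightarrow>'a"
 assumes imul_add: "imul (x + y) = imul x + imul y"
  and imul_scaleR: "imul (r *\<^sub>R x) = r *\<^sub>R imul x"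
  and imul_imul [simp]: "imul (imul x) =-x"
  and inner_imul_imul [simp]: "inner (imul x) (imul y) = inner x y"

instance complex_hilbert \<subseteq> banach ..

lemma norm_imul [simp]: "norm (imul x) = norm (x::'a::complex_hilbert)" by (simp add: norm_eq_sqrt_inner)

lemma bounded_linear_imul: "bounded_linear (imul::'a::complex_hilbert\<Rightarrow>'a)" by (rule bounded_linear_intro[where K=1]) (simp_all add: imul_add imul_scaleR)

lemma imul_zero: "imul (0::'a::complex_hilbert) = 0"
 and imul_minus: "imul (- x) =-imul (x::'a::complex_hilbert)"
 and imul_diff: "imul (x-y) = imul x-imul (y::'a::complex_hilbert)"
 by (simp_all add: linear_0[OF bounded_linear.linear[OF bounded_linear_imul]] linear_neg[OF bounded_linear.linear[OF bounded_linear_imul]]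
  linear_diff[OF bounded_linear.linear[OF bounded_linear_imul]])

lemma inner_imul_left: "inner (imul x) y =-inner x (imul (y::'a::complex_hilbert))" using inner_imul_imul[of x "imul y"] by simp

lemma inner_imul_self [simp]: "inner x (imul x) = (0::real)" "inner (imul x) x = (0::real)"
 for x :: "'a::complex_hilbert" using inner_imul_left[of x x] by (simp_all add: inner_commute)

definition cscale :: "complex\<Rightarrow>'a::complex_hilbert\<Rightarrow>'a" (infixr "*\<^sub>C" 75) where
 "z *\<^sub>C x = Re z *\<^sub>R x + Im z *\<^sub>R imul x"

text \<open>Linear in the first argument and conjugate linear in the second.\<close>

definition cinner :: "'a::complex_hilbert\<Rightarrow>'a\<Rightarrow>complex" where
 "cinner x y = Complex (inner x y) (inner x (imul y))"

lemma Re_cinner [simp]: "Re (cinner x y) = inner x y" by (simp add: cinner_def)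

lemma cinner_add_left: "cinner (x + y) z = cinner x z + cinner y z"
 and cinner_add_right: "cinner x (y + z) = cinner x y + cinner x z"
 and cinner_diff_left: "cinner (x-y) z = cinner x z-cinner y z"
 and cinner_diff_right: "cinner x (y-z) = cinner x y-cinner x z"
 and cinner_minus_left [simp]: "cinner (- x) z =-cinner x z"
 and cinner_minus_right [simp]: "cinner x (- z) =-cinner x z"
 and cinner_zero_left [simp]: "cinner 0 y = 0"
 and cinner_zero_right [simp]: "cinner x 0 = 0" by (auto simp: cinner_def complex_eq_iff inner_add inner_diff imul_add imul_diff imul_minus imul_zero)

lemma cinner_scale_left [simp]: "cinner (z *\<^sub>C x) y = z * cinner x y" by (simp add: cinner_def cscale_def complex_eq_iff inner_add inner_imul_left imul_add imul_scaleR)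

lemma cinner_scale_right [simp]: "cinner x (z *\<^sub>C y) = cnj z * cinner x y" by (simp add: cinner_def cscale_def complex_eq_iff inner_add inner_diff imul_add imul_scaleR)

lemma cnj_cinner: "cnj (cinner x y) = cinner y x"
 by (simp add: cinner_def complex_eq_iff inner_commute inner_imul_left[symmetric, of x y, unfolded inner_commute[of "imul x"]])

lemma cinner_eq_0_commute: "cinner x y = 0\<longleftrightarrow>cinner y x = 0" by (metis cnj_cinner complex_cnj_zero)

lemma cinner_self: "cinner x x = of_real ((norm x)\<^sup>2)" by (simp add: cinner_def complex_eq_iff power2_norm_eq_inner)

lemma cinner_self_eq_0 [simp]: "cinner x x = 0\<longleftrightarrow>x = 0" by (simp add: cinner_self)

lemma cscale_one [simp]: "1 *\<^sub>C x = x"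
 and cscale_zero_left [simp]: "0 *\<^sub>C x = 0"
 and cscale_zero_right [simp]: "z *\<^sub>C (0::'a::complex_hilbert) = 0"
 and cscale_of_real: "of_real r *\<^sub>C x = r *\<^sub>R x"
 and cscale_ii: "\<i> *\<^sub>C x = imul x" by (simp_all add: cscale_def imul_zero)

lemma cscale_cscale [simp]: "z *\<^sub>C (u *\<^sub>C x) = (z * u) *\<^sub>C (x::'a::complex_hilbert)" by (simp add: cscale_def imul_add imul_scaleR algebra_simps)

lemma cscale_add_left: "(z + u) *\<^sub>C x = z *\<^sub>C x + u *\<^sub>C (x::'a::complex_hilbert)" by (simp add: cscale_def algebra_simps)

lemma cscale_minus_left: "(- z) *\<^sub>C x =-(z *\<^sub>C (x::'a::complex_hilbert))" by (simp add: cscale_def algebra_simps)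

lemma norm_cscale [simp]: "norm (z *\<^sub>C x) = cmod z * norm (x::'a::complex_hilbert)"
proof -
 have "(norm (z *\<^sub>C x))\<^sup>2 = ((Re z)\<^sup>2 + (Im z)\<^sup>2) * (norm x)\<^sup>2"
  by (simp add: cscale_def power2_norm_eq_inner inner_add algebra_simps power2_eq_square[of "Re z"] power2_eq_square[of "Im z"])
 also have "\<dots> = (cmod z * norm x)\<^sup>2" by (simp add: cmod_power2 power_mult_distrib)
 finally show ?thesis by simp
qed

lemma bounded_bilinear_cscale: "bounded_bilinear ((*\<^sub>C)::complex\<Rightarrow>'a::complex_hilbert\<Rightarrow>'a)" by (rule bounded_bilinear.intro)
  (auto simp: cscale_add_left cscale_def[of _ "_ + _"] cscale_def[of "_ *\<^sub>R _"] cscale_def[of _ "_ *\<^sub>R _"]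
   imul_add imul_scaleR cscale_def[of _ "_::'a"] norm_cscale[unfolded cscale_def] algebra_simps intro!: exI[of _ 1])

interpretation cscale: bounded_bilinear "(*\<^sub>C)::complex\<Rightarrow>'a::complex_hilbert\<Rightarrow>'a" by (rule bounded_bilinear_cscale)

lemma norm_cinner_le: "cmod (cinner x y)\<le>norm x * norm y"
proof (cases "cinner x y = 0")
 case False
 \<comment> \<open>A phase that rotates the inner product onto the positive axis, where the real
   Cauchy-Schwarz inequality applies.\<close>
 define u where "u = cnj (cinner x y)/of_real (cmod (cinner x y))"
 have u: "cmod u = 1" using False by (simp add: u_def norm_divide)
 have "of_real (cmod (cinner x y)) = u * cinner x y" using False by (simp add: u_def field_simps flip: complex_norm_square) (simp add: power2_eq_square)
 hence "cmod (cinner x y) = Re (cinner (u *\<^sub>C x) y)" by (metis Re_complex_of_real cinner_scale_left)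
 also have "\<dots>\<le>norm (u *\<^sub>C x) * norm y" unfolding Re_cinner by (rule norm_cauchy_schwarz)
 finally show ?thesis using u by simp
qed simp

lemma bounded_linear_cinner_left: "bounded_linear (\<lambda>x. cinner x y)"
proof (rule bounded_linear_intro[where K="norm y"])
 show "cinner (r *\<^sub>R x) y = r *\<^sub>R cinner x y" for r x by (simp add: cinner_def complex_eq_iff)
qed (auto simp: cinner_add_left norm_cinner_le)

lemma cinner_sum_left: "cinner (sum f A) y = (\<Sum>i\<in>A. cinner (f i) y)" using linear_sum[OF bounded_linear.linear[OF bounded_linear_cinner_left]] by blast

lemma cinner_eqI: "(\<And>y. cinner x y = cinner z y)\<Longrightarrow>x = z" by (metis cinner_diff_left cinner_self_eq_0 eq_iff_diff_eq_0)

definition clinear_map :: "('a::complex_hilbert\<Rightarrow>'b::complex_hilbert)\<Rightarrow>bool" where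
 "clinear_map K\<longleftrightarrow>bounded_linear K\<and>(\<forall>x. K (imul x) = imul (K x))"

lemma clinear_map_bounded_linear: "clinear_map K\<Longrightarrow>bounded_linear K" by (simp add: clinear_map_def)

lemma clinear_map_imul: "clinear_map K\<Longrightarrow>K (imul x) = imul (K x)" by (simp add: clinear_map_def)

lemma clinear_map_cscale: "clinear_map K\<Longrightarrow>K (z *\<^sub>C x) = z *\<^sub>C K x" by (simp add: clinear_map_def cscale_def linear_simps)

lemma clinear_map_compose: "clinear_map K\<Longrightarrow>clinear_map L\<Longrightarrow>clinear_map (\<lambda>x. K (L x))" by (simp add: clinear_map_def bounded_linear_compose)

lemma clinear_map_ident: "clinear_map (\<lambda>x. x)" by (simp add: clinear_map_def)

lemma ex_clinear_adjoint:
 fixes K :: "'a::complex_hilbert\<Rightarrow>'a"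
 assumes K: "clinear_map K"
 shows "\<exists>K'. clinear_map K'\<and>(\<forall>x y. inner (K x) y = inner x (K' y))"
proof -
 obtain K' where K': "bounded_linear K'" "\<And>x y. inner (K x) y = inner x (K' y)" using ex_adjoint[OF clinear_map_bounded_linear[OF K]] by blast
 have "K' (imul y) = imul (K' y)" for y
 proof -
  have "inner x (K' (imul y)) = inner x (imul (K' y))" for x using K'(2)[of x "imul y"] K'(2)[of "imul x" y] by (simp add: clinear_map_imul[OF K] inner_imul_left)
  thus ?thesis using vector_eq_ldot by blast
 qed
 thus ?thesis using K' by (intro exI[of _ K']) (simp add: clinear_map_def)
qed

definition csubspace :: "'a::complex_hilbert set\<Rightarrow>bool" where
 "csubspace S\<longleftrightarrow>subspace S\<and>(\<forall>x\<in>S. imul x\<in>S)"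

lemma clinear_map_proj:
 assumes S: "closed S" "csubspace S"
 shows "clinear_map (proj S)" unfolding clinear_map_def
proof (intro conjI allI)
 have S': "subspace S" "\<And>x. x\<in>S\<Longrightarrow>imul x\<in>S" using S(2) by (auto simp: csubspace_def)
 show "bounded_linear (proj S)" by (rule bounded_linear_proj[OF S(1) S'(1)])
 fix x
 show "proj S (imul x) = imul (proj S x)"
 proof (rule proj_unique[OF S(1) S'(1)])
  show "imul (proj S x)\<in>S" using proj_props(1)[OF S(1) S'(1)] S'(2) by blast
  fix v assume "v\<in>S"
  hence "inner (x-proj S x) (imul v) = 0" using proj_props(2)[OF S(1) S'(1)] S'(2) by blast
  thus "inner (imul x-imul (proj S x)) v = 0" by (simp add: inner_imul_left flip: imul_diff)
 qed
qed

lemma cinner_proj_compl: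
 assumes S: "closed S" "csubspace S" and v: "v\<in>S"
 shows "cinner (x-proj S x) v = 0" using proj_props(2)[of S, of _ x] assms by (auto simp: csubspace_def cinner_def complex_eq_iff)

text \<open>Gram-Schmidt, in which a vector already contained in the span is dropped; hence
  \<open>k \<le> N\<close>. Of the \<open>e i\<close> only the annihilator is retained, because
  finite-codimension conditions are all that is asked of them.\<close>

lemma ex_orthonormal_same_annihilator:
 fixes e :: "nat\<Rightarrow>'a::complex_hilbert"
 shows "\<exists>k\<le>N. \<exists>f::nat\<Rightarrow>'a. (\<forall>i<k. \<forall>j<k. cinner (f i) (f j) = (if i = j then 1 else 0)) \<and>
   (\<forall>x. (\<forall>i<k. cinner x (f i) = 0)\<longrightarrow>(\<forall>i<N. cinner x (e i) = 0))"
proof (induction N)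
 case (Suc N)
 then obtain k f where k: "k\<le>N" "\<And>i j. i<k\<Longrightarrow>j<k\<Longrightarrow>cinner (f i) (f j) = (if i = j then 1 else 0)"
  "\<And>x i. (\<And>i. i<k\<Longrightarrow>cinner x (f i) = 0)\<Longrightarrow>i<N\<Longrightarrow>cinner x (e i) = 0" by metis
 define v where "v = e N-(\<Sum>i<k. cinner (e N) (f i) *\<^sub>C f i)"
 have vf: "cinner v (f j) = 0" if "j<k" for j
 proof -
  have "(\<Sum>i<k. cinner (e N) (f i) * cinner (f i) (f j)) = (\<Sum>i<k. if i = j then cinner (e N) (f i) else 0)" using k(2) that by (intro sum.cong) auto
  also have "\<dots> = cinner (e N) (f j)" using that by simp
  finally show ?thesis by (simp add: v_def cinner_diff_left cinner_sum_left)
 qed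
 have eN: "cinner x (e N) = cinner x v" if "\<And>i. i<k\<Longrightarrow>cinner x (f i) = 0" for x
 proof -
  have "cinner (f i) x = 0" if "i<k" for i by (subst cinner_eq_0_commute) (rule \<open>\<And>i. i < k \<Longrightarrow> cinner x (f i) = 0\<close>[OF that])
  hence "cinner (\<Sum>i<k. cinner (e N) (f i) *\<^sub>C f i) x = 0" by (simp add: cinner_sum_left)
  hence "cinner x (\<Sum>i<k. cinner (e N) (f i) *\<^sub>C f i) = 0" by (subst cinner_eq_0_commute)
  thus ?thesis by (simp add: v_def cinner_diff_right)
 qed
 show ?case
 proof (cases "v = 0")
  case True
  show ?thesis
  proof (intro exI[of _ k] conjI exI[of _ f] allI impI)
   fix x i assume "\<forall>i<k. cinner x (f i) = 0" "i<Suc N"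
   thus "cinner x (e i) = 0" using k(3)[of x i] eN[of x] True by (cases "i = N") auto
  qed (use k in auto)
 next
  case False
  define g where "g = f(k := (1/norm v) *\<^sub>R v)"
  have gk: "g k = of_real (1/norm v) *\<^sub>C v" by (simp add: g_def cscale_of_real del: of_real_divide)
  show ?thesis
  proof (intro exI[of _ "Suc k"] conjI exI[of _ g] allI impI)
   show "Suc k\<le>Suc N" using k by simp
   fix i j assume ij: "i<Suc k" "j<Suc k"
   have fv: "cinner (f i) v = 0" if "i<k" for i by (subst cinner_eq_0_commute) (rule vf[OF that])
   have kk: "cinner (g k) (g k) = 1" unfolding gk using False by (simp add: cinner_self power2_eq_square del: of_real_divide flip: of_real_mult)
   have ik: "cinner (g i) (g k) = 0" "cinner (g k) (g i) = 0" if "i<k" for i using that fv[OF that] vf[OF that] unfolding gk by (simp_all add: g_def)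
   show "cinner (g i) (g j) = (if i = j then 1 else 0)" using ij kk ik[of i] ik[of j] k(2)[of i j] by (cases "i = k"; cases "j = k") (auto simp: g_def)
  next
   fix x i assume x: "\<forall>i<Suc k. cinner x (g i) = 0" and i: "i<Suc N"
   have "cinner x (f i) = 0" if "i<k" for i using x that by (auto simp: g_def dest: spec[of _ i])
   moreover have "cinner x v = 0" using x[rule_format, of k] False unfolding gk by simp
   ultimately show "cinner x (e i) = 0" using k(3)[of x i] eN[of x] i by (cases "i = N") auto
  qed
 qed
qed auto

section \<open>Lower bounds for functions without zeros, and determinants\<close>

text \<open>Borel-Caratheodory for a logarithm \<open>g\<close> of \<open>f\<close>: a Moebius map
  takes the half-plane \<open>Re < A\<close> to the unit disc and fixes 0, so Schwarz's lemma bounds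
  \<open>g\<close> by \<open>2 A\<close> on the half disc. It converts an upper bound for a
  determinant without zeros into a lower one.\<close>

lemma zero_free_lower_bound:
 fixes f :: "complex\<Rightarrow>complex"
 assumes hol: "f holomorphic_on ball 0 R" and R: "R>0" and f0: "f 0 = 1"
  and nz: "\<And>z. cmod z<R\<Longrightarrow>f z\<noteq>0" and M: "\<And>z. cmod z<R\<Longrightarrow>cmod (f z)<exp A" and A: "A>0"
  and z: "cmod z\<le>R/2"
 shows "cmod (f z)\<ge>exp (- 2 * A)"
proof -
 obtain g0 where g0: "g0 holomorphic_on ball 0 R" "\<And>x. x\<in>ball 0 R\<Longrightarrow>f x = exp (g0 x)"
  using holomorphic_logarithm_exists[OF convex_ball open_ball hol, of 0] nz R by (metis centre_in_ball dist_0_norm mem_ball)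
 define g where "g x = g0 x-g0 0" for x
 have g: "g holomorphic_on ball 0 R" "\<And>x. cmod x<R\<Longrightarrow>f x = exp (g x)" "g 0 = 0"
 proof -
  show "g holomorphic_on ball 0 R" unfolding g_def by (intro holomorphic_intros g0)
  have "exp (g0 0) = 1" using g0(2)[of 0] R f0 by simp
  thus "\<And>x. cmod x<R\<Longrightarrow>f x = exp (g x)" using g0(2) by (simp add: g_def exp_diff)
 qed (simp add: g_def)
 have Re_g: "Re (g x)<A" if "cmod x<R" for x using M[OF that] g(2)[OF that] by simp
 have ne: "2 * of_real A-g x\<noteq>0" if "cmod x<R" for x
 proof
  assume "2 * of_real A-g x = 0"
  hence "Re (g x) = 2 * A" by (auto simp: complex_eq_iff)
  thus False using Re_g[OF that] A by simp
 qed
 define h where "h x = g (of_real R * x)/(2 * of_real A-g (of_real R * x))" for x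
 have in_ball: "cmod (of_real R * x)<R" if "cmod x<1" for x using that R by (simp add: norm_mult)
 have h: "h holomorphic_on ball 0 1"
 proof -
  have "(\<lambda>x. g (of_real R * x)) holomorphic_on ball 0 1" using in_ball by (intro holomorphic_on_compose_gen[OF _ g(1), unfolded o_def] holomorphic_intros) auto
  thus ?thesis unfolding h_def using ne[OF in_ball] by (intro holomorphic_intros) auto
 qed
 have h1: "cmod (h x)<1" if "cmod x<1" for x
 proof -
  define y where "y = g (of_real R * x)"
  have y: "Re y<A" "2 * of_real A-y\<noteq>0" using Re_g[OF in_ball[OF that]] ne[OF in_ball[OF that]] by (auto simp: y_def)
  have "(cmod y)\<^sup>2<(cmod (2 * of_real A-y))\<^sup>2"
  proof -
   have "(cmod (2 * of_real A-y))\<^sup>2 = (cmod y)\<^sup>2 + 4 * A * (A-Re y)" by (simp add: cmod_power2) (simp add: power2_eq_square algebra_simps)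
   moreover have "A-Re y>0" using y by simp
   ultimately show ?thesis using A by simp
  qed
  hence "cmod y<cmod (2 * of_real A-y)" by (rule power_less_imp_less_base) simp
  thus ?thesis using y by (simp add: h_def y_def[symmetric] norm_divide)
 qed
 define y where "y = g z"
 have zR: "cmod z<R" using z R by simp
 have "cmod (h (z/of_real R))\<le>cmod (z/of_real R)" by (rule Schwarz_Lemma(1)[OF h]) (use h1 g(3) zR R in \<open>auto simp: h_def norm_divide\<close>)
 also have "\<dots>\<le>1/2" using z R by (simp add: norm_divide field_simps)
 finally have "cmod y/cmod (2 * of_real A-y)\<le>1/2" using R by (simp add: h_def y_def norm_divide)
 hence "2 * cmod y\<le>cmod (2 * of_real A-y)" using ne[OF zR] by (simp add: y_def field_simps)
 also have "\<dots>\<le>2 * A + cmod y" using norm_triangle_ineq4[of "2 * of_real A" y] A by simp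
 finally have "- Re y\<le>2 * A" using abs_Re_le_cmod[of y] by linarith
 thus ?thesis using g(2)[OF zR] by (simp add: y_def)
qed

text \<open>Entries given by a function of two naturals can depend on further parameters without
  reference to matrix carriers; for \<open>k = 0\<close> the value is 1.\<close>

definition cdet :: "nat\<Rightarrow>(nat\<Rightarrow>nat\<Rightarrow>complex)\<Rightarrow>complex" where
 "cdet k M = det (mat k k (\<lambda>(i, j). M i j))"

lemma cdet_eq:
 "cdet k M = (\<Sum>p | p permutes {0..<k}. signof p * (\<Prod>i = 0..<k. M i (p i)))"
proof -
 have "cdet k M = (\<Sum>p | p permutes {0..<k}. signof p * (\<Prod>i = 0..<k. mat k k (\<lambda>(i, j). M i j) $$ (i, p i)))" unfolding cdet_def by (rule det_def') simp
 also have "\<dots> = (\<Sum>p | p permutes {0..<k}. signof p * (\<Prod>i = 0..<k. M i (p i)))" by (intro sum.cong prod.cong arg_cong2[where f="(*)"] refl) (auto dest: permutes_in_image)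
 finally show ?thesis .
qed

lemma cdet_holomorphic:
 assumes "\<And>i j. i<k\<Longrightarrow>j<k\<Longrightarrow>(\<lambda>z. M z i j) holomorphic_on U"
 shows "(\<lambda>z. cdet k (M z)) holomorphic_on U" unfolding cdet_eq by (intro holomorphic_intros assms) (auto dest: permutes_in_image)

text \<open>Leibniz's formula estimated term by term. The crude factor \<open>fact k\<close> adds
  about \<open>k ln k\<close> to the exponent, which the growth estimate can afford.\<close>

lemma norm_cdet_le:
 assumes "\<And>i j. i<k\<Longrightarrow>j<k\<Longrightarrow>cmod (M i j)\<le>B"
 shows "cmod (cdet k M)\<le>fact k * B^k"
proof -
 have "cmod (cdet k M)\<le>(\<Sum>p | p permutes {0..<k}. cmod (signof p * (\<Prod>i = 0..<k. M i (p i))))" unfolding cdet_eq by (rule norm_sum)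
 also have "\<dots>\<le>(\<Sum>p | p permutes {0..<k}. B^k)"
 proof (rule sum_mono)
  fix p assume p: "p\<in>{p. p permutes {0..<k}}"
  have "cmod (\<Prod>i = 0..<k. M i (p i)) = (\<Prod>i = 0..<k. cmod (M i (p i)))" by (rule prod_norm[symmetric])
  also have "\<dots>\<le>(\<Prod>i = 0..<k. B)" using p by (intro prod_mono) (auto intro!: assms dest: permutes_in_image)
  finally show "cmod (signof p * (\<Prod>i = 0..<k. M i (p i)))\<le>B^k" by (simp add: norm_mult sign_def)
 qed
 also have "\<dots> = fact k * B^k" by (simp add: card_permutations[of "{0..<k}" k])
 finally show ?thesis .
qed

lemma cdet_identity: "cdet k (\<lambda>i j. if i = j then 1 else 0) = 1"
proof -
 have "mat k k (\<lambda>(i, j). if i = j then 1 else 0) = (1\<^sub>m k::complex mat)" by (rule eq_matI) auto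
 thus ?thesis by (simp add: cdet_def)
qed

text \<open>Cramer's rule displays the solution as quotients of determinants, hence as holomorphic
  functions of a parameter with explicit bounds. The hypothesis is injectivity of the matrix,
  because that is what the absence of eigenvalues will supply.\<close>

lemma cdet_cramer:
 assumes inj: "\<And>c. (\<And>i. i<k\<Longrightarrow>(\<Sum>j<k. M i j * c j) = 0)\<Longrightarrow>(\<And>i. i<k\<Longrightarrow>c i = 0)"
 shows "cdet k M\<noteq>0"
  and "i<k\<Longrightarrow>(\<Sum>j<k. M i j * (cdet k (\<lambda>i' j'. if j' = j then b i' else M i' j')/cdet k M)) = b i"
proof -
 define A where "A = mat k k (\<lambda>(i, j). M i j)"
 have A: "A\<in>carrier_mat k k" by (simp add: A_def)
 have Av: "(A *\<^sub>v v) $ i = (\<Sum>j<k. M i j * v $ j)" if "i<k" "v\<in>carrier_vec k" for v i using that by (simp add: A_def scalar_prod_def atLeast0LessThan)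
 show nz: "cdet k M\<noteq>0"
 proof
  assume "cdet k M = 0"
  hence "det A = 0" by (simp add: cdet_def A_def)
  then obtain v where v: "v\<in>carrier_vec k" "v\<noteq>0\<^sub>v k" "A *\<^sub>v v = 0\<^sub>v k" using det_0_iff_vec_prod_zero_field[OF A] by blast
  have "v $ i = 0" if "i<k" for i
  proof (rule inj[of "\<lambda>i. v $ i"])
   show "(\<Sum>j<k. M i j * v $ j) = 0" if "i<k" for i using Av[OF that v(1)] v(3) that by simp
  qed fact
  hence "v = 0\<^sub>v k" using v(1) by (intro eq_vecI) auto
  thus False using v(2) by simp
 qed
 define bv where "bv = vec k b"
 \<comment> \<open>The adjugate provides a solution; its entries are afterwards identified with the
   Cramer quotients.\<close>
 define x where "x = (1/det A) \<cdot>\<^sub>v (adj_mat A *\<^sub>v bv)"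
 have bv: "bv\<in>carrier_vec k" by (simp add: bv_def)
 have adj: "adj_mat A\<in>carrier_mat k k" using adj_mat(1)[OF A] .
 have x: "x\<in>carrier_vec k" using adj bv by (simp add: x_def)
 have dA: "det A = cdet k M" by (simp add: A_def cdet_def)
 have "A *\<^sub>v x = (1/det A) \<cdot>\<^sub>v (A *\<^sub>v (adj_mat A *\<^sub>v bv))" unfolding x_def using A adj bv by (intro mult_mat_vec) auto
 also have "A *\<^sub>v (adj_mat A *\<^sub>v bv) = (A * adj_mat A) *\<^sub>v bv" using A adj bv by simp
 also have "\<dots> = det A \<cdot>\<^sub>v bv" unfolding adj_mat(2)[OF A] using bv by (intro eq_vecI) auto
 finally have Ax: "A *\<^sub>v x = bv" using nz dA bv by (simp add: smult_smult_assoc)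
 have xj: "x $ j = cdet k (\<lambda>i' j'. if j' = j then b i' else M i' j')/cdet k M" if "j<k" for j
 proof -
  have "det (replace_col A bv j) = x $ j * det A" using cramer_lemma_mat[OF A x that] Ax by simp
  moreover have "replace_col A bv j = mat k k (\<lambda>(i', j'). if j' = j then b i' else M i' j')" unfolding replace_col_def by (rule eq_matI) (auto simp: A_def bv_def)
  ultimately show ?thesis using nz by (simp add: dA cdet_def[of k "\<lambda>i' j'. if j' = j then b i' else M i' j'"])
 qed
 show "(\<Sum>j<k. M i j * (cdet k (\<lambda>i' j'. if j' = j then b i' else M i' j')/cdet k M)) = b i" if "i<k"
 proof -
  have "(\<Sum>j<k. M i j * (cdet k (\<lambda>i' j'. if j' = j then b i' else M i' j')/cdet k M)) = (\<Sum>j<k. M i j * x $ j)" by (intro sum.cong) (auto simp: xj)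
  also have "\<dots> = b i" using Av[OF that x] Ax that by (simp add: bv_def)
  finally show ?thesis .
 qed
qed

lemma clinear_mapI: "bounded_linear K\<Longrightarrow>(\<And>x. K (imul x) = imul (K x))\<Longrightarrow>clinear_map K" by (simp add: clinear_map_def)

lemma clinear_map_add: "clinear_map K\<Longrightarrow>clinear_map L\<Longrightarrow>clinear_map (\<lambda>x. K x + L x)" by (simp add: clinear_map_def bounded_linear_add imul_add)

lemma imul_cscale: "imul (\<zeta> *\<^sub>C v) = \<zeta> *\<^sub>C imul v" by (simp add: cscale_def imul_add imul_scaleR)

lemma clinear_map_funpow:
 fixes B :: "'a::complex_hilbert\<Rightarrow>'a"
 assumes "clinear_map B"
 shows "clinear_map (B ^^ m)"
proof (induction m)
 case 0
 show ?case unfolding funpow.simps id_def by (rule clinear_map_ident)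
next
 case (Suc m)
 show ?case unfolding funpow.simps o_def by (rule clinear_map_compose[OF assms Suc])
qed

lemma clinear_map_ident_minus_cscale:
 assumes K: "clinear_map K"
 shows "clinear_map (\<lambda>x. x-\<zeta> *\<^sub>C K x)"
proof (rule clinear_mapI)
 show "bounded_linear (\<lambda>x. x-\<zeta> *\<^sub>C K x)"
  by (intro bounded_linear_sub bounded_linear_ident bounded_linear_compose[OF cscale.bounded_linear_right] clinear_map_bounded_linear[OF K])
 show "imul x-\<zeta> *\<^sub>C K (imul x) = imul (x-\<zeta> *\<^sub>C K x)" for x by (simp add: clinear_map_imul[OF K] imul_diff imul_cscale)
qed

section \<open>Neumann series and reduction to finite rank\<close>

definition neumann :: "('a::complex_hilbert\<Rightarrow>'a)\<Rightarrow>complex\<Rightarrow>'a\<Rightarrow>'a" where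
 "neumann E z v = (\<Sum>n. z^n *\<^sub>C (E ^^ n) v)"

text \<open>The condition \<open>cmod z * \<eta> \<le> 1/2\<close> makes the series geometric with
  ratio 1/2, the origin of the factor 2 in the bounds built on it.\<close>

lemma neumann_props:
 fixes E :: "'a::complex_hilbert\<Rightarrow>'a"
 assumes E: "clinear_map E" and \<eta>: "\<And>x. norm (E x)\<le>\<eta> * norm x" "\<eta>\<ge>0" and z: "cmod z * \<eta>\<le>1/2"
 shows "summable (\<lambda>n. z^n *\<^sub>C (E ^^ n) v)"
  and "neumann E z v = v + z *\<^sub>C E (neumann E z v)"
  and "norm (neumann E z v)\<le>2 * norm v"
proof -
 have En: "norm ((E ^^ n) v)\<le>\<eta>^n * norm v" for n
 proof (induction n)
  case (Suc n)
  have "norm ((E ^^ Suc n) v)\<le>\<eta> * norm ((E ^^ n) v)" using \<eta>(1) by simp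
  also have "\<dots>\<le>\<eta> * (\<eta>^n * norm v)" by (intro mult_left_mono Suc \<eta>)
  finally show ?case by simp
 qed simp
 have bd: "norm (z^n *\<^sub>C (E ^^ n) v)\<le>(1/2)^n * norm v" for n
 proof -
  have "norm (z^n *\<^sub>C (E ^^ n) v)\<le>cmod z^n * (\<eta>^n * norm v)" by (simp add: norm_power mult_left_mono En)
  also have "\<dots> = (cmod z * \<eta>)^n * norm v" by (simp add: power_mult_distrib)
  also have "\<dots>\<le>(1/2)^n * norm v" using z \<eta>(2) by (intro mult_right_mono power_mono) auto
  finally show ?thesis .
 qed
 have gs: "(\<lambda>n. (1/2::real)^n * norm v) sums (2 * norm v)" using sums_mult2[OF geometric_sums[of "1/2::real"], of "norm v"] by simp
 show sm: "summable (\<lambda>n. z^n *\<^sub>C (E ^^ n) v)" by (rule summable_comparison_test'[OF sums_summable[OF gs], of 0]) (use bd in simp)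
 show "norm (neumann E z v)\<le>2 * norm v"
 proof -
  have sn: "summable (\<lambda>n. norm (z^n *\<^sub>C (E ^^ n) v))" by (rule summable_comparison_test'[OF sums_summable[OF gs], of 0]) (use bd in simp)
  have "norm (neumann E z v)\<le>(\<Sum>n. norm (z^n *\<^sub>C (E ^^ n) v))" unfolding neumann_def by (rule summable_norm[OF sn])
  also have "\<dots>\<le>(\<Sum>n. (1/2::real)^n * norm v)" by (rule suminf_le[OF bd sn sums_summable[OF gs]])
  also have "\<dots> = 2 * norm v" using gs sums_unique by metis
  finally show ?thesis .
 qed
 have blE: "bounded_linear (\<lambda>x. z *\<^sub>C E x)" by (intro bounded_linear_compose[OF cscale.bounded_linear_right] clinear_map_bounded_linear[OF E])
 have "neumann E z v = (\<Sum>n. z^Suc n *\<^sub>C (E ^^ Suc n) v) + v" unfolding neumann_def by (subst suminf_split_head[OF sm]) simp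
 also have "(\<Sum>n. z^Suc n *\<^sub>C (E ^^ Suc n) v) = (\<Sum>n. z *\<^sub>C E (z^n *\<^sub>C (E ^^ n) v))" by (simp add: clinear_map_cscale[OF E])
 also have "\<dots> = z *\<^sub>C E (neumann E z v)" unfolding neumann_def by (rule bounded_linear.suminf[OF blE sm, symmetric])
 finally show "neumann E z v = v + z *\<^sub>C E (neumann E z v)" unfolding add.commute[of v] .
qed

lemma neumann_holomorphic:
 fixes E :: "'a::complex_hilbert\<Rightarrow>'a"
 assumes E: "clinear_map E" and \<eta>: "\<And>x. norm (E x)\<le>\<eta> * norm x" "\<eta>\<ge>0" and R: "R * \<eta>\<le>1/2"
  and L: "clinear_map (L::'a\<Rightarrow>'a)"
 shows "(\<lambda>z. cinner (L (neumann E z v)) u) holomorphic_on ball 0 R"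
proof (rule power_series_holomorphic)
 fix z :: complex assume z: "z\<in>ball 0 R"
 have "cmod z * \<eta>\<le>R * \<eta>" using z \<eta>(2) by (intro mult_right_mono) auto
 hence z2: "cmod z * \<eta>\<le>1/2" using R by simp
 have bl: "bounded_linear (\<lambda>x. cinner (L x) u)" by (intro bounded_linear_compose[OF bounded_linear_cinner_left] clinear_map_bounded_linear[OF L])
 have "(\<lambda>n. z^n *\<^sub>C (E ^^ n) v) sums neumann E z v" unfolding neumann_def by (intro summable_sums neumann_props(1)[OF E \<eta> z2])
 from bounded_linear.sums[OF bl this]
 show "(\<lambda>n. cinner (L ((E ^^ n) v)) u * (z-0)^n) sums cinner (L (neumann E z v)) u" by (simp add: clinear_map_cscale[OF L] mult.commute)
qed

lemma clinear_map_rank_one: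
 assumes L: "clinear_map L"
 shows "clinear_map (\<lambda>x. cinner (L x) a *\<^sub>C b)"
proof (rule clinear_mapI)
 show "bounded_linear (\<lambda>x. cinner (L x) a *\<^sub>C b)" by (intro bounded_linear_compose[OF cscale.bounded_linear_left] bounded_linear_compose[OF bounded_linear_cinner_left]
    clinear_map_bounded_linear L)
 show "cinner (L (imul x)) a *\<^sub>C b = imul (cinner (L x) a *\<^sub>C b)" for x by (simp only: cscale_ii[symmetric] clinear_map_cscale[OF L] cinner_scale_left cscale_cscale)
qed

lemma clinear_map_sum: "(\<And>j. clinear_map (h j))\<Longrightarrow>clinear_map (\<lambda>x. \<Sum>j<(m::nat). h j x)"
proof (induction m)
 case (Suc m)
 then show ?case unfolding sum.lessThan_Suc by (intro clinear_map_add) simp_all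
qed (simp add: clinear_map_def imul_zero)

lemma orthonormal_projection:
 fixes f :: "nat\<Rightarrow>'a::complex_hilbert"
 assumes f: "\<forall>i<k. \<forall>j<k. cinner (f i) (f j) = (if i = j then 1 else 0)"
 defines "P \<equiv> \<lambda>x. \<Sum>i<k. cinner x (f i) *\<^sub>C f i"
 shows "clinear_map P" "j<k\<Longrightarrow>cinner (x-P x) (f j) = 0" "norm (x-P x)\<le>norm x"
  "\<forall>i<k. cinner y (f i) = 0\<Longrightarrow>cinner (P x) y = 0"
proof -
 show "clinear_map P" unfolding P_def by (intro clinear_map_sum clinear_map_rank_one clinear_map_ident)
 have perp: "cinner (x-P x) (f j) = 0" if "j<k" for j using that f by (simp add: P_def cinner_diff_left cinner_sum_left if_distrib[of "\<lambda>z. _ * z"] cong: if_cong)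
 thus "j<k\<Longrightarrow>cinner (x-P x) (f j) = 0" .
 have zero: "cinner (P x) y = 0" if "\<forall>i<k. cinner y (f i) = 0" for y
 proof -
  have "cinner (f i) y = 0" if "i<k" for i using \<open>\<forall>i<k. cinner y (f i) = 0\<close> that by (subst cinner_eq_0_commute) blast
  thus ?thesis by (simp add: P_def cinner_sum_left)
 qed
 thus "\<forall>i<k. cinner y (f i) = 0\<Longrightarrow>cinner (P x) y = 0" .
 have "inner (P x) (x-P x) = 0" using zero[of "x-P x"] perp Re_cinner[of "P x" "x-P x"] by simp
 moreover have "norm b\<le>norm (c + b)" if "inner c b = 0" for b c :: 'a using that unfolding norm_le by (simp add: inner_add_left inner_add_right inner_commute)
 ultimately have "norm (x-P x)\<le>norm (P x + (x-P x))" by blast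
 thus "norm (x-P x)\<le>norm x" by simp
qed

text \<open>With \<open>P\<close> the projection on the span of the \<open>f i\<close> and
  \<open>Q = 1 - P\<close>, one has \<open>A = Q A Q + P A + Q A P\<close>. The first summand is
  small because \<open>small\<close> controls the form of \<open>A\<close> on the annihilator; the
  other two have rank at most \<open>k\<close> each, whence \<open>k + k\<close> terms. Their
  coefficients are (A x, f_i) and (x, f_i) respectively, so \<open>L j\<close> is \<open>A\<close>
  in the first half of the sum and the identity in the second.\<close>

lemma small_compression_finite_rank:
 fixes A :: "'a::complex_hilbert\<Rightarrow>'a"
 assumes A: "clinear_map A" "\<And>x. norm (A x)\<le>a * norm x" and a: "a\<ge>1" and \<eta>: "\<eta>\<ge>0"
  and f: "\<forall>i<k. \<forall>j<k. cinner (f i) (f j) = (if i = j then 1 else 0)"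
  and small: "\<forall>x y. (\<forall>i<k. cinner x (f i) = 0)\<longrightarrow>(\<forall>i<k. cinner y (f i) = 0)\<longrightarrow>cmod (cinner (A x) y)\<le>\<eta> * norm x * norm y"
 shows "\<exists>E. clinear_map E\<and>(\<forall>x. norm (E x)\<le>\<eta> * norm x)\<and>(\<exists>L::nat\<Rightarrow>'a\<Rightarrow>'a. \<exists>f' g.
  (\<forall>x. A x = E x + (\<Sum>j<k + k. cinner (L j x) (f' j) *\<^sub>C g j))\<and>(\<forall>j. clinear_map (L j)\<and>(\<forall>x. norm (L j x)\<le>a * norm x)) \<and>
  (\<forall>j<k + k. norm (f' j)\<le>1\<and>norm (g j)\<le>a))"
proof -
 define P where "P x = (\<Sum>i<k. cinner x (f i) *\<^sub>C f i)" for x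
 define Q where "Q x = x-P x" for x
 note P = orthonormal_projection[of k f, OF f, folded P_def, folded Q_def]
 have clQ: "clinear_map Q" using P(1) unfolding clinear_map_def Q_def[abs_def] by (auto intro: bounded_linear_sub bounded_linear_ident simp: imul_diff)
 have add: "T (x + y) = T x + T y" if "clinear_map T" for T :: "'a\<Rightarrow>'a" and x y using clinear_map_bounded_linear[OF that] by (simp add: linear_simps)
 have sum: "T (\<Sum>j\<in>I. h j) = (\<Sum>j\<in>I. T (h j))" if "clinear_map T" for T :: "'a\<Rightarrow>'a" and h and I :: "nat set"
  using linear_sum[OF bounded_linear.linear[OF clinear_map_bounded_linear[OF that]]] by blast
 define E where "E x = Q (A (Q x))" for x
 have E\<eta>: "norm (E x)\<le>\<eta> * norm x" for x
 proof -
  have Ef: "\<forall>i<k. cinner (E x) (f i) = 0" "\<forall>i<k. cinner (Q x) (f i) = 0" by (simp_all add: E_def P(2))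
  have "cinner (E x) (E x) = cinner (A (Q x)) (E x)-cinner (P (A (Q x))) (E x)" by (simp add: E_def Q_def cinner_diff_left)
  also have "cinner (P (A (Q x))) (E x) = 0" by (rule P(4)[OF Ef(1)])
  finally have "cmod (cinner (E x) (E x))\<le>\<eta> * norm (Q x) * norm (E x)" using small[rule_format, OF Ef(2)[rule_format] Ef(1)[rule_format]] by simp
  also have "\<dots>\<le>\<eta> * norm x * norm (E x)" by (intro mult_right_mono mult_left_mono P(3) \<eta>) auto
  finally have "norm (E x) * norm (E x)\<le>(\<eta> * norm x) * norm (E x)" by (simp add: cinner_self power2_eq_square norm_mult)
  thus ?thesis using \<eta> by (cases "norm (E x) = 0") (auto simp: mult_le_cancel_right)
 qed
 define L where "L j = (if j<k then A else (\<lambda>x. x))" for j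
 define f' where "f' j = (if j<k then f j else f (j-k))" for j
 define g where "g j = (if j<k then f j else Q (A (f (j-k))))" for j
 have "(\<Sum>j<k + m. cinner (L j x) (f' j) *\<^sub>C g j) = P (A x) + (\<Sum>j<m. cinner x (f j) *\<^sub>C Q (A (f j)))" for m x
  by (induction m) (simp_all add: P_def L_def f'_def g_def add.assoc)
 moreover have "(\<Sum>j<k. cinner x (f j) *\<^sub>C Q (A (f j))) = Q (A (P x))" for x
  by (simp add: P_def sum[OF A(1)] sum[OF clQ] clinear_map_cscale[OF A(1)] clinear_map_cscale[OF clQ])
 moreover have "A x = E x + (P (A x) + Q (A (P x)))" for x
 proof -
  have "A x = P (A x) + Q (A (Q x + P x))" by (simp add: Q_def)
  also have "Q (A (Q x + P x)) = E x + Q (A (P x))" unfolding add[OF A(1)] add[OF clQ] E_def ..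
  finally show ?thesis by (simp add: algebra_simps)
 qed
 ultimately have dec: "A x = E x + (\<Sum>j<k + k. cinner (L j x) (f' j) *\<^sub>C g j)" for x by simp
 have f1: "norm (f i) = 1" if "i<k" for i
 proof -
  have "(norm (f i))\<^sup>2 = Re (cinner (f i) (f i))" by (simp only: cinner_self Re_complex_of_real)
  also have "\<dots> = 1\<^sup>2" using f that by simp
  finally show ?thesis by (rule power2_eq_imp_eq) auto
 qed
 have "norm (f' j)\<le>1\<and>norm (g j)\<le>a" if "j<k + k" for j
 proof (cases "j<k")
  case False
  hence j: "norm (f (j-k)) = 1" using that by (intro f1) simp
  have "norm (Q (A (f (j-k))))\<le>a" using order_trans[OF P(3) A(2)[of "f (j-k)"]] j by simp
  thus ?thesis using False j by (simp add: f'_def g_def)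
 qed (use f1 a in \<open>simp add: f'_def g_def\<close>)
 moreover have "clinear_map (L j)\<and>(\<forall>x. norm (L j x)\<le>a * norm x)" for j using A clinear_map_ident mult_right_mono[OF a norm_ge_zero] by (auto simp: L_def)
 moreover have "clinear_map E" unfolding E_def[abs_def] by (rule clinear_map_compose[OF clQ clinear_map_compose[OF A(1) clQ]])
 ultimately show ?thesis using E\<eta> dec by (intro exI[of _ E] conjI allI exI[of _ L] exI[of _ f'] exI[of _ g]) blast+
qed

text \<open>For \<open>A = E + F\<close> with \<open>z E\<close> small and \<open>F\<close> of rank \<open>k\<close>, the Neumann series inverts \<open>1 - z E\<close>,
 which reduces \<open>X = n + z A X\<close> to a \<open>k\<close> by \<open>k\<close> linear system.\<close>

lemma finite_rank_perturbation_resolvent: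
 fixes A E :: "'a::complex_hilbert\<Rightarrow>'a"
  and L :: "nat\<Rightarrow>'a\<Rightarrow>'a"
 assumes E: "clinear_map E" "\<And>x. norm (E x)\<le>\<eta> * norm x" "\<eta>\<ge>0"
  and A: "\<And>x. A x = E x + (\<Sum>j<k. cinner (L j x) (f j) *\<^sub>C g j)"
  and L: "\<And>j. clinear_map (L j)" "\<And>j x. norm (L j x)\<le>a * norm x"
  and fg: "\<forall>j<k. norm (f j)\<le>1\<and>norm (g j)\<le>a" and a: "a\<ge>1"
  and R: "R\<ge>1" "R * \<eta>\<le>1/2" and inj: "\<And>z x. x = z *\<^sub>C A x\<Longrightarrow>x = 0"
  and B: "B = 2 * (1 + R * a\<^sup>2)\<^sup>2 * (1 + norm n)"
 shows "\<exists>X. \<forall>z. cmod z<R\<longrightarrow>X z = n + z *\<^sub>C A (X z)"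
  and "\<And>X u. (\<And>z. cmod z<R\<Longrightarrow>X z = n + z *\<^sub>C A (X z))\<Longrightarrow>(\<lambda>z. cinner (X z) u) holomorphic_on ball 0 R"
  and "\<And>X u z. (\<And>z. cmod z<R\<Longrightarrow>X z = n + z *\<^sub>C A (X z))\<Longrightarrow>cmod z\<le>R/2 \<Longrightarrow>
   cmod (cinner (X z) u)\<le>(real k + 1) * (2 * fact k * B^k)^3 * B * norm u"
proof -
 have add: "T (x + y) = T x + T y" if "clinear_map T" for T :: "'a\<Rightarrow>'a" and x y using clinear_map_bounded_linear[OF that] by (simp add: linear_simps)
 have sum: "T (\<Sum>j\<in>I. h j) = (\<Sum>j\<in>I. T (h j))" if "clinear_map T" for T :: "'a\<Rightarrow>'a" and h and I :: "nat set"
  using linear_sum[OF bounded_linear.linear[OF clinear_map_bounded_linear[OF that]]] by blast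
 have zero: "T 0 = 0" if "clinear_map T" for T :: "'a\<Rightarrow>'a" using clinear_map_cscale[OF that, of 0 0] by simp
 have clA: "clinear_map A" unfolding A[abs_def] by (intro clinear_map_add E(1) clinear_map_sum clinear_map_rank_one L(1))
 have z\<eta>: "cmod z * \<eta>\<le>1/2" if "cmod z<R" for z using mult_right_mono[of "cmod z" R \<eta>] that E(3) R(2) by simp
 define G where "G = neumann E"
 note N = neumann_props[OF E z\<eta>, folded G_def]
 \<comment> \<open>The matrix of the system for the numbers \<open>cinner (L i X) (f i)\<close>.
   Given these, \<open>X\<close> is the Neumann series applied to \<open>n\<close> plus
   \<open>z\<close> times the combination of the \<open>g j\<close> with these coefficients.\<close>
 define S where "S z i j = (if i = j then 1 else 0)-z * cinner (L i (G z (g j))) (f i)" for z i j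
 define b where "b z i = cinner (L i (G z n)) (f i)" for z i
 define sol where "sol z c m = G z m + z *\<^sub>C (\<Sum>j<k. c j *\<^sub>C G z (g j))" for z c m
 have coeff: "cinner (L i (sol z c m)) (f i) = c i"
  if "i<k" "(\<Sum>j<k. S z i j * c j) = cinner (L i (G z m)) (f i)" for z c m i
 proof -
  have "(\<Sum>j<k. S z i j * c j) = (\<Sum>j<k. if i = j then c j else 0)-(\<Sum>j<k. z * (c j * cinner (L i (G z (g j))) (f i)))"
   unfolding sum_subtractf[symmetric] by (intro sum.cong) (auto simp: S_def algebra_simps)
  thus ?thesis using that by (simp add: sol_def add[OF L(1)] sum[OF L(1)] clinear_map_cscale[OF L(1)] cinner_add_left cinner_sum_left sum_distrib_left)
 qed
 have sol: "sol z c m = m + z *\<^sub>C A (sol z c m)"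
  if z: "cmod z<R" and c: "\<And>i. i<k\<Longrightarrow>(\<Sum>j<k. S z i j * c j) = cinner (L i (G z m)) (f i)" for z c m
 proof -
  have "(\<Sum>j<k. c j *\<^sub>C G z (g j)) = (\<Sum>j<k. c j *\<^sub>C (g j + z *\<^sub>C E (G z (g j))))" using N(2)[OF z] by simp
  also have "\<dots> = (\<Sum>j<k. c j *\<^sub>C g j) + E (z *\<^sub>C (\<Sum>j<k. c j *\<^sub>C G z (g j)))"
   by (simp add: cscale.add_right sum.distrib sum[OF E(1)] clinear_map_cscale[OF E(1)] cscale.sum_right mult.commute)
  finally have 1: "(\<Sum>j<k. c j *\<^sub>C G z (g j)) = (\<Sum>j<k. c j *\<^sub>C g j) + E (z *\<^sub>C (\<Sum>j<k. c j *\<^sub>C G z (g j)))" .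
  have "sol z c m = (m + z *\<^sub>C E (G z m)) + z *\<^sub>C ((\<Sum>j<k. c j *\<^sub>C g j) + E (z *\<^sub>C (\<Sum>j<k. c j *\<^sub>C G z (g j))))"
   unfolding sol_def by (subst 1, subst N(2)[OF z]) (rule refl)
  also have "\<dots> = m + z *\<^sub>C (E (sol z c m) + (\<Sum>j<k. c j *\<^sub>C g j))" by (simp add: sol_def add[OF E(1)] cscale.add_right)
  also have "E (sol z c m) + (\<Sum>j<k. c j *\<^sub>C g j) = A (sol z c m)" unfolding A using coeff[OF _ c] by simp
  finally show ?thesis .
 qed
 \<comment> \<open>A null vector of the matrix produces a solution of
   \<open>x = z *\<^sub>C A x\<close>, which \<open>inj\<close> makes zero; hence the determinant
   has no zeros in the disc.\<close>
 have inj': "c i = 0" if z: "cmod z<R" and c: "\<And>i. i<k\<Longrightarrow>(\<Sum>j<k. S z i j * c j) = 0" and i: "i<k" for z c i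
 proof -
  have G0: "G z 0 = 0" using N(3)[OF z, of 0] by simp
  have c0: "(\<Sum>j<k. S z i j * c j) = cinner (L i (G z 0)) (f i)" if "i<k" for i using c[OF that] by (simp add: G0 zero[OF L(1)])
  have "sol z c 0 = 0 + z *\<^sub>C A (sol z c 0)" by (rule sol[OF z c0])
  hence "sol z c 0 = 0" using inj[of "sol z c 0" z] by simp
  thus ?thesis using coeff[OF i c0[OF i]] by (simp add: zero[OF L(1)])
 qed
 define D where "D z = cdet k (S z)" for z
 define C where "C z j = cdet k (\<lambda>i' j'. if j' = j then b z i' else S z i' j')" for z j
 have D0: "D z\<noteq>0" if "cmod z<R" for z unfolding D_def by (rule cdet_cramer(1)) (use inj'[OF that] in blast)
 define Y where "Y z = sol z (\<lambda>j. C z j/D z) n" for z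
 have Y: "Y z = n + z *\<^sub>C A (Y z)" if "cmod z<R" for z unfolding Y_def
 proof (rule sol[OF that])
  fix i assume "i<k"
  show "(\<Sum>j<k. S z i j * (C z j/D z)) = cinner (L i (G z n)) (f i)"
   unfolding C_def D_def by (subst cdet_cramer(2)[OF _ \<open>i < k\<close>]) (use inj'[OF that] in \<open>auto simp: b_def\<close>)
 qed
 show "\<exists>X. \<forall>z. cmod z<R\<longrightarrow>X z = n + z *\<^sub>C A (X z)" by (intro exI[of _ Y] allI impI) (rule Y)
 have holG: "(\<lambda>z. cinner (T (G z v)) u) holomorphic_on ball 0 R" if "clinear_map T" for T :: "'a\<Rightarrow>'a" and v u
  unfolding G_def by (rule neumann_holomorphic[OF E R(2) that])
 have holS: "(\<lambda>z. S z i j) holomorphic_on ball 0 R" for i j unfolding S_def by (intro holomorphic_intros holG L)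
 have holb: "(\<lambda>z. b z i) holomorphic_on ball 0 R" for i unfolding b_def by (intro holG L)
 have holD: "D holomorphic_on ball 0 R" unfolding D_def[abs_def] by (rule cdet_holomorphic) (rule holS)
 have holC: "(\<lambda>z. C z j) holomorphic_on ball 0 R" for j unfolding C_def
 proof (rule cdet_holomorphic)
  show "(\<lambda>z. if j' = j then b z i' else S z i' j') holomorphic_on ball 0 R" for i' j' by (cases "j' = j") (auto intro: holb holS)
 qed
 have F: "cinner (Y z) u = (\<Sum>j<k. C z j/D z * (z * cinner (G z (g j)) u)) + cinner (G z n) u" for z u
  by (simp add: Y_def sol_def cinner_add_left cinner_sum_left sum_distrib_left algebra_simps)
 have holF: "(\<lambda>z. cinner (Y z) u) holomorphic_on ball 0 R" for u unfolding F using D0 by (intro holomorphic_intros holC holD holG[OF clinear_map_ident]) auto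
 \<comment> \<open>Uniqueness, again from \<open>inj\<close>, lets the conclusions speak of an
   arbitrary solution instead of the constructed one; this is what later glues the solutions on
   different discs.\<close>
 have uniq: "X z = Y z" if "\<And>z. cmod z<R\<Longrightarrow>X z = n + z *\<^sub>C A (X z)" "cmod z<R" for X z
 proof -
  have "X z-Y z = z *\<^sub>C A (X z)-z *\<^sub>C A (Y z)" by (subst that(1)[OF that(2)], subst Y[OF that(2)]) simp
  also have "\<dots> = z *\<^sub>C A (X z-Y z)" using clinear_map_bounded_linear[OF clA] by (simp add: linear_simps cscale.diff_right)
  finally have "X z-Y z = 0" by (rule inj)
  thus ?thesis by simp
 qed
 show "(\<lambda>z. cinner (X z) u) holomorphic_on ball 0 R" if X: "\<And>z. cmod z<R\<Longrightarrow>X z = n + z *\<^sub>C A (X z)" for X u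
  by (rule holomorphic_transform[OF holF[of u]]) (use uniq[OF X] in auto)
 define q where "q = R * a\<^sup>2"
 have aq: "1\<le>a * a" "a\<le>a * a" "a * a\<le>q" "R * a\<le>q"
  using a R(1) mult_mono[of 1 a 1 a] mult_right_mono[of 1 a a] mult_right_mono[of 1 R "a * a"] mult_left_mono[of a "a * a" R] by (auto simp: q_def power2_eq_square)
 have B1: "B = 2 * (1 + q)\<^sup>2 * (1 + norm n)" by (simp add: B q_def)
 have q2: "1 + 2 * q\<le>(1 + q)\<^sup>2" "0\<le>q" using aq by (simp_all add: power2_sum)
 have Bge: "2 * (1 + q)\<^sup>2\<le>B" "2 * (1 + q)\<^sup>2 * norm n\<le>B" by (simp_all add: B1 algebra_simps)
 have Bq: "1 + 2 * q\<le>B" "2 * q * norm n\<le>B" using q2 Bge order_trans[OF mult_right_mono[of "2 * q" "2 * (1 + q)\<^sup>2" "norm n"] Bge(2)] by simp_all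
 have cL: "cmod (cinner (L i x) (f i))\<le>a * norm x" if "i<k" for i x
  using norm_cinner_le[of "L i x" "f i"] mult_mono[OF L(2)[of i x], of "norm (f i)" 1] fg that a by simp
 have nG: "norm (G z (g j))\<le>2 * a" if "cmod z<R" "j<k" for z j using order_trans[OF N(3)[OF that(1), of "g j"], of "2 * a"] fg that(2) by simp
 have SB: "cmod (S z i j)\<le>B" if z: "cmod z<R" and ij: "i<k" "j<k" for z i j
 proof -
  have "cmod (S z i j)\<le>cmod (if i = j then 1 else 0) + cmod z * cmod (cinner (L i (G z (g j))) (f i))"
   unfolding S_def by (rule order_trans[OF norm_triangle_ineq4]) (simp add: norm_mult)
  also have "\<dots>\<le>1 + R * (a * (2 * a))" using z R a order_trans[OF cL[OF ij(1)] mult_left_mono[OF nG[OF z ij(2)]]] by (intro add_mono mult_mono) auto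
  also have "\<dots> = 1 + 2 * q" by (simp add: q_def power2_eq_square)
  finally show ?thesis using Bq by linarith
 qed
 have nn: "2 * a * norm n\<le>B" using order_trans[OF mult_right_mono[of "2 * a" "2 * q" "norm n"] Bq(2)] aq by simp
 have bB: "cmod (b z i)\<le>B" if z: "cmod z<R" and i: "i<k" for z i
  using order_trans[OF cL[OF i, of "G z n"] mult_left_mono[OF N(3)[OF z, of n], of a]] a nn by (simp add: b_def mult_ac)
 define W where "W = fact k * B^k"
 have Bge1: "B\<ge>1" using Bq(1) q2(2) by linarith
 have W1: "W\<ge>1" unfolding W_def using Bge1 by (intro mult_ge1_I) (auto simp: one_le_power fact_ge_1)
 have DW: "cmod (D z)\<le>W" if "cmod z<R" for z unfolding D_def W_def by (rule norm_cdet_le) (rule SB[OF that])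
 have CW: "cmod (C z j)\<le>W" if "cmod z<R" for z j unfolding C_def W_def by (rule norm_cdet_le) (use SB[OF that] bB[OF that] in auto)
 \<comment> \<open>\<open>W\<close> bounds the determinant; \<open>2 * W\<close> makes the bound
   strict and its logarithm positive. As \<open>D 0 = 1\<close>, the zero-free estimate gives
   \<open>1/(2 * W)\<^sup>2\<close> from below, and dividing numerators of size \<open>W\<close> by
   it leads to the cube in the conclusion.\<close>
 have DL: "cmod (D z)\<ge>1/(2 * W)\<^sup>2" if "cmod z\<le>R/2" for z
 proof -
  have e: "exp (ln (2 * W)) = 2 * W" using W1 by simp
  have "cmod (D z)\<ge>exp (- 2 * ln (2 * W))"
  proof (rule zero_free_lower_bound[OF holD _ _ D0 _ _ that])
   have "S 0 = (\<lambda>i j. if i = j then 1 else 0)" by (auto simp: S_def fun_eq_iff)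
   thus "D 0 = 1" by (simp add: D_def cdet_identity)
   show "cmod (D z)<exp (ln (2 * W))" if "cmod z<R" for z using DW[OF that] W1 e by simp
  qed (use W1 R in auto)
  also have "exp (- 2 * ln (2 * W)) = 1/(exp (ln (2 * W)))\<^sup>2" by (simp add: exp_minus inverse_eq_divide flip: exp_double)
  finally show ?thesis unfolding e .
 qed
 fix X u z assume X: "\<And>z. cmod z<R\<Longrightarrow>X z = n + z *\<^sub>C A (X z)" and z: "cmod z\<le>R/2"
 have zR: "cmod z<R" using z R by simp
 have cj: "cmod (C z j/D z)\<le>(2 * W)^3" for j
 proof -
  have "cmod (C z j/D z)\<le>W/(1/(2 * W)\<^sup>2)" unfolding norm_divide using CW[OF zR] DL[OF z] W1 by (intro frac_le) auto
  also have "\<dots>\<le>(2 * W)^3" using W1 by (simp add: power2_eq_square power3_eq_cube)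
  finally show ?thesis .
 qed
 have cG: "cmod (cinner (G z v) u)\<le>2 * norm v * norm u" for v by (rule order_trans[OF norm_cinner_le]) (intro mult_right_mono N(3)[OF zR], simp)
 have tm: "cmod (z * cinner (G z (g j)) u)\<le>B * norm u" if "j<k" for j
 proof -
  have "cmod (z * cinner (G z (g j)) u)\<le>R * ((2 * a) * norm u)" unfolding norm_mult using zR R fg that by (intro mult_mono order_trans[OF cG] mult_right_mono) auto
  also have "\<dots> = (2 * (R * a)) * norm u" by simp
  also have "\<dots>\<le>B * norm u" using aq(4) Bq(1) by (intro mult_right_mono) auto
  finally show ?thesis .
 qed
 have XF: "cinner (X z) u = (\<Sum>j<k. C z j/D z * (z * cinner (G z (g j)) u)) + cinner (G z n) u" by (subst uniq[of X z, OF X zR]) (assumption, rule F)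
 have "cmod (cinner (X z) u)\<le>(\<Sum>j<k. cmod (C z j/D z) * cmod (z * cinner (G z (g j)) u)) + cmod (cinner (G z n) u)"
  unfolding XF norm_mult[symmetric] by (intro order_trans[OF norm_triangle_ineq] add_mono norm_sum order_refl)
 also have "\<dots>\<le>(\<Sum>j<k. (2 * W)^3 * (B * norm u)) + (2 * W)^3 * (B * norm u)"
 proof (intro add_mono sum_mono mult_mono)
  have "cmod (cinner (G z n) u)\<le>B * norm u"
   using order_trans[OF cG[of n] mult_right_mono[of "2 * norm n" B "norm u"]] nn mult_right_mono[OF a, of "2 * norm n"] by simp
  also have "\<dots>\<le>(2 * W)^3 * (B * norm u)" using W1 Bge1 mult_right_mono[of 1 "(2*W)^3" "B * norm u"] one_le_power[of "2*W" 3] by simp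
  finally show "cmod (cinner (G z n) u)\<le>(2 * W)^3 * (B * norm u)" .
 qed (use cj tm W1 in auto)
 also have "\<dots> = (real k + 1) * (2 * fact k * B^k)^3 * B * norm u" by (simp add: W_def algebra_simps)
 finally show "cmod (cinner (X z) u)\<le>(real k + 1) * (2 * fact k * B^k)^3 * B * norm u" .
qed

section \<open>Completeness by Phragmen-Lindelof\<close>

text \<open>Taking \<open>N\<close> as the ceiling of (2 C R)^(1/q) gives R C N^(-q) \<le> 1/2. The
  rank after reduction is at most \<open>2 * N\<close>, thus of order R^(1/q), and the determinant
  bound becomes the exponential of a multiple of R^(1/q) ln R, which is below
  \<open>exp (R powr \<rho>)\<close> as soon as \<rho> > 1/q.\<close>

lemma growth_asymptotics:
 fixes q \<rho> C a nn :: real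
 assumes q: "q>1" and \<rho>: "1/q<\<rho>" and C: "C>0" and a: "a\<ge>0" and nn: "nn\<ge>0"
 shows "\<exists>R0\<ge>1. \<forall>R\<ge>R0. \<exists>N\<ge>(1::nat). R * (C * real N powr (- q))\<le>1/2 \<and>
  (\<forall>k\<le>2 * N. (real k + 1) * (2 * fact k * (2 * (1 + R * a)\<^sup>2 * (1 + nn))^k)^3 * (2 * (1 + R * a)\<^sup>2 * (1 + nn))
   \<le>exp (R powr \<rho>))"
proof -
 define s where "s = 1/q"
 have s: "s>0" "s<1" "s<\<rho>" using q \<rho> by (auto simp: s_def)
 define D where "D = (2 * C) powr s"
 have D: "D>0" using C by (simp add: D_def)
 define B where "B R = 2 * (1 + R * a)\<^sup>2 * (1 + nn)" for R
 have 1: "eventually (\<lambda>R. 2 * (D * R powr s) + 3\<le>R^2) at_top" using s D by real_asymp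
 \<comment> \<open>\<open>a + 1\<close> in place of \<open>a\<close> keeps the leading coefficient
   positive when \<open>a = 0\<close>.\<close>
 have 2: "eventually (\<lambda>R::real. 2 * (1 + R * (a + 1))\<^sup>2 * (1 + nn)\<le>R^3) at_top" using a nn by real_asymp
 \<comment> \<open>The exponent anticipates the count below: \<open>M * B R \<le> R^5\<close>,
   raised to the power \<open>M\<close> and cubed, gives \<open>15 * M\<close>, and the remaining
   factors cost \<open>R^6\<close>.\<close>
 have 3: "eventually (\<lambda>R::real. (6 + 15 * (2 * (D * R powr s) + 2)) * ln R\<le>R powr \<rho>) at_top" using s D by real_asymp
 have 4: "eventually (\<lambda>R::real. R\<ge>8\<and>2 * C * R\<ge>1) at_top"
 proof (rule eventually_conj)
  show "eventually (\<lambda>R::real. 2 * C * R\<ge>1) at_top" using C by real_asymp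
 qed (rule eventually_ge_at_top)
 from eventually_conj[OF 1 eventually_conj[OF 2 eventually_conj[OF 3 4]]]
 obtain R1 where R1: "\<And>R. R\<ge>R1\<Longrightarrow>2 * (D * R powr s) + 3\<le>R^2\<and>2 * (1 + R * (a + 1))\<^sup>2 * (1 + nn)\<le>R^3 \<and>
  (6 + 15 * (2 * (D * R powr s) + 2)) * ln R\<le>R powr \<rho>\<and>R\<ge>8\<and>2 * C * R\<ge>1" unfolding eventually_at_top_linorder by blast
 show ?thesis unfolding B_def[symmetric]
 proof (intro exI[of _ "max R1 1"] conjI allI impI)
  fix R assume "R\<ge>max R1 1"
  hence R: "2 * (D * R powr s) + 3\<le>R^2" "2 * (1 + R * (a + 1))\<^sup>2 * (1 + nn)\<le>R^3"
   "(6 + 15 * (2 * (D * R powr s) + 2)) * ln R\<le>R powr \<rho>" "R\<ge>8" "2 * C * R\<ge>1" using R1 by auto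
  have BR: "B R\<le>R^3"
  proof -
   have "B R\<le>2 * (1 + R * (a + 1))\<^sup>2 * (1 + nn)" unfolding B_def using R a nn by (intro mult_right_mono mult_left_mono power_mono add_left_mono) auto
   thus ?thesis using R(2) by linarith
  qed
  have B1: "B R\<ge>1"
  proof -
   have "1\<le>(1 + R * a)\<^sup>2" using R a by (intro one_le_power) simp
   hence "1 * 1\<le>(2 * (1 + R * a)\<^sup>2) * (1 + nn)" using nn by (intro mult_mono) auto
   thus ?thesis by (simp add: B_def)
  qed
  define t where "t = (2 * C * R) powr s"
  have t1: "t\<ge>1" using R(5) s by (simp add: t_def ge_one_powr_ge_zero)
  have tD: "t = D * R powr s" using C R by (simp add: t_def D_def powr_mult)
  define N where "N = nat \<lceil>t\<rceil>"
  have N: "real N\<ge>t" "real N\<le>t + 1" using t1 by (auto simp: N_def)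
  have N1: "N\<ge>1" using N t1 by linarith
  show "\<exists>N\<ge>(1::nat). R * (C * real N powr (- q))\<le>1/2 \<and>
   (\<forall>k\<le>2 * N. (real k + 1) * (2 * fact k * B R^k)^3 * B R\<le>exp (R powr \<rho>))"
  proof (intro exI[of _ N] conjI allI impI N1)
   have "real N powr (- q)\<le>t powr (- q)" using N t1 q by (intro powr_mono2') auto
   also have "t powr (- q) = 1/(2 * C * R)" unfolding t_def powr_powr using q R C by (simp add: s_def powr_minus_divide)
   finally have "R * (C * real N powr (- q))\<le>R * (C * (1/(2 * C * R)))" using R C by (intro mult_left_mono) auto
   also have "\<dots> = 1/2" using R C by simp
   finally show "R * (C * real N powr (- q))\<le>1/2" .
   define M where "M = 2 * N"
   have M: "real M\<le>2 * t + 2" "M\<ge>1" using N(2) N1 by (auto simp: M_def)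
   fix k assume "k\<le>2 * N"
   hence k: "k\<le>M" by (simp add: M_def)
   have NR: "real M + 1\<le>R^2" using M(1) tD R(1) by simp
   have NB: "real M * B R\<le>R^5"
   proof -
    have "real M * B R\<le>R^2 * R^3" using NR BR B1 by (intro mult_mono) auto
    thus ?thesis by (simp flip: power_add)
   qed
   have NB1: "real M * B R\<ge>1" using M(2) B1 by (intro mult_ge1_I) auto
   have "fact k\<le>(real M)^k"
   proof -
    have "fact k\<le>real k^k" by (metis fact_le_power le_refl of_nat_fact of_nat_power)
    also have "\<dots>\<le>real M^k" using k by (intro power_mono) auto
    finally show ?thesis .
   qed
   hence "fact k * B R^k\<le>real M^k * B R^k" using B1 by (intro mult_right_mono) auto
   also have "\<dots> = (real M * B R)^k" by (simp add: power_mult_distrib)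
   also have "\<dots>\<le>(R^5)^k" using NB NB1 by (intro power_mono) auto
   also have "\<dots>\<le>(R^5)^M" using R(4) k by (intro power_increasing one_le_power) auto
   finally have "2 * fact k * B R^k\<le>2 * (R^5)^M" by simp
   hence "(2 * fact k * B R^k)^3\<le>(2 * (R^5)^M)^3" using B1 by (intro power_mono) auto
   also have "\<dots> = 8 * R^(15 * M)" by (simp add: power_mult_distrib flip: power_mult)
   also have "\<dots>\<le>R * R^(15 * M)" using R(4) by (intro mult_right_mono) auto
   finally have f3: "(2 * fact k * B R^k)^3\<le>R * R^(15 * M)" .
   have "(real k + 1) * (2 * fact k * B R^k)^3 * B R\<le>R^2 * (R * R^(15 * M)) * R^3" using f3 NR k BR B1 R(4) by (intro mult_mono) auto
   also have "\<dots> = R^(6 + 15 * M)" by (simp add: power_add power2_eq_square power3_eq_cube power_numeral_reduce)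
   also have "\<dots> = exp ((6 + 15 * real M) * ln R)" using R(4) by (simp add: exp_of_nat_mult[symmetric] flip: powr_realpow) (simp add: powr_def)
   also have "(6 + 15 * real M) * ln R\<le>(6 + 15 * (2 * (D * R powr s) + 2)) * ln R" using M(1) tD R(4) by (intro mult_right_mono) auto
   also have "\<dots>\<le>R powr \<rho>" by (rule R)
   finally show "(real k + 1) * (2 * fact k * B R^k)^3 * B R\<le>exp (R powr \<rho>)" by simp
  qed
 qed auto
qed

text \<open>Phragmen-Lindelof, carried out for \<open>F (exp \<zeta>)\<close> on a strip so that no branch cut and no corner
 at the origin appears.\<close>

lemma Phragmen_Lindelof_sector:
 assumes F: "F holomorphic_on UNIV" and \<rho>: "\<rho>>0" and b: "0<b" "b<pi" "\<rho> * b<pi/2"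
  and growth: "\<And>z. cmod z\<ge>R0\<Longrightarrow>cmod (F z)\<le>K * exp ((2 * cmod z) powr \<rho>)"
  and sector: "\<And>z. \<bar>Arg z\<bar>\<ge>b\<or>z = 0\<Longrightarrow>cmod (F z)\<le>M" and M: "M>0" and K: "K>0"
 shows "cmod (F z)\<le>M"
proof (cases "\<bar>Arg z\<bar>\<ge>b\<or>z = 0")
 case False
 define \<zeta>0 where "\<zeta>0 = Ln z"
 have z: "z = exp \<zeta>0" "\<bar>Im \<zeta>0\<bar><b" using False by (auto simp: \<zeta>0_def Arg_eq_Im_Ln)
 \<comment> \<open>Midway between \<rho> and pi/(2 b): large enough for the damping factor to beat
   growth of order \<rho>, small enough for \<open>exp (\<sigma> * \<zeta>)\<close> to have positive
   real part on the whole strip.\<close>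
 define \<sigma> where "\<sigma> = (\<rho> + pi/(2 * b))/2"
 have \<sigma>: "\<rho><\<sigma>" "\<sigma> * b<pi/2" "\<sigma>>0"
 proof -
  have "\<rho><pi/(2 * b)" using b by (simp add: field_simps)
  thus "\<rho><\<sigma>" by (simp add: \<sigma>_def)
  thus "\<sigma>>0" using \<rho> by simp
  have "\<sigma><pi/(2 * b)" using \<open>\<rho> < pi / (2 * b)\<close> by (simp add: \<sigma>_def)
  thus "\<sigma> * b<pi/2" using b by (simp add: field_simps)
 qed
 define \<kappa> where "\<kappa> = cos (\<sigma> * b)"
 have "\<sigma> * b>0" using \<sigma> b by simp
 hence "- (pi/2)<\<sigma> * b" using pi_half_gt_zero by linarith
 hence \<kappa>: "\<kappa>>0" unfolding \<kappa>_def using \<sigma>(2) by (intro cos_gt_zero_pi)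
 have Re_low: "Re (exp (of_real \<sigma> * \<zeta>))\<ge>\<kappa> * exp (\<sigma> * Re \<zeta>)" if "\<bar>Im \<zeta>\<bar>\<le>b" for \<zeta>
 proof -
  have "\<sigma> * b\<le>pi" using \<sigma>(2) pi_half_gt_zero by linarith
  hence "\<kappa>\<le>cos (\<sigma> * \<bar>Im \<zeta>\<bar>)" unfolding \<kappa>_def using that \<sigma> by (intro cos_monotone_0_pi_le mult_left_mono mult_nonneg_nonneg) auto
  also have "\<dots> = cos (\<sigma> * Im \<zeta>)" by (cases "Im \<zeta>\<ge>0") auto
  finally show ?thesis by (simp add: Re_exp mult.commute)
 qed
 have main: "cmod (F z) * exp (- \<epsilon> * Re (exp (of_real \<sigma> * \<zeta>0)))\<le>M + \<epsilon>" if \<epsilon>: "\<epsilon>>0" for \<epsilon>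
 proof -
  \<comment> \<open>Near the origin continuity bounds \<open>F\<close> by
    \<open>M + \<epsilon>\<close>, which takes care of the left edge of the rectangle and explains
    the \<epsilon> added to \<open>M\<close>.\<close>
  have "isCont F 0" using F holomorphic_on_imp_continuous_on continuous_on_eq_continuous_at open_UNIV by blast
  then obtain d where d: "d>0" "\<And>y. cmod y<d\<Longrightarrow>cmod (F y-F 0)<\<epsilon>" using \<epsilon> unfolding continuous_at_eps_delta by (metis dist_norm diff_zero)
  have left: "cmod (F y)\<le>M + \<epsilon>" if "cmod y<d" for y using d(2)[OF that] sector[of 0] norm_triangle_sub[of "F y" "F 0"] by auto
  have "eventually (\<lambda>L. K * exp ((2 * exp L) powr \<rho>) * exp (- \<epsilon> * (\<kappa> * exp (\<sigma> * L)))\<le>M) at_top"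
  proof -
   have "((\<lambda>L. K * exp ((2 * exp L) powr \<rho>) * exp (- \<epsilon> * (\<kappa> * exp (\<sigma> * L))))\<longlongrightarrow>0) at_top" using \<sigma> \<rho> \<kappa> \<epsilon> K by real_asymp
   hence "eventually (\<lambda>L. K * exp ((2 * exp L) powr \<rho>) * exp (- \<epsilon> * (\<kappa> * exp (\<sigma> * L)))<M) at_top" using M by (rule order_tendstoD(2))
   thus ?thesis by eventually_elim simp
  qed
  moreover have "eventually (\<lambda>L. exp L\<ge>R0) at_top" by real_asymp
  moreover have "eventually (\<lambda>L. exp (- L)<d) at_top" using d(1) by real_asymp
  moreover have "eventually (\<lambda>L. L>\<bar>Re \<zeta>0\<bar>) at_top" by (rule eventually_gt_at_top)
  ultimately have "eventually (\<lambda>L. K * exp ((2 * exp L) powr \<rho>) * exp (- \<epsilon> * (\<kappa> * exp (\<sigma> * L)))\<le>M \<and>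
   exp L\<ge>R0\<and>exp (- L)<d\<and>L>\<bar>Re \<zeta>0\<bar>) at_top" by eventually_elim auto
  \<comment> \<open>Far enough to the right for the damping to win, and far enough to the left for
    the exponential of that edge to fall into the disc of continuity.\<close>
  then obtain L where L: "K * exp ((2 * exp L) powr \<rho>) * exp (- \<epsilon> * (\<kappa> * exp (\<sigma> * L)))\<le>M"
   "exp L\<ge>R0" "exp (- L)<d" "L>\<bar>Re \<zeta>0\<bar>" using eventually_happens by (metis (no_types, lifting) trivial_limit_at_top_linorder)
  \<comment> \<open>The damping factor has modulus at most 1 on the rectangle and defeats the growth
    on its right edge; letting \<epsilon> tend to 0 removes it in the end.\<close>
  define G where "G \<zeta> = F (exp \<zeta>) * exp (- of_real \<epsilon> * exp (of_real \<sigma> * \<zeta>))" for \<zeta>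
  define S where "S = cbox (Complex (- L) (- b)) (Complex L b)"
  have cG: "cmod (G \<zeta>) = cmod (F (exp \<zeta>)) * exp (- \<epsilon> * Re (exp (of_real \<sigma> * \<zeta>)))" for \<zeta> by (simp add: G_def norm_mult)
  have hG: "G holomorphic_on UNIV"
  proof -
   have "(\<lambda>\<zeta>. F (exp \<zeta>)) holomorphic_on UNIV" by (rule holomorphic_on_compose_gen[OF _ F, unfolded o_def]) (auto intro: holomorphic_intros)
   thus ?thesis unfolding G_def by (intro holomorphic_intros)
  qed
  have le1: "exp (- \<epsilon> * Re (exp (of_real \<sigma> * \<zeta>)))\<le>1" if "\<bar>Im \<zeta>\<bar>\<le>b" for \<zeta>
  proof -
   have "0\<le>\<kappa> * exp (\<sigma> * Re \<zeta>)" using \<kappa> by simp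
   hence "0\<le>Re (exp (of_real \<sigma> * \<zeta>))" using Re_low[OF that] by linarith
   thus ?thesis using \<epsilon> by simp
  qed
  have "cmod (G \<zeta>0)\<le>M + \<epsilon>"
  proof (rule maximum_modulus_frontier[of G S])
   show "G holomorphic_on interior S" using hG holomorphic_on_subset by blast
   show "continuous_on (closure S) G" using hG holomorphic_on_imp_continuous_on continuous_on_subset by blast
   show "bounded S" by (simp add: S_def)
   show "\<zeta>0\<in>S" using z(2) L(4) by (auto simp: S_def in_cbox_complex_iff)
   fix \<zeta> assume "\<zeta>\<in>frontier S"
   hence \<zeta>: "\<bar>Re \<zeta>\<bar>\<le>L" "\<bar>Im \<zeta>\<bar>\<le>b" "\<bar>Re \<zeta>\<bar> = L\<or>\<bar>Im \<zeta>\<bar> = b" by (auto simp: S_def frontier_cbox in_cbox_complex_iff in_box_complex_iff)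
   consider "\<bar>Im \<zeta>\<bar> = b" | "Re \<zeta> = L" | "Re \<zeta> =-L" using \<zeta>(3) by linarith
   thus "cmod (G \<zeta>)\<le>M + \<epsilon>"
   proof cases
    case 1
    have "Arg (exp \<zeta>) = Im \<zeta>" using 1 b by (intro Arg_exp) auto
    hence "cmod (F (exp \<zeta>))\<le>M" using sector[of "exp \<zeta>"] 1 by simp
    hence "cmod (G \<zeta>)\<le>M * 1" unfolding cG using le1[OF \<zeta>(2)] M by (intro mult_mono) auto
    thus ?thesis using \<epsilon> by simp
   next
    case 2
    have "cmod (F (exp \<zeta>))\<le>K * exp ((2 * exp L) powr \<rho>)" using growth[of "exp \<zeta>"] L(2) 2 by simp
    moreover have "exp (- \<epsilon> * Re (exp (of_real \<sigma> * \<zeta>)))\<le>exp (- \<epsilon> * (\<kappa> * exp (\<sigma> * L)))" using Re_low[OF \<zeta>(2)] \<epsilon> 2 by simp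
    ultimately have "cmod (G \<zeta>)\<le>K * exp ((2 * exp L) powr \<rho>) * exp (- \<epsilon> * (\<kappa> * exp (\<sigma> * L)))" unfolding cG using K by (intro mult_mono) auto
    thus ?thesis using L(1) \<epsilon> by simp
   next
    case 3
    have "cmod (F (exp \<zeta>))\<le>M + \<epsilon>" using left[of "exp \<zeta>"] L(3) 3 by simp
    hence "cmod (G \<zeta>)\<le>(M + \<epsilon>) * 1" unfolding cG using le1[OF \<zeta>(2)] M \<epsilon> by (intro mult_mono) auto
    thus ?thesis by simp
   qed
  qed
  thus ?thesis by (simp add: cG z(1))
 qed
 have lim1: "((\<lambda>\<epsilon>. cmod (F z) * exp (- \<epsilon> * Re (exp (of_real \<sigma> * \<zeta>0))))\<longlongrightarrow>cmod (F z) * exp (- 0 * Re (exp (of_real \<sigma> * \<zeta>0)))) (at_right 0)" by (intro tendsto_intros)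
 have lim2: "((\<lambda>\<epsilon>. M + \<epsilon>)\<longlongrightarrow>M + 0) (at_right 0)" by (intro tendsto_intros)
 have "eventually (\<lambda>\<epsilon>. cmod (F z) * exp (- \<epsilon> * Re (exp (of_real \<sigma> * \<zeta>0)))\<le>M + \<epsilon>) (at_right 0)"
  unfolding eventually_at_right_field using main by (intro exI[of _ 1]) auto
 from tendsto_le[OF _ lim2 lim1 this] show ?thesis by simp
qed (use sector in auto)

text \<open>The resolvent of \<open>K'\<close> itself may have poles. They disappear on the
  complement \<open>NN\<close> of all root vectors, which \<open>K'\<close> leaves invariant and
  where the Fredholm argument excludes eigenvectors with nonzero eigenvalue. The condition
  \<open>b/q < pi/2\<close> says that growth of an order just above 1/q is admissible in a sector of
  half-angle \<open>b\<close>.\<close>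

theorem orthogonal_root_vectors_eq_0:
 fixes K :: "'a::complex_hilbert\<Rightarrow>'a"
 assumes K: "clinear_map K" "compact_map K" and dense: "\<And>n. (\<And>x. inner (K x) n = 0)\<Longrightarrow>n = 0"
  and K': "clinear_map K'" "\<And>x y. inner (K x) y = inner x (K' y)"
  and q: "q>1" and C: "C>0"
  and small: "\<And>N::nat. N\<ge>1\<Longrightarrow>\<exists>e::nat\<Rightarrow>'a. \<forall>x y. (\<forall>i<N. cinner x (e i) = 0)\<longrightarrow>(\<forall>i<N. cinner y (e i) = 0) \<longrightarrow>
    cmod (cinner (K x) y)\<le>C * real N powr (- q) * norm x * norm y"
  and b: "0<b" "b<pi" "b/q<pi/2"
  and \<kappa>: "\<kappa>>0" and sector: "\<And>x z. \<bar>Arg z\<bar>\<ge>b\<Longrightarrow>z\<noteq>0\<Longrightarrow>\<kappa> * norm x\<le>norm (x-z *\<^sub>C K' x)"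
  and n: "\<And>z j x. ((\<lambda>x. x-z *\<^sub>C K x) ^^ j) x = 0\<Longrightarrow>inner n x = 0"
 shows "n = 0"
proof -
 define B where "B z x = x-z *\<^sub>C K x" for z x
 define NN where "NN = {n. \<forall>z j x. (B z ^^ j) x = 0\<longrightarrow>inner n x = 0}"
 have nNN: "n\<in>NN" using n by (simp add: NN_def B_def[abs_def])
 have blK: "bounded_linear K" and blK': "bounded_linear K'" using K K' by (auto intro: clinear_map_bounded_linear)
 have BK: "(B z ^^ j) (K x) = K ((B z ^^ j) x)" for z j x
 proof (induction j arbitrary: x)
  case (Suc j)
  have "B z (K x) = K (B z x)" for x using blK by (simp add: B_def linear_simps clinear_map_cscale[OF K(1)])
  thus ?case using Suc by simp
 qed simp
 have Bi: "(B z ^^ j) (imul x) = imul ((B z ^^ j) x)" for z j x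
  unfolding B_def[abs_def] by (intro clinear_map_imul clinear_map_funpow clinear_map_ident_minus_cscale K(1))
 have K0: "K 0 = 0" using blK by (simp add: linear_simps)
 have NN: "closed NN" "csubspace NN"
 proof -
  have "NN = (\<Inter>(z, j, x)\<in>{(z, j, x). (B z ^^ j) x = 0}. {n. inner n x = 0})" by (auto simp: NN_def)
  thus "closed NN" by (auto intro!: closed_INT closed_Collect_eq continuous_intros)
  have "subspace NN" by (auto simp: subspace_def NN_def inner_add)
  moreover have "imul m\<in>NN" if "m\<in>NN" for m
  proof -
   have "inner (imul m) x = 0" if x: "(B z ^^ j) x = 0" for z j x
   proof -
    have "(B z ^^ j) (imul x) = 0" unfolding Bi x imul_zero ..
    hence "inner m (imul x) = 0" using \<open>m \<in> NN\<close> unfolding NN_def by blast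
    thus ?thesis by (simp add: inner_imul_left)
   qed
   thus ?thesis by (simp add: NN_def)
  qed
  ultimately show "csubspace NN" by (simp add: csubspace_def)
 qed
 have NN': "subspace NN" using NN(2) by (simp add: csubspace_def)
 have K'NN: "K' m\<in>NN" if "m\<in>NN" for m
 proof -
  have "inner (K' m) x = 0" if x: "(B z ^^ j) x = 0" for z j x
  proof -
   have "(B z ^^ j) (K x) = 0" unfolding BK x K0 ..
   hence "inner m (K x) = 0" using \<open>m \<in> NN\<close> unfolding NN_def by blast
   thus ?thesis using K'(2)[of x m] by (simp add: inner_commute)
  qed
  thus ?thesis by (simp add: NN_def)
 qed
 define Q where "Q = proj NN"
 have clQ: "clinear_map Q" unfolding Q_def by (rule clinear_map_proj[OF NN])
 have QNN: "Q x\<in>NN" for x unfolding Q_def by (rule proj_props(1)[OF NN(1) NN'])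
 have Qid: "m\<in>NN\<Longrightarrow>Q m = m" for m unfolding Q_def by (rule proj_id[OF NN(1) NN'])
 have Qsa: "cinner (Q x) y = cinner x y" if "y\<in>NN" for x y using cinner_proj_compl[OF NN that, of x] by (simp add: Q_def cinner_diff_left)
 have Qsa': "cinner y (Q x) = cinner y x" if "y\<in>NN" for x y using arg_cong[OF Qsa[OF that, of x], of cnj] unfolding cnj_cinner .
 have Qle: "norm (Q x)\<le>norm x" for x unfolding Q_def by (rule norm_proj_le[OF NN(1) NN'])
 \<comment> \<open>Composition with the projection on \<open>NN\<close> keeps the map defined on the
   whole space, while its eigenvectors with nonzero eigenvalue all lie in \<open>NN\<close>.\<close>
 define A where "A x = K' (Q x)" for x
 have clA: "clinear_map A" unfolding A_def[abs_def] by (rule clinear_map_compose[OF K'(1) clQ])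
 have ANN: "A x\<in>NN" for x unfolding A_def by (intro K'NN QNN)
 have cK': "cinner (K x) y = cinner x (K' y)" for x y by (simp add: cinner_def K'(2) clinear_map_imul[OF K'(1)])
 have scNN: "z *\<^sub>C m\<in>NN" if "m\<in>NN" for z m using NN(2) that by (simp add: csubspace_def cscale_def subspace_add subspace_scale)
 \<comment> \<open>A solution lies in \<open>NN\<close>, hence is orthogonal to the root spaces of
   \<open>cnj z *\<^sub>C K\<close>, whose adjoint \<open>z *\<^sub>C K'\<close> fixes it.\<close>
 have inj: "x = 0" if x: "x = z *\<^sub>C A x" for x z
 proof -
  have xN: "x\<in>NN" by (subst x) (intro scNN ANN)
  have x1: "z *\<^sub>C K' x = x" using x by (simp add: A_def Qid[OF xN])
  show ?thesis
  proof (rule adjoint_kernel_orthogonal_root_spaces[where T="\<lambda>x. cnj z *\<^sub>C K x" and T'="\<lambda>x. z *\<^sub>C K' x" and B="B (cnj z)"])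
   show "compact_map (\<lambda>x. cnj z *\<^sub>C K x)" by (rule compact_map_comp_left[OF cscale.bounded_linear_right K(2)])
   show "bounded_linear (\<lambda>x. z *\<^sub>C K' x)" by (rule bounded_linear_compose[OF cscale.bounded_linear_right blK'])
   show "inner (cnj z *\<^sub>C K x) y = inner x (z *\<^sub>C K' y)" for x y unfolding Re_cinner[symmetric] by (simp add: cK')
   show "B (cnj z) x = x-cnj z *\<^sub>C K x" for x by (simp add: B_def)
   show "z *\<^sub>C K' x = x" by (rule x1)
   show "inner x y = 0" if "(B (cnj z) ^^ j) y = 0" for j y using xN that unfolding NN_def by blast
  qed
 qed
 obtain a0 where a0: "\<And>x. norm (A x)\<le>a0 * norm x" "a0\<ge>0" using bounded_linear.nonneg_bounded[OF clinear_map_bounded_linear[OF clA]] by (auto simp: mult.commute)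
 define a where "a = a0 + 1"
 have a: "norm (A x)\<le>a * norm x" "a\<ge>1" for x using a0(1)[of x] a0(2) norm_ge_zero[of x] unfolding a_def distrib_right by linarith+
 have smallA: "\<exists>k\<le>N. \<exists>f::nat\<Rightarrow>'a. (\<forall>i<k. \<forall>j<k. cinner (f i) (f j) = (if i = j then 1 else 0)) \<and>
   (\<forall>x y. (\<forall>i<k. cinner x (f i) = 0)\<longrightarrow>(\<forall>i<k. cinner y (f i) = 0) \<longrightarrow>
    cmod (cinner (A x) y)\<le>C * real N powr (- q) * norm x * norm y)" if N: "N\<ge>1" for N
 proof -
  obtain e where e: "\<And>x y. (\<And>i. i<N\<Longrightarrow>cinner x (e i) = 0)\<Longrightarrow>(\<And>i. i<N\<Longrightarrow>cinner y (e i) = 0) \<Longrightarrow>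
    cmod (cinner (K x) y)\<le>C * real N powr (- q) * norm x * norm y" using small[OF N] by blast
  \<comment> \<open>The vectors are replaced by \<open>Q (e i)\<close>: orthogonality of
    \<open>x\<close> to these is orthogonality of \<open>Q x\<close> to the \<open>e i\<close>. The
    estimate for \<open>K\<close> is then read for \<open>K'\<close> with the arguments
    exchanged.\<close>
  obtain k f where k: "k\<le>N" and f: "\<forall>i<k. \<forall>j<k. cinner (f i) (f j) = (if i = j then 1 else 0)"
   and fe: "\<And>x. (\<forall>i<k. cinner x (f i) = 0)\<Longrightarrow>(\<forall>i<N. cinner x (Q (e i)) = 0)" using ex_orthonormal_same_annihilator[of N "\<lambda>i. Q (e i)"] by blast
  have "cmod (cinner (A x) y)\<le>C * real N powr (- q) * norm x * norm y"
   if x: "\<forall>i<k. cinner x (f i) = 0" and y: "\<forall>i<k. cinner y (f i) = 0" for x y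
  proof -
   have Qx: "cinner (Q x) (e i) = 0" if "i<N" for i using fe[OF x] that Qsa[OF QNN, of x "e i"] Qsa'[OF QNN, of x "e i"] by simp
   have Qy: "cinner (Q y) (e i) = 0" if "i<N" for i using fe[OF y] that Qsa[OF QNN, of y "e i"] Qsa'[OF QNN, of y "e i"] by simp
   have "cinner (A x) y = cinner (K' (Q x)) (Q y)" using Qsa'[OF ANN[of x], of y] by (simp add: A_def)
   also have "\<dots> = cnj (cinner (K (Q y)) (Q x))" unfolding cK' cnj_cinner ..
   finally have "cmod (cinner (A x) y) = cmod (cinner (K (Q y)) (Q x))" by simp
   also have "\<dots>\<le>C * real N powr (- q) * norm (Q y) * norm (Q x)" by (rule e) (rule Qy Qx, assumption)+
   also have "\<dots>\<le>C * real N powr (- q) * norm y * norm x" using C by (intro mult_mono Qle) auto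
   finally show ?thesis by (simp add: mult_ac)
  qed
  thus ?thesis using k f by blast
 qed
 define \<rho> where "\<rho> = (1/q + pi/(2 * b))/2"
 have "1/q<pi/(2 * b)" using b q by (simp add: field_simps)
 hence \<rho>: "1/q<\<rho>" "\<rho><pi/(2 * b)" by (auto simp: \<rho>_def)
 hence \<rho>b: "\<rho> * b<pi/2" "\<rho>>0" using b q by (auto simp: field_simps intro: order_less_trans[of 0 "1/q"])
 define Bd where "Bd R = 2 * (1 + R * a\<^sup>2)\<^sup>2 * (1 + norm n)" for R
 obtain R0 where R0: "R0\<ge>1" and R0': "\<And>R. R\<ge>R0\<Longrightarrow>\<exists>N\<ge>1. R * (C * real N powr (- q))\<le>1/2 \<and>
  (\<forall>k\<le>2 * N. (real k + 1) * (2 * fact k * Bd R^k)^3 * Bd R\<le>exp (R powr \<rho>))"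
  using growth_asymptotics[OF q \<rho>(1) C zero_le_power2[of a] norm_ge_zero[of n]] unfolding Bd_def by blast
 \<comment> \<open>The rank, and with it the construction, depends on the radius; so existence is
   obtained disc by disc, with a bound on the half disc in terms of the radius.\<close>
 have local: "(\<exists>X. \<forall>z. cmod z<R\<longrightarrow>X z = n + z *\<^sub>C A (X z)) \<and>
   (\<forall>X u. (\<forall>z. cmod z<R\<longrightarrow>X z = n + z *\<^sub>C A (X z))\<longrightarrow>(\<lambda>z. cinner (X z) u) holomorphic_on ball 0 R \<and>
    (\<forall>z. cmod z\<le>R/2\<longrightarrow>cmod (cinner (X z) u)\<le>exp (R powr \<rho>) * norm u))" if R: "R\<ge>R0" for R
 proof -
  obtain N where N: "N\<ge>1" "R * (C * real N powr (- q))\<le>1/2"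
   "\<And>k. k\<le>2 * N\<Longrightarrow>(real k + 1) * (2 * fact k * Bd R^k)^3 * Bd R\<le>exp (R powr \<rho>)" using R0'[OF R] by blast
  obtain k and f :: "nat\<Rightarrow>'a" where k: "k\<le>N" and f: "\<forall>i<k. \<forall>j<k. cinner (f i) (f j) = (if i = j then 1 else 0)"
   "\<forall>x y. (\<forall>i<k. cinner x (f i) = 0)\<longrightarrow>(\<forall>i<k. cinner y (f i) = 0) \<longrightarrow>
    cmod (cinner (A x) y)\<le>C * real N powr (- q) * norm x * norm y" using smallA[OF N(1)] by blast
  have R1: "R\<ge>1" using R R0 by simp
  have \<eta>: "C * real N powr (- q)\<ge>0" using C by simp
  from small_compression_finite_rank[OF clA a \<eta> f] obtain E where E: "clinear_map E" "\<forall>x. norm (E x)\<le>C * real N powr (- q) * norm x"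
   "\<exists>L::nat\<Rightarrow>'a\<Rightarrow>'a. \<exists>f' g. (\<forall>x. A x = E x + (\<Sum>j<k + k. cinner (L j x) (f' j) *\<^sub>C g j)) \<and>
    (\<forall>j. clinear_map (L j)\<and>(\<forall>x. norm (L j x)\<le>a * norm x))\<and>(\<forall>j<k + k. norm (f' j)\<le>1\<and>norm (g j)\<le>a)" by auto
  from E(3) obtain L :: "nat\<Rightarrow>'a\<Rightarrow>'a" and f' g where L: "\<forall>x. A x = E x + (\<Sum>j<k + k. cinner (L j x) (f' j) *\<^sub>C g j)"
   "\<forall>j. clinear_map (L j)\<and>(\<forall>x. norm (L j x)\<le>a * norm x)" "\<forall>j<k + k. norm (f' j)\<le>1\<and>norm (g j)\<le>a" by auto
  note loc = finite_rank_perturbation_resolvent[where n=n, OF E(1) spec[OF E(2)] \<eta> spec[OF L(1)]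
   spec[OF L(2), THEN conjunct1] spec[OF spec[OF L(2), THEN conjunct2]] L(3) a(2) R1 N(2) _ Bd_def]
  show ?thesis
  proof (intro conjI allI impI)
   show "\<exists>X. \<forall>z. cmod z<R\<longrightarrow>X z = n + z *\<^sub>C A (X z)" by (rule loc(1)) (rule inj)
   fix X u assume X: "\<forall>z. cmod z<R\<longrightarrow>X z = n + z *\<^sub>C A (X z)"
   have X': "X z = n + z *\<^sub>C A (X z)" if "cmod z<R" for z by (rule X[THEN spec, THEN mp, OF that])
   show "(\<lambda>z. cinner (X z) u) holomorphic_on ball 0 R" by (rule loc(2)) (rule inj X'; assumption)+
   fix z assume z: "cmod z\<le>R/2"
   have "cmod (cinner (X z) u)\<le>(real (k + k) + 1) * (2 * fact (k + k) * Bd R^(k + k))^3 * Bd R * norm u" by (rule loc(3)[OF _ _ z]) (rule inj X'; assumption)+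
   also have "\<dots>\<le>exp (R powr \<rho>) * norm u" using k by (intro mult_right_mono N(3)) auto
   finally show "cmod (cinner (X z) u)\<le>exp (R powr \<rho>) * norm u" .
  qed
 qed
 have "\<forall>z. \<exists>x. x = n + z *\<^sub>C A x"
 proof
  fix z
  have "\<exists>X. \<forall>w. cmod w<max R0 (cmod z + 1)\<longrightarrow>X w = n + w *\<^sub>C A (X w)" by (rule local[THEN conjunct1]) simp
  then obtain X where X: "\<forall>w. cmod w<max R0 (cmod z + 1)\<longrightarrow>X w = n + w *\<^sub>C A (X w)" ..
  have "X z = n + z *\<^sub>C A (X z)" by (rule X[THEN spec, THEN mp]) simp
  thus "\<exists>x. x = n + z *\<^sub>C A x" ..
 qed
 \<comment> \<open>One choice for all \<open>z\<close>: on each disc it is among the solutions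
   treated in \<open>local\<close>, hence holomorphic there.\<close>
 from choice[OF this] obtain X where "\<forall>z. X z = n + z *\<^sub>C A (X z)" ..
 hence X: "X z = n + z *\<^sub>C A (X z)" for z ..
 have hol: "(\<lambda>z. cinner (X z) u) holomorphic_on UNIV" for u
 proof (subst holomorphic_on_open)
  show "\<forall>z\<in>UNIV. \<exists>f'. ((\<lambda>z. cinner (X z) u) has_field_derivative f') (at z)"
  proof
   fix z
   have "(\<lambda>z. cinner (X z) u) holomorphic_on ball 0 (max R0 (cmod z + 1))" by (rule local[THEN conjunct2, rule_format, THEN conjunct1]) (simp, rule X)
   thus "\<exists>f'. ((\<lambda>z. cinner (X z) u) has_field_derivative f') (at z)" by (subst (asm) holomorphic_on_open) auto
  qed
 qed simp
 have XNN: "X z\<in>NN" for z by (subst X) (intro subspace_add[OF NN'] scNN ANN nNN)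
 \<comment> \<open>The growth comes from \<open>local\<close> with radius \<open>2 * cmod z\<close>,
   whence the doubled modulus. Outside the open sector the equation reads
   \<open>X - z K' X = n\<close>, because \<open>X\<close> stays in \<open>NN\<close>, and the
   hypothesis \<open>sector\<close> applies. The summands 1 keep the constants positive for
   \<open>u = 0\<close>.\<close>
 have bound: "cmod (cinner (X z) u)\<le>(norm n/\<kappa> + norm n) * norm u + 1" for z u
 proof (rule Phragmen_Lindelof_sector[OF hol \<rho>b(2) b(1,2) \<rho>b(1), of R0 u "norm u + 1"])
  fix z assume z: "R0\<le>cmod z"
  have zz: "R0\<le>2 * cmod z" using z R0 by simp
  have "cmod (cinner (X z) u)\<le>exp ((2 * cmod z) powr \<rho>) * norm u" by (rule local[OF zz, THEN conjunct2, rule_format, THEN conjunct2, rule_format]) (rule X, simp)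
  also have "\<dots>\<le>exp ((2 * cmod z) powr \<rho>) * (norm u + 1)" by (intro mult_left_mono) auto
  finally show "cmod (cinner (X z) u)\<le>(norm u + 1) * exp ((2 * cmod z) powr \<rho>)" by (simp add: mult.commute)
 next
  fix z assume z: "b\<le>\<bar>Arg z\<bar>\<or>z = 0"
  have "norm (X z)\<le>norm n/\<kappa> + norm n"
  proof (cases "z = 0")
   case True
   hence "X z = n" using X[of 0] by simp
   thus ?thesis using \<kappa> by simp
  next
   case False
   have "X z-z *\<^sub>C K' (X z) = n" by (subst (1) X) (simp add: A_def Qid[OF XNN])
   hence "\<kappa> * norm (X z)\<le>norm n" using sector[of z "X z"] z False by simp
   hence "norm (X z)\<le>norm n/\<kappa>" using \<kappa> by (simp add: field_simps)
   thus ?thesis using norm_ge_zero[of n] by linarith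
  qed
  hence "norm (X z) * norm u\<le>(norm n/\<kappa> + norm n) * norm u" by (intro mult_right_mono) auto
  thus "cmod (cinner (X z) u)\<le>(norm n/\<kappa> + norm n) * norm u + 1" using norm_cinner_le[of "X z" u] by linarith
 next
  have "(norm n/\<kappa> + norm n) * norm u\<ge>0" using \<kappa> by simp
  thus "0<(norm n/\<kappa> + norm n) * norm u + 1" by linarith
 qed (auto simp: add_nonneg_pos)
 have const: "cinner (X 1) u = cinner (X 0) u" for u
 proof -
  have "bounded (range (\<lambda>z. cinner (X z) u))" using bound[of _ u] by (auto simp: bounded_iff)
  from Liouville_theorem[OF hol this] show ?thesis unfolding constant_on_def by auto
 qed
 hence X10: "X 1 = X 0" by (rule cinner_eqI)
 have X0: "X 0 = n" by (subst X) simp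
 have "n = n + A n" using X[of 1] unfolding X10 X0 by simp
 hence "A n = 0" by simp
 hence "K' n = 0" by (simp add: A_def Qid[OF nNN])
 hence "inner (K x) n = 0" for x by (simp add: K'(2))
 thus ?thesis by (rule dense)
qed

section \<open>Square-integrable functions and weak derivatives\<close>

lemma borel_measurable_cnj [measurable (raw)]:
 "f\<in>borel_measurable M\<Longrightarrow>(\<lambda>x. cnj (f x))\<in>borel_measurable M" by (rule borel_measurable_continuous_on[of cnj]) (intro continuous_intros)

lemma Re_mult_cnj: "Re (z * cnj z) = (cmod z)\<^sup>2" by (simp add: cmod_power2) (simp add: power2_eq_square)

definition sq_int :: "(real\<Rightarrow>complex)\<Rightarrow>bool" where
 "sq_int f\<longleftrightarrow>f\<in>borel_measurable lebesgue\<and>integrable lebesgue (\<lambda>x. (cmod (f x))\<^sup>2)"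

lemma sq_int_measurable [measurable_dest]: "sq_int f\<Longrightarrow>f\<in>borel_measurable lebesgue" by (simp add: sq_int_def)

lemma sq_int_norm: "sq_int f\<Longrightarrow>sq_int (\<lambda>x. of_real (cmod (f x)))" by (auto simp: sq_int_def intro!: borel_measurable_of_real borel_measurable_norm)

lemma sq_int_dominated:
 assumes "f\<in>borel_measurable lebesgue" "sq_int g" "AE x in lebesgue. cmod (f x)\<le>C * cmod (g x)"
 shows "sq_int f"
proof -
 have "integrable lebesgue (\<lambda>x. (cmod (f x))\<^sup>2)"
 proof (rule Bochner_Integration.integrable_bound)
  show "integrable lebesgue (\<lambda>x. C\<^sup>2 * (cmod (g x))\<^sup>2)" using assms(2) by (simp add: sq_int_def)
  show "(\<lambda>x. (cmod (f x))\<^sup>2)\<in>borel_measurable lebesgue" using assms(1) by measurable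
  show "AE x in lebesgue. norm ((cmod (f x))\<^sup>2)\<le>norm (C\<^sup>2 * (cmod (g x))\<^sup>2)" using assms(3)
  proof eventually_elim
   case (elim x)
   have "(cmod (f x))\<^sup>2\<le>(C * cmod (g x))\<^sup>2" by (rule power_mono[OF elim]) simp
   thus ?case by (simp add: power_mult_distrib)
  qed
 qed
 thus ?thesis using assms(1) by (simp add: sq_int_def)
qed

lemma sq_int_add:
 assumes "sq_int f" "sq_int g"
 shows "sq_int (\<lambda>x. f x + g x)"
proof -
 have [measurable]: "f\<in>borel_measurable lebesgue" "g\<in>borel_measurable lebesgue" using assms by (auto simp: sq_int_def)
 have "integrable lebesgue (\<lambda>x. (cmod (f x + g x))\<^sup>2)"
 proof (rule Bochner_Integration.integrable_bound)
  show "integrable lebesgue (\<lambda>x. 2 * (cmod (f x))\<^sup>2 + 2 * (cmod (g x))\<^sup>2)" using assms by (simp add: sq_int_def)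
  show "AE x in lebesgue. norm ((cmod (f x + g x))\<^sup>2)\<le>norm (2 * (cmod (f x))\<^sup>2 + 2 * (cmod (g x))\<^sup>2)"
  proof (rule AE_I2)
   fix x
   have "(cmod (f x + g x))\<^sup>2\<le>(cmod (f x) + cmod (g x))\<^sup>2" by (intro power_mono norm_triangle_ineq) simp
   also have "\<dots>\<le>2 * (cmod (f x))\<^sup>2 + 2 * (cmod (g x))\<^sup>2" using sum_squares_bound[of "cmod (f x)" "cmod (g x)"] by (simp add: power2_sum)
   finally show "norm ((cmod (f x + g x))\<^sup>2)\<le>norm (2 * (cmod (f x))\<^sup>2 + 2 * (cmod (g x))\<^sup>2)" by simp
  qed
 qed measurable
 thus ?thesis by (simp add: sq_int_def)
qed

lemma sq_int_mult_const: "sq_int f\<Longrightarrow>sq_int (\<lambda>x. c * f x)" by (rule sq_int_dominated[of _ f "cmod c"]) (auto simp: norm_mult)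

lemma sq_int_zero: "sq_int (\<lambda>x. 0)" by (simp add: sq_int_def)

lemma sq_int_uminus: "sq_int f\<Longrightarrow>sq_int (\<lambda>x.-f x)" using sq_int_mult_const[of f "-1"] by simp

lemma sq_int_diff: "sq_int f\<Longrightarrow>sq_int g\<Longrightarrow>sq_int (\<lambda>x. f x-g x)" using sq_int_add[of f "\<lambda>x.-g x"] sq_int_uminus[of g] by simp

lemma sq_int_cong_AE:
 assumes "sq_int f" "AE x in lebesgue. f x = g x" "g\<in>borel_measurable lebesgue"
 shows "sq_int g" by (rule sq_int_dominated[of _ f 1]) (use assms in \<open>auto elim: eventually_mono\<close>)

lemma integrable_mult_sq_int:
 assumes "sq_int f" "sq_int g"
 shows "integrable lebesgue (\<lambda>x. f x * g x)"
proof (rule Bochner_Integration.integrable_bound)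
 have [measurable]: "f\<in>borel_measurable lebesgue" "g\<in>borel_measurable lebesgue" using assms by (auto simp: sq_int_def)
 show "integrable lebesgue (\<lambda>x. (cmod (f x))\<^sup>2 + (cmod (g x))\<^sup>2)" using assms by (simp add: sq_int_def)
 show "(\<lambda>x. f x * g x)\<in>borel_measurable lebesgue" by measurable
 show "AE x in lebesgue. norm (f x * g x)\<le>norm ((cmod (f x))\<^sup>2 + (cmod (g x))\<^sup>2)"
 proof (rule AE_I2)
  fix x
  have "cmod (f x) * cmod (g x)\<le>2 * cmod (f x) * cmod (g x)" by simp
  also have "\<dots>\<le>(cmod (f x))\<^sup>2 + (cmod (g x))\<^sup>2" by (rule sum_squares_bound)
  finally show "norm (f x * g x)\<le>norm ((cmod (f x))\<^sup>2 + (cmod (g x))\<^sup>2)" by (simp add: norm_mult)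
 qed
qed

lemma sq_int_cnj: "sq_int f\<Longrightarrow>sq_int (\<lambda>x. cnj (f x))" by (auto simp: sq_int_def intro!: borel_measurable_cnj)

lemma integrable_mult_cnj_sq_int:
 "sq_int f\<Longrightarrow>sq_int g\<Longrightarrow>integrable lebesgue (\<lambda>x. f x * cnj (g x))" by (rule integrable_mult_sq_int[OF _ sq_int_cnj])

section \<open>The Hilbert space of square-integrable functions modulo null sets\<close>

definition l2_rel :: "(real\<Rightarrow>complex)\<Rightarrow>(real\<Rightarrow>complex)\<Rightarrow>bool" where
 "l2_rel f g\<longleftrightarrow>sq_int f\<and>sq_int g\<and>(AE x in lebesgue. f x = g x)"

\<comment> \<open>Classes modulo null sets form a type, so that the Hilbert space results stated for
  type classes apply to them. The quotient is partial: only square-integrable functions are related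
  to themselves, and every use of \<open>emb\<close> has to supply integrability before anything can
  be said about it.\<close>
quotient_type l2 = "real\<Rightarrow>complex" / partial: l2_rel
proof (rule part_equivpI)
 show "\<exists>x. l2_rel x x" by (intro exI[of _ "\<lambda>x. 0"]) (simp add: l2_rel_def sq_int_zero)
 show "symp l2_rel" by (auto simp: l2_rel_def symp_def elim: eventually_mono)
 show "transp l2_rel" unfolding l2_rel_def
 proof (rule transpI, intro conjI; elim conjE)
  fix f g h :: "real\<Rightarrow>complex" assume "AE x in lebesgue. f x = g x" "AE x in lebesgue. g x = h x"
  thus "AE x in lebesgue. f x = h x" by eventually_elim simp
 qed
qed

definition emb :: "(real\<Rightarrow>complex)\<Rightarrow>l2" where "emb = abs_l2"

definition rep :: "l2\<Rightarrow>real\<Rightarrow>complex" where "rep = rep_l2"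

lemma sq_int_rep [simp]: "sq_int (rep u)" using Quotient_rep_reflp[OF Quotient_l2, of u] by (simp add: rep_def l2_rel_def)

lemma rep_measurable [measurable]: "rep u\<in>borel_measurable lebesgue" using sq_int_rep[of u] by (simp add: sq_int_def)

lemma emb_rep [simp]: "emb (rep u) = u" unfolding emb_def rep_def by (rule Quotient_abs_rep[OF Quotient_l2])

lemma AE_rep_emb: "sq_int f\<Longrightarrow>AE x in lebesgue. rep (emb f) x = f x" using Quotient_rep_abs[OF Quotient_l2, of f] by (simp add: rep_def emb_def l2_rel_def)

lemma emb_eqI: "sq_int f\<Longrightarrow>sq_int g\<Longrightarrow>AE x in lebesgue. f x = g x\<Longrightarrow>emb f = emb g" unfolding emb_def by (rule Quotient_rel_abs[OF Quotient_l2]) (simp add: l2_rel_def)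

lemma l2_eqI: "AE x in lebesgue. rep u x = rep v x\<Longrightarrow>u = v" using emb_eqI[of "rep u" "rep v"] by simp

lemma emb_eq_iff:
 assumes "sq_int f"
 shows "emb f = u\<longleftrightarrow>(AE x in lebesgue. f x = rep u x)"
proof
 assume "emb f = u"
 thus "AE x in lebesgue. f x = rep u x" using AE_rep_emb[OF assms] by (auto elim: eventually_mono)
next
 assume "AE x in lebesgue. f x = rep u x"
 hence "AE x in lebesgue. rep (emb f) x = rep u x" using AE_rep_emb[OF assms] by eventually_elim simp
 thus "emb f = u" by (rule l2_eqI)
qed

instantiation l2 :: real_vector
begin
definition "0 = emb (\<lambda>x. 0)"
definition "u + v = emb (\<lambda>x. rep u x + rep v x)"
definition "u-v = emb (\<lambda>x. rep u x-rep v x)"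
definition "- u = emb (\<lambda>x.-rep u x)"
definition "scaleR r u = emb (\<lambda>x. of_real r * rep u x)"

lemma AE_rep_zero': "AE x in lebesgue. rep 0 x = 0" unfolding zero_l2_def by (rule AE_rep_emb[OF sq_int_zero])
lemma AE_rep_add': "AE x in lebesgue. rep (u + v) x = rep u x + rep v x" unfolding plus_l2_def by (rule AE_rep_emb) (simp add: sq_int_add)
lemma AE_rep_diff': "AE x in lebesgue. rep (u-v) x = rep u x-rep v x" unfolding minus_l2_def by (rule AE_rep_emb) (simp add: sq_int_diff)
lemma AE_rep_uminus': "AE x in lebesgue. rep (- u) x =-rep u x" unfolding uminus_l2_def by (rule AE_rep_emb) (simp add: sq_int_uminus)
lemma AE_rep_scaleR': "AE x in lebesgue. rep (r *\<^sub>R u) x = of_real r * rep u x" unfolding scaleR_l2_def by (rule AE_rep_emb) (simp add: sq_int_mult_const)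

instance
proof
 fix u v w :: l2 and r s :: real
 show "u + v + w = u + (v + w)" using AE_rep_add'[of "u + v" w] AE_rep_add'[of u "v + w"] AE_rep_add'[of u v] AE_rep_add'[of v w] by (intro l2_eqI, eventually_elim) simp
 show "u + v = v + u" using AE_rep_add'[of u v] AE_rep_add'[of v u] by (intro l2_eqI, eventually_elim) simp
 show "0 + u = u" using AE_rep_add'[of 0 u] AE_rep_zero' by (intro l2_eqI, eventually_elim) simp
 show "- u + u = 0" using AE_rep_add'[of "-u" u] AE_rep_zero' AE_rep_uminus'[of u] by (intro l2_eqI, eventually_elim) simp
 show "u-v = u +-v" using AE_rep_add'[of u "-v"] AE_rep_diff'[of u v] AE_rep_uminus'[of v] by (intro l2_eqI, eventually_elim) simp
 show "r *\<^sub>R (u + v) = r *\<^sub>R u + r *\<^sub>R v"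
  using AE_rep_add'[of "r *\<^sub>R u" "r *\<^sub>R v"] AE_rep_scaleR'[of r "u + v"] AE_rep_scaleR'[of r u] AE_rep_scaleR'[of r v] AE_rep_add'[of u v]
  by (intro l2_eqI, eventually_elim) (simp add: algebra_simps)
 show "(r + s) *\<^sub>R u = r *\<^sub>R u + s *\<^sub>R u" using AE_rep_add'[of "r *\<^sub>R u" "s *\<^sub>R u"] AE_rep_scaleR'[of "r + s" u] AE_rep_scaleR'[of r u] AE_rep_scaleR'[of s u]
  by (intro l2_eqI, eventually_elim) (simp add: algebra_simps)
 show "r *\<^sub>R s *\<^sub>R u = (r * s) *\<^sub>R u" using AE_rep_scaleR'[of r "s *\<^sub>R u"] AE_rep_scaleR'[of "r * s" u] AE_rep_scaleR'[of s u]
  by (intro l2_eqI, eventually_elim) (simp add: algebra_simps)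
 show "1 *\<^sub>R u = u" using AE_rep_scaleR'[of 1 u] by (intro l2_eqI, eventually_elim) simp
qed
end

lemmas AE_rep_zero = AE_rep_zero'
lemmas AE_rep_add = AE_rep_add'
lemmas AE_rep_diff = AE_rep_diff'
lemmas AE_rep_uminus = AE_rep_uminus'
lemmas AE_rep_scaleR = AE_rep_scaleR'

instantiation l2 :: real_inner
begin
definition "inner_l2 u v = (LINT x|lebesgue. Re (rep u x * cnj (rep v x)))"
definition "norm_l2 (u::l2) = sqrt (inner u u)"
definition "dist_l2 (u::l2) v = norm (u-v)"
definition "sgn_l2 (u::l2) = u /\<^sub>R norm u"
definition "(uniformity::(l2 \<times> l2) filter) = (INF e\<in>{0 <..}. principal {(x, y). dist x y<e})"
definition "open_l2 (U::l2 set)\<longleftrightarrow>(\<forall>x\<in>U. eventually (\<lambda>(x', y). x' = x\<longrightarrow>y\<in>U) uniformity)"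

instance
proof
 fix u v w :: l2 and r :: real
 note int = integrable_mult_cnj_sq_int[OF sq_int_rep sq_int_rep, THEN integrable_Re]
 show "inner u v = inner v u" unfolding inner_l2_def by (intro Bochner_Integration.integral_cong) (auto simp: algebra_simps)
 have "inner (u + v) w = (LINT x|lebesgue. Re (rep u x * cnj (rep w x)) + Re (rep v x * cnj (rep w x)))" unfolding inner_l2_def using AE_rep_add[of u v]
  by (intro integral_cong_AE) (measurable, auto elim!: eventually_mono simp: algebra_simps)
 also have "\<dots> = inner u w + inner v w" unfolding inner_l2_def by (intro Bochner_Integration.integral_add int)
 finally show "inner (u + v) w = inner u w + inner v w" .
 have "inner (r *\<^sub>R u) w = (LINT x|lebesgue. r * Re (rep u x * cnj (rep w x)))" unfolding inner_l2_def using AE_rep_scaleR[of r u]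
  by (intro integral_cong_AE) (measurable, auto elim!: eventually_mono simp: algebra_simps)
 also have "\<dots> = r * inner u w" unfolding inner_l2_def by simp
 finally show "inner (r *\<^sub>R u) w = r * inner u w" .
 have sq: "Re (rep u x * cnj (rep u x)) = (cmod (rep u x))\<^sup>2" for x by (rule Re_mult_cnj)
 show "0\<le>inner u u" unfolding inner_l2_def sq by (intro integral_nonneg_AE) auto
 have "inner u u = 0\<longleftrightarrow>(AE x in lebesgue. (cmod (rep u x))\<^sup>2 = 0)" unfolding inner_l2_def sq
  by (rule integral_nonneg_eq_0_iff_AE) (use sq_int_rep[of u] in \<open>auto simp: sq_int_def\<close>)
 also have "\<dots>\<longleftrightarrow>(AE x in lebesgue. rep u x = 0)" by simp
 also have "\<dots>\<longleftrightarrow>u = 0"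
 proof
  assume "AE x in lebesgue. rep u x = 0"
  thus "u = 0" using AE_rep_zero by (intro l2_eqI, eventually_elim) simp
 qed (simp add: AE_rep_zero)
 finally show "inner u u = 0\<longleftrightarrow>u = 0" .
qed (simp_all add: norm_l2_def dist_l2_def sgn_l2_def uniformity_l2_def open_l2_def)
end

lemma norm_l2_sq: "(norm u)\<^sup>2 = (LINT x|lebesgue. (cmod (rep u x))\<^sup>2)" unfolding power2_norm_eq_inner inner_l2_def Re_mult_cnj ..

lemma norm_emb_sq:
 assumes "sq_int f"
 shows "(norm (emb f))\<^sup>2 = (LINT x|lebesgue. (cmod (f x))\<^sup>2)"
proof -
 have [measurable]: "f\<in>borel_measurable lebesgue" using assms by (simp add: sq_int_def)
 show ?thesis unfolding norm_l2_sq using AE_rep_emb[OF assms] by (intro integral_cong_AE) (measurable, auto elim!: eventually_mono)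
qed

lemma nn_integral_rep: "(\<integral>\<^sup>+x. ennreal ((cmod (rep u x))\<^sup>2) \<partial>lebesgue) = ennreal ((norm u)\<^sup>2)"
 unfolding norm_l2_sq using sq_int_rep[of u] by (intro nn_integral_eq_integral) (auto simp: sq_int_def)

text \<open>Riesz-Fischer: the increments have summable norms, so the partial sums of their moduli
  stay bounded in norm. Monotone convergence makes the series absolutely convergent almost
  everywhere, and Fatou's lemma turns pointwise into norm convergence.\<close>

lemma l2_fast_Cauchy_convergent:
 fixes X :: "nat\<Rightarrow>l2"
 assumes X: "\<And>n. norm (X (Suc n)-X n)\<le>(1/2)^n"
 shows "convergent X"
proof -
 define f where "f n = rep (X n)" for n
 have f [measurable]: "f n\<in>borel_measurable lebesgue" for n by (simp add: f_def)
 \<comment> \<open>The class of the modulus of an increment; the triangle inequality for these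
   classes bounds the sums of moduli.\<close>
 define d where "d n = emb (\<lambda>x. of_real (cmod (rep (X (Suc n)-X n) x)))" for n
 have nd: "norm (d n)\<le>(1/2)^n" for n
 proof -
  have "(norm (d n))\<^sup>2 = (norm (X (Suc n)-X n))\<^sup>2" unfolding d_def by (subst norm_emb_sq) (simp_all add: sq_int_norm norm_l2_sq)
  thus ?thesis using X[of n] by simp
 qed
 have rd: "AE x in lebesgue. rep (d n) x = of_real (cmod (f (Suc n) x-f n x))" for n
  using AE_rep_emb[OF sq_int_norm[OF sq_int_rep], of "X (Suc n)-X n"] AE_rep_diff[of "X (Suc n)" "X n"]
  unfolding d_def[symmetric] by eventually_elim (simp add: f_def)
 define g where "g N x = (\<Sum>n<N. cmod (f (Suc n) x-f n x))" for N x
 have g [measurable]: "g N\<in>borel_measurable lebesgue" for N unfolding g_def by measurable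
 have rg: "AE x in lebesgue. rep (\<Sum>n<N. d n) x = of_real (g N x)" for N
 proof (induction N)
  case 0
  show ?case using AE_rep_zero by (simp add: g_def)
 next
  case (Suc N)
  show ?case using Suc AE_rep_add[of "\<Sum>n<N. d n" "d N"] rd[of N] by eventually_elim (simp add: g_def)
 qed
 have ng: "norm (\<Sum>n<N. d n)\<le>2" for N
 proof -
  have "norm (\<Sum>n<N. d n)\<le>(\<Sum>n<N. norm (d n))" by (rule norm_sum)
  also have "\<dots>\<le>(\<Sum>n<N. (1/2)^n)" by (intro sum_mono nd)
  also have "\<dots>\<le>(\<Sum>n. (1/2)^n)" by (intro sum_le_suminf) auto
  also have "\<dots> = 2" by (simp add: suminf_geometric)
  finally show ?thesis .
 qed
 have gi: "(\<integral>\<^sup>+x. ennreal ((g N x)\<^sup>2) \<partial>lebesgue)\<le>4" for N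
 proof -
  have "(\<integral>\<^sup>+x. ennreal ((g N x)\<^sup>2) \<partial>lebesgue) = (\<integral>\<^sup>+x. ennreal ((cmod (rep (\<Sum>n<N. d n) x))\<^sup>2) \<partial>lebesgue)"
   using rg[of N] by (intro nn_integral_cong_AE) (auto elim!: eventually_mono)
  also have "\<dots> = ennreal ((norm (\<Sum>n<N. d n))\<^sup>2)" by (rule nn_integral_rep)
  also have "\<dots>\<le>ennreal (2\<^sup>2)" by (intro ennreal_leI power_mono ng) auto
  finally show ?thesis by simp
 qed
 have g0: "g N x\<ge>0" for N x by (simp add: g_def sum_nonneg)
 have gmono: "g N x\<le>g M x" if "N\<le>M" for N M x unfolding g_def by (intro sum_mono2) (use that in auto)
 have "(\<integral>\<^sup>+x. (SUP N. ennreal ((g N x)\<^sup>2)) \<partial>lebesgue) = (SUP N. (\<integral>\<^sup>+x. ennreal ((g N x)\<^sup>2) \<partial>lebesgue))" by (intro nn_integral_monotone_convergence_SUP)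
   (auto simp: incseq_def le_fun_def intro!: ennreal_leI power_mono gmono g0)
 also have "\<dots>\<le>4" by (intro SUP_least gi)
 finally have le4: "(\<integral>\<^sup>+x. (SUP N. ennreal ((g N x)\<^sup>2)) \<partial>lebesgue)\<le>4" .
 have "(4::ennreal)<\<infinity>" by simp
 with le4 have "(\<integral>\<^sup>+x. (SUP N. ennreal ((g N x)\<^sup>2)) \<partial>lebesgue)<\<infinity>" by (rule le_less_trans)
 hence fin: "(\<integral>\<^sup>+x. (SUP N. ennreal ((g N x)\<^sup>2)) \<partial>lebesgue)\<noteq>\<infinity>" by simp
 have "AE x in lebesgue. (SUP N. ennreal ((g N x)\<^sup>2))\<noteq>\<infinity>" by (rule nn_integral_PInf_AE[OF _ fin]) measurable
 hence conv: "AE x in lebesgue. convergent (\<lambda>n. f n x)"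
 proof eventually_elim
  case (elim x)
  then obtain b where b: "(SUP N. ennreal ((g N x)\<^sup>2)) = ennreal b" "b\<ge>0" by (metis ennreal_cases infinity_ennreal_def)
  have gb: "g N x\<le>sqrt b" for N
  proof -
   have "ennreal ((g N x)\<^sup>2)\<le>ennreal b" unfolding b(1)[symmetric] by (rule SUP_upper) simp
   hence "(g N x)\<^sup>2\<le>b" using b(2) by simp
   thus ?thesis by (rule real_le_rsqrt)
  qed
  have "summable (\<lambda>n. cmod (f (Suc n) x-f n x))" by (rule summableI_nonneg_bounded[where x="sqrt b"]) (use gb in \<open>auto simp: g_def\<close>)
  hence "summable (\<lambda>n. f (Suc n) x-f n x)" by (rule summable_norm_cancel)
  hence "convergent (\<lambda>n. \<Sum>i<n. f (Suc i) x-f i x)"  unfolding summable_iff_convergent .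
  hence "convergent (\<lambda>n. f n x-f 0 x)" using sum_lessThan_telescope[of "\<lambda>i. f i x"] by simp
  from convergent_add[OF this convergent_const[of "f 0 x"]]
  show ?case by simp
 qed
 define F where "F x = lim (\<lambda>n. f n x)" for x
 have F [measurable]: "F\<in>borel_measurable lebesgue" unfolding F_def by measurable
 have lim: "AE x in lebesgue. (\<lambda>n. f n x)\<longlonglongrightarrow>F x" using conv by eventually_elim (simp add: F_def convergent_LIMSEQ_iff)
 have Cau: "norm (X n-X m)\<le>2 * (1/2)^m" if "m\<le>n" for m n
 proof -
  have "norm (X n-X m)\<le>(\<Sum>k=m..<n. norm (X (Suc k)-X k))" unfolding sum_Suc_diff'[OF that, of X, symmetric] by (rule norm_sum)
  also have "\<dots>\<le>(\<Sum>k=m..<n. (1/2)^k)" by (intro sum_mono X)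
  also have "\<dots> = 2 * ((1/2)^m-(1/2)^n)" using that by (induction n rule: dec_induct) auto
  also have "\<dots>\<le>2 * (1/2)^m" by simp
  finally show ?thesis .
 qed
 \<comment> \<open>Fatou's lemma along \<open>n\<close> with \<open>m\<close> fixed, using the
   geometric bound \<open>Cau\<close> for the tails.\<close>
 have dist: "(\<integral>\<^sup>+x. ennreal ((cmod (F x-f m x))\<^sup>2) \<partial>lebesgue)\<le>ennreal ((2 * (1/2)^m)\<^sup>2)" for m
 proof -
  have "(\<integral>\<^sup>+x. ennreal ((cmod (F x-f m x))\<^sup>2) \<partial>lebesgue) = (\<integral>\<^sup>+x. liminf (\<lambda>n. ennreal ((cmod (f n x-f m x))\<^sup>2)) \<partial>lebesgue)"
  proof (rule nn_integral_cong_AE, use lim in eventually_elim)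
   case (elim x)
   have "(\<lambda>n. ennreal ((cmod (f n x-f m x))\<^sup>2))\<longlonglongrightarrow>ennreal ((cmod (F x-f m x))\<^sup>2)" by (intro tendsto_intros elim)
   from lim_imp_Liminf[OF _ this] show ?case by simp
  qed
  also have "\<dots>\<le>liminf (\<lambda>n. (\<integral>\<^sup>+x. ennreal ((cmod (f n x-f m x))\<^sup>2) \<partial>lebesgue))" by (rule nn_integral_liminf) measurable
  also have "\<dots>\<le>liminf (\<lambda>n. ennreal ((2 * (1/2)^m)\<^sup>2))"
  proof (rule Liminf_mono, rule eventually_sequentiallyI[of m])
   fix n assume "m\<le>n"
   have "(\<integral>\<^sup>+x. ennreal ((cmod (f n x-f m x))\<^sup>2) \<partial>lebesgue) = (\<integral>\<^sup>+x. ennreal ((cmod (rep (X n-X m) x))\<^sup>2) \<partial>lebesgue)"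
    using AE_rep_diff[of "X n" "X m"] by (intro nn_integral_cong_AE) (auto elim!: eventually_mono simp: f_def)
   also have "\<dots> = ennreal ((norm (X n-X m))\<^sup>2)" by (rule nn_integral_rep)
   also have "\<dots>\<le>ennreal ((2 * (1/2)^m)\<^sup>2)" by (intro ennreal_leI power_mono Cau \<open>m \<le> n\<close>) auto
   finally show "(\<integral>\<^sup>+x. ennreal ((cmod (f n x-f m x))\<^sup>2) \<partial>lebesgue)\<le>ennreal ((2 * (1/2)^m)\<^sup>2)" .
  qed
  also have "\<dots> = ennreal ((2 * (1/2)^m)\<^sup>2)" by (simp add: Liminf_const)
  finally show ?thesis .
 qed
 have sqd: "sq_int (\<lambda>x. F x-f m x)" for m unfolding sq_int_def
 proof
  show "integrable lebesgue (\<lambda>x. (cmod (F x-f m x))\<^sup>2)" by (rule integrableI_bounded) (measurable, use dist[of m] in \<open>auto intro: le_less_trans\<close>)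
 qed measurable
 have sqF: "sq_int F" using sq_int_add[OF sqd[of 0] sq_int_rep[of "X 0"]] by (simp add: f_def)
 have "norm (emb F-X m)\<le>2 * (1/2)^m" for m
 proof -
  have "ennreal ((norm (emb F-X m))\<^sup>2) = (\<integral>\<^sup>+x. ennreal ((cmod (rep (emb F-X m) x))\<^sup>2) \<partial>lebesgue)" by (rule nn_integral_rep[symmetric])
  also have "\<dots> = (\<integral>\<^sup>+x. ennreal ((cmod (F x-f m x))\<^sup>2) \<partial>lebesgue)"
  proof (rule nn_integral_cong_AE)
   show "AE x in lebesgue. ennreal ((cmod (rep (emb F-X m) x))\<^sup>2) = ennreal ((cmod (F x-f m x))\<^sup>2)"
    using AE_rep_diff[of "emb F" "X m"] AE_rep_emb[OF sqF] by eventually_elim (simp add: f_def)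
  qed
  also have "\<dots>\<le>ennreal ((2 * (1/2)^m)\<^sup>2)" by (rule dist)
  finally have "(norm (emb F-X m))\<^sup>2\<le>(2 * (1/2)^m)\<^sup>2" by (simp only: ennreal_le_iff zero_le_power2)
  thus ?thesis by (rule power2_le_imp_le) simp
 qed
 hence le: "\<forall>m. norm (X m-emb F)\<le>2 * (1/2)^m" by (simp add: norm_minus_commute)
 have lim0: "(\<lambda>m. 2 * (1/2::real)^m)\<longlonglongrightarrow>0" by real_asymp
 have "(\<lambda>m. X m-emb F)\<longlonglongrightarrow>0" by (rule Lim_null_comparison[OF always_eventually[OF le] lim0])
 hence "X\<longlonglongrightarrow>emb F" by (rule LIM_zero_cancel)
 thus ?thesis by (auto simp: convergent_def)
qed

instance l2 :: complete_space
proof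
 fix X :: "nat\<Rightarrow>l2" assume X: "Cauchy X"
 have "\<exists>N. \<forall>m\<ge>N. \<forall>n\<ge>N. norm (X m-X n)<(1/2)^k" for k using CauchyD[OF X, of "(1/2)^k"] by simp
 then obtain N where N: "\<And>k m n. m\<ge>N k\<Longrightarrow>n\<ge>N k\<Longrightarrow>norm (X m-X n)<(1/2)^k" by metis
 \<comment> \<open>Summing makes the indices strictly increasing while keeping
   \<open>r k \<ge> N k\<close>.\<close>
 define r where "r k = (\<Sum>i\<le>k. Suc (N i))" for k
 have rN: "r k\<ge>N k" for k unfolding r_def by (rule order_trans[OF _ member_le_sum[of k]]) auto
 have r: "strict_mono r" by (auto simp: strict_mono_Suc_iff r_def)
 have "convergent (X\<circ>r)"
 proof (rule l2_fast_Cauchy_convergent)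
  fix k
  have "r (Suc k)\<ge>N k" using rN[of k] r by (metis le_SucI lessI less_imp_le order_trans strict_mono_less_eq)
  thus "norm ((X\<circ>r) (Suc k)-(X\<circ>r) k)\<le>(1/2)^k" using N[of k "r (Suc k)" "r k"] rN[of k] by simp
 qed
 then obtain l where "(X\<circ>r)\<longlonglongrightarrow>l" by (auto simp: convergent_def)
 hence "X\<longlonglongrightarrow>l" by (rule Cauchy_converges_subseq[OF X r])
 thus "convergent X" by (auto simp: convergent_def)
qed

instantiation l2 :: complex_hilbert
begin
definition "imul_l2 (u::l2) = emb (\<lambda>x. \<i> * rep u x)"

lemma AE_rep_imul': "AE x in lebesgue. rep (imul u) x = \<i> * rep u x" unfolding imul_l2_def by (rule AE_rep_emb) (simp add: sq_int_mult_const)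

instance
proof
 fix u v :: l2 and r :: real
 show "imul (u + v) = imul u + imul v" using AE_rep_imul'[of "u + v"] AE_rep_imul'[of u] AE_rep_imul'[of v] AE_rep_add[of u v] AE_rep_add[of "imul u" "imul v"]
  by (intro l2_eqI, eventually_elim) (simp add: algebra_simps)
 show "imul (r *\<^sub>R u) = r *\<^sub>R imul u" using AE_rep_imul'[of "r *\<^sub>R u"] AE_rep_imul'[of u] AE_rep_scaleR[of r u] AE_rep_scaleR[of r "imul u"]
  by (intro l2_eqI, eventually_elim) (simp add: algebra_simps)
 show "imul (imul u) =-u" using AE_rep_imul'[of "imul u"] AE_rep_imul'[of u] AE_rep_uminus[of u] by (intro l2_eqI, eventually_elim) (simp add: algebra_simps)
 show "inner (imul u) (imul v) = inner u v" unfolding inner_l2_def using AE_rep_imul'[of u] AE_rep_imul'[of v]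
  by (intro integral_cong_AE) (measurable, auto elim!: eventually_elim2 simp: algebra_simps)
qed
end

lemmas AE_rep_imul = AE_rep_imul'

lemma AE_rep_cscale: "AE x in lebesgue. rep (z *\<^sub>C u) x = z * rep u x"
 using AE_rep_add[of "Re z *\<^sub>R u" "Im z *\<^sub>R imul u"] AE_rep_scaleR[of "Re z" u] AE_rep_scaleR[of "Im z" "imul u"] AE_rep_imul[of u]
 unfolding cscale_def by eventually_elim (simp add: complex_eq_iff)

lemma cinner_l2: "cinner u v = (LINT x|lebesgue. rep u x * cnj (rep v x))"
proof -
 have int: "integrable lebesgue (\<lambda>x. rep u x * cnj (rep v x))" by (rule integrable_mult_cnj_sq_int) auto
 have "inner u (imul v) = (LINT x|lebesgue. Im (rep u x * cnj (rep v x)))" unfolding inner_l2_def using AE_rep_imul[of v]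
  by (intro integral_cong_AE) (measurable, auto elim!: eventually_mono)
 also have "\<dots> = Im (LINT x|lebesgue. rep u x * cnj (rep v x))" by (rule integral_Im[OF int])
 finally show ?thesis using integral_Re[OF int] by (simp add: cinner_def complex_eq_iff inner_l2_def)
qed

lemma cinner_emb:
 assumes "sq_int f" "sq_int g"
 shows "cinner (emb f) (emb g) = (LINT x|lebesgue. f x * cnj (g x))"
proof -
 have [measurable]: "f\<in>borel_measurable lebesgue" "g\<in>borel_measurable lebesgue" using assms by (auto simp: sq_int_def)
 show ?thesis unfolding cinner_l2 using AE_rep_emb[OF assms(1)] AE_rep_emb[OF assms(2)] by (intro integral_cong_AE) (measurable, auto elim!: eventually_elim2)
qed

lemma cinner_emb_right:
 assumes "sq_int g"
 shows "cinner u (emb g) = (LINT x|lebesgue. rep u x * cnj (g x))" using cinner_emb[OF sq_int_rep[of u] assms] by simp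

section \<open>Multiplication by essentially bounded functions\<close>

definition bdd_fun :: "real\<Rightarrow>(real\<Rightarrow>complex)\<Rightarrow>bool" where
 "bdd_fun C h\<longleftrightarrow>h\<in>borel_measurable lebesgue\<and>(AE x in lebesgue. cmod (h x)\<le>C)"

definition mulop :: "(real\<Rightarrow>complex)\<Rightarrow>l2\<Rightarrow>l2" where
 "mulop h u = emb (\<lambda>x. h x * rep u x)"

lemma sq_int_mult_bdd: "bdd_fun C h\<Longrightarrow>sq_int f\<Longrightarrow>sq_int (\<lambda>x. h x * f x)" by (rule sq_int_dominated[of _ f C])
  (auto simp: bdd_fun_def norm_mult sq_int_def elim!: eventually_mono intro!: mult_right_mono)

lemma AE_rep_mulop: "bdd_fun C h\<Longrightarrow>AE x in lebesgue. rep (mulop h u) x = h x * rep u x" unfolding mulop_def by (rule AE_rep_emb) (rule sq_int_mult_bdd, auto)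

lemma mulop_emb:
 assumes "bdd_fun C h" "sq_int f"
 shows "mulop h (emb f) = emb (\<lambda>x. h x * f x)" unfolding mulop_def using AE_rep_emb[OF assms(2)]
 by (intro emb_eqI sq_int_mult_bdd[OF assms(1)]) (auto simp: assms elim!: eventually_mono)

lemma bdd_fun_nonneg: "bdd_fun C h\<Longrightarrow>C\<ge>0"
proof (rule ccontr)
 assume h: "bdd_fun C h" and C: "\<not> C\<ge>0"
 have "AE x in (lebesgue::real measure). False" using h C unfolding bdd_fun_def by (auto elim!: eventually_mono) (meson dual_order.trans norm_ge_zero)
 thus False by (simp add: trivial_limit_def[symmetric] ae_filter_eq_bot_iff)
qed

lemma norm_mulop_le:
 assumes "bdd_fun C h"
 shows "norm (mulop h u)\<le>C * norm u"
proof -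
 have "(norm (mulop h u))\<^sup>2\<le>C\<^sup>2 * (norm u)\<^sup>2"
 proof -
  have "ennreal ((norm (mulop h u))\<^sup>2)\<le>(\<integral>\<^sup>+x. ennreal (C\<^sup>2) * ennreal ((cmod (rep u x))\<^sup>2) \<partial>lebesgue)" unfolding nn_integral_rep[symmetric]
  proof (rule nn_integral_mono_AE)
   have "AE x in lebesgue. cmod (h x)\<le>C" using assms by (simp add: bdd_fun_def)
   thus "AE x in lebesgue. ennreal ((cmod (rep (mulop h u) x))\<^sup>2)\<le>ennreal (C\<^sup>2) * ennreal ((cmod (rep u x))\<^sup>2)" using AE_rep_mulop[OF assms, of u]
   proof eventually_elim
    case (elim x)
    have "(cmod (rep (mulop h u) x))\<^sup>2\<le>C\<^sup>2 * (cmod (rep u x))\<^sup>2" unfolding elim(2) norm_mult power_mult_distrib by (intro mult_right_mono power_mono elim) auto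
    thus ?case by (simp flip: ennreal_mult')
   qed
  qed
  also have "\<dots> = ennreal (C\<^sup>2) * ennreal ((norm u)\<^sup>2)" unfolding nn_integral_rep[symmetric] by (rule nn_integral_cmult) measurable
  also have "\<dots> = ennreal (C\<^sup>2 * (norm u)\<^sup>2)" by (simp add: ennreal_mult)
  finally show ?thesis by (subst (asm) ennreal_le_iff) auto
 qed
 hence "(norm (mulop h u))\<^sup>2\<le>(C * norm u)\<^sup>2" by (simp add: power_mult_distrib)
 thus ?thesis by (rule power2_le_imp_le) (simp add: bdd_fun_nonneg[OF assms])
qed

lemma clinear_map_mulop:
 assumes "bdd_fun C h"
 shows "clinear_map (mulop h)" unfolding clinear_map_def
proof (intro conjI allI)
 note [simp] = AE_rep_mulop[OF assms]
 show "bounded_linear (mulop h)"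
 proof (rule bounded_linear_intro)
  fix u v r
  show "mulop h (u + v) = mulop h u + mulop h v" using AE_rep_mulop[OF assms, of "u + v"] AE_rep_mulop[OF assms, of u] AE_rep_mulop[OF assms, of v]
    AE_rep_add[of u v] AE_rep_add[of "mulop h u" "mulop h v"] by (intro l2_eqI, eventually_elim) (simp add: algebra_simps)
  show "mulop h (r *\<^sub>R u) = r *\<^sub>R mulop h u" using AE_rep_mulop[OF assms, of "r *\<^sub>R u"] AE_rep_mulop[OF assms, of u]
    AE_rep_scaleR[of r u] AE_rep_scaleR[of r "mulop h u"] by (intro l2_eqI, eventually_elim) (simp add: algebra_simps)
  show "norm (mulop h u)\<le>norm u * C" using norm_mulop_le[OF assms, of u] by (simp add: mult.commute)
 qed
 fix u
 show "mulop h (imul u) = imul (mulop h u)" using AE_rep_mulop[OF assms, of "imul u"] AE_rep_mulop[OF assms, of u]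
   AE_rep_imul[of u] AE_rep_imul[of "mulop h u"] by (intro l2_eqI, eventually_elim) (simp add: algebra_simps)
qed

section \<open>Smooth functions\<close>

definition smooth :: "(real\<Rightarrow>'a::real_normed_vector)\<Rightarrow>bool" where
 "smooth f\<longleftrightarrow>(\<forall>k. (vderiv ^^ k) f differentiable_on UNIV)"

lemma vderivI: "(\<And>x. (f has_vector_derivative f' x) (at x))\<Longrightarrow>vderiv f = f'" by (auto simp: vderiv_def fun_eq_iff intro: vector_derivative_at)

lemma smooth_has_deriv:
 assumes "smooth f"
 shows "(f has_vector_derivative vderiv f x) (at x)"
proof -
 have "(vderiv ^^ 0) f differentiable_on UNIV" using assms unfolding smooth_def by blast
 hence "f differentiable (at x)" by (simp add: differentiable_on_def)
 thus ?thesis unfolding vderiv_def by (simp add: vector_derivative_works)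
qed

lemma smooth_funpow_vderiv: "smooth f\<Longrightarrow>smooth ((vderiv ^^ k) f)" unfolding smooth_def by (metis comp_apply funpow_add)

lemma smooth_vderiv: "smooth f\<Longrightarrow>smooth (vderiv f)" using smooth_funpow_vderiv[of f 1] by simp

lemma smooth_continuous: "smooth f\<Longrightarrow>continuous_on S f" by (intro continuous_at_imp_continuous_on ballI has_vector_derivative_continuous[OF smooth_has_deriv])

text \<open>Smoothness is always shown by exhibiting a family of functions that contains its derivatives.\<close>

lemma smoothI_family:
 assumes "\<And>f. f\<in>F\<Longrightarrow>\<exists>f'\<in>F. \<forall>x. (f has_vector_derivative f' x) (at x)" and "f\<in>F"
 shows "smooth f"
proof -
 have "(vderiv ^^ k) f\<in>F" for k
 proof (induction k)
  case (Suc k)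
  then obtain f' where f': "f'\<in>F" "\<forall>x. ((vderiv ^^ k) f has_vector_derivative f' x) (at x)" using assms(1) by blast
  have "vderiv ((vderiv ^^ k) f) = f'" by (rule vderivI) (rule f'(2)[rule_format])
  thus ?case using f'(1) by simp
 qed (use assms in simp)
 moreover have "g differentiable_on UNIV" if "g\<in>F" for g using assms(1)[OF that] by (auto simp: differentiable_on_def differentiable_def has_vector_derivative_def)
 ultimately show ?thesis by (simp add: smooth_def)
qed

text \<open>The derivative of a generator is usually a sum of generators; with closure under
  addition built in, only the generators have to be differentiated.\<close>

inductive_set fsums :: "(real\<Rightarrow>'a::real_normed_vector) set\<Rightarrow>(real\<Rightarrow>'a) set" for G where
 base: "g\<in>G\<Longrightarrow>g\<in>fsums G"
| add: "f\<in>fsums G\<Longrightarrow>g\<in>fsums G\<Longrightarrow>(\<lambda>x. f x + g x)\<in>fsums G"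

lemma smoothI_fsums:
 assumes "\<And>g. g\<in>G\<Longrightarrow>\<exists>g'\<in>fsums G. \<forall>x. (g has_vector_derivative g' x) (at x)" and "f\<in>fsums G"
 shows "smooth f"
proof (rule smoothI_family[OF _ assms(2)])
 fix f assume "f\<in>fsums G"
 thus "\<exists>f'\<in>fsums G. \<forall>x. (f has_vector_derivative f' x) (at x)"
 proof induction
  case (base g)
  thus ?case by (rule assms(1))
 next
  case (add f g)
  then obtain f' g' where "f'\<in>fsums G" "\<And>x. (f has_vector_derivative f' x) (at x)"
    "g'\<in>fsums G" "\<And>x. (g has_vector_derivative g' x) (at x)" by blast
  thus ?case by (intro bexI[of _ "\<lambda>x. f' x + g' x"]) (auto intro: has_vector_derivative_add fsums.add)
 qed
qed

lemma smooth_const: "smooth (\<lambda>x. c)"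
proof (rule smoothI_family[of "range (\<lambda>c x. c)"])
 fix f :: "real\<Rightarrow>'a" assume "f\<in>range (\<lambda>c x. c)"
 thus "\<exists>f'\<in>range (\<lambda>c x. c). \<forall>x. (f has_vector_derivative f' x) (at x)" by (intro bexI[of _ "\<lambda>x. 0"]) auto
qed auto

lemma smooth_bounded_linear:
 assumes "bounded_linear L" "smooth f"
 shows "smooth (\<lambda>x. L (f x))" by (rule smoothI_family[of "{\<lambda>x. L (f x) | f. smooth f}"])
  (use assms in \<open>auto intro!: bounded_linear.has_vector_derivative[OF assms(1)] smooth_has_deriv smooth_vderiv\<close>)

lemma smooth_add:
 assumes "smooth f" "smooth g"
 shows "smooth (\<lambda>x. f x + g x)" by (rule smoothI_family[of "{\<lambda>x. f x + g x | f g. smooth f\<and>smooth g}"])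
  (use assms in \<open>auto intro!: has_vector_derivative_add smooth_has_deriv smooth_vderiv\<close>)

lemma smooth_mult:
 fixes f g :: "real\<Rightarrow>'a::real_normed_algebra"
 assumes "smooth f" "smooth g"
 shows "smooth (\<lambda>x. f x * g x)"
proof (rule smoothI_fsums[of "{\<lambda>x. f x * g x | f g. smooth f\<and>smooth g}"])
 fix h :: "real\<Rightarrow>'a" assume "h\<in>{\<lambda>x. f x * g x | f g. smooth f\<and>smooth g}"
 then obtain f g :: "real\<Rightarrow>'a" where h: "h = (\<lambda>x. f x * g x)" and fg: "smooth f" "smooth g" by blast
 show "\<exists>g'\<in>fsums {\<lambda>x. f x * g x | f g. smooth f\<and>smooth g}. \<forall>x. (h has_vector_derivative g' x) (at x)"
 proof (intro bexI allI)
  show "(h has_vector_derivative f x * vderiv g x + vderiv f x * g x) (at x)" for x unfolding h by (intro has_vector_derivative_mult smooth_has_deriv fg)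
  show "(\<lambda>x. f x * vderiv g x + vderiv f x * g x)\<in>fsums {\<lambda>x. f x * g x | f g. smooth f\<and>smooth g}"
  proof (rule fsums.add)
   show "(\<lambda>x. f x * vderiv g x)\<in>fsums {\<lambda>x. f x * g x | f g. smooth f\<and>smooth g}"
    by (intro fsums.base CollectI exI[of _ f] exI[of _ "vderiv g"] conjI refl smooth_vderiv fg)
   show "(\<lambda>x. vderiv f x * g x)\<in>fsums {\<lambda>x. f x * g x | f g. smooth f\<and>smooth g}"
    by (intro fsums.base CollectI exI[of _ "vderiv f"] exI[of _ g] conjI refl smooth_vderiv fg)
  qed
 qed
qed (use assms in \<open>auto intro!: fsums.base\<close>)

lemma smooth_mult_exp:
 fixes p q :: "real\<Rightarrow>real"
 assumes "smooth p" "smooth q"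
 shows "smooth (\<lambda>x. p x * exp (q x))"
proof (rule smoothI_family[of "{\<lambda>x. p x * exp (q x) | p. smooth p}"])
 fix h assume "h\<in>{\<lambda>x. p x * exp (q x) | p. smooth p}"
 then obtain p where h: "h = (\<lambda>x. p x * exp (q x))" and p: "smooth p" by blast
 have d: "(f has_real_derivative vderiv f x) (at x)" if "smooth f" for f x using smooth_has_deriv[OF that] by (simp add: has_real_derivative_iff_has_vector_derivative)
 show "\<exists>f'\<in>{\<lambda>x. p x * exp (q x) | p. smooth p}. \<forall>x. (h has_vector_derivative f' x) (at x)"
 proof (intro bexI allI)
  show "(h has_vector_derivative (vderiv p x + p x * vderiv q x) * exp (q x)) (at x)" for x unfolding h has_real_derivative_iff_has_vector_derivative[symmetric]
   by (auto intro!: derivative_eq_intros d p assms simp: algebra_simps)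
  show "(\<lambda>x. (vderiv p x + p x * vderiv q x) * exp (q x))\<in>{\<lambda>x. p x * exp (q x) | p. smooth p}"
   by (intro CollectI exI[of _ "\<lambda>x. vderiv p x + p x * vderiv q x"] conjI refl smooth_add smooth_mult smooth_vderiv p assms)
 qed
qed (use assms in auto)

lemma smooth_exp: "smooth q\<Longrightarrow>smooth (\<lambda>x. exp (q x::real))" using smooth_mult_exp[OF smooth_const[of 1], of q] by simp

lemma smooth_primitive:
 assumes "\<And>x. (f has_vector_derivative g x) (at x)" "smooth g"
 shows "smooth f"
proof (rule smoothI_family[of "insert f {g. smooth g}"])
 fix h assume "h\<in>insert f {g. smooth g}"
 thus "\<exists>f'\<in>insert f {g. smooth g}. \<forall>x. (h has_vector_derivative f' x) (at x)"
 proof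
  assume "h = f"
  thus ?thesis using assms by (intro bexI[of _ g]) auto
 next
  assume "h\<in>{g. smooth g}"
  thus ?thesis by (intro bexI[of _ "vderiv h"]) (auto intro: smooth_has_deriv smooth_vderiv)
 qed
qed simp

lemma smooth_compose_affine:
 assumes "smooth f"
 shows "smooth (\<lambda>x. f (a * x + b))"
proof (rule smoothI_family[of "{\<lambda>x. f (a * x + b) | f. smooth f}"])
 fix h :: "real\<Rightarrow>'a" assume "h\<in>{\<lambda>x. f (a * x + b) | f. smooth f}"
 then obtain f :: "real\<Rightarrow>'a" where h: "h = (\<lambda>x. f (a * x + b))" and f: "smooth f" by blast
 show "\<exists>f'\<in>{\<lambda>x. f (a * x + b) | f. smooth f}. \<forall>x. (h has_vector_derivative f' x) (at x)"
 proof (intro bexI allI)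
  show "(h has_vector_derivative a *\<^sub>R vderiv f (a * x + b)) (at x)" for x
  proof -
   have "((\<lambda>x. a * x + b) has_vector_derivative a) (at x)" unfolding has_real_derivative_iff_has_vector_derivative[symmetric] by (auto intro!: derivative_eq_intros)
   from vector_diff_chain_at[OF this smooth_has_deriv[OF f]] show ?thesis by (simp add: h o_def)
  qed
  have "smooth (\<lambda>x. a *\<^sub>R vderiv f x)" by (rule smooth_bounded_linear[OF bounded_linear_scaleR_right smooth_vderiv[OF f]])
  thus "(\<lambda>x. a *\<^sub>R vderiv f (a * x + b))\<in>{\<lambda>x. f (a * x + b) | f. smooth f}" by (intro CollectI exI[of _ "\<lambda>x. a *\<^sub>R vderiv f x"] conjI refl)
 qed
qed (use assms in blast)

text \<open>The functions c (1/x)^n exp (-1/x) on the positive axis, extended by 0, form a family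
  that contains its derivatives up to sums. At 0 the exponential beats every power, so the
  difference quotients tend to 0.\<close>

lemma smooth_flat: "smooth (\<lambda>x::real. if x\<le>0 then 0 else exp (- 1/x))"
proof -
 define G where "G = range (\<lambda>(c, n) x. if x\<le>(0::real) then 0 else c * (1/x)^n * exp (- 1/x))"
 have inG: "(\<lambda>x. if x\<le>0 then 0 else c * (1/x)^n * exp (- 1/x))\<in>G" for c n unfolding G_def by (rule image_eqI[of _ _ "(c, n)"]) auto
 show ?thesis
 proof (rule smoothI_fsums[of G])
  have eq: "(\<lambda>x::real. if x\<le>0 then 0 else exp (- 1/x)) = (\<lambda>x. if x\<le>0 then 0 else 1 * (1/x)^0 * exp (- 1/x))" by (rule ext) simp
  show "(\<lambda>x::real. if x\<le>0 then 0 else exp (- 1/x))\<in>fsums G" unfolding eq by (intro fsums.base inG)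
  fix g assume "g\<in>G"
  then obtain c n where g: "g = (\<lambda>x. if x\<le>0 then 0 else c * (1/x)^n * exp (- 1/x))" unfolding G_def by auto
  define g' where "g' x = (if x\<le>0 then 0 else (- c * real n) * (1/x)^(n + 1) * exp (- 1/x))
   + (if x\<le>0 then 0 else c * (1/x)^(n + 2) * exp (- 1/x))" for x :: real
  show "\<exists>g'\<in>fsums G. \<forall>x. (g has_vector_derivative g' x) (at x)"
  proof (intro bexI[of _ g'] allI)
   show "g'\<in>fsums G" unfolding g'_def by (intro fsums.intros inG)
   fix x :: real
   consider "x<0" | "x = 0" | "x>0" by linarith
   hence "(g has_real_derivative g' x) (at x)"
   proof cases
    case 1
    have "((\<lambda>x. 0) has_real_derivative g' x) (at x)" using 1 by (simp add: g'_def)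
    thus ?thesis by (rule has_field_derivative_transform_within_open[of _ _ _ "{..<0}"]) (use 1 in \<open>auto simp: g\<close>)
   next
    case 3
    have "((\<lambda>x. c * (1/x)^n * exp (- 1/x)) has_real_derivative g' x) (at x)"
    proof (cases n)
     case 0
     thus ?thesis using 3 by (auto intro!: derivative_eq_intros simp: g'_def field_simps power2_eq_square)
    next
     case (Suc m)
     have 1: "((\<lambda>x. 1/x) has_real_derivative-((1/x)\<^sup>2)) (at x)" using 3 by (auto intro!: derivative_eq_intros simp: field_simps power2_eq_square)
     have 2: "((\<lambda>x. exp (- 1/x)) has_real_derivative exp (- 1/x) * (1/x)\<^sup>2) (at x)"
      using 3 by (auto intro!: derivative_eq_intros simp: field_simps power2_eq_square)
     have 4: "g' x =-c * (1 + real m) * (1/x)^(m + 2) * exp (- 1/x) + c * (1/x)^(m + 3) * exp (- 1/x)"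
      using 3 unfolding g'_def Suc by (simp add: eval_nat_numeral)
     show ?thesis unfolding Suc 4 by (rule DERIV_cong[OF DERIV_mult[OF DERIV_cmult[OF DERIV_power_Suc[OF 1]] 2]])
       (simp add: algebra_simps power_add power2_eq_square power3_eq_cube add_divide_distrib diff_divide_distrib)
    qed
    thus ?thesis by (rule has_field_derivative_transform_within_open[of _ _ _ "{0<..}"]) (use 3 in \<open>auto simp: g\<close>)
   next
    case 2
    have "((\<lambda>h. (g (0 + h)-g 0)/h)\<longlongrightarrow>0) (at 0)"
    proof (rule filterlim_split_at)
     show "((\<lambda>h. (g (0 + h)-g 0)/h)\<longlongrightarrow>0) (at_left 0)" by (rule tendsto_eventually) (auto simp: eventually_at_left_field g intro!: exI[of _ "-1"])
     have l: "((\<lambda>h. c * ((1/h)^n * exp (- 1/h)/h))\<longlongrightarrow>c * 0) (at_right 0)" by (intro tendsto_mult tendsto_const) real_asymp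
     have e: "eventually (\<lambda>h. c * ((1/h)^n * exp (- 1/h)/h) = (g (0 + h)-g 0)/h) (at_right 0)"
      by (auto simp: eventually_at_right_field g intro!: exI[of _ 1])
     show "((\<lambda>h. (g (0 + h)-g 0)/h)\<longlongrightarrow>0) (at_right 0)" using Lim_transform_eventually[OF l e] by (simp only: mult_zero_right)
    qed
    thus ?thesis using 2 by (simp add: DERIV_def g'_def)
   qed
   thus "(g has_vector_derivative g' x) (at x)" by (simp add: has_real_derivative_iff_has_vector_derivative)
  qed
 qed
qed

section \<open>Test functions and local integrability\<close>

lemma test_functions_iff:
 "f\<in>test_functions\<longleftrightarrow>smooth f\<and>(\<exists>L. \<forall>x. f x\<noteq>0\<longrightarrow>\<bar>x\<bar>\<le>L)" by (simp add: test_functions_def smooth_def compact_closure bounded_iff)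

lemma test_functionD:
 assumes "f\<in>test_functions"
 shows "\<exists>L>0. smooth f\<and>(\<forall>x. f x\<noteq>0\<longrightarrow>\<bar>x\<bar>\<le>L)"
proof -
 obtain L where L: "smooth f" "\<forall>x. f x\<noteq>0\<longrightarrow>\<bar>x\<bar>\<le>L" using assms unfolding test_functions_iff by blast
 have "\<bar>x\<bar>\<le>max L 1" if "f x\<noteq>0" for x using L(2)[rule_format, OF that] by simp
 moreover have "max L 1>0" by simp
 ultimately show ?thesis using L(1) by blast
qed

lemma test_function_smooth: "f\<in>test_functions\<Longrightarrow>smooth f" by (simp add: test_functions_iff)

lemma test_functionI:
 assumes "smooth f" "\<And>x. f x\<noteq>0\<Longrightarrow>\<bar>x\<bar>\<le>L"
 shows "f\<in>test_functions" using assms unfolding test_functions_iff by blast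

lemma vderiv_support:
 assumes f: "smooth f" and supp: "\<And>x. f x\<noteq>0\<Longrightarrow>\<bar>x\<bar>\<le>L" and x: "vderiv f x\<noteq>0"
 shows "\<bar>x\<bar>\<le>L"
proof (rule ccontr)
 assume nx: "\<not> \<bar>x\<bar>\<le>L"
 have "((\<lambda>x. 0) has_vector_derivative 0) (at x)" by simp
 moreover have "open {y. \<bar>y\<bar>>L}" by (intro open_Collect_less continuous_intros)
 ultimately have "(f has_vector_derivative 0) (at x)" by (rule has_vector_derivative_transform_within_open) (use nx supp in \<open>force+\<close>)
 hence "vderiv f x = 0" unfolding vderiv_def by (rule vector_derivative_at)
 thus False using x by simp
qed

lemma test_function_vderiv:
 assumes "f\<in>test_functions"
 shows "vderiv f\<in>test_functions"
proof -
 obtain L where L: "smooth f" "\<And>x. f x\<noteq>0\<Longrightarrow>\<bar>x\<bar>\<le>L" using test_functionD[OF assms] by blast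
 show ?thesis by (rule test_functionI[OF smooth_vderiv[OF L(1)] vderiv_support[OF L]])
qed

lemma test_function_add:
 assumes "f\<in>test_functions" "g\<in>test_functions"
 shows "(\<lambda>x. f x + g x)\<in>test_functions"
proof -
 obtain L M where L: "smooth f" "\<And>x. f x\<noteq>0\<Longrightarrow>\<bar>x\<bar>\<le>L" and M: "smooth g" "\<And>x. g x\<noteq>0\<Longrightarrow>\<bar>x\<bar>\<le>M" using test_functionD[OF assms(1)] test_functionD[OF assms(2)] by blast
 show ?thesis
 proof (rule test_functionI[OF smooth_add[OF L(1) M(1)]])
  fix x assume "f x + g x\<noteq>0"
  hence "f x\<noteq>0\<or>g x\<noteq>0" by auto
  thus "\<bar>x\<bar>\<le>max L M" using L(2)[of x] M(2)[of x] by auto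
 qed
qed

lemma test_function_mult_left:
 fixes f g :: "real\<Rightarrow>'a::real_normed_algebra"
 assumes "smooth f" "g\<in>test_functions"
 shows "(\<lambda>x. f x * g x)\<in>test_functions"
proof -
 obtain L where L: "smooth g" "\<And>x. g x\<noteq>0\<Longrightarrow>\<bar>x\<bar>\<le>L" using test_functionD[OF assms(2)] by blast
 show ?thesis
 proof (rule test_functionI[OF smooth_mult[OF assms(1) L(1)]])
  fix x assume "f x * g x\<noteq>0"
  hence "g x\<noteq>0" by auto
  thus "\<bar>x\<bar>\<le>L" by (rule L(2))
 qed
qed

lemma test_function_bounded_linear:
 assumes "bounded_linear T" "f\<in>test_functions"
 shows "(\<lambda>x. T (f x))\<in>test_functions"
proof -
 interpret T: bounded_linear T by fact
 obtain L where L: "smooth f" "\<And>x. f x\<noteq>0\<Longrightarrow>\<bar>x\<bar>\<le>L" using test_functionD[OF assms(2)] by blast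
 show ?thesis
 proof (rule test_functionI[OF smooth_bounded_linear[OF assms(1) L(1)]])
  fix x assume "T (f x)\<noteq>0"
  hence "f x\<noteq>0" using T.zero by auto
  thus "\<bar>x\<bar>\<le>L" by (rule L(2))
 qed
qed

lemma test_function_zero: "(\<lambda>x. 0)\<in>test_functions" by (rule test_functionI[OF smooth_const, of _ 0]) simp

lemma test_function_uminus: "f\<in>test_functions\<Longrightarrow>(\<lambda>x.-f x)\<in>test_functions" by (rule test_function_bounded_linear[OF bounded_linear_minus[OF bounded_linear_ident]])

lemma test_function_diff:
 assumes "f\<in>test_functions" "g\<in>test_functions"
 shows "(\<lambda>x. f x-g x)\<in>test_functions" using test_function_add[OF assms(1) test_function_uminus[OF assms(2)]] by simp

lemma vderiv_add: "smooth f\<Longrightarrow>smooth g\<Longrightarrow>vderiv (\<lambda>x. f x + g x) = (\<lambda>x. vderiv f x + vderiv g x)" by (intro vderivI has_vector_derivative_add smooth_has_deriv)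

lemma vderiv_bounded_linear: "bounded_linear T\<Longrightarrow>smooth f\<Longrightarrow>vderiv (\<lambda>x. T (f x)) = (\<lambda>x. T (vderiv f x))"
 by (intro vderivI bounded_linear.has_vector_derivative[of T] smooth_has_deriv)

lemma vderiv_mult:
 fixes f g :: "real\<Rightarrow>'a::real_normed_algebra"
 shows "smooth f\<Longrightarrow>smooth g\<Longrightarrow>vderiv (\<lambda>x. f x * g x) = (\<lambda>x. f x * vderiv g x + vderiv f x * g x)" by (intro vderivI has_vector_derivative_mult smooth_has_deriv)

lemma continuous_lebesgue_measurable:
 fixes f :: "real\<Rightarrow>'a::topological_space"
 assumes "continuous_on UNIV f"
 shows "f\<in>borel_measurable lebesgue"
proof -
 have "f\<in>borel_measurable lborel" using borel_measurable_continuous_onI[OF assms] by simp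
 thus ?thesis by (rule measurable_completion)
qed

lemma test_function_measurable: "f\<in>test_functions\<Longrightarrow>f\<in>borel_measurable lebesgue" by (intro continuous_lebesgue_measurable smooth_continuous test_function_smooth)

lemma continuous_bounded_support:
 fixes f :: "real\<Rightarrow>'a::real_normed_vector"
 assumes "continuous_on UNIV f" "\<And>x. f x\<noteq>0\<Longrightarrow>\<bar>x\<bar>\<le>L"
 obtains B where "B\<ge>0" "\<And>x. norm (f x)\<le>B"
proof -
 have "compact (f ` {-L..L})" by (intro compact_continuous_image continuous_on_subset[OF assms(1)]) auto
 hence "bounded (f ` {-L..L})" by (rule compact_imp_bounded)
 then obtain B where B0: "\<forall>y\<in>f ` {-L..L}. norm y\<le>B" unfolding bounded_iff by blast
 have B: "norm (f x)\<le>B" if "x\<in>{-L..L}" for x using B0 that by blast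
 show ?thesis
 proof (rule that[of "max B 0"])
  fix x show "norm (f x)\<le>max B 0"
  proof (cases "f x = 0")
   case False
   hence "\<bar>x\<bar>\<le>L" by (rule assms(2))
   thus ?thesis using B[of x] by (simp add: abs_le_iff)
  qed simp
 qed simp
qed

lemma test_function_bounded:
 fixes f :: "real\<Rightarrow>'a::real_normed_vector"
 assumes "f\<in>test_functions"
 obtains B where "B\<ge>0" "\<And>x. norm (f x)\<le>B"
proof -
 obtain L where L: "smooth f" "\<And>x. f x\<noteq>0\<Longrightarrow>\<bar>x\<bar>\<le>L" using test_functionD[OF assms] by blast
 show ?thesis by (rule continuous_bounded_support[OF smooth_continuous[OF L(1)] L(2)]) (use that in auto)
qed

lemma locally_integrable_Icc: "locally_integrable h\<Longrightarrow>set_integrable lebesgue {a..b::real} h" by (simp add: locally_integrable_def)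

lemma locally_integrableI:
 fixes h :: "real\<Rightarrow>'a::{banach, second_countable_topology}"
 assumes "\<And>L. set_integrable lebesgue {-L..L} h"
 shows "locally_integrable h" unfolding locally_integrable_def
proof (intro allI impI)
 fix K :: "real set" assume K: "compact K"
 then obtain L where L: "\<And>x. x\<in>K\<Longrightarrow>\<bar>x\<bar>\<le>L" using compact_imp_bounded[OF K] by (auto simp: bounded_iff)
 have "K\<subseteq>{-L..L}" using L by (fastforce simp: abs_le_iff)
 moreover have "K\<in>sets lebesgue" using lmeasurable_compact[OF K] by (rule fmeasurableD)
 ultimately show "set_integrable lebesgue K h" using assms set_integrable_subset by blast
qed

lemma locally_integrable_measurable:
 fixes h :: "real\<Rightarrow>'a::{banach, second_countable_topology}"
 assumes "locally_integrable h"
 shows "h\<in>borel_measurable lebesgue"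
proof (rule borel_measurable_LIMSEQ_metric)
 fix n :: nat
 show "(\<lambda>x. indicator {- real n..real n} x *\<^sub>R h x)\<in>borel_measurable lebesgue"
  using locally_integrable_Icc[OF assms, of "- real n" "real n"] unfolding set_integrable_def by (rule borel_measurable_integrable)
next
 fix x :: real
 obtain N :: nat where N: "\<bar>x\<bar>\<le>real N" using real_arch_simple by blast
 have "eventually (\<lambda>n. indicator {- real n..real n} x *\<^sub>R h x = h x) sequentially"
  using N by (intro eventually_sequentiallyI[of N]) (auto simp: indicator_def abs_le_iff)
 thus "(\<lambda>n. indicator {- real n..real n} x *\<^sub>R h x)\<longlonglongrightarrow>h x" by (rule tendsto_eventually)
qed

lemma integrable_locally_integrable_scaleR:
 fixes h :: "real\<Rightarrow>'a::{banach, second_countable_topology}" and \<phi> :: "real\<Rightarrow>real"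
 assumes h: "locally_integrable h" and [measurable]: "\<phi>\<in>borel_measurable lebesgue"
  and B: "AE x in lebesgue. \<bar>\<phi> x\<bar>\<le>B" and L: "\<And>x. \<phi> x\<noteq>0\<Longrightarrow>\<bar>x\<bar>\<le>L"
 shows "integrable lebesgue (\<lambda>x. \<phi> x *\<^sub>R h x)"
proof (rule Bochner_Integration.integrable_bound)
 have [measurable]: "h\<in>borel_measurable lebesgue" by (rule locally_integrable_measurable[OF h])
 show "integrable lebesgue (\<lambda>x. B *\<^sub>R (indicator {-L..L} x *\<^sub>R h x))"
  using locally_integrable_Icc[OF h, of "-L" L] unfolding set_integrable_def by (rule integrable_scaleR_right)
 show "(\<lambda>x. \<phi> x *\<^sub>R h x)\<in>borel_measurable lebesgue" by measurable
 show "AE x in lebesgue. norm (\<phi> x *\<^sub>R h x)\<le>norm (B *\<^sub>R (indicator {-L..L} x *\<^sub>R h x))" using B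
 proof eventually_elim
  case (elim x)
  show ?case
  proof (cases "\<phi> x = 0")
   case False
   hence "x\<in>{-L..L}" using L[of x] by (auto simp: abs_le_iff)
   thus ?thesis using elim by (auto intro!: mult_right_mono)
  qed simp
 qed
qed

lemma integrable_locally_integrable_mult:
 fixes h \<phi> :: "real\<Rightarrow>'a::{real_normed_field, banach, second_countable_topology}"
 assumes h: "locally_integrable h" and [measurable]: "\<phi>\<in>borel_measurable lebesgue"
  and B: "AE x in lebesgue. norm (\<phi> x)\<le>B" and L: "\<And>x. \<phi> x\<noteq>0\<Longrightarrow>\<bar>x\<bar>\<le>L"
 shows "integrable lebesgue (\<lambda>x. h x * \<phi> x)"
proof (rule Bochner_Integration.integrable_bound)
 have [measurable]: "h\<in>borel_measurable lebesgue" by (rule locally_integrable_measurable[OF h])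
 show "integrable lebesgue (\<lambda>x. norm (\<phi> x) *\<^sub>R h x)" by (rule integrable_locally_integrable_scaleR[OF h _ _ L]) (use B in auto)
 show "(\<lambda>x. h x * \<phi> x)\<in>borel_measurable lebesgue" by measurable
qed (auto simp: norm_mult)

lemma integrable_test_mult:
 fixes h \<phi> :: "real\<Rightarrow>'a::{real_normed_field, banach, second_countable_topology}"
 assumes h: "locally_integrable h" and \<phi>: "\<phi>\<in>test_functions"
 shows "integrable lebesgue (\<lambda>x. h x * \<phi> x)"
proof -
 obtain B where B: "\<And>x. norm (\<phi> x)\<le>B" using test_function_bounded[OF \<phi>] by blast
 obtain L where L: "\<And>x. \<phi> x\<noteq>0\<Longrightarrow>\<bar>x\<bar>\<le>L" using test_functionD[OF \<phi>] by blast
 show ?thesis by (rule integrable_locally_integrable_mult[OF h test_function_measurable[OF \<phi>] _ L]) (use B in auto)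
qed

lemma locally_integrable_continuous:
 fixes f :: "real\<Rightarrow>'a::{banach, second_countable_topology}"
 assumes "continuous_on UNIV f"
 shows "locally_integrable f" unfolding locally_integrable_def
proof (intro allI impI)
 fix K :: "real set" assume K: "compact K"
 have i: "integrable lborel (\<lambda>x. indicator K x *\<^sub>R f x)" by (rule borel_integrable_compact[OF K continuous_on_subset[OF assms]]) simp
 thus "set_integrable lebesgue K f" unfolding set_integrable_def using integrable_completion[OF borel_measurable_integrable[OF i]] by simp
qed

lemma integral_vderiv_test_function:
 fixes \<phi> :: "real\<Rightarrow>'a::euclidean_space"
 assumes "\<phi>\<in>test_functions"
 shows "(LINT x|lebesgue. vderiv \<phi> x) = 0"
proof -
 obtain L where L: "smooth \<phi>" "L>0" "\<And>x. \<phi> x\<noteq>0\<Longrightarrow>\<bar>x\<bar>\<le>L" using test_functionD[OF assms] by blast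
 have c: "continuous_on UNIV (vderiv \<phi>)" by (intro smooth_continuous smooth_vderiv L)
 have "(LINT x|lborel. indicator {-(L+1)..L+1} x *\<^sub>R vderiv \<phi> x) = \<phi> (L + 1)-\<phi> (-(L+1))"
 proof (rule integral_FTC_Icc)
  show "-(L+1)\<le>L + 1" using L(2) by simp
  show "(\<phi> has_vector_derivative vderiv \<phi> x) (at x within {-(L+1)..L+1})" for x by (rule has_vector_derivative_at_within[OF smooth_has_deriv[OF L(1)]])
  show "continuous_on {-(L+1)..L+1} (vderiv \<phi>)" using c continuous_on_subset by blast
 qed
 also have "\<phi> (L + 1) = 0" using L(3)[of "L+1"] L(2) by auto
 also have "\<phi> (-(L+1)) = 0" using L(3)[of "-(L+1)"] L(2) by auto
 also have "(\<lambda>x. indicator {-(L+1)..L+1} x *\<^sub>R vderiv \<phi> x) = vderiv \<phi>"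
 proof
  fix x show "indicator {-(L+1)..L+1} x *\<^sub>R vderiv \<phi> x = vderiv \<phi> x"
   using vderiv_support[OF L(1,3), of x] by (cases "vderiv \<phi> x = 0") (auto simp: indicator_def abs_le_iff)
 qed
 finally have "(LINT x|lborel. vderiv \<phi> x) = 0" by simp
 moreover have "vderiv \<phi>\<in>borel_measurable lborel" using borel_measurable_continuous_onI[OF c] by simp
 ultimately show ?thesis by (simp add: integral_completion)
qed

section \<open>Bumps and the fundamental lemma of the calculus of variations\<close>

lemma smooth_real_bump:
 fixes c d :: real
 shows "\<exists>\<psi>::real\<Rightarrow>real. smooth \<psi>\<and>(\<forall>x. \<psi> x\<noteq>0\<longleftrightarrow>c<x\<and>x<d)\<and>(\<forall>x. \<psi> x\<ge>0)"
proof -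
 define e where "e x = (if x\<le>0 then 0 else exp (- 1/x))" for x :: real
 have e: "smooth e" unfolding e_def by (rule smooth_flat)
 define \<psi> where "\<psi> x = e (1 * x + (- c)) * e ((-1) * x + d)" for x
 show ?thesis
 proof (intro exI[of _ \<psi>] conjI allI)
  show "smooth \<psi>" unfolding \<psi>_def by (intro smooth_mult smooth_compose_affine e)
 qed (auto simp: \<psi>_def e_def)
qed

lemma sigma_finite_lebesgue: "sigma_finite_measure (lebesgue::real measure)"
proof
 have "x\<in>(\<Union>n::nat. {- real n..real n})" for x
 proof -
  obtain n :: nat where "\<bar>x\<bar>\<le>real n" using real_arch_simple by blast
  hence "x\<in>{- real n..real n}" by (simp add: abs_le_iff)
  thus ?thesis by blast
 qed
 thus "\<exists>A::real set set. countable A\<and>A\<subseteq>sets lebesgue\<and>\<Union>A = space lebesgue\<and>(\<forall>a\<in>A. emeasure lebesgue a\<noteq>\<infinity>)"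
  by (intro exI[of _ "range (\<lambda>n::nat. {- real n..real n})"]) auto
qed

text \<open>If \<psi> is smooth and positive exactly on an interval, the functions 1 - exp (- n
  \<psi>) are test functions increasing to its indicator, so \<open>h\<close> integrates to zero
  over every subinterval. A Dynkin argument passes to Borel sets, and completion to Lebesgue
  sets.\<close>

lemma fundamental_lemma_variations:
 fixes h :: "real\<Rightarrow>'a::{banach, second_countable_topology}"
 assumes int: "set_integrable lebesgue {a<..<b} h"
  and z: "\<And>\<phi>::real\<Rightarrow>real. \<phi>\<in>test_functions\<Longrightarrow>{x. \<phi> x\<noteq>0}\<subseteq>{a<..<b}\<Longrightarrow>(LINT x|lebesgue. \<phi> x *\<^sub>R h x) = 0"
 shows "AE x in lebesgue. x\<in>{a<..<b}\<longrightarrow>h x = 0"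
proof -
 define g where "g x = indicator {a<..<b} x *\<^sub>R h x" for x
 have g: "integrable lebesgue g" using int by (simp add: g_def[abs_def] set_integrable_def)
 note [measurable] = borel_measurable_integrable[OF g]
 have gi: "integrable lebesgue (\<lambda>x. indicator A x *\<^sub>R g x)" if "A\<in>sets lebesgue" for A using integrable_mult_indicator[OF that g] .
 have basic0: "(LINT x|lebesgue. indicator {c<..<d} x *\<^sub>R g x) = 0" if cd: "a\<le>c" "c<d" "d\<le>b" for c d
 proof -
  obtain \<psi> :: "real\<Rightarrow>real" where \<psi>: "smooth \<psi>" "\<And>x. \<psi> x\<noteq>0\<longleftrightarrow>c<x\<and>x<d" "\<And>x. \<psi> x\<ge>0" using smooth_real_bump[of c d] by blast
  define \<phi> where "\<phi> n x = 1 +-exp ((- real n) * \<psi> x)" for n x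
  have supp: "\<phi> n x = 0" if "\<not> (c<x\<and>x<d)" for n x using \<psi>(2)[of x] that by (simp add: \<phi>_def)
  have sm: "smooth (\<phi> n)" for n
  proof -
   have "smooth (\<lambda>x. exp ((- real n) * \<psi> x))" by (intro smooth_exp smooth_bounded_linear[OF bounded_linear_mult_right] \<psi>(1))
   from smooth_bounded_linear[OF bounded_linear_minus[OF bounded_linear_ident] this]
   show ?thesis unfolding \<phi>_def by (intro smooth_add smooth_const)
  qed
  have tf: "\<phi> n\<in>test_functions" for n
  proof (rule test_functionI[OF sm])
   fix x assume "\<phi> n x\<noteq>0"
   hence "c<x\<and>x<d" using supp by blast
   thus "\<bar>x\<bar>\<le>max \<bar>c\<bar> \<bar>d\<bar>" by linarith
  qed
  have z0: "(LINT x|lebesgue. \<phi> n x *\<^sub>R g x) = 0" for n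
  proof -
   have "{x. \<phi> n x\<noteq>0}\<subseteq>{a<..<b}"
   proof
    fix x assume "x\<in>{x. \<phi> n x\<noteq>0}"
    hence "c<x\<and>x<d" using supp by blast
    thus "x\<in>{a<..<b}" using cd by auto
   qed
   hence "(LINT x|lebesgue. \<phi> n x *\<^sub>R h x) = 0" by (rule z[OF tf])
   moreover have "(\<lambda>x. \<phi> n x *\<^sub>R h x) = (\<lambda>x. \<phi> n x *\<^sub>R g x)"
   proof
    fix x show "\<phi> n x *\<^sub>R h x = \<phi> n x *\<^sub>R g x" using supp[of x n] cd by (cases "c<x\<and>x<d") (auto simp: g_def)
   qed
   ultimately show ?thesis by simp
  qed
  have [measurable]: "\<phi> n\<in>borel_measurable lebesgue" for n by (rule test_function_measurable[OF tf])
  have "(\<lambda>n. LINT x|lebesgue. \<phi> n x *\<^sub>R g x)\<longlonglongrightarrow>(LINT x|lebesgue. indicator {c<..<d} x *\<^sub>R g x)"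
  proof (rule integral_dominated_convergence[where w="\<lambda>x. norm (g x)"])
   show "AE x in lebesgue. (\<lambda>n. \<phi> n x *\<^sub>R g x)\<longlonglongrightarrow>indicator {c<..<d} x *\<^sub>R g x"
   proof (rule AE_I2, rule tendsto_scaleR[OF _ tendsto_const])
    fix x show "(\<lambda>n. \<phi> n x)\<longlonglongrightarrow>indicator {c<..<d} x"
    proof (cases "c<x\<and>x<d")
     case True
     hence "\<psi> x>0" using \<psi>(2,3)[of x] by (simp add: order_less_le)
     hence "(\<lambda>n. \<phi> n x)\<longlonglongrightarrow>1" unfolding \<phi>_def by real_asymp
     thus ?thesis using True by simp
    next
     case False
     thus ?thesis using supp[of x] by auto
    qed
   qed
   show "AE x in lebesgue. norm (\<phi> n x *\<^sub>R g x)\<le>norm (g x)" for n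
   proof (rule AE_I2)
    fix x
    have "exp ((- real n) * \<psi> x)\<le>1" "exp ((- real n) * \<psi> x)>0" using \<psi>(3)[of x] by auto
    hence "\<bar>\<phi> n x\<bar>\<le>1" unfolding \<phi>_def by linarith
    thus "norm (\<phi> n x *\<^sub>R g x)\<le>norm (g x)" by (simp add: mult_left_le_one_le)
   qed
   show "(\<lambda>x. indicator {c<..<d} x *\<^sub>R g x)\<in>borel_measurable lebesgue" by (rule borel_measurable_integrable[OF gi]) simp
   show "(\<lambda>x. \<phi> n x *\<^sub>R g x)\<in>borel_measurable lebesgue" for n by measurable
  qed (use g in auto)
  thus ?thesis by (simp add: z0 LIMSEQ_const_iff)
 qed
 have ivl0: "(LINT x|lebesgue. indicator {c<..<d} x *\<^sub>R g x) = 0" for c d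
 proof -
  have eq: "(\<lambda>x. indicator {c<..<d} x *\<^sub>R g x) = (\<lambda>x. indicator {max a c<..<min b d} x *\<^sub>R g x)" by (auto simp: g_def indicator_def fun_eq_iff)
  show ?thesis
  proof (cases "max a c<min b d")
   case True
   thus ?thesis unfolding eq by (intro basic0) auto
  next
   case False
   hence "{max a c<..<min b d} = {}" by auto
   thus ?thesis unfolding eq by simp
  qed
 qed
 have borel0: "(LINT x|lebesgue. indicator A x *\<^sub>R g x) = 0" if A: "A\<in>sets borel" for A :: "real set"
 proof -
  have sb: "sets (borel::real measure) = sigma_sets UNIV (range (\<lambda>(a, b). {a<..<b}))"
  proof -
   have bx: "(\<lambda>(a, b). box a b) = (\<lambda>(a, b). {a<..<b::real})" by (auto simp: fun_eq_iff box_real)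
   show ?thesis by (subst borel_eq_box, subst bx) (simp add: sets_measure_of)
  qed
  have lb: "B\<in>sets lebesgue" if "B\<in>sigma_sets UNIV (range (\<lambda>(a, b). {a<..<b::real}))" for B using that unfolding sb[symmetric] by (intro sets_completionI_sets) simp
  have stable: "Int_stable (range (\<lambda>(a, b). {a<..<b::real}))"
  proof (rule Int_stableI_image)
   fix p q :: "real \<times> real"
   show "\<exists>k\<in>UNIV. (case p of (a, b)\<Rightarrow>{a<..<b})\<inter>(case q of (a, b)\<Rightarrow>{a<..<b}) = (case k of (a, b)\<Rightarrow>{a<..<b})"
    by (intro bexI[of _ "(max (fst p) (fst q), min (snd p) (snd q))"]) (auto simp: case_prod_beta)
  qed
  have A': "A\<in>sigma_sets UNIV (range (\<lambda>(a, b). {a<..<b::real}))" using A unfolding sb .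
  have "range (\<lambda>(a, b). {a<..<b::real})\<subseteq>Pow UNIV" by simp
  \<comment> \<open>Open intervals generate the Borel sets and are stable under intersection;
    vanishing of the integral passes to complements, by subtraction from the whole interval, and to
    countable disjoint unions.\<close>
  from stable this A' show ?thesis
  proof (induction rule: sigma_sets_induct_disjoint)
   case (basic A)
   thus ?case by (auto simp: ivl0)
  next
   case empty
   show ?case by simp
  next
   case (compl A)
   hence Am: "A\<in>sets lebesgue" using lb by blast
   have "(\<lambda>x. indicator (UNIV-A) x *\<^sub>R g x) = (\<lambda>x. indicator {a<..<b} x *\<^sub>R g x-indicator A x *\<^sub>R g x)" by (auto simp: indicator_def fun_eq_iff g_def)
   thus ?case using compl(2) gi[OF Am] gi[of "{a<..<b}"] by (simp add: ivl0)
  next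
   case (union A)
   have Am: "A i\<in>sets lebesgue" for i using union(2) by (intro lb) auto
   have "(LINT x:(\<Union>i. A i)|lebesgue. g x) = (\<Sum>i. (LINT x:(A i)|lebesgue. g x))" by (rule lebesgue_integral_countable_add[OF Am])
     (use union(1) gi Am in \<open>auto simp: disjoint_family_on_def set_integrable_def\<close>)
   thus ?case using union(3) by (simp add: set_lebesgue_integral_def)
  qed
 qed
 have "AE x in lebesgue. g x = 0"
 proof (rule sigma_finite_measure.density_zero[OF sigma_finite_lebesgue g])
  fix A assume "A\<in>sets (lebesgue::real measure)"
  then obtain S N N' where S: "A = S\<union>N" "N\<subseteq>N'" "N'\<in>null_sets lborel" "S\<in>sets lborel" by (rule sets_completionE)
  have "AE x in lebesgue. x\<notin>N'" using S(3) by (intro AE_not_in null_sets_completionI)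
  hence "AE x in lebesgue. indicator A x *\<^sub>R g x = indicator S x *\<^sub>R g x" by eventually_elim (use S(1,2) in \<open>auto simp: indicator_def\<close>)
  hence "(LINT x|lebesgue. indicator A x *\<^sub>R g x) = (LINT x|lebesgue. indicator S x *\<^sub>R g x)"
   using \<open>A \<in> sets lebesgue\<close> S(4) by (intro integral_cong_AE borel_measurable_integrable gi) auto
  thus "(LINT x:A|lebesgue. g x) = 0" using borel0 S(4) by (simp add: set_lebesgue_integral_def)
 qed
 thus ?thesis by eventually_elim (auto simp: g_def indicator_def split: if_splits)
qed

lemma subspace_closure:
 fixes S :: "'a::real_normed_vector set"
 assumes "subspace S"
 shows "subspace (closure S)"
proof (rule subspaceI)
 show "0\<in>closure S" using subspace_0[OF assms] closure_subset by blast
 fix x y assume "x\<in>closure S" "y\<in>closure S"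
 then obtain f g where f: "\<forall>n. f n\<in>S" "f\<longlonglongrightarrow>x" and g: "\<forall>n. g n\<in>S" "g\<longlonglongrightarrow>y" unfolding closure_sequential by blast
 show "x + y\<in>closure S" unfolding closure_sequential
  by (intro exI[of _ "\<lambda>n. f n + g n"] conjI tendsto_add f g allI subspace_add[OF assms] f(1)[rule_format] g(1)[rule_format])
next
 fix c x assume "x\<in>closure S"
 then obtain f where f: "\<forall>n. f n\<in>S" "f\<longlonglongrightarrow>x" unfolding closure_sequential by blast
 show "c *\<^sub>R x\<in>closure S" unfolding closure_sequential
  by (intro exI[of _ "\<lambda>n. c *\<^sub>R f n"] conjI tendsto_scaleR tendsto_const f allI subspace_scale[OF assms] f(1)[rule_format])
qed

text \<open>Density by duality: \<open>u\<close> differs from its projection on the closure by a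
  vector orthogonal to \<open>S\<close>, which the hypothesis makes orthogonal to \<open>u\<close>
  as well. Approximation by test functions and density in the weighted space are both proved in this
  form.\<close>

lemma orthogonal_complement_criterion:
 fixes S :: "'a::{real_inner,complete_space} set"
 assumes S: "subspace S" and u: "\<And>g. (\<And>v. v\<in>S\<Longrightarrow>inner v g = 0)\<Longrightarrow>inner u g = 0"
 shows "u\<in>closure S"
proof -
 have C: "closed (closure S)" "subspace (closure S)" using subspace_closure[OF S] by auto
 define g where "g = u-proj (closure S) u"
 have g: "inner v g = 0" if "v\<in>closure S" for v using proj_props(2)[OF C that, of u] by (simp add: g_def inner_commute)
 have "inner u g = 0" by (rule u) (use g closure_subset in blast)
 moreover have "inner (proj (closure S) u) g = 0" by (rule g[OF proj_props(1)[OF C]])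
 ultimately have "inner g g = 0" by (simp add: g_def inner_diff)
 hence "u = proj (closure S) u" by (simp add: g_def)
 thus ?thesis using proj_props(1)[OF C, of u] by simp
qed

lemma AE_real_intervalsI:
 assumes "\<And>n::nat. AE x in lebesgue. x\<in>{- real n<..<real n}\<longrightarrow>P x"
 shows "AE x in (lebesgue::real measure). P x"
proof -
 have "AE x in lebesgue. \<forall>n::nat. x\<in>{- real n<..<real n}\<longrightarrow>P x" unfolding AE_all_countable using assms by blast
 thus ?thesis
 proof eventually_elim
  case (elim x)
  obtain n :: nat where "\<bar>x\<bar><real n" using reals_Archimedean2 by blast
  hence "x\<in>{- real n<..<real n}" by (auto simp: abs_less_iff)
  thus ?case using elim by blast
 qed
qed

lemma fundamental_lemma_global:
 fixes h :: "real\<Rightarrow>'a::{banach, second_countable_topology}"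
 assumes h: "locally_integrable h"
  and z: "\<And>\<phi>::real\<Rightarrow>real. \<phi>\<in>test_functions\<Longrightarrow>(LINT x|lebesgue. \<phi> x *\<^sub>R h x) = 0"
 shows "AE x in lebesgue. h x = 0"
proof (rule AE_real_intervalsI)
 fix n :: nat
 have "set_integrable lebesgue {- real n<..<real n} h" by (rule set_integrable_subset[OF locally_integrable_Icc[OF h, of "- real n" "real n"]]) auto
 thus "AE x in lebesgue. x\<in>{- real n<..<real n}\<longrightarrow>h x = 0" by (rule fundamental_lemma_variations) (rule z)
qed

lemma test_function_of_real:
 assumes "\<phi>\<in>test_functions"
 shows "(\<lambda>x. complex_of_real (\<phi> x))\<in>test_functions" by (rule test_function_bounded_linear[OF bounded_linear_of_real assms])

lemma fundamental_lemma_complex: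
 fixes h :: "real\<Rightarrow>complex"
 assumes h: "locally_integrable h"
  and z: "\<And>\<phi>::real\<Rightarrow>complex. \<phi>\<in>test_functions\<Longrightarrow>(LINT x|lebesgue. h x * \<phi> x) = 0"
 shows "AE x in lebesgue. h x = 0"
proof (rule fundamental_lemma_global[OF h])
 fix \<phi> :: "real\<Rightarrow>real" assume "\<phi>\<in>test_functions"
 from z[OF test_function_of_real[OF this]] show "(LINT x|lebesgue. \<phi> x *\<^sub>R h x) = 0" by (simp add: scaleR_conv_of_real mult.commute)
qed

section \<open>Calculus of weak derivatives\<close>

lemma locally_integrable_add:
 assumes "locally_integrable f" "locally_integrable g"
 shows "locally_integrable (\<lambda>x. f x + g x)" using assms unfolding locally_integrable_def by (auto intro: set_integral_add)

lemma locally_integrable_diff: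
 assumes "locally_integrable f" "locally_integrable g"
 shows "locally_integrable (\<lambda>x. f x-g x)" using assms unfolding locally_integrable_def by (auto intro: set_integral_diff)

lemma locally_integrable_cong_AE:
 assumes f: "locally_integrable f" and g: "g\<in>borel_measurable lebesgue" and eq: "AE x in lebesgue. f x = g x"
 shows "locally_integrable g"
proof (rule locally_integrableI)
 fix L
 have i: "integrable lebesgue (\<lambda>x. indicator {-L..L} x *\<^sub>R f x)" using locally_integrable_Icc[OF f, of "-L" L] by (simp add: set_integrable_def)
 have "integrable lebesgue (\<lambda>x. indicator {-L..L} x *\<^sub>R g x)"
 proof (rule integrable_cong_AE_imp[OF i])
  show "(\<lambda>x. indicator {-L..L} x *\<^sub>R g x)\<in>borel_measurable lebesgue" by (intro borel_measurable_scaleR borel_measurable_indicator g) simp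
  show "AE x in lebesgue. indicator {-L..L} x *\<^sub>R f x = indicator {-L..L} x *\<^sub>R g x" using eq by eventually_elim simp
 qed
 thus "set_integrable lebesgue {-L..L} g" by (simp add: set_integrable_def)
qed

lemma weak_derivative_diff:
 assumes "weak_derivative f f'" "weak_derivative g g'"
 shows "weak_derivative (\<lambda>x. f x-g x) (\<lambda>x. f' x-g' x)" unfolding weak_derivative_def
proof (intro conjI ballI)
 fix \<phi> :: "real\<Rightarrow>'a" assume \<phi>: "\<phi>\<in>test_functions"
 have i: "integrable lebesgue (\<lambda>x. f x * vderiv \<phi> x)" "integrable lebesgue (\<lambda>x. g x * vderiv \<phi> x)"
  "integrable lebesgue (\<lambda>x. f' x * \<phi> x)" "integrable lebesgue (\<lambda>x. g' x * \<phi> x)"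
  using assms \<phi> by (auto simp: weak_derivative_def intro: integrable_test_mult test_function_vderiv)
 show "(LINT x|lebesgue. (f x-g x) * vderiv \<phi> x) =-(LINT x|lebesgue. (f' x-g' x) * \<phi> x)" using assms \<phi> i by (simp add: weak_derivative_def left_diff_distrib)
qed (use assms in \<open>auto simp: weak_derivative_def intro: locally_integrable_diff\<close>)

lemma weak_derivative_cong_AE:
 assumes w: "weak_derivative f f'" and [measurable]: "g\<in>borel_measurable lebesgue" "g'\<in>borel_measurable lebesgue"
  and eq: "AE x in lebesgue. f x = g x" "AE x in lebesgue. f' x = g' x"
 shows "weak_derivative g g'" unfolding weak_derivative_def
proof (intro conjI ballI)
 show l: "locally_integrable g" "locally_integrable g'" using w eq assms(2,3) by (auto simp: weak_derivative_def intro: locally_integrable_cong_AE)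
 have lf: "locally_integrable f" "locally_integrable f'" using w by (auto simp: weak_derivative_def)
 note [measurable] = locally_integrable_measurable[OF lf(1)] locally_integrable_measurable[OF lf(2)]
 fix \<phi> :: "real\<Rightarrow>'a" assume \<phi>: "\<phi>\<in>test_functions"
 note [measurable] = test_function_measurable[OF \<phi>] test_function_measurable[OF test_function_vderiv[OF \<phi>]]
 have "(LINT x|lebesgue. g x * vderiv \<phi> x) = (LINT x|lebesgue. f x * vderiv \<phi> x)" using eq(1) by (intro integral_cong_AE) (measurable, auto elim!: eventually_mono)
 also have "\<dots> =-(LINT x|lebesgue. f' x * \<phi> x)" using w \<phi> by (simp add: weak_derivative_def)
 also have "(LINT x|lebesgue. f' x * \<phi> x) = (LINT x|lebesgue. g' x * \<phi> x)" using eq(2) by (intro integral_cong_AE) (measurable, auto elim!: eventually_mono)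
 finally show "(LINT x|lebesgue. g x * vderiv \<phi> x) =-(LINT x|lebesgue. g' x * \<phi> x)" .
qed

lemma weak_derivative_unique:
 fixes f g g' :: "real\<Rightarrow>complex"
 assumes "weak_derivative f g" "weak_derivative f g'"
 shows "AE x in lebesgue. g x = g' x"
proof -
 have w: "weak_derivative (\<lambda>x. f x-f x) (\<lambda>x. g x-g' x)" by (rule weak_derivative_diff[OF assms])
 have "AE x in lebesgue. g x-g' x = 0" by (rule fundamental_lemma_complex) (use w in \<open>auto simp: weak_derivative_def\<close>)
 thus ?thesis by simp
qed

lemma AE_wderiv:
 fixes f g :: "real\<Rightarrow>complex"
 assumes "weak_derivative f g"
 shows "AE x in lebesgue. wderiv f x = g x"
proof -
 have "weak_derivative f (wderiv f)" using someI[of "weak_derivative f" g, OF assms] by (simp add: wderiv_def)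
 thus ?thesis using assms weak_derivative_unique by blast
qed

lemma integral_by_parts_smooth:
 fixes f \<phi> :: "real\<Rightarrow>'a::{real_normed_field, euclidean_space}"
 assumes f: "smooth f" and \<phi>: "\<phi>\<in>test_functions"
 shows "(LINT x|lebesgue. f x * vderiv \<phi> x) =-(LINT x|lebesgue. vderiv f x * \<phi> x)"
proof -
 have i: "integrable lebesgue (\<lambda>x. f x * vderiv \<phi> x)" "integrable lebesgue (\<lambda>x. vderiv f x * \<phi> x)"
  by (intro integrable_test_mult locally_integrable_continuous smooth_continuous smooth_vderiv f test_function_vderiv \<phi>)+
 have "(LINT x|lebesgue. f x * vderiv \<phi> x) + (LINT x|lebesgue. vderiv f x * \<phi> x)
   = (LINT x|lebesgue. vderiv (\<lambda>x. f x * \<phi> x) x)" using i by (simp add: vderiv_mult[OF f test_function_smooth[OF \<phi>]])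
 also have "\<dots> = 0" by (rule integral_vderiv_test_function[OF test_function_mult_left[OF f \<phi>]])
 finally show ?thesis by (simp add: eq_neg_iff_add_eq_0)
qed

lemma weak_derivative_smooth:
 fixes f :: "real\<Rightarrow>'a::{real_normed_field, euclidean_space}"
 assumes "smooth f"
 shows "weak_derivative f (vderiv f)" unfolding weak_derivative_def
 by (intro conjI ballI locally_integrable_continuous smooth_continuous smooth_vderiv assms integral_by_parts_smooth)

text \<open>For a real function \<open>weak_derivative\<close> tests with real test functions only,
  so a complex test function is split into real and imaginary part. The multiplier \<Phi> is real,
  whereas the functions it multiplies are complex.\<close>

lemma weak_derivative_of_real:
 assumes w: "weak_derivative (f::real\<Rightarrow>real) f'"
 shows "weak_derivative (\<lambda>x. complex_of_real (f x)) (\<lambda>x. complex_of_real (f' x))" unfolding weak_derivative_def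
proof (intro conjI ballI)
 have lf: "locally_integrable f" "locally_integrable f'" using w by (auto simp: weak_derivative_def)
 show l: "locally_integrable (\<lambda>x. complex_of_real (f x))" "locally_integrable (\<lambda>x. complex_of_real (f' x))" using lf unfolding locally_integrable_def set_integrable_def
  by (auto simp: scaleR_conv_of_real simp flip: of_real_mult)
 fix \<phi> :: "real\<Rightarrow>complex" assume \<phi>: "\<phi>\<in>test_functions"
 have i: "integrable lebesgue (\<lambda>x. complex_of_real (f x) * vderiv \<phi> x)" "integrable lebesgue (\<lambda>x. complex_of_real (f' x) * \<phi> x)"
  using l \<phi> by (auto intro: integrable_test_mult test_function_vderiv)
 have T: "(LINT x|lebesgue. f x * T (vderiv \<phi> x)) =-(LINT x|lebesgue. f' x * T (\<phi> x))" if "bounded_linear T" for T :: "complex\<Rightarrow>real"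
  using w test_function_bounded_linear[OF that \<phi>] vderiv_bounded_linear[OF that test_function_smooth[OF \<phi>]] unfolding weak_derivative_def by metis
 show "(LINT x|lebesgue. complex_of_real (f x) * vderiv \<phi> x) =-(LINT x|lebesgue. complex_of_real (f' x) * \<phi> x)"
 proof (rule complex_eqI)
  show "Re (LINT x|lebesgue. complex_of_real (f x) * vderiv \<phi> x) = Re (- (LINT x|lebesgue. complex_of_real (f' x) * \<phi> x))"
   using T[OF bounded_linear_Re] integral_Re[OF i(1)] integral_Re[OF i(2)] by simp
  show "Im (LINT x|lebesgue. complex_of_real (f x) * vderiv \<phi> x) = Im (- (LINT x|lebesgue. complex_of_real (f' x) * \<phi> x))"
   using T[OF bounded_linear_Im] integral_Im[OF i(1)] integral_Im[OF i(2)] by simp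
 qed
qed

lemma locally_integrable_mult_continuous:
 fixes f g :: "real\<Rightarrow>'a::{real_normed_field, banach, second_countable_topology}"
 assumes f: "locally_integrable f" and g: "continuous_on UNIV g"
 shows "locally_integrable (\<lambda>x. f x * g x)"
proof (rule locally_integrableI)
 fix L
 have "compact (g ` {-L..L})" by (intro compact_continuous_image continuous_on_subset[OF g]) auto
 hence "bounded (g ` {-L..L})" by (rule compact_imp_bounded)
 then obtain B where B0: "\<forall>y\<in>g ` {-L..L}. norm y\<le>B" unfolding bounded_iff by blast
 have "integrable lebesgue (\<lambda>x. f x * (if x\<in>{-L..L} then g x else 0))"
 proof (rule integrable_locally_integrable_mult[OF f])
  show "(\<lambda>x. if x\<in>{- L..L} then g x else 0)\<in>borel_measurable lebesgue" by (rule measurable_If_set[OF continuous_lebesgue_measurable[OF g]]) auto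
  show "AE x in lebesgue. norm (if x\<in>{- L..L} then g x else 0)\<le>max B 0" using B0 by (intro AE_I2) (auto simp: le_max_iff_disj)
  show "\<bar>x\<bar>\<le>L" if "(if x\<in>{- L..L} then g x else 0)\<noteq>0" for x using that by (auto simp: abs_le_iff split: if_splits)
 qed
 moreover have "(\<lambda>x. f x * (if x\<in>{-L..L} then g x else 0)) = (\<lambda>x. indicator {-L..L} x *\<^sub>R (f x * g x))" by (auto simp: fun_eq_iff indicator_def)
 ultimately show "set_integrable lebesgue {-L..L} (\<lambda>x. f x * g x)" by (simp add: set_integrable_def)
qed

lemma weak_derivative_mult_smooth:
 fixes f f' \<psi> :: "real\<Rightarrow>'a::{real_normed_field, euclidean_space}"
 assumes w: "weak_derivative f f'" and \<psi>: "smooth \<psi>"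
 shows "weak_derivative (\<lambda>x. f x * \<psi> x) (\<lambda>x. f' x * \<psi> x + f x * vderiv \<psi> x)" unfolding weak_derivative_def
proof (intro conjI ballI)
 have lf: "locally_integrable f" "locally_integrable f'" using w by (auto simp: weak_derivative_def)
 show l: "locally_integrable (\<lambda>x. f x * \<psi> x)" "locally_integrable (\<lambda>x. f' x * \<psi> x + f x * vderiv \<psi> x)"
  by (intro locally_integrable_add locally_integrable_mult_continuous lf smooth_continuous smooth_vderiv \<psi>)+
 fix \<phi> :: "real\<Rightarrow>'a" assume \<phi>: "\<phi>\<in>test_functions"
 have t: "(\<lambda>x. \<psi> x * \<phi> x)\<in>test_functions" by (rule test_function_mult_left[OF \<psi> \<phi>])
 have t': "(\<lambda>x. vderiv \<psi> x * \<phi> x)\<in>test_functions" by (rule test_function_mult_left[OF smooth_vderiv[OF \<psi>] \<phi>])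
 have t'': "(\<lambda>x. \<psi> x * vderiv \<phi> x)\<in>test_functions" by (rule test_function_mult_left[OF \<psi> test_function_vderiv[OF \<phi>]])
 have "(LINT x|lebesgue. f x * vderiv (\<lambda>x. \<psi> x * \<phi> x) x) =-(LINT x|lebesgue. f' x * (\<psi> x * \<phi> x))" using w t unfolding weak_derivative_def by blast
 moreover have "(LINT x|lebesgue. f x * vderiv (\<lambda>x. \<psi> x * \<phi> x) x) =
   (LINT x|lebesgue. f x * (\<psi> x * vderiv \<phi> x)) + (LINT x|lebesgue. f x * (vderiv \<psi> x * \<phi> x))"
  using integrable_test_mult[OF lf(1) t''] integrable_test_mult[OF lf(1) t'] by (simp add: vderiv_mult[OF \<psi> test_function_smooth[OF \<phi>]] distrib_left)
 moreover have "(LINT x|lebesgue. (f' x * \<psi> x + f x * vderiv \<psi> x) * \<phi> x) =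
   (LINT x|lebesgue. f' x * (\<psi> x * \<phi> x)) + (LINT x|lebesgue. f x * (vderiv \<psi> x * \<phi> x))" using integrable_test_mult[OF lf(2) t] integrable_test_mult[OF lf(1) t']
  by (simp add: distrib_right mult.assoc)
 ultimately show "(LINT x|lebesgue. f x * \<psi> x * vderiv \<phi> x) =-(LINT x|lebesgue. (f' x * \<psi> x + f x * vderiv \<psi> x) * \<phi> x)"
  by (simp add: mult.assoc) (metis (no_types, lifting) add.commute add_diff_cancel_right' minus_add_distrib uminus_add_conv_diff)
qed

text \<open>The zero integral of \<open>h\<close> is what makes the primitive vanish again to the
  right of \<open>L\<close>. The integral formula exhibits the value at \<open>x\<close> as a
  functional of \<open>h\<close>, from which uniform estimates follow.\<close>

lemma ex_test_primitive:
 fixes h :: "real\<Rightarrow>'a::euclidean_space"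
 assumes h: "smooth h" "\<And>x. h x\<noteq>0\<Longrightarrow>\<bar>x\<bar>\<le>L" and L: "L>0" and int0: "(LINT x|lebesgue. h x) = 0"
 shows "\<exists>F. F\<in>test_functions\<and>(\<forall>x. F x\<noteq>0\<longrightarrow>\<bar>x\<bar>\<le>L)\<and>vderiv F = h \<and>
   (\<forall>x. F x = (LINT t|lebesgue. indicator {-L..x} t *\<^sub>R h t))"
proof -
 \<comment> \<open>A base point strictly to the left of the support gives two-sided
   differentiability also at \<open>-L\<close>.\<close>
 define F where "F x = integral {-L-1..x} h" for x
 have hc: "continuous_on S h" for S by (rule smooth_continuous[OF h(1)])
 have h0: "h x = 0" if "\<bar>x\<bar>>L" for x using h(2)[of x] that by auto
 have li: "locally_integrable h" by (rule locally_integrable_continuous[OF hc])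
 have F_int: "F x = (LINT t|lebesgue. indicator {-L..x} t *\<^sub>R h t)" for x
 proof -
  have "F x = (LINT t:{-L-1..x}|lebesgue. h t)" unfolding F_def by (rule set_lebesgue_integral_eq_integral(2)[symmetric]) (rule locally_integrable_Icc[OF li])
  also have "\<dots> = (LINT t|lebesgue. indicator {-L..x} t *\<^sub>R h t)" unfolding set_lebesgue_integral_def
  proof (rule Bochner_Integration.integral_cong[OF refl])
   fix t show "indicator {-L-1..x} t *\<^sub>R h t = indicator {-L..x} t *\<^sub>R h t" using h0[of t] by (cases "\<bar>t\<bar>>L") (auto simp: indicator_def abs_le_iff)
  qed
  finally show ?thesis .
 qed
 have Fneg: "F x = 0" if "x < -L" for x
 proof -
  have "(\<lambda>t. indicator {-L..x} t *\<^sub>R h t) = (\<lambda>t. 0)" using that by (simp add: indicator_def)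
  thus ?thesis unfolding F_int by simp
 qed
 have Fpos: "F x = 0" if "x>L" for x
 proof -
  have "(\<lambda>t. indicator {-L..x} t *\<^sub>R h t) = h"
  proof
   fix t show "indicator {-L..x} t *\<^sub>R h t = h t" using that h0[of t] by (cases "\<bar>t\<bar>>L") (auto simp: indicator_def abs_le_iff)
  qed
  thus ?thesis unfolding F_int using int0 by simp
 qed
 have dF: "(F has_vector_derivative h x) (at x)" for x
 proof (cases "x < -L")
  case True
  have "((\<lambda>x. 0) has_vector_derivative h x) (at x)" using h0[of x] True L by simp
  thus ?thesis by (rule has_vector_derivative_transform_within_open[of _ _ _ "{..<-L}"]) (use True Fneg in auto)
 next
  case False
  have "(F has_vector_derivative h x) (at x within {-L-1..x+1})" unfolding F_def[abs_def] by (rule integral_has_vector_derivative[OF hc]) (use False in auto)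
  moreover have "at x within {-L-1..x+1} = at x" by (rule at_within_interior) (use False in \<open>auto simp: interior_atLeastAtMost_real\<close>)
  ultimately show ?thesis by simp
 qed
 have supp: "\<bar>x\<bar>\<le>L" if "F x\<noteq>0" for x using Fneg[of x] Fpos[of x] that by (fastforce simp: abs_le_iff)
 have "F\<in>test_functions" by (rule test_functionI[OF smooth_primitive[OF dF h(1)] supp])
 thus ?thesis using supp F_int vderivI[OF dF] by blast
qed

lemma ex_unit_bump:
 assumes "c<d"
 shows "\<exists>\<beta>::real\<Rightarrow>real. \<beta>\<in>test_functions\<and>(\<forall>x. \<beta> x\<noteq>0\<longrightarrow>c<x\<and>x<d)\<and>(LINT x|lebesgue. \<beta> x) = 1"
proof -
 obtain \<psi> :: "real\<Rightarrow>real" where \<psi>: "smooth \<psi>" "\<And>x. \<psi> x\<noteq>0\<longleftrightarrow>c<x\<and>x<d" "\<And>x. \<psi> x\<ge>0" using smooth_real_bump[of c d] by blast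
 have tf: "\<psi>\<in>test_functions"
 proof (rule test_functionI[OF \<psi>(1)])
  fix x assume "\<psi> x\<noteq>0"
  thus "\<bar>x\<bar>\<le>max \<bar>c\<bar> \<bar>d\<bar>" using \<psi>(2)[of x] by linarith
 qed
 have int: "integrable lebesgue \<psi>" using integrable_test_mult[OF locally_integrable_continuous[of "\<lambda>x. 1::real"] tf] by simp
 define I where "I = (LINT x|lebesgue. \<psi> x)"
 have "I\<noteq>0"
 proof
  assume "I = 0"
  hence "AE x in lebesgue. \<psi> x = 0" unfolding I_def using integral_nonneg_eq_0_iff_AE[OF int] \<psi>(3) by simp
  hence "AE x in lebesgue. x\<notin>{c<..<d}" by eventually_elim (use \<psi>(2) in auto)
  hence "{c<..<d}\<in>null_sets lebesgue" by (subst (asm) AE_iff_null_sets[symmetric]) auto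
  hence "emeasure lebesgue {c<..<d} = 0" by auto
  thus False using assms by simp
 qed
 show ?thesis
 proof (intro exI[of _ "\<lambda>x. (1/I) * \<psi> x"] conjI allI impI)
  show "(\<lambda>x. (1/I) * \<psi> x)\<in>test_functions" by (rule test_function_bounded_linear[OF bounded_linear_mult_right tf])
  show "(LINT x|lebesgue. 1/I * \<psi> x) = 1" using \<open>I \<noteq> 0\<close> by (simp add: I_def)
 qed (use \<psi>(2) in auto)
qed

text \<open>A function with vanishing weak derivative is constant; testing against a bump to the left of
 its support shows that the constant is zero.\<close>

lemma weak_derivative_zero_imp_zero:
 fixes u :: "real\<Rightarrow>complex"
 assumes w: "weak_derivative u (\<lambda>x. 0)" and u: "AE x in lebesgue. x < -L\<longrightarrow>u x = 0"
 shows "AE x in lebesgue. u x = 0"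
proof (rule fundamental_lemma_complex)
 show lu: "locally_integrable u" using w by (simp add: weak_derivative_def)
 obtain \<beta>0 :: "real\<Rightarrow>real" where \<beta>0: "\<beta>0\<in>test_functions" "\<And>x. \<beta>0 x\<noteq>0\<Longrightarrow>-L-2<x\<and>x < -L-1"
  "(LINT x|lebesgue. \<beta>0 x) = 1" using ex_unit_bump[of "-L-2" "-L-1"] by auto
 define \<beta> where "\<beta> x = complex_of_real (\<beta>0 x)" for x
 have \<beta>: "\<beta>\<in>test_functions" unfolding \<beta>_def[abs_def] by (rule test_function_of_real[OF \<beta>0(1)])
 have i\<beta>: "(LINT x|lebesgue. \<beta> x) = 1" by (simp add: \<beta>_def \<beta>0(3))
 fix \<phi> :: "real\<Rightarrow>complex" assume \<phi>: "\<phi>\<in>test_functions"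
 define I where "I = (LINT x|lebesgue. \<phi> x)"
 define h where "h x = \<phi> x-I * \<beta> x" for x
 have I\<beta>: "(\<lambda>x. I * \<beta> x)\<in>test_functions" by (rule test_function_bounded_linear[OF bounded_linear_mult_right \<beta>])
 have h: "h\<in>test_functions" unfolding h_def[abs_def] by (rule test_function_diff[OF \<phi> I\<beta>])
 have int: "integrable lebesgue f" if "f\<in>test_functions" for f :: "real\<Rightarrow>complex"
  using integrable_test_mult[OF locally_integrable_continuous[of "\<lambda>x. 1::complex"] that] by simp
 have "(LINT x|lebesgue. h x) = 0" unfolding h_def using int[OF \<phi>] int[OF \<beta>] by (simp add: I_def i\<beta>)
 moreover obtain M where M: "M>0" "smooth h" "\<And>x. h x\<noteq>0\<Longrightarrow>\<bar>x\<bar>\<le>M" using test_functionD[OF h] by blast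
 ultimately obtain F where F: "F\<in>test_functions" "vderiv F = h" using ex_test_primitive[OF M(2,3,1)] by blast
 have "(LINT x|lebesgue. u x * h x) = 0" using w F unfolding weak_derivative_def by force
 moreover have "(LINT x|lebesgue. u x * h x) = (LINT x|lebesgue. u x * \<phi> x)-(LINT x|lebesgue. u x * (I * \<beta> x))" unfolding h_def right_diff_distrib
  by (rule Bochner_Integration.integral_diff) (intro integrable_test_mult lu \<phi> I\<beta>)+
 moreover have "(LINT x|lebesgue. u x * (I * \<beta> x)) = 0"
 proof (rule integral_eq_zero_AE)
  show "AE x in lebesgue. u x * (I * \<beta> x) = 0" using u by eventually_elim (use \<beta>0(2) in \<open>force simp: \<beta>_def\<close>)
 qed
 ultimately show "(LINT x|lebesgue. u x * \<phi> x) = 0" by simp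
qed

section \<open>Approximation by test functions on an interval\<close>

lemma integrable_bounded_support:
 fixes f :: "real\<Rightarrow>'a::{banach, second_countable_topology}"
 assumes f: "locally_integrable f" and supp: "\<And>x. f x\<noteq>0\<Longrightarrow>\<bar>x\<bar>\<le>L"
 shows "integrable lebesgue f"
proof -
 have "(\<lambda>x. indicator {-L..L} x *\<^sub>R f x) = f"
 proof
  fix x show "indicator {-L..L} x *\<^sub>R f x = f x" using supp[of x] by (cases "f x = 0") (auto simp: indicator_def abs_le_iff)
 qed
 thus ?thesis using locally_integrable_Icc[OF f, of "-L" L] by (simp add: set_integrable_def)
qed

lemma sq_int_continuous_bounded_support:
 assumes f: "continuous_on UNIV f" and supp: "\<And>x. f x\<noteq>0\<Longrightarrow>\<bar>x\<bar>\<le>L"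
 shows "sq_int f" unfolding sq_int_def
proof
 show "f\<in>borel_measurable lebesgue" by (rule continuous_lebesgue_measurable[OF f])
 show "integrable lebesgue (\<lambda>x. (cmod (f x))\<^sup>2)" by (rule integrable_bounded_support[of _ L]) (auto intro!: locally_integrable_continuous continuous_intros f supp)
qed

lemma sq_int_test:
 assumes "\<phi>\<in>test_functions"
 shows "sq_int \<phi>"
proof -
 obtain L where L: "smooth \<phi>" "\<And>x. \<phi> x\<noteq>0\<Longrightarrow>\<bar>x\<bar>\<le>L" using test_functionD[OF assms] by blast
 show ?thesis by (rule sq_int_continuous_bounded_support[OF smooth_continuous[OF L(1)] L(2)])
qed

lemma emb_add: "sq_int f\<Longrightarrow>sq_int g\<Longrightarrow>emb (\<lambda>x. f x + g x) = emb f + emb g" unfolding plus_l2_def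
proof (rule emb_eqI)
 assume "sq_int f" "sq_int g"
 thus "AE x in lebesgue. f x + g x = rep (emb f) x + rep (emb g) x" using AE_rep_emb[of f] AE_rep_emb[of g] by auto
qed (auto intro: sq_int_add)

lemma emb_diff: "sq_int f\<Longrightarrow>sq_int g\<Longrightarrow>emb (\<lambda>x. f x-g x) = emb f-emb g" unfolding minus_l2_def
proof (rule emb_eqI)
 assume "sq_int f" "sq_int g"
 thus "AE x in lebesgue. f x-g x = rep (emb f) x-rep (emb g) x" using AE_rep_emb[of f] AE_rep_emb[of g] by auto
qed (auto intro: sq_int_diff)

lemma emb_cscale: "sq_int f\<Longrightarrow>emb (\<lambda>x. c * f x) = c *\<^sub>C emb f"
proof -
 assume f: "sq_int f"
 have "AE x in lebesgue. c * f x = rep (c *\<^sub>C emb f) x" using AE_rep_emb[OF f] AE_rep_cscale[of c "emb f"] by eventually_elim simp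
 thus ?thesis using emb_eq_iff[OF sq_int_mult_const[OF f]] by blast
qed

lemma emb_zero: "emb (\<lambda>x. 0) = 0" by (simp add: zero_l2_def)

lemma integrable_indicator_compact:
 assumes "compact (K::real set)"
 shows "integrable lebesgue (indicator K::real\<Rightarrow>real)" using fmeasurableD[OF lmeasurable_compact[OF assms]] fmeasurableD2[OF lmeasurable_compact[OF assms]]
 by (intro integrable_real_indicator) (auto simp: less_top)

lemma sq_int_locally_integrable:
 assumes f: "sq_int f"
 shows "locally_integrable f"
proof (rule locally_integrableI)
 fix L :: real
 have "sq_int (\<lambda>x. indicator {-L..L} x)" unfolding sq_int_def
 proof
  show "(\<lambda>x. indicator {-L..L} x::complex)\<in>borel_measurable lebesgue" by (intro borel_measurable_indicator) simp
  have "(\<lambda>x. (cmod (indicator {-L..L} x))\<^sup>2) = (\<lambda>x. indicator {-L..L} x::real)" by (auto simp: indicator_def fun_eq_iff)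
  thus "integrable lebesgue (\<lambda>x. (cmod (indicator {-L..L} x))\<^sup>2)" using integrable_indicator_compact[of "{-L..L}"] by simp
 qed
 from integrable_mult_sq_int[OF this f] show "set_integrable lebesgue {-L..L} f"
  unfolding set_integrable_def by (rule Bochner_Integration.integrable_cong[THEN iffD1, rotated 2]) (auto simp: indicator_def)
qed

lemma locally_integrable_rep: "locally_integrable (rep u)" by (rule sq_int_locally_integrable) simp

lemma inner_zero_imp_cinner_zero:
 assumes "inner u g = 0" "inner (imul u) g = 0"
 shows "cinner u g = 0" using assms by (simp add: cinner_def complex_eq_iff inner_imul_left)

text \<open>By duality it suffices to consider \<open>g\<close> orthogonal to all admissible test
  functions; such a \<open>g\<close> vanishes almost everywhere inside the interval, and
  \<open>v\<close> vanishes outside.\<close>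

lemma ex_test_near_on_interval:
 assumes v: "sq_int v" "AE x in lebesgue. x\<notin>{-L<..<L}\<longrightarrow>v x = 0" and \<epsilon>: "\<epsilon>>0"
 shows "\<exists>h. h\<in>test_functions\<and>(\<forall>x. h x\<noteq>0\<longrightarrow>\<bar>x\<bar>\<le>L)\<and>norm (emb h-emb v)<\<epsilon>"
proof -
 define T where "T = {h::real\<Rightarrow>complex. h\<in>test_functions\<and>(\<forall>x. h x\<noteq>0\<longrightarrow>\<bar>x\<bar>\<le>L)}"
 have T0: "(\<lambda>x. 0)\<in>T" by (simp add: T_def test_function_zero)
 have Tadd: "(\<lambda>x. f x + g x)\<in>T" if "f\<in>T" "g\<in>T" for f g unfolding T_def
 proof (intro CollectI conjI allI impI)
  show "(\<lambda>x. f x + g x)\<in>test_functions" using that by (simp add: T_def test_function_add)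
  fix x assume "f x + g x\<noteq>0"
  hence "f x\<noteq>0\<or>g x\<noteq>0" by auto
  thus "\<bar>x\<bar>\<le>L" using that by (auto simp: T_def)
 qed
 have Tsc: "(\<lambda>x. c * f x)\<in>T" if "f\<in>T" for c f using that by (auto simp: T_def intro: test_function_bounded_linear[OF bounded_linear_mult_right])
 have sqT: "f\<in>T\<Longrightarrow>sq_int f" for f by (auto simp: T_def intro: sq_int_test)
 have sub: "subspace (emb ` T)"
 proof (rule subspaceI)
  show "0\<in>emb ` T" using T0 emb_zero by (metis imageI)
  show "x + y\<in>emb ` T" if xy: "x\<in>emb ` T" "y\<in>emb ` T" for x y
  proof -
   obtain f g where fg: "f\<in>T" "x = emb f" "g\<in>T" "y = emb g" using xy by blast
   hence "x + y = emb (\<lambda>x. f x + g x)" using emb_add[OF sqT[OF fg(1)] sqT[OF fg(3)]] by simp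
   thus ?thesis using Tadd[OF fg(1,3)] by blast
  qed
  show "r *\<^sub>R x\<in>emb ` T" if x: "x\<in>emb ` T" for r x
  proof -
   obtain f where f: "f\<in>T" "x = emb f" using x by blast
   hence "r *\<^sub>R x = emb (\<lambda>x. of_real r * f x)" using emb_cscale[OF sqT[OF f(1)], of "of_real r"] by (simp add: cscale_of_real)
   thus ?thesis using Tsc[OF f(1)] by blast
  qed
 qed
 have "emb v\<in>closure (emb ` T)"
 proof (rule orthogonal_complement_criterion[OF sub])
  fix g assume g: "\<And>u. u\<in>emb ` T\<Longrightarrow>inner u g = 0"
  have "AE x in lebesgue. x\<in>{-L<..<L}\<longrightarrow>cnj (rep g x) = 0"
  proof (rule fundamental_lemma_variations)
   have "locally_integrable (\<lambda>x. cnj (rep g x))" by (rule sq_int_locally_integrable[OF sq_int_cnj[OF sq_int_rep]])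
   thus "set_integrable lebesgue {-L<..<L} (\<lambda>x. cnj (rep g x))" by (intro set_integrable_subset[OF locally_integrable_Icc[of _ "-L" L]]) auto
   fix \<phi> :: "real\<Rightarrow>real" assume \<phi>: "\<phi>\<in>test_functions" "{x. \<phi> x\<noteq>0}\<subseteq>{-L<..<L}"
   define f where "f x = complex_of_real (\<phi> x)" for x
   have "\<bar>x\<bar>\<le>L" if "\<phi> x\<noteq>0" for x
   proof -
    have "x\<in>{-L<..<L}" using \<phi>(2) that by blast
    thus ?thesis by (simp add: abs_le_iff)
   qed
   hence f: "f\<in>T" using test_function_of_real[OF \<phi>(1)] by (simp add: T_def f_def[abs_def])
   have fi: "imul (emb f) = emb (\<lambda>x. \<i> * f x)" using emb_cscale[OF sqT[OF f], of \<i>] by (simp add: cscale_ii)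
   have "cinner (emb f) g = 0" by (rule inner_zero_imp_cinner_zero) (use g f Tsc[OF f, of \<i>] fi in auto)
   hence "(LINT x|lebesgue. f x * cnj (rep g x)) = 0" using cinner_emb[OF sqT[OF f] sq_int_rep[of g]] by simp
   thus "(LINT x|lebesgue. \<phi> x *\<^sub>R cnj (rep g x)) = 0" by (simp add: f_def scaleR_conv_of_real)
  qed
  hence "AE x in lebesgue. v x * cnj (rep g x) = 0" using v(2) by eventually_elim auto
  hence "(LINT x|lebesgue. v x * cnj (rep g x)) = 0" by (rule integral_eq_zero_AE)
  hence "cinner (emb v) g = 0" using cinner_emb[OF v(1) sq_int_rep[of g]] by simp
  thus "inner (emb v) g = 0" using Re_cinner[of "emb v" g] by simp
 qed
 then obtain h where h: "h\<in>T" "dist (emb h) (emb v)<\<epsilon>" using \<epsilon> unfolding closure_approachable by blast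
 thus ?thesis by (auto simp: T_def dist_norm)
qed

text \<open>It is \<open>v'\<close> that is approximated in norm by a test function; a multiple of a
  unit bump restores the zero integral, and the primitive of the result is \<phi>. Integration over
  a bounded interval is continuous from L2 to the uniform norm, so \<phi> is uniformly close to
  \<open>v\<close>. Uniform closeness is used later, where \<phi> is multiplied by the merely
  locally square-integrable |V|^(1/2).\<close>

lemma ex_test_approx:
 fixes v v' :: "real\<Rightarrow>complex"
 assumes w: "weak_derivative v v'" and v': "sq_int v'" and L: "L>0"
  and out: "AE x in lebesgue. x\<notin>{-L<..<L}\<longrightarrow>v x = 0" "AE x in lebesgue. x\<notin>{-L<..<L}\<longrightarrow>v' x = 0"
  and int0: "(LINT x|lebesgue. v' x) = 0" and \<epsilon>: "\<epsilon>>0"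
 shows "\<exists>\<phi>\<in>test_functions. (\<forall>x. \<phi> x\<noteq>0\<longrightarrow>\<bar>x\<bar>\<le>L)\<and>(AE x in lebesgue. cmod (\<phi> x-v x)\<le>\<epsilon>) \<and>
   norm (emb (vderiv \<phi>)-emb v')\<le>\<epsilon>"
proof -
 \<comment> \<open>The value at \<open>x\<close> of the primitive of a function supported in
   \<open>{-L..L}\<close> is its inner product with \<open>one x\<close>, whose norm is at most
   \<open>s\<close> for every \<open>x\<close>.\<close>
 define one where "one x t = (indicator ({-L..x}\<inter>{-L..L}) t::complex)" for x t
 have sq1: "sq_int (one x)" for x unfolding sq_int_def
 proof
  show "one x\<in>borel_measurable lebesgue" unfolding one_def[abs_def] by (intro borel_measurable_indicator) simp
  have "(\<lambda>t. (cmod (one x t))\<^sup>2) = (\<lambda>t. indicator ({-L..x}\<inter>{-L..L}) t::real)" by (auto simp: one_def indicator_def fun_eq_iff)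
  thus "integrable lebesgue (\<lambda>t. (cmod (one x t))\<^sup>2)" using integrable_indicator_compact[of "{-L..x}\<inter>{-L..L}"] by simp
 qed
 define s where "s = norm (emb (one L))"
 have n1: "norm (emb (one x))\<le>s" for x
 proof -
  have "AE t in lebesgue. one x t = one x t * one L t" by (auto simp: one_def indicator_def)
  hence "emb (one x) = mulop (one x) (emb (one L))" using mulop_emb[of 1 "one x", OF _ sq1[of L]] sq1[of x]
   by (subst mulop_emb[of 1 "one x", OF _ sq1[of L]]) (auto simp: bdd_fun_def sq_int_def one_def indicator_def intro!: arg_cong[of _ _ emb])
  also have "norm \<dots>\<le>1 * norm (emb (one L))" by (rule norm_mulop_le) (use sq1[of x] in \<open>auto simp: bdd_fun_def sq_int_def one_def indicator_def\<close>)
  finally show ?thesis by (simp add: s_def)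
 qed
 have s0: "s\<ge>0" by (simp add: s_def)
 have cone: "cinner (emb h) (emb (one x)) = (LINT t|lebesgue. indicator {-L..x} t *\<^sub>R h t)"
  if "sq_int h" "AE t in lebesgue. t\<notin>{-L..L}\<longrightarrow>h t = 0" for h x
 proof -
  have [measurable]: "h\<in>borel_measurable lebesgue" "one x\<in>borel_measurable lebesgue" using that sq1[of x] by (auto simp: sq_int_def)
  have "(LINT t|lebesgue. h t * cnj (one x t)) = (LINT t|lebesgue. indicator {-L..x} t *\<^sub>R h t)"
  proof (rule integral_cong_AE)
   show "AE t in lebesgue. h t * cnj (one x t) = indicator {-L..x} t *\<^sub>R h t" using that(2) by eventually_elim (auto simp: one_def indicator_def)
   show "(\<lambda>t. indicator {-L..x} t *\<^sub>R h t)\<in>borel_measurable lebesgue" by (intro borel_measurable_scaleR borel_measurable_indicator) auto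
  qed measurable
  thus ?thesis by (simp add: cinner_emb[OF that(1) sq1])
 qed
 have cone': "cinner (emb h) (emb (one L)) = (LINT t|lebesgue. h t)"
  if "sq_int h" "AE t in lebesgue. t\<notin>{-L..L}\<longrightarrow>h t = 0" for h
 proof -
  have [measurable]: "h\<in>borel_measurable lebesgue" using that by (auto simp: sq_int_def)
  have "(LINT t|lebesgue. indicator {-L..L} t *\<^sub>R h t) = (LINT t|lebesgue. h t)"
  proof (rule integral_cong_AE)
   show "AE t in lebesgue. indicator {-L..L} t *\<^sub>R h t = h t" using that(2) by eventually_elim (auto simp: indicator_def)
   show "(\<lambda>t. indicator {-L..L} t *\<^sub>R h t)\<in>borel_measurable lebesgue" by (intro borel_measurable_scaleR borel_measurable_indicator) auto
  qed measurable
  thus ?thesis using cone[OF that] by simp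
 qed
 have out': "AE t in lebesgue. t\<notin>{-L..L}\<longrightarrow>v' t = 0" using out(2) by eventually_elim auto
 define vt where "vt x = cinner (emb v') (emb (one x))" for x
 have approx: "\<exists>F. F\<in>test_functions\<and>(\<forall>x. F x\<noteq>0\<longrightarrow>\<bar>x\<bar>\<le>L)\<and>(\<forall>x. cmod (F x-vt x)\<le>\<delta>) \<and>
   norm (emb (vderiv F)-emb v')\<le>\<delta>" if \<delta>: "\<delta>>0" for \<delta>
 proof -
  obtain \<beta>0 :: "real\<Rightarrow>real" where \<beta>0: "\<beta>0\<in>test_functions" "\<And>x. \<beta>0 x\<noteq>0\<Longrightarrow>-L<x\<and>x<L"
   "(LINT x|lebesgue. \<beta>0 x) = 1" using ex_unit_bump[of "-L" L] L by auto
  define \<beta> where "\<beta> x = complex_of_real (\<beta>0 x)" for x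
  have \<beta>: "\<beta>\<in>test_functions" unfolding \<beta>_def[abs_def] by (rule test_function_of_real[OF \<beta>0(1)])
  have i\<beta>: "(LINT x|lebesgue. \<beta> x) = 1" by (simp add: \<beta>_def \<beta>0(3))
  define b where "b = norm (emb \<beta>)"
  have b0: "b\<ge>0" by (simp add: b_def)
  \<comment> \<open>Dominates both error constants, \<open>1 + s * b\<close> for the derivative and
    \<open>s * (1 + s * b)\<close> for the values.\<close>
  define K where "K = (1 + s) * (1 + s * b)"
  have K: "K>0" using s0 b0 by (simp add: K_def add_pos_nonneg)
  have Kge: "1 + s * b\<le>K" "s * (1 + s * b)\<le>K" using s0 b0 by (auto simp: K_def algebra_simps)
  define \<eta> where "\<eta> = \<delta>/K"
  have \<eta>: "\<eta>>0" "\<eta> * K = \<delta>" using \<delta> K by (auto simp: \<eta>_def)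
  obtain h where h: "h\<in>test_functions" "\<And>x. h x\<noteq>0\<Longrightarrow>\<bar>x\<bar>\<le>L" "norm (emb h-emb v')<\<eta>" using ex_test_near_on_interval[OF v' out(2) \<eta>(1)] by blast
  have hout: "AE t in lebesgue. t\<notin>{-L..L}\<longrightarrow>h t = 0" using h(2) by (intro AE_I2) (fastforce simp: abs_le_iff)
  \<comment> \<open>The defect of the integral of \<open>h\<close>, small because \<open>v'\<close>
    has integral zero.\<close>
  define c where "c = (LINT x|lebesgue. h x)"
  have "c = cinner (emb h-emb v') (emb (one L))" by (simp add: c_def cinner_diff_left cone'[OF sq_int_test[OF h(1)] hout] cone'[OF v' out'] int0)
  hence cle: "cmod c\<le>\<eta> * s" using norm_cinner_le[of "emb h-emb v'" "emb (one L)"] mult_mono[of "norm (emb h-emb v')" \<eta> "norm (emb (one L))" s] h(3) \<eta>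
   by (simp add: s_def)
  have c\<beta>: "(\<lambda>x. c * \<beta> x)\<in>test_functions" by (rule test_function_bounded_linear[OF bounded_linear_mult_right \<beta>])
  define g where "g x = h x-c * \<beta> x" for x
  have g: "g\<in>test_functions" unfolding g_def[abs_def] by (rule test_function_diff[OF h(1) c\<beta>])
  have gs: "\<bar>x\<bar>\<le>L" if "g x\<noteq>0" for x
  proof -
   have "h x\<noteq>0\<or>\<beta> x\<noteq>0" using that by (auto simp: g_def)
   thus ?thesis using h(2)[of x] \<beta>0(2)[of x] by (auto simp: \<beta>_def abs_le_iff)
  qed
  have int: "integrable lebesgue f" if "f\<in>test_functions" for f :: "real\<Rightarrow>complex"
   using integrable_test_mult[OF locally_integrable_continuous[of "\<lambda>x. 1::complex"] that] by simp
  have g0: "(LINT x|lebesgue. g x) = 0" unfolding g_def using int[OF h(1)] int[OF \<beta>] by (simp add: c_def i\<beta>)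
  have gv: "norm (emb g-emb v')\<le>\<eta> * (1 + s * b)"
  proof -
   have "emb g = emb h-c *\<^sub>C emb \<beta>" unfolding g_def[abs_def] by (subst emb_diff) (auto intro: sq_int_test h c\<beta> simp: emb_cscale[OF sq_int_test[OF \<beta>]])
   hence eq: "emb g-emb v' = (emb h-emb v')-c *\<^sub>C emb \<beta>" by simp
   have "norm (emb g-emb v')\<le>norm (emb h-emb v') + cmod c * b" unfolding eq b_def norm_cscale[symmetric] by (rule norm_triangle_ineq4)
   also have "\<dots>\<le>\<eta> + (\<eta> * s) * b" using h(3) cle b0 by (intro add_mono mult_right_mono) auto
   finally show ?thesis by (simp add: algebra_simps)
  qed
  obtain F where F: "F\<in>test_functions" "\<And>x. F x\<noteq>0\<Longrightarrow>\<bar>x\<bar>\<le>L" "vderiv F = g"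
   "\<And>x. F x = (LINT t|lebesgue. indicator {-L..x} t *\<^sub>R g t)" using ex_test_primitive[OF test_function_smooth[OF g] gs L g0] by blast
  have gout: "AE t in lebesgue. t\<notin>{-L..L}\<longrightarrow>g t = 0" using gs by (intro AE_I2) (fastforce simp: abs_le_iff)
  have Fv: "cmod (F x-vt x)\<le>\<delta>" for x
  proof -
   have "F x-vt x = cinner (emb g-emb v') (emb (one x))" by (simp add: F(4) vt_def cinner_diff_left cone[OF sq_int_test[OF g] gout])
   hence "cmod (F x-vt x)\<le>norm (emb g-emb v') * norm (emb (one x))" using norm_cinner_le by simp
   also have "\<dots>\<le>(\<eta> * (1 + s * b)) * s" using gv n1 s0 b0 \<eta> by (intro mult_mono) auto
   also have "\<dots> = \<eta> * (s * (1 + s * b))" by simp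
   also have "\<dots>\<le>\<eta> * K" using \<eta> Kge by (intro mult_left_mono) auto
   finally show ?thesis using \<eta> by simp
  qed
  have "norm (emb (vderiv F)-emb v')\<le>\<eta> * (1 + s * b)" using gv F(3) by simp
  also have "\<dots>\<le>\<eta> * K" using \<eta> Kge by (intro mult_left_mono) auto
  finally have "norm (emb (vderiv F)-emb v')\<le>\<delta>" using \<eta> by simp
  thus ?thesis using F Fv by blast
 qed
 have cont: "continuous_on UNIV vt"
 proof -
  have "\<forall>n::nat. \<exists>F. F\<in>test_functions\<and>(\<forall>x. cmod (F x-vt x)\<le>1/real (Suc n))"
  proof
   fix n :: nat
   have "1/real (Suc n)>0" by simp
   from approx[OF this] show "\<exists>F. F\<in>test_functions\<and>(\<forall>x. cmod (F x-vt x)\<le>1/real (Suc n))" by blast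
  qed
  from choice[OF this] obtain F where F0: "\<forall>n. F n\<in>test_functions\<and>(\<forall>x. cmod (F n x-vt x)\<le>1/real (Suc n))" ..
  have F: "F n\<in>test_functions" "cmod (F n x-vt x)\<le>1/real (Suc n)" for n x using F0 by auto
  have "uniform_limit UNIV F vt sequentially"
  proof (rule uniform_limitI)
   fix e :: real assume "e>0"
   then obtain N :: nat where N: "1/real (Suc N)<e" using nat_approx_posE by blast
   show "\<forall>\<^sub>F n in sequentially. \<forall>x\<in>UNIV. dist (F n x) (vt x)<e"
   proof (rule eventually_sequentiallyI[of N], intro ballI)
    fix n x assume "N\<le>n"
    hence "1/real (Suc n)\<le>1/real (Suc N)" by (intro divide_left_mono) auto
    thus "dist (F n x) (vt x)<e" using F(2)[of n x] N by (simp only: dist_norm)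
   qed
  qed
  thus ?thesis by (rule uniform_limit_theorem[rotated]) (auto intro!: always_eventually smooth_continuous test_function_smooth F)
 qed
 \<comment> \<open>The approximants satisfy the identity exactly, so the defect \<open>Z\<close> for
   the primitive is at most \<open>\<delta> * K\<close> for every positive \<delta>.\<close>
 have wt: "weak_derivative vt v'" unfolding weak_derivative_def
 proof (intro conjI ballI)
  show lv: "locally_integrable vt" by (rule locally_integrable_continuous[OF cont])
  show lv': "locally_integrable v'" by (rule sq_int_locally_integrable[OF v'])
  fix \<xi> :: "real\<Rightarrow>complex" assume \<xi>: "\<xi>\<in>test_functions"
  define Z where "Z = (LINT x|lebesgue. vt x * vderiv \<xi> x) + (LINT x|lebesgue. v' x * \<xi> x)"
  have \<xi>': "vderiv \<xi>\<in>test_functions" by (rule test_function_vderiv[OF \<xi>])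
  have int: "integrable lebesgue f" if "f\<in>test_functions" for f :: "real\<Rightarrow>complex"
   using integrable_test_mult[OF locally_integrable_continuous[of "\<lambda>x. 1::complex"] that] by simp
  define K where "K = (LINT x|lebesgue. cmod (vderiv \<xi> x)) + norm (emb (\<lambda>x. cnj (\<xi> x)))"
  have Z: "cmod Z\<le>\<delta> * K" if \<delta>: "\<delta>>0" for \<delta>
  proof -
   obtain F where F: "F\<in>test_functions" "\<And>x. cmod (F x-vt x)\<le>\<delta>" "norm (emb (vderiv F)-emb v')\<le>\<delta>" using approx[OF \<delta>] by blast
   have lF: "locally_integrable F" "locally_integrable (vderiv F)" by (intro locally_integrable_continuous smooth_continuous smooth_vderiv test_function_smooth F)+
   have "(LINT x|lebesgue. F x * vderiv \<xi> x) =-(LINT x|lebesgue. vderiv F x * \<xi> x)" by (rule integral_by_parts_smooth[OF test_function_smooth[OF F(1)] \<xi>])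
   hence "Z = (LINT x|lebesgue. (vt x-F x) * vderiv \<xi> x) + (LINT x|lebesgue. (v' x-vderiv F x) * \<xi> x)"
    unfolding Z_def left_diff_distrib using integrable_test_mult[OF lv \<xi>'] integrable_test_mult[OF lF(1) \<xi>']
     integrable_test_mult[OF lv' \<xi>] integrable_test_mult[OF lF(2) \<xi>] by simp
   hence "cmod Z\<le>cmod (LINT x|lebesgue. (vt x-F x) * vderiv \<xi> x) + cmod (LINT x|lebesgue. (v' x-vderiv F x) * \<xi> x)" by (simp add: norm_triangle_ineq)
   also have "cmod (LINT x|lebesgue. (vt x-F x) * vderiv \<xi> x)\<le>(LINT x|lebesgue. \<delta> * cmod (vderiv \<xi> x))"
   proof (rule order_trans[OF integral_norm_bound integral_mono])
    show "integrable lebesgue (\<lambda>x. cmod ((vt x-F x) * vderiv \<xi> x))" by (intro integrable_norm integrable_test_mult[OF locally_integrable_diff[OF lv lF(1)] \<xi>'])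
    show "integrable lebesgue (\<lambda>x. \<delta> * cmod (vderiv \<xi> x))" using int[OF \<xi>'] by simp
    show "cmod ((vt x-F x) * vderiv \<xi> x)\<le>\<delta> * cmod (vderiv \<xi> x)" for x using F(2)[of x] by (simp add: norm_mult norm_minus_commute mult_right_mono)
   qed
   also have "(LINT x|lebesgue. (v' x-vderiv F x) * \<xi> x) = cinner (emb v'-emb (vderiv F)) (emb (\<lambda>x. cnj (\<xi> x)))"
    using cinner_emb[OF sq_int_diff[OF v' sq_int_test[OF test_function_vderiv[OF F(1)]]] sq_int_cnj[OF sq_int_test[OF \<xi>]]]
    by (simp add: emb_diff[OF v' sq_int_test[OF test_function_vderiv[OF F(1)]]])
   also have "cmod \<dots>\<le>norm (emb v'-emb (vderiv F)) * norm (emb (\<lambda>x. cnj (\<xi> x)))" by (rule norm_cinner_le)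
   also have "\<dots>\<le>\<delta> * norm (emb (\<lambda>x. cnj (\<xi> x)))" using F(3) by (intro mult_right_mono) (auto simp: norm_minus_commute)
   finally show ?thesis by (simp add: K_def distrib_left)
  qed
  have K0: "K\<ge>0" unfolding K_def by (intro add_nonneg_nonneg integral_nonneg_AE) auto
  have "cmod Z\<le>0 + e" if "e>0" for e
  proof -
   have "cmod Z\<le>(e/(K + 1)) * K" using that K0 by (intro Z) simp
   also have "\<dots>\<le>e" using that K0 by (simp add: field_simps)
   finally show ?thesis by simp
  qed
  hence "cmod Z\<le>0" by (rule field_le_epsilon)
  thus "(LINT x|lebesgue. vt x * vderiv \<xi> x) =-(LINT x|lebesgue. v' x * \<xi> x)" by (simp add: Z_def eq_neg_iff_add_eq_0)
 qed
 \<comment> \<open>\<open>v\<close> and the primitive \<open>vt\<close> have the same weak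
   derivative and both vanish to the left of \<open>-L\<close>, so they agree almost
   everywhere.\<close>
 have "weak_derivative (\<lambda>x. v x-vt x) (\<lambda>x. v' x-v' x)" by (rule weak_derivative_diff[OF w wt])
 hence "weak_derivative (\<lambda>x. v x-vt x) (\<lambda>x. 0)" by simp
 moreover have "AE x in lebesgue. x < -L\<longrightarrow>v x-vt x = 0" using out(1)
 proof eventually_elim
  case (elim x)
  have "vt x = 0" if "x < -L"
  proof -
   have "one x = (\<lambda>t. 0)" using that by (auto simp: one_def)
   thus ?thesis by (simp add: vt_def emb_zero)
  qed
  thus ?case using elim by auto
 qed
 ultimately have "AE x in lebesgue. v x-vt x = 0" by (rule weak_derivative_zero_imp_zero)
 hence vvt: "AE x in lebesgue. v x = vt x" by simp
 obtain F where F: "F\<in>test_functions" "\<And>x. F x\<noteq>0\<Longrightarrow>\<bar>x\<bar>\<le>L" "\<And>x. cmod (F x-vt x)\<le>\<epsilon>"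
  "norm (emb (vderiv F)-emb v')\<le>\<epsilon>" using approx[OF \<epsilon>] by blast
 have "AE x in lebesgue. cmod (F x-v x)\<le>\<epsilon>" using vvt by eventually_elim (simp add: F(3))
 thus ?thesis using F by blast
qed

section \<open>The form of the weighted operator\<close>

lemma japanese_bracket_ge_1: "japanese_bracket x\<ge>1" by (simp add: japanese_bracket_def)

lemma abs_le_japanese_bracket: "\<bar>x\<bar>\<le>japanese_bracket x" unfolding japanese_bracket_def by (rule real_le_rsqrt) simp

lemma japanese_bracket_powr: "japanese_bracket x powr a = (1 + x\<^sup>2) powr (a/2)"
 unfolding japanese_bracket_def by (subst powr_half_sqrt[symmetric]) (auto simp: powr_powr add_nonneg_nonneg)

lemma one_plus_sq_powr_deriv:
 "((\<lambda>x::real. (1 + x\<^sup>2) powr b) has_real_derivative b * (1 + x\<^sup>2) powr (b-1) * (2 * x)) (at x)"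
proof -
 have "1 + x\<^sup>2>0" by (simp add: add_pos_nonneg)
 thus ?thesis by (auto intro!: derivative_eq_intros)
qed

lemma smooth_one_plus_sq_powr: "smooth (\<lambda>x::real. (1 + x\<^sup>2) powr b)"
proof -
 define G where "G = range (\<lambda>(c, n, b) x::real. c * x^n * (1 + x\<^sup>2) powr b)"
 have inG: "(\<lambda>x::real. c * x^n * (1 + x\<^sup>2) powr b)\<in>G" for c n b unfolding G_def by (rule image_eqI[of _ _ "(c, n, b)"]) auto
 show ?thesis
 proof (rule smoothI_fsums[of G])
  have "(\<lambda>x::real. 1 * x^0 * (1 + x\<^sup>2) powr b)\<in>fsums G" by (intro fsums.base inG)
  thus "(\<lambda>x::real. (1 + x\<^sup>2) powr b)\<in>fsums G" by simp
  fix g assume "g\<in>G"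
  then obtain c n b where g: "g = (\<lambda>x::real. c * x^n * (1 + x\<^sup>2) powr b)" unfolding G_def by auto
  define g' where "g' x = (c * real n) * x^(n-1) * (1 + x\<^sup>2) powr b + (c * (2 * b)) * x^(n + 1) * (1 + x\<^sup>2) powr (b-1)" for x :: real
  show "\<exists>g'\<in>fsums G. \<forall>x. (g has_vector_derivative g' x) (at x)"
  proof (intro bexI[of _ g'] allI)
   show "g'\<in>fsums G" unfolding g'_def by (intro fsums.add fsums.base inG)
   fix x
   have 1: "((\<lambda>x. c * x^n) has_real_derivative (c * real n) * x^(n-1)) (at x)" by (rule derivative_eq_intros refl)+ simp
   have "(g has_real_derivative g' x) (at x)" unfolding g by (rule DERIV_cong[OF DERIV_mult[OF 1 one_plus_sq_powr_deriv[of b x]]]) (simp add: g'_def algebra_simps)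
   thus "(g has_vector_derivative g' x) (at x)" by (simp add: has_real_derivative_iff_has_vector_derivative)
  qed
 qed
qed

lemma powr_le_small_powr_plus_const:
 fixes a b \<epsilon> :: real
 assumes "a<b" "\<epsilon>>0"
 shows "\<exists>C\<ge>0. \<forall>t\<ge>1. t powr a\<le>\<epsilon> * t powr b + C"
proof -
 have "eventually (\<lambda>t. t powr a\<le>\<epsilon> * t powr b) at_top" using assms by real_asymp
 then obtain T where T: "\<And>t. t\<ge>T\<Longrightarrow>t powr a\<le>\<epsilon> * t powr b" unfolding eventually_at_top_linorder by blast
 show ?thesis
 proof (intro exI[of _ "max T 1 powr \<bar>a\<bar>"] conjI allI impI)
  fix t :: real assume t: "t\<ge>1"
  show "t powr a\<le>\<epsilon> * t powr b + max T 1 powr \<bar>a\<bar>"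
  proof (cases "t\<ge>T")
   case True
   have "0\<le>max T 1 powr \<bar>a\<bar>" by simp
   thus ?thesis using T[OF True] by linarith
  next
   case False
   have "t powr a\<le>t powr \<bar>a\<bar>" using t by (intro powr_mono) auto
   also have "\<dots>\<le>max T 1 powr \<bar>a\<bar>" using t False by (intro powr_mono2) auto
   moreover have "0\<le>\<epsilon> * t powr b" using assms by simp
   ultimately show ?thesis by linarith
  qed
 qed simp
qed

lemma norm_emb_mono:
 assumes h: "sq_int h" and g: "g\<in>borel_measurable lebesgue" and le: "AE x in lebesgue. cmod (g x)\<le>C * cmod (h x)" and C: "C\<ge>0"
 shows "norm (emb g)\<le>C * norm (emb h)"
proof -
 have sg: "sq_int g" by (rule sq_int_dominated[OF g h le])
 have "(norm (emb g))\<^sup>2\<le>(LINT x|lebesgue. C\<^sup>2 * (cmod (h x))\<^sup>2)" unfolding norm_emb_sq[OF sg]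
 proof (rule integral_mono_AE)
  show "integrable lebesgue (\<lambda>x. (cmod (g x))\<^sup>2)" using sg by (simp add: sq_int_def)
  show "integrable lebesgue (\<lambda>x. C\<^sup>2 * (cmod (h x))\<^sup>2)" using h by (simp add: sq_int_def)
  show "AE x in lebesgue. (cmod (g x))\<^sup>2\<le>C\<^sup>2 * (cmod (h x))\<^sup>2" using le
  proof eventually_elim
   case (elim x)
   have "(cmod (g x))\<^sup>2\<le>(C * cmod (h x))\<^sup>2" by (rule power_mono[OF elim]) simp
   thus ?case by (simp add: power_mult_distrib)
  qed
 qed
 also have "\<dots> = (C * norm (emb h))\<^sup>2" by (simp add: norm_emb_sq[OF h] power_mult_distrib)
 finally show ?thesis by (rule power2_le_imp_le) (simp add: C)
qed

lemma sq_int_bounded_support: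
 assumes f: "f\<in>borel_measurable lebesgue" and li: "locally_integrable (\<lambda>x. (cmod (f x))\<^sup>2)"
  and supp: "\<And>x. f x\<noteq>0\<Longrightarrow>\<bar>x\<bar>\<le>L"
 shows "sq_int f" unfolding sq_int_def by (intro conjI f integrable_bounded_support[OF li, of L]) (simp add: supp)

lemma sq_int_mult_continuous_bounded_support:
 assumes f: "f\<in>borel_measurable lebesgue" and li: "locally_integrable (\<lambda>x. (cmod (f x))\<^sup>2)"
  and g: "continuous_on UNIV g" and supp: "\<And>x. f x * g x\<noteq>0\<Longrightarrow>\<bar>x\<bar>\<le>L"
 shows "sq_int (\<lambda>x. f x * g x)"
proof (rule sq_int_bounded_support)
 show "(\<lambda>x. f x * g x)\<in>borel_measurable lebesgue" by (intro borel_measurable_times f continuous_lebesgue_measurable g)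
 have "locally_integrable (\<lambda>x. (cmod (f x))\<^sup>2 * (cmod (g x))\<^sup>2)" by (rule locally_integrable_mult_continuous[OF li]) (intro continuous_intros g)
 thus "locally_integrable (\<lambda>x. (cmod (f x * g x))\<^sup>2)" by (simp add: norm_mult power_mult_distrib)
qed (rule supp)

section \<open>The weight, the potential and the form domain\<close>

text \<open>The sign \<open>s\<close> selects the growing or the decaying weight, so that both are
  treated at once.\<close>

locale weighted_schroedinger =
 fixes \<gamma> \<alpha> c s :: real and V :: "real\<Rightarrow>complex" and w \<Phi> \<Phi>' R :: "real\<Rightarrow>real"
 assumes \<gamma>: "\<gamma>>2" and V: "locally_square_integrable V" and ReV: "AE x in lebesgue. Re (V x)\<ge>0"
  and c: "c>0" and Vlow: "AE x in lebesgue. cmod (V x) + 1\<ge>c * japanese_bracket x powr \<gamma>"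
  and \<alpha>: "0<\<alpha>" "\<alpha><1 + \<gamma>/2"
  and w: "w = (\<lambda>x. exp (s * japanese_bracket x powr \<alpha>))" and s: "\<bar>s\<bar> = 1"
  and \<Phi>: "\<And>x. \<bar>\<Phi> x\<bar>\<le>1" "weak_derivative \<Phi> \<Phi>'"
  and \<Phi>': "\<And>\<epsilon>. \<epsilon>>0\<Longrightarrow>\<exists>C\<ge>0. AE x in lebesgue. \<bar>\<Phi>' x\<bar>\<le>\<epsilon> * sqrt (cmod (V x)) + C"
  and R: "locally_integrable R" "AE x in lebesgue. R x\<ge>0"
   "AE x in lebesgue. \<Phi> x * Im (V x)\<ge>\<bar>Im (V x)\<bar>-R x"
   "\<And>\<epsilon>. \<epsilon>>0\<Longrightarrow>\<exists>C\<ge>0. \<forall>f\<in>(test_functions::(real\<Rightarrow>complex) set).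
      (normw w (\<lambda>x. sqrt (R x) *\<^sub>R f x))\<^sup>2
      \<le>\<epsilon> * (normw w (vderiv f))\<^sup>2
        + \<epsilon> * (normw w (\<lambda>x. sqrt (cmod (V x)) *\<^sub>R f x))\<^sup>2
        + C * (normw w f)\<^sup>2"
begin

definition \<rho> :: "real\<Rightarrow>real" where "\<rho> x = exp (s/2 * japanese_bracket x powr \<alpha>)"

text \<open>The logarithmic derivative w'/w; since \<rho> is the square root of \<open>w\<close>,
  that of \<rho> is half of it.\<close>

definition \<omega> :: "real\<Rightarrow>real" where "\<omega> x = s * \<alpha> * japanese_bracket x powr (\<alpha>-2) * x"

definition \<sigma> :: "real\<Rightarrow>real" where "\<sigma> x = sqrt (cmod (V x))"

abbreviation rc :: "real\<Rightarrow>complex" where "rc x \<equiv> complex_of_real (\<rho> x)"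

abbreviation sc :: "real\<Rightarrow>complex" where "sc x \<equiv> complex_of_real (\<sigma> x)"

text \<open>\<omega> and the derivative of \<Phi> are dominated only with the help of \<sigma>, so
  they need not be bounded multipliers. Divided by 1 + \<sigma> they are bounded; applied to the sum
  of the first and third components of a triple, which is (1 + \<sigma>) \<rho> f, they act on
  \<rho> f as \<open>h\<close> itself.\<close>

abbreviation damped :: "(real\<Rightarrow>real)\<Rightarrow>real\<Rightarrow>complex" where "damped h \<equiv> \<lambda>x. complex_of_real (h x/(1 + \<sigma> x))"

text \<open>The phase of \<open>V\<close>; division by zero gives the value 0 where \<open>V\<close>
  vanishes.\<close>

abbreviation \<tau> :: "real\<Rightarrow>complex" where "\<tau> \<equiv> \<lambda>x. V x/of_real (cmod (V x))"

abbreviation \<Phi>c :: "real\<Rightarrow>complex" where "\<Phi>c \<equiv> \<lambda>x. of_real (\<Phi> x)"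

abbreviation m\<^sub>\<Phi> :: "real\<Rightarrow>real\<Rightarrow>complex" where "m\<^sub>\<Phi> \<delta> \<equiv> \<lambda>x. 1 + \<i> * of_real (\<delta> * \<Phi> x)"

definition J :: "(real\<Rightarrow>complex)\<Rightarrow>l2" where "J f = emb (\<lambda>x. rc x * f x)"

text \<open>With \<open>v\<close>, its derivative and \<sigma> v kept as separate weighted
  components, the norm of the form domain becomes the product norm and the form becomes
  bounded.\<close>

definition triple :: "(real\<Rightarrow>complex)\<Rightarrow>(real\<Rightarrow>complex)\<Rightarrow>l2 \<times> l2 \<times> l2" where
 "triple v v' = (J v, J v', J (\<lambda>x. sc x * v x))"

text \<open>The image of the closure of the test functions, realised as a closed subspace of a fixed
  Hilbert space, so that completeness is inherited and Lax-Milgram on subspaces applies.\<close>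

definition form_domain :: "(l2 \<times> l2 \<times> l2) set" where
 "form_domain = closure ((\<lambda>\<phi>. triple \<phi> (vderiv \<phi>)) ` test_functions)"

lemma \<rho>_pos: "\<rho> x>0" by (simp add: \<rho>_def)

lemma \<rho>_nz [simp]: "\<rho> x\<noteq>0" by (simp add: \<rho>_def)

lemma w_eq: "w x = (\<rho> x)\<^sup>2" by (simp add: w \<rho>_def power2_eq_square flip: exp_add)

lemma \<sigma>_nonneg: "\<sigma> x\<ge>0" by (simp add: \<sigma>_def)

lemma \<sigma>_sq: "(\<sigma> x)\<^sup>2 = cmod (V x)" by (simp add: \<sigma>_def)

lemma smooth_exp_bracket: "smooth (\<lambda>x. exp (r * japanese_bracket x powr \<alpha>))" unfolding japanese_bracket_powr
 by (intro smooth_exp smooth_bounded_linear[OF bounded_linear_mult_right] smooth_one_plus_sq_powr)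

lemma smooth_\<rho>: "smooth \<rho>" unfolding \<rho>_def[abs_def] by (rule smooth_exp_bracket)

lemma smooth_inverse_\<rho>: "smooth (\<lambda>x. 1/\<rho> x)" using smooth_exp_bracket[of "- s/2"] by (simp add: \<rho>_def exp_minus inverse_eq_divide)

lemma smooth_w: "smooth w" unfolding w by (rule smooth_exp_bracket)

lemma smooth_inverse_w: "smooth (\<lambda>x. 1/w x)" using smooth_exp_bracket[of "- s"] by (simp add: w exp_minus inverse_eq_divide)

text \<open>The factor \<open>r * s\<close> arises because \<omega> already contains
  \<open>s\<close>, and \<open>s * s = 1\<close>.\<close>

lemma exp_bracket_deriv:
 "((\<lambda>x. exp (r * japanese_bracket x powr \<alpha>)) has_real_derivative (r * s * \<omega> x) * exp (r * japanese_bracket x powr \<alpha>)) (at x)"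
proof -
 have ss: "s * s = 1" using s by (metis abs_mult_self_eq mult_1)
 have d: "((\<lambda>x. exp (r * (1 + x\<^sup>2) powr (\<alpha>/2))) has_real_derivative
   exp (r * (1 + x\<^sup>2) powr (\<alpha>/2)) * (r * (\<alpha>/2 * (1 + x\<^sup>2) powr (\<alpha>/2-1) * (2 * x)))) (at x)" by (intro DERIV_fun_exp DERIV_cmult one_plus_sq_powr_deriv)
 have e: "r * s * \<omega> x = r * (\<alpha>/2 * (1 + x\<^sup>2) powr (\<alpha>/2-1) * (2 * x))"
 proof -
  have "r * s * \<omega> x = (s * s) * (r * \<alpha> * (1 + x\<^sup>2) powr ((\<alpha>-2)/2) * x)" by (simp add: \<omega>_def japanese_bracket_powr)
  also have "(\<alpha>-2)/2 = \<alpha>/2-1" by simp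
  finally show ?thesis by (simp add: ss)
 qed
 show ?thesis unfolding japanese_bracket_powr e by (rule DERIV_cong[OF d]) (rule mult.commute)
qed

lemma \<rho>_deriv: "(\<rho> has_real_derivative (\<omega> x/2) * \<rho> x) (at x)"
proof -
 have ss: "s * s = 1" using s by (metis abs_mult_self_eq mult_1)
 have "s/2 * s * \<omega> x = (s * s) * (\<omega> x/2)" by simp
 thus ?thesis using exp_bracket_deriv[of "s/2" x] unfolding \<rho>_def[abs_def] by (simp add: ss)
qed

lemma w_deriv: "(w has_real_derivative \<omega> x * w x) (at x)"
proof -
 have ss: "s * s = 1" using s by (metis abs_mult_self_eq mult_1)
 thus ?thesis using exp_bracket_deriv[of s x] unfolding w by simp
qed

lemma V_measurable [measurable]: "V\<in>borel_measurable lebesgue" using V by (simp add: locally_square_integrable_def)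

lemma \<sigma>_measurable [measurable]: "\<sigma>\<in>borel_measurable lebesgue" unfolding \<sigma>_def by measurable

lemma \<rho>_continuous: "continuous_on A \<rho>" by (rule smooth_continuous[OF smooth_\<rho>])

lemma \<rho>_measurable [measurable]: "\<rho>\<in>borel_measurable lebesgue" by (rule continuous_lebesgue_measurable[OF \<rho>_continuous])

lemma \<omega>_measurable [measurable]: "\<omega>\<in>borel_measurable lebesgue"
proof (rule continuous_lebesgue_measurable)
 have "x\<^sup>2 + 1\<noteq>0" for x :: real by (metis add_nonneg_eq_0_iff zero_le_power2 zero_neq_one zero_le_one)
 thus "continuous_on UNIV \<omega>" unfolding \<omega>_def[abs_def] japanese_bracket_powr by (intro continuous_intros) (auto simp: add.commute)
qed

lemma V_locally_integrable: "locally_integrable (\<lambda>x. cmod (V x))"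
proof (rule locally_integrableI)
 fix L
 have i: "integrable lebesgue (\<lambda>x. indicator {-L..L} x *\<^sub>R (cmod (V x))\<^sup>2)" using V locally_integrable_Icc[of "\<lambda>x. (cmod (V x))\<^sup>2" "-L" L]
  unfolding locally_square_integrable_def set_integrable_def by blast
 have "integrable lebesgue (\<lambda>x. indicator {-L..L} x *\<^sub>R (cmod (V x)))"
 proof (rule Bochner_Integration.integrable_bound)
  show "integrable lebesgue (\<lambda>x. indicator {-L..L} x + indicator {-L..L} x *\<^sub>R (cmod (V x))\<^sup>2)"
   by (rule Bochner_Integration.integrable_add[OF integrable_indicator_compact i]) simp
  show "(\<lambda>x. indicator {-L..L} x *\<^sub>R (cmod (V x)))\<in>borel_measurable lebesgue"
  proof -
   have "(\<lambda>x. cmod (V x))\<in>borel_measurable lebesgue" by measurable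
   thus ?thesis by (intro borel_measurable_scaleR borel_measurable_indicator) simp_all
  qed
  show "AE x in lebesgue. norm (indicator {-L..L} x *\<^sub>R (cmod (V x)))\<le>norm (indicator {-L..L} x + indicator {-L..L} x *\<^sub>R (cmod (V x))\<^sup>2)"
  proof (rule AE_I2)
   fix x
   have "cmod (V x)\<le>1 + (cmod (V x))\<^sup>2"
   proof -
    have "2 * cmod (V x)\<le>1 + (cmod (V x))\<^sup>2" using sum_squares_bound[of 1 "cmod (V x)"] by simp
    thus ?thesis using norm_ge_zero[of "V x"] by linarith
   qed
   thus "norm (indicator {-L..L} x *\<^sub>R (cmod (V x)))\<le>norm (indicator {-L..L} x + indicator {-L..L} x *\<^sub>R (cmod (V x))\<^sup>2)" by (simp add: indicator_def)
  qed
 qed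
 thus "set_integrable lebesgue {-L..L} (\<lambda>x. cmod (V x))" by (simp add: set_integrable_def)
qed

lemma L2w_iff: "f\<in>L2w w\<longleftrightarrow>f\<in>borel_measurable lebesgue\<and>sq_int (\<lambda>x. rc x * f x)"
proof -
 have eq: "(\<lambda>x. (cmod (rc x * f x))\<^sup>2) = (\<lambda>x. (cmod (f x))\<^sup>2 * w x)" for f :: "real\<Rightarrow>complex" using \<rho>_pos by (auto simp: norm_mult power_mult_distrib w_eq fun_eq_iff)
 show ?thesis unfolding L2w_def sq_int_def eq by auto
qed

lemma normw_eq:
 assumes "sq_int (\<lambda>x. rc x * f x)"
 shows "normw w f = norm (J f)"
proof -
 have "(norm (J f))\<^sup>2 = (LINT x|lebesgue. (cmod (f x))\<^sup>2 * w x)"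
  unfolding J_def norm_emb_sq[OF assms] by (intro Bochner_Integration.integral_cong) (auto simp: norm_mult power_mult_distrib w_eq)
 thus ?thesis unfolding normw_def by (metis norm_ge_zero real_sqrt_unique)
qed

text \<open>Here \<alpha> < 1 + \<gamma>/2 enters: \<omega> is at most \<alpha> times the bracket to
  the power \<alpha> - 1, which is below \<gamma>/2, while \<sigma> + 1 is at least
  \<open>sqrt c\<close> times the bracket to the power \<gamma>/2.\<close>

lemma \<omega>_bound:
 assumes "\<epsilon>>0"
 shows "\<exists>C\<ge>0. AE x in lebesgue. \<bar>\<omega> x\<bar>\<le>\<epsilon> * \<sigma> x + C"
proof -
 \<comment> \<open>Scaled so that the factors \<alpha> and \<open>sqrt c\<close> cancel in the
   end.\<close>
 define \<epsilon>' where "\<epsilon>' = \<epsilon> * sqrt c/\<alpha>"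
 have \<epsilon>': "\<epsilon>'>0" using assms c \<alpha> by (simp add: \<epsilon>'_def)
 have "\<alpha>-1<\<gamma>/2" using \<alpha> by simp
 from powr_le_small_powr_plus_const[OF this \<epsilon>'] obtain C where C: "C\<ge>0"
  "\<And>t. t\<ge>1\<Longrightarrow>t powr (\<alpha>-1)\<le>\<epsilon>' * t powr (\<gamma>/2) + C" by blast
 have "AE x in lebesgue. \<bar>\<omega> x\<bar>\<le>\<epsilon> * \<sigma> x + (\<epsilon> + \<alpha> * C)" using Vlow
 proof eventually_elim
  case (elim x)
  define j where "j = japanese_bracket x"
  have j: "j\<ge>1" "\<bar>x\<bar>\<le>j" using japanese_bracket_ge_1 abs_le_japanese_bracket by (auto simp: j_def)
  have "\<bar>\<omega> x\<bar> = \<alpha> * (j powr (\<alpha>-2) * \<bar>x\<bar>)" using s \<alpha> by (simp add: \<omega>_def j_def abs_mult)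
  also have "\<dots>\<le>\<alpha> * (j powr (\<alpha>-2) * j)" using \<alpha> j by (intro mult_left_mono) auto
  also have "j powr (\<alpha>-2) * j = j powr (\<alpha>-1)" using j powr_mult_base[of j "\<alpha>-2"] by (simp add: mult.commute)
  also have "\<alpha> * j powr (\<alpha>-1)\<le>\<alpha> * (\<epsilon>' * j powr (\<gamma>/2) + C)" using \<alpha> C(2)[OF j(1)] by (intro mult_left_mono) auto
  also have "\<dots> = \<epsilon> * (sqrt c * j powr (\<gamma>/2)) + \<alpha> * C" using \<alpha> by (simp add: \<epsilon>'_def algebra_simps)
  also have "sqrt c * j powr (\<gamma>/2)\<le>\<sigma> x + 1"
  proof (rule power2_le_imp_le)
   have "(sqrt c * j powr (\<gamma>/2))\<^sup>2 = c * j powr \<gamma>" using c j by (simp add: power_mult_distrib powr_power)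
   also have "\<dots>\<le>(\<sigma> x)\<^sup>2 + 1" using elim by (simp add: \<sigma>_sq j_def)
   also have "\<dots>\<le>(\<sigma> x + 1)\<^sup>2" using \<sigma>_nonneg[of x] by (simp add: power2_sum)
   finally show "(sqrt c * j powr (\<gamma>/2))\<^sup>2\<le>(\<sigma> x + 1)\<^sup>2" .
  qed (use \<sigma>_nonneg[of x] in simp)
  finally show ?case using assms by (simp add: algebra_simps)
 qed
 moreover have "\<epsilon> + \<alpha> * C\<ge>0" using assms \<alpha> C by simp
 ultimately show ?thesis by blast
qed

lemma smooth_rc: "smooth rc" using smooth_bounded_linear[OF bounded_linear_of_real smooth_\<rho>] .

lemma sq_int_\<rho>_test: "\<phi>\<in>test_functions\<Longrightarrow>sq_int (\<lambda>x. rc x * \<phi> x)" by (intro sq_int_test test_function_mult_left smooth_rc)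

lemma sq_int_\<sigma>_test:
 assumes "\<phi>\<in>test_functions"
 shows "sq_int (\<lambda>x. sc x * \<phi> x)"
proof -
 obtain L where L: "smooth \<phi>" "\<And>x. \<phi> x\<noteq>0\<Longrightarrow>\<bar>x\<bar>\<le>L" using test_functionD[OF assms] by blast
 show ?thesis
 proof (rule sq_int_mult_continuous_bounded_support[of _ _ L])
  show "(\<lambda>x. complex_of_real (\<sigma> x))\<in>borel_measurable lebesgue" by measurable
  show "locally_integrable (\<lambda>x. (cmod (complex_of_real (\<sigma> x)))\<^sup>2)" using V_locally_integrable by (simp add: \<sigma>_sq)
 qed (intro smooth_continuous L, use L in auto)
qed

lemma sq_int_\<rho>_\<sigma>_test: "\<phi>\<in>test_functions\<Longrightarrow>sq_int (\<lambda>x. rc x * (sc x * \<phi> x))"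
 using sq_int_\<sigma>_test[OF test_function_mult_left[OF smooth_rc]] by (simp add: mult.left_commute)

lemmas sq_int_triple = sq_int_\<rho>_test sq_int_\<rho>_test[OF test_function_vderiv] sq_int_\<rho>_\<sigma>_test

end

instantiation prod :: (complex_hilbert, complex_hilbert) complex_hilbert
begin
definition "imul U = (imul (fst U), imul (snd U))"
instance by standard (simp_all add: imul_prod_def imul_add imul_scaleR inner_prod_def prod_eq_iff)
end

lemma fst_imul [simp]: "fst (imul U) = imul (fst U)"
 and snd_imul [simp]: "snd (imul U) = imul (snd U)" by (simp_all add: imul_prod_def)

lemma fst_cscale [simp]: "fst (z *\<^sub>C U) = z *\<^sub>C fst U"
 and snd_cscale [simp]: "snd (z *\<^sub>C U) = z *\<^sub>C snd U" by (simp_all add: cscale_def)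

lemma clinear_map_fst: "clinear_map fst" by (intro clinear_mapI bounded_linear_fst fst_imul)

lemma clinear_map_snd: "clinear_map snd" by (intro clinear_mapI bounded_linear_snd snd_imul)

lemma clinear_map_Pair: "clinear_map K\<Longrightarrow>clinear_map L\<Longrightarrow>clinear_map (\<lambda>x. (K x, L x))" by (simp add: clinear_map_def bounded_linear_Pair imul_prod_def)

lemma csubspace_closure:
 assumes "csubspace S"
 shows "csubspace (closure S)" unfolding csubspace_def
proof (intro conjI ballI)
 show "subspace (closure S)" using assms by (simp add: csubspace_def subspace_closure)
 fix x assume x: "x\<in>closure S"
 have "imul ` closure S\<subseteq>closure (imul ` S)" by (intro closure_bounded_linear_image_subset bounded_linear_imul)
 also have "\<dots>\<subseteq>closure S" using assms by (intro closure_mono) (auto simp: csubspace_def)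
 finally show "imul x\<in>closure S" using x by (rule set_mp[OF _ imageI])
qed

context weighted_schroedinger
begin

definition D :: "(real\<Rightarrow>complex)\<Rightarrow>l2 \<times> l2 \<times> l2" where
 "D \<phi> = triple \<phi> (vderiv \<phi>)"

lemma form_domain_eq: "form_domain = closure (D ` test_functions)" unfolding form_domain_def D_def[abs_def] ..

lemma J_add: "sq_int (\<lambda>x. rc x * f x)\<Longrightarrow>sq_int (\<lambda>x. rc x * g x)\<Longrightarrow>J (\<lambda>x. f x + g x) = J f + J g" unfolding J_def by (subst emb_add[symmetric]) (auto simp: algebra_simps)

lemma J_diff: "sq_int (\<lambda>x. rc x * f x)\<Longrightarrow>sq_int (\<lambda>x. rc x * g x)\<Longrightarrow>J (\<lambda>x. f x-g x) = J f-J g"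
 unfolding J_def by (subst emb_diff[symmetric]) (auto simp: algebra_simps)

lemma J_cscale: "sq_int (\<lambda>x. rc x * f x)\<Longrightarrow>J (\<lambda>x. z * f x) = z *\<^sub>C J f" unfolding J_def by (subst emb_cscale[symmetric]) (auto simp: algebra_simps)

lemma D_add: "\<phi>\<in>test_functions\<Longrightarrow>\<psi>\<in>test_functions\<Longrightarrow>D (\<lambda>x. \<phi> x + \<psi> x) = D \<phi> + D \<psi>"
 by (simp add: D_def triple_def vderiv_add test_function_smooth J_add sq_int_triple distrib_left)

lemma D_cscale:
 assumes "\<phi>\<in>test_functions"
 shows "D (\<lambda>x. z * \<phi> x) = z *\<^sub>C D \<phi>"
proof -
 have "J (\<lambda>x. sc x * (z * \<phi> x)) = J (\<lambda>x. z * (sc x * \<phi> x))" by (simp add: mult.left_commute)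
 thus ?thesis using assms by (simp add: D_def triple_def vderiv_bounded_linear[OF bounded_linear_mult_right] test_function_smooth
    J_cscale sq_int_triple prod_eq_iff)
qed

lemma test_function_cmult: "\<phi>\<in>test_functions\<Longrightarrow>(\<lambda>x. (z::complex) * \<phi> x)\<in>test_functions" by (rule test_function_bounded_linear[OF bounded_linear_mult_right])

lemma csubspace_form_domain: "csubspace form_domain" unfolding form_domain_eq
proof (rule csubspace_closure)
 show "csubspace (D ` test_functions)" unfolding csubspace_def
 proof (intro conjI ballI subspaceI)
  have "0 *\<^sub>C D (\<lambda>x. 0)\<in>D ` test_functions" unfolding D_cscale[OF test_function_zero, symmetric] by (intro imageI test_function_cmult test_function_zero)
  thus "0\<in>D ` test_functions" by simp
  fix U G assume "U\<in>D ` test_functions"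
  then obtain \<phi> where \<phi>: "\<phi>\<in>test_functions" "U = D \<phi>" by blast
  have "r *\<^sub>R U = D (\<lambda>x. of_real r * \<phi> x)" for r by (simp add: \<phi> D_cscale cscale_of_real)
  thus "r *\<^sub>R U\<in>D ` test_functions" for r using test_function_cmult[OF \<phi>(1)] by simp
  have "imul U = D (\<lambda>x. \<i> * \<phi> x)" by (simp add: \<phi> D_cscale cscale_ii)
  thus "imul U\<in>D ` test_functions" using test_function_cmult[OF \<phi>(1)] by simp
  assume "G\<in>D ` test_functions"
  then obtain \<psi> where \<psi>: "\<psi>\<in>test_functions" "G = D \<psi>" by blast
  have "U + G = D (\<lambda>x. \<phi> x + \<psi> x)" by (simp add: \<phi> \<psi> D_add)
  thus "U + G\<in>D ` test_functions" using test_function_add[OF \<phi>(1) \<psi>(1)] by simp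
 qed
qed

lemma subspace_form_domain: "subspace form_domain" using csubspace_form_domain by (simp add: csubspace_def)

lemma closed_form_domain: "closed form_domain" by (simp add: form_domain_eq)

lemma D_in_form_domain: "\<phi>\<in>test_functions\<Longrightarrow>D \<phi>\<in>form_domain" unfolding form_domain_eq by (rule set_mp[OF closure_subset imageI])

text \<open>A closed condition on the form domain has to be checked on test functions only; this
  carries the limit arguments of the later estimates.\<close>

lemma form_domain_minimal:
 assumes U: "U\<in>form_domain" and closed: "closed {U. P U}" and P: "\<And>\<phi>. \<phi>\<in>test_functions\<Longrightarrow>P (D \<phi>)"
 shows "P U"
proof -
 have "form_domain\<subseteq>{U. P U}" unfolding form_domain_eq by (rule closure_minimal[OF _ closed]) (auto simp: P)
 with U show ?thesis by blast
qed

lemma form_domain_approx: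
 "U\<in>form_domain\<longleftrightarrow>(\<forall>\<epsilon>>0. \<exists>\<phi>\<in>test_functions. norm (D \<phi>-U)<\<epsilon>)" unfolding form_domain_eq closure_approachable dist_norm by blast

lemma bdd_inverse_one_plus_\<sigma>: "bdd_fun 1 (\<lambda>x. complex_of_real (1/(1 + \<sigma> x)))" unfolding bdd_fun_def
proof (intro conjI AE_I2)
 show "(\<lambda>x. complex_of_real (1/(1 + \<sigma> x)))\<in>borel_measurable lebesgue" by measurable
 show "cmod (complex_of_real (1/(1 + \<sigma> x)))\<le>1" for x using \<sigma>_nonneg[of x] unfolding norm_of_real by simp
qed

lemma bdd_\<sigma>_over_one_plus_\<sigma>: "bdd_fun 1 (\<lambda>x. complex_of_real (\<sigma> x/(1 + \<sigma> x)))" unfolding bdd_fun_def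
proof (intro conjI AE_I2)
 show "(\<lambda>x. complex_of_real (\<sigma> x/(1 + \<sigma> x)))\<in>borel_measurable lebesgue" by measurable
 have "\<bar>\<sigma> x/(1 + \<sigma> x)\<bar>\<le>1" for x using \<sigma>_nonneg[of x] by (simp add: divide_le_eq)
 thus "cmod (complex_of_real (\<sigma> x/(1 + \<sigma> x)))\<le>1" for x by (simp only: norm_of_real)
qed

text \<open>Multiplication by \<sigma> is in general not continuous, but 1/(1 + \<sigma>) and
  \<sigma>/(1 + \<sigma>) are bounded multipliers. The relation divided by 1 + \<sigma> is therefore
  a closed condition, valid for test functions.\<close>

lemma form_domain_\<sigma>:
 assumes U: "U\<in>form_domain"
 shows "AE x in lebesgue. rep (snd (snd U)) x = sc x * rep (fst U) x"
proof -
 define a where "a x = complex_of_real (1/(1 + \<sigma> x))" for x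
 define b where "b x = complex_of_real (\<sigma> x/(1 + \<sigma> x))" for x
 have ba: "bdd_fun 1 a" "bdd_fun 1 b" unfolding a_def b_def by (fact bdd_inverse_one_plus_\<sigma> bdd_\<sigma>_over_one_plus_\<sigma>)+
 have bl: "bounded_linear (mulop a)" "bounded_linear (mulop b)" using ba by (simp_all add: clinear_map_bounded_linear clinear_map_mulop)
 have b_eq: "b x = a x * sc x" for x by (simp add: a_def b_def)
 have "mulop a (snd (snd U)) = mulop b (fst U)" using U
 proof (rule form_domain_minimal)
  show "closed {U. mulop a (snd (snd U)) = mulop b (fst U)}"
   by (intro closed_Collect_eq bounded_linear.continuous_on[OF bl(1)] bounded_linear.continuous_on[OF bl(2)] continuous_intros)
  fix \<phi> :: "real\<Rightarrow>complex" assume \<phi>: "\<phi>\<in>test_functions"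
  show "mulop a (snd (snd (D \<phi>))) = mulop b (fst (D \<phi>))"
   unfolding D_def triple_def J_def fst_conv snd_conv mulop_emb[OF ba(1) sq_int_triple(3)[OF \<phi>]] mulop_emb[OF ba(2) sq_int_triple(1)[OF \<phi>]]
   by (simp only: b_eq mult_ac)
 qed
 hence "AE x in lebesgue. rep (mulop a (snd (snd U))) x = rep (mulop b (fst U)) x" by simp
 with AE_rep_mulop[OF ba(1), of "snd (snd U)"] AE_rep_mulop[OF ba(2), of "fst U"]
 show ?thesis
 proof eventually_elim
  case (elim x)
  have "a x\<noteq>0" using \<sigma>_nonneg[of x] unfolding a_def of_real_eq_0_iff by simp
  with elim show ?case unfolding b_eq by (metis mult.assoc mult_cancel_left)
 qed
qed

lemma smooth_inverse_rc: "smooth (\<lambda>x. 1/rc x)"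
proof -
 have "smooth (\<lambda>x. complex_of_real (1/\<rho> x))" by (rule smooth_bounded_linear[OF bounded_linear_of_real smooth_inverse_\<rho>])
 thus ?thesis by simp
qed

text \<open>Pairing with \<psi>/\<rho>, for a fixed test function \<psi> or its derivative, is
  continuous in the triple, so integration by parts survives the closure.\<close>

lemma form_domain_weak_derivative:
 assumes U: "U\<in>form_domain"
 shows "weak_derivative (\<lambda>x. rep (fst U) x/rc x) (\<lambda>x. rep (fst (snd U)) x/rc x)" unfolding weak_derivative_def
proof (intro conjI ballI)
 have li: "locally_integrable (\<lambda>x. rep u x/rc x)" for u
  using locally_integrable_mult_continuous[OF locally_integrable_rep smooth_continuous[OF smooth_inverse_rc]] by simp
 thus "locally_integrable (\<lambda>x. rep (fst U) x/rc x)" "locally_integrable (\<lambda>x. rep (fst (snd U)) x/rc x)" by auto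
 fix \<psi> :: "real\<Rightarrow>complex" assume \<psi>: "\<psi>\<in>test_functions"
 define g where "g \<psi> x = cnj (1/rc x * \<psi> x)" for \<psi> :: "real\<Rightarrow>complex" and x
 have g: "sq_int (g \<psi>)" if "\<psi>\<in>test_functions" for \<psi> unfolding g_def by (intro sq_int_cnj sq_int_test test_function_mult_left smooth_inverse_rc that)
 have eq: "cinner u (emb (g \<psi>)) = (LINT x|lebesgue. rep u x/rc x * \<psi> x)" if "\<psi>\<in>test_functions" for u \<psi> unfolding cinner_emb_right[OF g[OF that]] g_def by simp
 have "cinner (fst U) (emb (g (vderiv \<psi>))) =-cinner (fst (snd U)) (emb (g \<psi>))" using U
 proof (rule form_domain_minimal)
  show "closed {U::l2 \<times> l2 \<times> l2. cinner (fst U) (emb (g (vderiv \<psi>))) =-cinner (fst (snd U)) (emb (g \<psi>))}"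
   by (intro closed_Collect_eq bounded_linear.continuous_on[OF bounded_linear_cinner_left] continuous_intros)
  fix \<phi> :: "real\<Rightarrow>complex" assume \<phi>: "\<phi>\<in>test_functions"
  have c: "cinner (J \<phi>) (emb (g \<psi>)) = (LINT x|lebesgue. \<phi> x * \<psi> x)" if "\<phi>\<in>test_functions" "\<psi>\<in>test_functions" for \<phi> \<psi>
   unfolding J_def cinner_emb[OF sq_int_\<rho>_test[OF that(1)] g[OF that(2)]] g_def by (intro Bochner_Integration.integral_cong) auto
  show "cinner (fst (D \<phi>)) (emb (g (vderiv \<psi>))) =-cinner (fst (snd (D \<phi>))) (emb (g \<psi>))"
   by (simp add: D_def triple_def c \<phi> \<psi> test_function_vderiv integral_by_parts_smooth[OF test_function_smooth[OF \<phi>] \<psi>])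
 qed
 thus "(LINT x|lebesgue. rep (fst U) x/rc x * vderiv \<psi> x) =-(LINT x|lebesgue. rep (fst (snd U)) x/rc x * \<psi> x)" by (simp add: eq \<psi> test_function_vderiv)
qed

lemma \<Phi>_measurable [measurable]: "\<Phi>\<in>borel_measurable lebesgue"
 and \<Phi>'_measurable [measurable]: "\<Phi>'\<in>borel_measurable lebesgue" using \<Phi>(2) by (auto simp: weak_derivative_def locally_integrable_measurable)

lemma bdd_\<Phi>: "bdd_fun 1 \<Phi>c" using \<Phi>(1) by (simp add: bdd_fun_def)

lemma bdd_over_one_plus_\<sigma>:
 assumes [measurable]: "h\<in>borel_measurable lebesgue" and h: "AE x in lebesgue. \<bar>h x\<bar>\<le>\<epsilon> * \<sigma> x + C" and "\<epsilon>\<ge>0" "C\<ge>0"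
 shows "bdd_fun (\<epsilon> + C) (damped h)" unfolding bdd_fun_def
proof
 show "(damped h)\<in>borel_measurable lebesgue" by measurable
 show "AE x in lebesgue. cmod (complex_of_real (h x/(1 + \<sigma> x)))\<le>\<epsilon> + C" using h
 proof eventually_elim
  case (elim x)
  have "\<epsilon> * \<sigma> x + C\<le>(\<epsilon> + C) * (1 + \<sigma> x)" using assms(3,4) \<sigma>_nonneg[of x] by (simp add: algebra_simps)
  with elim have "\<bar>h x\<bar>\<le>(\<epsilon> + C) * (1 + \<sigma> x)" by linarith
  thus ?case using \<sigma>_nonneg[of x] unfolding norm_of_real by (simp add: divide_le_eq)
 qed
qed

lemma \<Phi>'_bound: "\<epsilon>>0\<Longrightarrow>\<exists>C\<ge>0. AE x in lebesgue. \<bar>\<Phi>' x\<bar>\<le>\<epsilon> * \<sigma> x + C" using \<Phi>' unfolding \<sigma>_def .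

lemma ex_bdd_\<Phi>': "\<exists>B. bdd_fun B (damped \<Phi>')"
proof -
 obtain C where "C\<ge>0" "AE x in lebesgue. \<bar>\<Phi>' x\<bar>\<le>1 * \<sigma> x + C" using \<Phi>'_bound[of 1] by auto
 from bdd_over_one_plus_\<sigma>[OF \<Phi>'_measurable this(2) _ this(1)] show ?thesis by auto
qed

text \<open>\<Phi> \<psi> need not be smooth, so membership in the closure takes an approximation of
  all three components by one test function: uniform for the values, in norm for the derivative.
  Uniform closeness is what controls the component with \<sigma>, which is only locally
  square-integrable.\<close>

lemma triple_\<Phi>_in_form_domain:
 assumes \<psi>: "\<psi>\<in>test_functions"
 shows "triple (\<lambda>x. of_real (\<Phi> x) * \<psi> x) (\<lambda>x. of_real (\<Phi>' x) * \<psi> x + of_real (\<Phi> x) * vderiv \<psi> x)\<in>form_domain"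
proof -
 define f where "f x = complex_of_real (\<Phi> x) * \<psi> x" for x
 define f' where "f' x = complex_of_real (\<Phi>' x) * \<psi> x + complex_of_real (\<Phi> x) * vderiv \<psi> x" for x
 obtain L0 where L0: "L0>0" "smooth \<psi>" "\<And>x. \<psi> x\<noteq>0\<Longrightarrow>\<bar>x\<bar>\<le>L0" using test_functionD[OF \<psi>] by blast
 have supp': "vderiv \<psi> x\<noteq>0\<Longrightarrow>\<bar>x\<bar>\<le>L0" for x by (rule vderiv_support[OF L0(2,3)])
 \<comment> \<open>Enlarged by 1 so that \<open>f\<close> and \<open>f'\<close> vanish off the open
   interval.\<close>
 define L where "L = L0 + 1"
 have z: "f x = 0" "f' x = 0" if "x\<notin>{-L<..<L}" for x
 proof -
  have "\<not> \<bar>x\<bar>\<le>L0" using that by (auto simp: L_def)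
  hence "\<psi> x = 0" "vderiv \<psi> x = 0" using L0(3) supp' by blast+
  thus "f x = 0" "f' x = 0" by (simp_all add: f_def f'_def)
 qed
 have wd: "weak_derivative \<Phi>c (\<lambda>x. complex_of_real (\<Phi>' x))" by (rule weak_derivative_of_real[OF \<Phi>(2)])
 have wf: "weak_derivative f f'" unfolding f_def f'_def by (rule weak_derivative_mult_smooth[OF wd L0(2)])
 have \<psi>m: "\<psi>\<in>borel_measurable lebesgue" "vderiv \<psi>\<in>borel_measurable lebesgue" using \<psi> test_function_vderiv test_function_measurable by blast+
 obtain B0 where B0: "bdd_fun B0 (damped \<Phi>')" using ex_bdd_\<Phi>' by blast
 have "complex_of_real (\<Phi>' x/(1 + \<sigma> x)) * (\<psi> x + sc x * \<psi> x) = complex_of_real (\<Phi>' x) * \<psi> x" for x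
 proof -
  have "1 + \<sigma> x\<noteq>0" using \<sigma>_nonneg[of x] by linarith
  hence "\<Phi>' x = \<Phi>' x/(1 + \<sigma> x) * (1 + \<sigma> x)" by simp
  hence "complex_of_real (\<Phi>' x) = complex_of_real (\<Phi>' x/(1 + \<sigma> x)) * complex_of_real (1 + \<sigma> x)" by (metis of_real_mult)
  thus ?thesis by (simp only: of_real_add of_real_1 distrib_left distrib_right mult_1_left mult_1_right mult_ac)
 qed
 with sq_int_mult_bdd[OF B0 sq_int_add[OF sq_int_test sq_int_\<sigma>_test], OF \<psi> \<psi>]
 have s1: "sq_int (\<lambda>x. complex_of_real (\<Phi>' x) * \<psi> x)" by simp
 have s2: "sq_int (\<lambda>x. complex_of_real (\<Phi> x) * vderiv \<psi> x)" by (intro sq_int_mult_bdd[OF bdd_\<Phi>] sq_int_test test_function_vderiv \<psi>)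
 have sf': "sq_int f'" unfolding f'_def by (rule sq_int_add[OF s1 s2])
 \<comment> \<open>The weak derivative identity of \<Phi> tested with \<psi>.\<close>
 have int0: "(LINT x|lebesgue. f' x) = 0"
 proof -
  have li: "locally_integrable (\<lambda>x. complex_of_real (\<Phi>' x))" "locally_integrable \<Phi>c" using wd by (auto simp: weak_derivative_def)
  have "(LINT x|lebesgue. f' x) = (LINT x|lebesgue. complex_of_real (\<Phi>' x) * \<psi> x) + (LINT x|lebesgue. complex_of_real (\<Phi> x) * vderiv \<psi> x)" unfolding f'_def
   by (intro Bochner_Integration.integral_add integrable_test_mult li \<psi> test_function_vderiv)
  also have "\<dots> = 0" using wd \<psi> by (simp add: weak_derivative_def)
  finally show ?thesis .
 qed
 \<comment> \<open>A cut-off equal to 1 on \<open>{-L..L}\<close>. In \<open>h\<close> it replaces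
   \<rho> by a compactly supported, hence bounded, multiplier that agrees with \<rho> wherever the
   functions in question live.\<close>
 define \<eta> where "\<eta> x = complex_of_real (max 0 (min 1 (L + 1-\<bar>x\<bar>)))" for x
 have \<eta>1: "\<eta> x = 1" if "\<bar>x\<bar>\<le>L" for x using that by (simp add: \<eta>_def)
 define h where "h x = rc x * \<eta> x" for x
 have hc: "continuous_on UNIV h" unfolding h_def \<eta>_def by (intro continuous_intros \<rho>_continuous)
 have hs: "\<bar>x\<bar>\<le>L + 1" if "h x\<noteq>0" for x using that by (simp add: h_def \<eta>_def max_def split: if_splits)
 obtain B where B: "\<And>x. cmod (h x)\<le>B" using continuous_bounded_support[OF hc hs] by blast
 have hm: "h\<in>borel_measurable lebesgue" by (rule continuous_lebesgue_measurable[OF hc])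
 have hb: "bdd_fun B h" unfolding bdd_fun_def using hm B by auto
 have B0: "B\<ge>0" by (rule bdd_fun_nonneg[OF hb])
 have sh: "sq_int h" by (rule sq_int_continuous_bounded_support[OF hc hs])
 have shs: "sq_int (\<lambda>x. sc x * h x)"
 proof (rule sq_int_mult_continuous_bounded_support[of _ _ "L + 1"])
  show "(\<lambda>x. complex_of_real (\<sigma> x))\<in>borel_measurable lebesgue" by measurable
  show "locally_integrable (\<lambda>x. (cmod (complex_of_real (\<sigma> x)))\<^sup>2)" using V_locally_integrable by (simp add: \<sigma>_sq)
 qed (rule hc, use hs in force)
 have rh: "rc x * g = h x * g" if "\<bar>x\<bar>>L\<Longrightarrow>g = 0" for x g using that \<eta>1[of x] by (cases "\<bar>x\<bar>\<le>L") (auto simp: h_def)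
 have zf: "f x = 0" "f' x = 0" if "\<bar>x\<bar>>L" for x using z[of x] that by (cases "x\<in>{-L<..<L}"; force)+
 have fm: "f\<in>borel_measurable lebesgue" using \<psi>m(1) unfolding f_def by measurable
 have sf: "sq_int f" unfolding f_def by (rule sq_int_mult_bdd[OF bdd_\<Phi> sq_int_test[OF \<psi>]])
 have "triple f f'\<in>form_domain" unfolding form_domain_approx
 proof (intro allI impI)
  fix \<epsilon> :: real assume \<epsilon>: "\<epsilon>>0"
  \<comment> \<open>The sum of the constants of the three components, with 1 added for
    positivity.\<close>
  define M where "M = norm (emb h) + B + norm (emb (\<lambda>x. sc x * h x)) + 1"
  have M: "M>0" using B0 unfolding M_def by (simp add: add_nonneg_pos)
  define e where "e = \<epsilon>/(2 * M)"
  have e: "e>0" using \<epsilon> M by (simp add: e_def)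
  have Lpos: "L>0" using L0 by (simp add: L_def)
  obtain \<phi> where \<phi>: "\<phi>\<in>test_functions" "\<And>x. \<phi> x\<noteq>0\<Longrightarrow>\<bar>x\<bar>\<le>L" "AE x in lebesgue. cmod (\<phi> x-f x)\<le>e"
   "norm (emb (vderiv \<phi>)-emb f')\<le>e" using ex_test_approx[OF wf sf' Lpos AE_I2 AE_I2 int0 e] z by blast
  have z\<phi>: "\<phi> x = 0" "vderiv \<phi> x = 0" if "\<bar>x\<bar>>L" for x using that \<phi>(2)[of x] vderiv_support[OF test_function_smooth[OF \<phi>(1)] \<phi>(2), of x] by force+
  have \<phi>m: "\<phi>\<in>borel_measurable lebesgue" by (rule test_function_measurable[OF \<phi>(1)])
  have eq0: "(\<lambda>x. rc x * \<phi> x) = (\<lambda>x. h x * \<phi> x)" "(\<lambda>x. rc x * f x) = (\<lambda>x. h x * f x)"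
   "(\<lambda>x. rc x * vderiv \<phi> x) = (\<lambda>x. h x * vderiv \<phi> x)" "(\<lambda>x. rc x * f' x) = (\<lambda>x. h x * f' x)" using rh zf z\<phi> by (auto intro!: ext)
  have eq1: "(\<lambda>x. rc x * (sc x * \<phi> x)) = (\<lambda>x. sc x * (h x * \<phi> x))" "(\<lambda>x. rc x * (sc x * f x)) = (\<lambda>x. sc x * (h x * f x))"
   using fun_cong[OF eq0(1)] fun_cong[OF eq0(2)] by (metis mult.left_commute)+
  have shf: "sq_int (\<lambda>x. sc x * (h x * f x))"
  proof (rule sq_int_dominated[where C = 1])
   show "(\<lambda>x. sc x * (h x * f x))\<in>borel_measurable lebesgue" using hm fm by measurable
   show "sq_int (\<lambda>x. rc x * (sc x * \<psi> x))" by (rule sq_int_\<rho>_\<sigma>_test[OF \<psi>])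
   show "AE x in lebesgue. cmod (sc x * (h x * f x))\<le>1 * cmod (rc x * (sc x * \<psi> x))"
   proof (rule AE_I2)
    fix x
    have "cmod (sc x * (h x * f x)) = cmod (rc x * (sc x * \<psi> x)) * \<bar>\<Phi> x\<bar>" unfolding fun_cong[OF eq1(2), symmetric] by (simp add: f_def norm_mult)
    also have "\<dots>\<le>cmod (rc x * (sc x * \<psi> x)) * 1" by (intro mult_left_mono \<Phi>(1)) simp
    finally show "cmod (sc x * (h x * f x))\<le>1 * cmod (rc x * (sc x * \<psi> x))" by simp
   qed
  qed
  have sh\<phi>: "sq_int (\<lambda>x. sc x * (h x * \<phi> x))" using sq_int_\<rho>_\<sigma>_test[OF \<phi>(1)] unfolding eq1 .
  have d0: "norm (J \<phi>-J f)\<le>e * norm (emb h)"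
  proof -
   have "J \<phi>-J f = emb (\<lambda>x. h x * \<phi> x-h x * f x)" unfolding J_def eq0 by (intro emb_diff[symmetric] sq_int_mult_bdd[OF hb] sf sq_int_test[OF \<phi>(1)])
   moreover have "norm (emb (\<lambda>x. h x * \<phi> x-h x * f x))\<le>e * norm (emb h)"
   proof (rule norm_emb_mono[OF sh])
    show "(\<lambda>x. h x * \<phi> x-h x * f x)\<in>borel_measurable lebesgue" using hm fm \<phi>m by measurable
    show "AE x in lebesgue. cmod (h x * \<phi> x-h x * f x)\<le>e * cmod (h x)" using \<phi>(3)
    proof eventually_elim
     case (elim x)
     have "cmod (h x * \<phi> x-h x * f x) = cmod (h x) * cmod (\<phi> x-f x)" by (simp flip: right_diff_distrib add: norm_mult)
     also have "\<dots>\<le>cmod (h x) * e" by (rule mult_left_mono[OF elim]) simp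
     finally show ?case by (simp add: mult.commute)
    qed
   qed (use e in simp)
   ultimately show ?thesis by simp
  qed
  have d1: "norm (J (vderiv \<phi>)-J f')\<le>B * e"
  proof -
   have "J (vderiv \<phi>)-J f' = mulop h (emb (vderiv \<phi>))-mulop h (emb f')"
    unfolding J_def eq0 by (simp add: mulop_emb[OF hb] sf' sq_int_test test_function_vderiv \<phi>(1))
   also have "\<dots> = mulop h (emb (vderiv \<phi>)-emb f')" by (rule linear_diff[symmetric]) (intro bounded_linear.linear clinear_map_bounded_linear clinear_map_mulop[OF hb])
   finally have "norm (J (vderiv \<phi>)-J f')\<le>B * norm (emb (vderiv \<phi>)-emb f')" using norm_mulop_le[OF hb] by simp
   also have "\<dots>\<le>B * e" using \<phi>(4) B0 by (rule mult_left_mono)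
   finally show ?thesis .
  qed
  have d2: "norm (J (\<lambda>x. sc x * \<phi> x)-J (\<lambda>x. sc x * f x))\<le>e * norm (emb (\<lambda>x. sc x * h x))"
  proof -
   have "J (\<lambda>x. sc x * \<phi> x)-J (\<lambda>x. sc x * f x) = emb (\<lambda>x. sc x * (h x * \<phi> x)-sc x * (h x * f x))" unfolding J_def eq1 by (intro emb_diff[symmetric] sh\<phi> shf)
   moreover have "norm (emb (\<lambda>x. sc x * (h x * \<phi> x)-sc x * (h x * f x)))\<le>e * norm (emb (\<lambda>x. sc x * h x))"
   proof (rule norm_emb_mono[OF shs])
    show "(\<lambda>x. sc x * (h x * \<phi> x)-sc x * (h x * f x))\<in>borel_measurable lebesgue" using hm fm \<phi>m by measurable
    show "AE x in lebesgue. cmod (sc x * (h x * \<phi> x)-sc x * (h x * f x))\<le>e * cmod (sc x * h x)" using \<phi>(3)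
    proof eventually_elim
     case (elim x)
     have "cmod (sc x * (h x * \<phi> x)-sc x * (h x * f x)) = cmod (sc x * h x) * cmod (\<phi> x-f x)" by (simp flip: right_diff_distrib norm_mult add: mult.assoc)
     also have "\<dots>\<le>cmod (sc x * h x) * e" by (rule mult_left_mono[OF elim]) simp
     finally show ?case by (simp add: mult.commute)
    qed
   qed (use e in simp)
   ultimately show ?thesis by simp
  qed
  have "norm (D \<phi>-triple f f')\<le>norm (J \<phi>-J f) + (norm (J (vderiv \<phi>)-J f') + norm (J (\<lambda>x. sc x * \<phi> x)-J (\<lambda>x. sc x * f x)))"
   unfolding D_def triple_def by (simp add: order_trans[OF norm_Pair_le add_left_mono[OF norm_Pair_le]])
  also have "\<dots>\<le>e * M" using d0 d1 d2 e by (simp add: M_def algebra_simps)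
  also have "\<dots><\<epsilon>" using \<epsilon> M by (simp add: e_def)
  finally show "\<exists>\<phi>\<in>test_functions. norm (D \<phi>-triple f f')<\<epsilon>" using \<phi>(1) by blast
 qed
 thus ?thesis unfolding f_def[abs_def] f'_def[abs_def] .
qed

end

lemma norm_triple_sq: "(norm (U::'a::real_inner \<times> 'b::real_inner \<times> 'c::real_inner))\<^sup>2 = (norm (fst U))\<^sup>2 + (norm (fst (snd U)))\<^sup>2 + (norm (snd (snd U)))\<^sup>2"
 by (simp add: norm_prod_def)

lemma norm_emb_norm:
 assumes "sq_int f"
 shows "norm (emb (\<lambda>x. complex_of_real (cmod (f x)))) = norm (emb f)"
proof -
 have "(norm (emb (\<lambda>x. complex_of_real (cmod (f x)))))\<^sup>2 = (norm (emb f))\<^sup>2" by (simp add: norm_emb_sq[OF sq_int_norm[OF assms]] norm_emb_sq[OF assms])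
 thus ?thesis by simp
qed

lemma norm_emb_sum_bound:
 assumes "sq_int f" "sq_int g" "h\<in>borel_measurable lebesgue" "a\<ge>0" "b\<ge>0"
  and le: "AE x in lebesgue. cmod (h x)\<le>a * cmod (f x) + b * cmod (g x)"
 shows "norm (emb h)\<le>a * norm (emb f) + b * norm (emb g)"
proof -
 define k where "k x = complex_of_real a * complex_of_real (cmod (f x)) + complex_of_real b * complex_of_real (cmod (g x))" for x
 note s = sq_int_norm[OF assms(1)] sq_int_norm[OF assms(2)]
 have k: "sq_int k" unfolding k_def by (intro sq_int_add sq_int_mult_const s)
 have kx: "cmod (k x) = a * cmod (f x) + b * cmod (g x)" for x using assms(4,5) unfolding k_def by (simp flip: of_real_mult of_real_add)
 have "norm (emb h)\<le>1 * norm (emb k)" by (rule norm_emb_mono[OF k assms(3)]) (use le kx in auto)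
 also have "emb k = complex_of_real a *\<^sub>C emb (\<lambda>x. of_real (cmod (f x))) + complex_of_real b *\<^sub>C emb (\<lambda>x. of_real (cmod (g x)))"
  unfolding k_def by (subst emb_add) (auto intro: s sq_int_mult_const simp: emb_cscale s)
 also have "1 * norm \<dots>\<le>a * norm (emb f) + b * norm (emb g)"
  using norm_triangle_ineq[of "complex_of_real a *\<^sub>C emb (\<lambda>x. of_real (cmod (f x)))" "complex_of_real b *\<^sub>C emb (\<lambda>x. of_real (cmod (g x)))"] assms(4,5)
  by (simp add: norm_emb_norm assms(1,2))
 finally show ?thesis .
qed

lemma inner_mulop_cnj:
 assumes m: "bdd_fun B m"
 shows "inner (mulop (\<lambda>t. cnj (m t)) u) v = inner u (mulop m v)"
proof -
 have "bdd_fun B (\<lambda>t. cnj (m t))" using m unfolding bdd_fun_def complex_mod_cnj by (intro conjI borel_measurable_cnj) auto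
 note s = sq_int_mult_bdd[OF this sq_int_rep] sq_int_mult_bdd[OF m sq_int_rep]
 have "cinner (emb (\<lambda>t. cnj (m t) * rep u t)) (emb (rep v)) = cinner (emb (rep u)) (emb (\<lambda>t. m t * rep v t))"
  unfolding cinner_emb[OF s(1) sq_int_rep] cinner_emb[OF sq_int_rep s(2)] by (simp add: mult_ac)
 thus ?thesis unfolding mulop_def by (metis Re_cinner emb_rep)
qed

text \<open>Multiplication by a real function followed by \<open>imul\<close> is skew; the imaginary
  part of the multiplier thus drops out of diagonal terms.\<close>

lemma inner_imul_mulop_real:
 assumes h: "bdd_fun B (\<lambda>x. complex_of_real (h x))"
 shows "inner u (imul (mulop (\<lambda>x. complex_of_real (h x)) u)) = 0" using inner_mulop_cnj[OF h, of u "imul u"]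
 by (simp add: clinear_map_imul[OF clinear_map_mulop[OF h]] inner_commute[of "mulop _ u"] inner_imul_left)

section \<open>The multiplier and coercivity of the twisted form\<close>

context weighted_schroedinger
begin

text \<open>Multiplication of \<open>f\<close> by \<Phi>, written on triples: the second component
  carries the product rule, with the derivative of \<Phi> acting through its damped
  multiplier.\<close>

definition PH :: "l2 \<times> l2 \<times> l2\<Rightarrow>l2 \<times> l2 \<times> l2" where
 "PH U = (mulop \<Phi>c (fst U),
      mulop \<Phi>c (fst (snd U)) + mulop (damped \<Phi>') (fst U + snd (snd U)),
      mulop \<Phi>c (snd (snd U)))"

text \<open>The action on triples of multiplying \<open>f\<close> by 1 + \<i> \<delta> \<Phi>; a
  plain multiplier in the first and third components only.\<close>

definition M :: "real\<Rightarrow>l2 \<times> l2 \<times> l2\<Rightarrow>l2 \<times> l2 \<times> l2" where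
 "M \<delta> U = U + \<delta> *\<^sub>R imul (PH U)"

text \<open>The sesquilinear form of \<open>T\<^sub>w + z\<close>, with \<open>V = \<tau> \<sigma>\<^sup>2\<close> and with the term \<open>\<omega>\<close> coming from
 the derivative of the weight.\<close>

definition form :: "real\<Rightarrow>l2 \<times> l2 \<times> l2\<Rightarrow>l2 \<times> l2 \<times> l2\<Rightarrow>real" where
 "form z U G = inner (fst (snd U)) (fst (snd G))
   + inner (fst (snd U)) (mulop (damped \<omega>) (fst G + snd (snd G)))
   + inner (mulop \<tau> (snd (snd U))) (snd (snd G))
   + z * inner (fst U) (fst G)"

lemma ex_bdd_\<omega>: "\<exists>B. bdd_fun B (damped \<omega>)"
proof -
 obtain C where "C\<ge>0" "AE x in lebesgue. \<bar>\<omega> x\<bar>\<le>1 * \<sigma> x + C" using \<omega>_bound[of 1] by auto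
 from bdd_over_one_plus_\<sigma>[OF \<omega>_measurable this(2) _ this(1)] show ?thesis by auto
qed

lemma mulop_over_one_plus_\<sigma>_test:
 assumes B: "bdd_fun B (damped h)" and \<psi>: "\<psi>\<in>test_functions"
 shows "sq_int (\<lambda>x. rc x * (of_real (h x) * \<psi> x))"
  "mulop (damped h) (J \<psi> + J (\<lambda>x. sc x * \<psi> x)) = J (\<lambda>x. of_real (h x) * \<psi> x)"
proof -
 note s = sq_int_triple[OF \<psi>]
 have s12: "sq_int (\<lambda>x. rc x * \<psi> x + rc x * (sc x * \<psi> x))" by (rule sq_int_add[OF s(1,3)])
 have eq: "complex_of_real (h x/(1 + \<sigma> x)) * (rc x * \<psi> x + rc x * (sc x * \<psi> x)) = rc x * (of_real (h x) * \<psi> x)" for x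
 proof -
  have p: "1 + \<sigma> x>0" using \<sigma>_nonneg[of x] by linarith
  have "complex_of_real (h x/(1 + \<sigma> x)) * (rc x * \<psi> x + rc x * (sc x * \<psi> x)) = rc x * (of_real (h x/(1 + \<sigma> x) * (1 + \<sigma> x)) * \<psi> x)"
   by (simp only: of_real_mult of_real_add of_real_1 distrib_left distrib_right mult_1_left mult_1_right mult_ac)
  also have "h x/(1 + \<sigma> x) * (1 + \<sigma> x) = h x" using p by simp
  finally show ?thesis .
 qed
 show "sq_int (\<lambda>x. rc x * (of_real (h x) * \<psi> x))" using sq_int_mult_bdd[OF B s12] unfolding eq .
 show "mulop (damped h) (J \<psi> + J (\<lambda>x. sc x * \<psi> x)) = J (\<lambda>x. of_real (h x) * \<psi> x)" unfolding J_def emb_add[OF s(1,3), symmetric] mulop_emb[OF B s12] eq ..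
qed

lemma bdd_\<tau>: "bdd_fun 1 \<tau>" unfolding bdd_fun_def by (auto simp: norm_divide)

text \<open>On the form domain the damped multiplier acts as \<open>h\<close> does on the first
  component, so the relative bound is inherited with the small factor \<epsilon> in front of the
  \<sigma>-component. The operator norm alone would give \<open>\<epsilon> + C\<close>.\<close>

lemma norm_mulop_form_domain:
 assumes U: "U\<in>form_domain" and h[measurable]: "h\<in>borel_measurable lebesgue" "AE x in lebesgue. \<bar>h x\<bar>\<le>\<epsilon> * \<sigma> x + C" and nn: "\<epsilon>\<ge>0" "C\<ge>0"
 shows "norm (mulop (damped h) (fst U + snd (snd U)))\<le>\<epsilon> * norm (snd (snd U)) + C * norm (fst U)"
proof -
 have "norm (emb (\<lambda>x. of_real (h x/(1 + \<sigma> x)) * rep (fst U + snd (snd U)) x))\<le>\<epsilon> * norm (emb (rep (snd (snd U)))) + C * norm (emb (rep (fst U)))"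
 proof (rule norm_emb_sum_bound[OF sq_int_rep sq_int_rep _ nn])
  show "(\<lambda>x. of_real (h x/(1 + \<sigma> x)) * rep (fst U + snd (snd U)) x)\<in>borel_measurable lebesgue" by measurable
  show "AE x in lebesgue. cmod (of_real (h x/(1 + \<sigma> x)) * rep (fst U + snd (snd U)) x)
  \<le>\<epsilon> * cmod (rep (snd (snd U)) x) + C * cmod (rep (fst U) x)" using h(2) AE_rep_add[of "fst U" "snd (snd U)"] form_domain_\<sigma>[OF U]
  proof eventually_elim
   case (elim x)
   have p: "1 + \<sigma> x>0" using \<sigma>_nonneg[of x] by linarith
   have "rep (fst U + snd (snd U)) x = of_real (1 + \<sigma> x) * rep (fst U) x" unfolding elim by (simp add: algebra_simps)
   hence "of_real (h x/(1 + \<sigma> x)) * rep (fst U + snd (snd U)) x = of_real (h x/(1 + \<sigma> x) * (1 + \<sigma> x)) * rep (fst U) x" by (simp only: of_real_mult mult.assoc)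
   also have "h x/(1 + \<sigma> x) * (1 + \<sigma> x) = h x" using p by simp
   finally have "cmod (of_real (h x/(1 + \<sigma> x)) * rep (fst U + snd (snd U)) x) = \<bar>h x\<bar> * cmod (rep (fst U) x)" by (simp only: norm_mult norm_of_real)
   also have "\<dots>\<le>(\<epsilon> * \<sigma> x + C) * cmod (rep (fst U) x)" by (rule mult_right_mono[OF elim(1)]) simp
   also have "\<dots> = \<epsilon> * cmod (rep (snd (snd U)) x) + C * cmod (rep (fst U) x)" using \<sigma>_nonneg[of x] by (simp add: elim(3) norm_mult algebra_simps)
   finally show ?case .
  qed
 qed
 thus ?thesis by (simp add: mulop_def)
qed

lemma clinear_map_PH: "clinear_map PH"
proof -
 obtain B where B: "bdd_fun B (damped \<Phi>')" using ex_bdd_\<Phi>' by blast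
 note c = clinear_map_compose[OF clinear_map_mulop[OF bdd_\<Phi>]] clinear_map_compose[OF clinear_map_mulop[OF B]]
  clinear_map_compose[OF clinear_map_fst clinear_map_snd] clinear_map_compose[OF clinear_map_snd clinear_map_snd]
 show ?thesis unfolding PH_def[abs_def] by (rule clinear_map_Pair clinear_map_add c clinear_map_fst)+
qed

lemma PH_form_domain:
 assumes "U\<in>form_domain"
 shows "PH U\<in>form_domain" using assms
proof (rule form_domain_minimal)
 have "continuous_on UNIV PH" by (rule bounded_linear.continuous_on[OF clinear_map_bounded_linear[OF clinear_map_PH] continuous_on_id])
 from closed_vimage[OF closed_form_domain this] show "closed {U. PH U\<in>form_domain}" by (simp add: vimage_def)
 fix \<psi> :: "real\<Rightarrow>complex" assume \<psi>: "\<psi>\<in>test_functions"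
 obtain B where B: "bdd_fun B (damped \<Phi>')" using ex_bdd_\<Phi>' by blast
 note s = sq_int_triple[OF \<psi>]
 note m = mulop_over_one_plus_\<sigma>_test[OF B \<psi>]
 have 1: "mulop \<Phi>c (J f) = J (\<lambda>x. of_real (\<Phi> x) * f x)" if "sq_int (\<lambda>x. rc x * f x)" for f unfolding J_def mulop_emb[OF bdd_\<Phi> that] by (simp add: mult.left_commute)
 have s\<Phi>: "sq_int (\<lambda>x. rc x * (of_real (\<Phi> x) * vderiv \<psi> x))" using sq_int_mult_bdd[OF bdd_\<Phi> s(2)] by (simp add: mult.left_commute)
 have c3: "(\<lambda>x. complex_of_real (\<Phi> x) * (sc x * \<psi> x)) = (\<lambda>x. sc x * (complex_of_real (\<Phi> x) * \<psi> x))" by (simp add: mult.left_commute)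
 have "PH (D \<psi>) = triple (\<lambda>x. of_real (\<Phi> x) * \<psi> x) (\<lambda>x. of_real (\<Phi>' x) * \<psi> x + of_real (\<Phi> x) * vderiv \<psi> x)"
  unfolding PH_def D_def triple_def fst_conv snd_conv m(2) 1[OF s(1)] 1[OF s(2)] 1[OF s(3)] J_add[OF m(1) s\<Phi>] c3 by (simp add: add.commute)
 thus "PH (D \<psi>)\<in>form_domain" using triple_\<Phi>_in_form_domain[OF \<psi>] by simp
qed

lemma clinear_map_M: "clinear_map (M \<delta>)"
proof -
 have "clinear_map (\<lambda>U. \<delta> *\<^sub>R imul (PH U))"
 proof (rule clinear_mapI)
  show "bounded_linear (\<lambda>U. \<delta> *\<^sub>R imul (PH U))"
   by (intro bounded_linear_const_scaleR bounded_linear_compose[OF bounded_linear_imul] clinear_map_bounded_linear[OF clinear_map_PH])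
 qed (simp add: clinear_map_imul[OF clinear_map_PH] imul_scaleR)
 thus ?thesis unfolding M_def[abs_def] by (rule clinear_map_add[OF clinear_map_ident])
qed

lemma M_form_domain: "U\<in>form_domain\<Longrightarrow>M \<delta> U\<in>form_domain" using csubspace_form_domain PH_form_domain[of U] unfolding M_def csubspace_def
 by (simp add: subspace_add subspace_scale)

lemma bdd_m:
 assumes "\<bar>\<delta>\<bar>\<le>1"
 shows "bdd_fun 2 (m\<^sub>\<Phi> \<delta>)" unfolding bdd_fun_def
proof (intro conjI AE_I2)
 fix x
 have "\<bar>\<delta> * \<Phi> x\<bar>\<le>1" using assms \<Phi>(1)[of x] by (simp add: abs_mult mult_le_one)
 hence "cmod (\<i> * complex_of_real (\<delta> * \<Phi> x))\<le>1" unfolding norm_mult norm_of_real by simp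
 thus "cmod (1 + \<i> * complex_of_real (\<delta> * \<Phi> x))\<le>2" using norm_triangle_ineq[of 1 "\<i> * complex_of_real (\<delta> * \<Phi> x)"] by simp
qed measurable

lemma M_components:
 assumes "\<bar>\<delta>\<bar>\<le>1"
 shows "fst (M \<delta> U) = mulop (m\<^sub>\<Phi> \<delta>) (fst U)"
  "snd (snd (M \<delta> U)) = mulop (m\<^sub>\<Phi> \<delta>) (snd (snd U))"
proof -
 have "u + \<delta> *\<^sub>R imul (mulop \<Phi>c u) = mulop (m\<^sub>\<Phi> \<delta>) u" for u
 proof (rule l2_eqI)
  show "AE x in lebesgue. rep (u + \<delta> *\<^sub>R imul (mulop \<Phi>c u)) x = rep (mulop (m\<^sub>\<Phi> \<delta>) u) x"
   using AE_rep_add[of u "\<delta> *\<^sub>R imul (mulop \<Phi>c u)"] AE_rep_scaleR[of \<delta> "imul (mulop \<Phi>c u)"]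
    AE_rep_imul[of "mulop \<Phi>c u"] AE_rep_mulop[OF bdd_\<Phi>, of u] AE_rep_mulop[OF bdd_m[OF assms], of u] by eventually_elim (simp add: algebra_simps)
 qed
 thus "fst (M \<delta> U) = mulop (m\<^sub>\<Phi> \<delta>) (fst U)"
  "snd (snd (M \<delta> U)) = mulop (m\<^sub>\<Phi> \<delta>) (snd (snd U))" by (simp_all add: M_def PH_def)
qed

lemma bounded_bilinear_form: "bounded_bilinear (form z)"
proof -
 obtain B where B: "bdd_fun B (damped \<omega>)" using ex_bdd_\<omega> by blast
 have bl: "bounded_linear (mulop (damped \<omega>))" "bounded_linear (mulop \<tau>)"
  by (fact clinear_map_bounded_linear[OF clinear_map_mulop[OF B]] clinear_map_bounded_linear[OF clinear_map_mulop[OF bdd_\<tau>]])+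
 have f: "bounded_linear (\<lambda>G::l2 \<times> l2 \<times> l2. fst (snd G))" "bounded_linear (\<lambda>G::l2 \<times> l2 \<times> l2. snd (snd G))"
  "bounded_linear (\<lambda>G::l2 \<times> l2 \<times> l2. fst G)" "bounded_linear (\<lambda>U. mulop \<tau> (snd (snd U::l2 \<times> l2))::l2)"
  by (intro bounded_linear_compose[OF bounded_linear_fst] bounded_linear_compose[OF bounded_linear_snd] bounded_linear_snd bounded_linear_fst
   bounded_linear_compose[OF bl(2)])+
 have g: "bounded_linear (\<lambda>G::l2 \<times> l2 \<times> l2. mulop (damped \<omega>) (fst G + snd (snd G)))" by (intro bounded_linear_compose[OF bl(1)] bounded_linear_add f)
 note ii = bounded_bilinear.comp[OF bounded_bilinear_inner]
 have add: "bounded_bilinear (\<lambda>x y. b x y + d x y)" if "bounded_bilinear b" "bounded_bilinear d"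
  for b d :: "l2 \<times> l2 \<times> l2\<Rightarrow>l2 \<times> l2 \<times> l2\<Rightarrow>real"
 proof -
  interpret b: bounded_bilinear b by fact
  interpret d: bounded_bilinear d by fact
  obtain Kb Kd where K: "\<And>x y. norm (b x y)\<le>norm x * norm y * Kb" "\<And>x y. norm (d x y)\<le>norm x * norm y * Kd" using b.bounded d.bounded by blast
  show ?thesis
  proof
   show "\<exists>K. \<forall>x y. norm (b x y + d x y)\<le>norm x * norm y * K"
   proof (intro exI[of _ "Kb + Kd"] allI)
    fix x y
    have "norm (b x y + d x y)\<le>norm (b x y) + norm (d x y)" by (rule norm_triangle_ineq)
    also have "\<dots>\<le>norm x * norm y * Kb + norm x * norm y * Kd" by (intro add_mono K)
    finally show "norm (b x y + d x y)\<le>norm x * norm y * (Kb + Kd)" by (simp add: distrib_left)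
   qed
  qed (simp_all add: b.add_left b.add_right d.add_left d.add_right b.scaleR_left b.scaleR_right d.scaleR_left d.scaleR_right algebra_simps)
 qed
 have z: "bounded_bilinear (\<lambda>(U::l2 \<times> l2 \<times> l2) (G::l2 \<times> l2 \<times> l2). z * inner (fst U) (fst G))"
 proof -
  have "bounded_bilinear (\<lambda>(U::l2 \<times> l2 \<times> l2) (G::l2 \<times> l2 \<times> l2). inner (z *\<^sub>R fst U) (fst G))"
   by (rule ii[OF bounded_linear_compose[OF bounded_linear_scaleR_right f(3)] f(3)])
  thus ?thesis by (simp only: inner_scaleR_left)
 qed
 show ?thesis unfolding form_def[abs_def] by (intro add z ii f g)
qed

end

text \<open>\<open>u0\<close>, \<open>u1\<close>, \<open>u2\<close> stand for the norms of the three
  components. The cross terms in \<open>u1 * u2\<close> add up to \<open>3/2 * \<delta>\<close> and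
  are absorbed into \<open>u1\<^sup>2/2\<close> and a fraction of
  \<open>\<delta> * u2\<^sup>2\<close>, for which \<open>\<delta> \<le> 1/4\<close> leaves room; all
  multiples of \<open>u0\<^sup>2\<close> are paid by \<open>z\<close>.\<close>

lemma coercivity_arith:
 fixes u0 u1 u2 \<delta> C1 C2 C4 z :: real
 assumes nn: "u0\<ge>0" "u1\<ge>0" "u2\<ge>0" "0<\<delta>" "\<delta>\<le>1/4"
  and z: "z\<ge>2 * (\<delta> * C1 + 2 * C2)\<^sup>2 + \<delta> * C4 + 1"
 shows "\<delta>/4 * (u0\<^sup>2 + (u1\<^sup>2 + u2\<^sup>2)) \<le>
  u1\<^sup>2-\<delta> * (u1 * (u2 + C1 * u0))-u1 * (2 * (\<delta>/4 * u2 + C2 * u0))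
   + (\<delta> * u2\<^sup>2-\<delta> * (1/4 * u1\<^sup>2 + 1/4 * u2\<^sup>2 + C4 * u0\<^sup>2)) + z * u0\<^sup>2"
proof -
 define k where "k = \<delta> * C1 + 2 * C2"
 have a: "3/2 * \<delta> * (u1 * u2)\<le>u1\<^sup>2/2 + 9/8 * (\<delta>\<^sup>2 * u2\<^sup>2)"
  using zero_le_power2[of "u1-3/2 * \<delta> * u2"] by (simp add: power2_diff power_mult_distrib algebra_simps power2_eq_square)
 have "\<delta>\<^sup>2 * u2\<^sup>2\<le>(\<delta>/4) * u2\<^sup>2" using nn by (intro mult_right_mono) (auto simp: power2_eq_square)
 with a have a': "3/2 * \<delta> * (u1 * u2)\<le>u1\<^sup>2/2 + 9/32 * (\<delta> * u2\<^sup>2)" by simp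
 have b: "k * (u1 * u0)\<le>u1\<^sup>2/8 + 2 * (k\<^sup>2 * u0\<^sup>2)"
  using zero_le_power2[of "u1-4 * k * u0"] by (simp add: power2_diff power_mult_distrib algebra_simps power2_eq_square)
 have c: "(2 * k\<^sup>2 + \<delta> * C4 + 1) * u0\<^sup>2\<le>z * u0\<^sup>2" using z by (intro mult_right_mono) (auto simp: k_def)
 have d: "\<delta> * u1\<^sup>2\<le>1/4 * u1\<^sup>2" "\<delta> * u0\<^sup>2\<le>1/4 * u0\<^sup>2" by (rule mult_right_mono[OF nn(5)], simp)+
 have e: "\<delta> * u2\<^sup>2\<ge>0" "u1\<^sup>2\<ge>0" "u0\<^sup>2\<ge>0" using nn by auto
 have eq: "u1\<^sup>2-\<delta> * (u1 * (u2 + C1 * u0))-u1 * (2 * (\<delta>/4 * u2 + C2 * u0))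
   + (\<delta> * u2\<^sup>2-\<delta> * (1/4 * u1\<^sup>2 + 1/4 * u2\<^sup>2 + C4 * u0\<^sup>2)) + z * u0\<^sup>2
  = u1\<^sup>2-3/2 * \<delta> * (u1 * u2)-k * (u1 * u0) + 3/4 * (\<delta> * u2\<^sup>2)-1/4 * (\<delta> * u1\<^sup>2)-\<delta> * C4 * u0\<^sup>2 + z * u0\<^sup>2" by (simp add: k_def algebra_simps)
 have c': "2 * (k\<^sup>2 * u0\<^sup>2) + \<delta> * C4 * u0\<^sup>2 + u0\<^sup>2\<le>z * u0\<^sup>2" using c by (simp add: algebra_simps)
 have lhs: "\<delta>/4 * (u0\<^sup>2 + (u1\<^sup>2 + u2\<^sup>2)) = 1/4 * (\<delta> * u0\<^sup>2) + 1/4 * (\<delta> * u1\<^sup>2) + 1/4 * (\<delta> * u2\<^sup>2)" by (simp add: algebra_simps)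
 show ?thesis unfolding eq lhs using a' b c' d e by linarith
qed

context weighted_schroedinger
begin

lemma R_measurable [measurable]: "R\<in>borel_measurable lebesgue" by (rule locally_integrable_measurable[OF R(1)])

lemma integrable_R_test:
 assumes "\<phi>\<in>test_functions"
 shows "integrable lebesgue (\<lambda>x. R x * (cmod (rc x * \<phi> x))\<^sup>2)"
proof -
 obtain L where L: "smooth \<phi>" "\<And>x. \<phi> x\<noteq>0\<Longrightarrow>\<bar>x\<bar>\<le>L" using test_functionD[OF assms] by blast
 have cont: "continuous_on UNIV (\<lambda>x. (cmod (rc x * \<phi> x))\<^sup>2)" by (intro continuous_intros \<rho>_continuous smooth_continuous L)
 have supp: "\<bar>x\<bar>\<le>L" if "(cmod (rc x * \<phi> x))\<^sup>2\<noteq>0" for x using L(2)[of x] that by auto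
 obtain B where B: "\<And>x. norm ((cmod (rc x * \<phi> x))\<^sup>2)\<le>B" using continuous_bounded_support[OF cont supp] by blast
 show ?thesis by (rule integrable_locally_integrable_mult[OF R(1) continuous_lebesgue_measurable[OF cont] AE_I2[OF B] supp])
qed

lemma R_form_bound:
 assumes "\<epsilon>>0"
 shows "\<exists>C\<ge>0. \<forall>\<phi>\<in>test_functions. (LINT x|lebesgue. R x * (cmod (rc x * \<phi> x))\<^sup>2)
 \<le>\<epsilon> * (norm (fst (snd (D \<phi>))))\<^sup>2 + \<epsilon> * (norm (snd (snd (D \<phi>))))\<^sup>2 + C * (norm (fst (D \<phi>)))\<^sup>2"
proof -
 obtain C where C: "C\<ge>0" "\<And>f::real\<Rightarrow>complex. f\<in>test_functions \<Longrightarrow>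
   (normw w (\<lambda>x. sqrt (R x) *\<^sub>R f x))\<^sup>2\<le>\<epsilon> * (normw w (vderiv f))\<^sup>2
        + \<epsilon> * (normw w (\<lambda>x. sqrt (cmod (V x)) *\<^sub>R f x))\<^sup>2 + C * (normw w f)\<^sup>2" using R(4)[OF assms] by blast
 show ?thesis
 proof (intro exI[of _ C] conjI ballI C(1))
  fix \<phi> :: "real\<Rightarrow>complex" assume \<phi>: "\<phi>\<in>test_functions"
  have AEeq: "AE x in lebesgue. R x * (cmod (rc x * \<phi> x))\<^sup>2 = (cmod (sqrt (R x) *\<^sub>R \<phi> x))\<^sup>2 * w x"
   using R(2) by eventually_elim (simp add: norm_mult power_mult_distrib w_eq)
  have [measurable]: "\<phi>\<in>borel_measurable lebesgue" by (rule test_function_measurable[OF \<phi>])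
  have [measurable]: "w\<in>borel_measurable lebesgue" by (rule continuous_lebesgue_measurable[OF smooth_continuous[OF smooth_w]])
  have "(LINT x|lebesgue. R x * (cmod (rc x * \<phi> x))\<^sup>2) = (LINT x|lebesgue. (cmod (sqrt (R x) *\<^sub>R \<phi> x))\<^sup>2 * w x)"
   by (rule Bochner_Integration.integral_cong_AE) (use AEeq in measurable)
  also have "\<dots> = (normw w (\<lambda>x. sqrt (R x) *\<^sub>R \<phi> x))\<^sup>2" unfolding normw_def by (intro real_sqrt_pow2[symmetric] Bochner_Integration.integral_nonneg) (simp add: w_eq)
  also have "\<dots>\<le>\<epsilon> * (normw w (vderiv \<phi>))\<^sup>2 + \<epsilon> * (normw w (\<lambda>x. sqrt (cmod (V x)) *\<^sub>R \<phi> x))\<^sup>2 + C * (normw w \<phi>)\<^sup>2" by (rule C(2)[OF \<phi>])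
  also have "(\<lambda>x. sqrt (cmod (V x)) *\<^sub>R \<phi> x) = (\<lambda>x. sc x * \<phi> x)" by (simp add: \<sigma>_def scaleR_conv_of_real)
  finally show "(LINT x|lebesgue. R x * (cmod (rc x * \<phi> x))\<^sup>2)
   \<le>\<epsilon> * (norm (fst (snd (D \<phi>))))\<^sup>2 + \<epsilon> * (norm (snd (snd (D \<phi>))))\<^sup>2 + C * (norm (fst (D \<phi>)))\<^sup>2" by (simp add: normw_eq sq_int_triple \<phi> D_def triple_def)
 qed
qed

text \<open>The real part equals \<open>Re v + \<delta> * (p * Im v)\<close>: the multiplier makes
  the imaginary part of the potential visible with a favourable sign, up to \<open>r\<close>. As
  \<delta> \<le> 1, a multiple \<delta> of \<open>Re v\<close> is at hand too, and the moduli of the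
  two parts together dominate \<open>cmod v\<close>.\<close>

lemma Re_V_mult_cnj_m:
 assumes "0\<le>\<delta>" "\<delta>\<le>1" "Re v\<ge>0" "p * Im v\<ge>\<bar>Im v\<bar>-r"
 shows "Re (v * cnj (1 + \<i> * complex_of_real (\<delta> * p)))\<ge>\<delta> * cmod v-\<delta> * r"
proof -
 have "Re (v * cnj (1 + \<i> * complex_of_real (\<delta> * p))) = Re v + \<delta> * (p * Im v)" by (simp add: algebra_simps)
 moreover have "\<delta> * Re v\<le>Re v" using assms by (simp add: mult_left_le_one_le)
 moreover have "\<delta> * (\<bar>Im v\<bar>-r)\<le>\<delta> * (p * Im v)" using assms by (intro mult_left_mono)
 moreover have "\<delta> * cmod v\<le>\<delta> * (\<bar>Re v\<bar> + \<bar>Im v\<bar>)" using assms(1) cmod_le by (intro mult_left_mono) auto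
 ultimately show ?thesis using assms(3) by (simp add: algebra_simps)
qed

text \<open>The pointwise inequality integrated. It is stated on test functions because
  \<open>R\<close> is only locally integrable; the passage to the form domain is made once
  \<open>R\<close> has been absorbed.\<close>

lemma potential_form_bound:
 assumes \<phi>: "\<phi>\<in>test_functions" and \<delta>: "0\<le>\<delta>" "\<delta>\<le>1"
 shows "inner (mulop \<tau> (snd (snd (D \<phi>)))) (mulop (m\<^sub>\<Phi> \<delta>) (snd (snd (D \<phi>))))
  \<ge>\<delta> * (norm (snd (snd (D \<phi>))))\<^sup>2-\<delta> * (LINT x|lebesgue. R x * (cmod (rc x * \<phi> x))\<^sup>2)"
proof -
 define f where "f x = rc x * \<phi> x" for x
 define u2 where "u2 x = rc x * (sc x * \<phi> x)" for x
 define t where "t x = V x/of_real (cmod (V x))" for x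
 define m where "m x = 1 + \<i> * complex_of_real (\<delta> * \<Phi> x)" for x
 have s2: "sq_int u2" unfolding u2_def by (rule sq_int_triple(3)[OF \<phi>])
 have D2: "snd (snd (D \<phi>)) = emb u2" by (simp add: D_def triple_def J_def u2_def[abs_def])
 have bt: "bdd_fun 1 t" unfolding t_def by (rule bdd_\<tau>)
 have bm: "bdd_fun 2 m" unfolding m_def by (rule bdd_m) (use \<delta> in simp)
 have st: "sq_int (\<lambda>x. t x * u2 x)" "sq_int (\<lambda>x. m x * u2 x)" by (rule sq_int_mult_bdd[OF bt s2], rule sq_int_mult_bdd[OF bm s2])
 have i: "integrable lebesgue (\<lambda>x. t x * u2 x * cnj (m x * u2 x))" by (rule integrable_mult_cnj_sq_int[OF st])
 have i2: "integrable lebesgue (\<lambda>x. (cmod (u2 x))\<^sup>2)" using s2 by (simp add: sq_int_def)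
 have iR: "integrable lebesgue (\<lambda>x. R x * (cmod (f x))\<^sup>2)" unfolding f_def by (rule integrable_R_test[OF \<phi>])
 have "\<delta> * (norm (emb u2))\<^sup>2-\<delta> * (LINT x|lebesgue. R x * (cmod (f x))\<^sup>2) =
  (LINT x|lebesgue. \<delta> * (cmod (u2 x))\<^sup>2-\<delta> * (R x * (cmod (f x))\<^sup>2))" using i2 iR by (simp add: norm_emb_sq[OF s2])
 also have "\<dots>\<le>(LINT x|lebesgue. Re (t x * u2 x * cnj (m x * u2 x)))"
 proof (rule integral_mono_AE)
  show "integrable lebesgue (\<lambda>x. \<delta> * (cmod (u2 x))\<^sup>2-\<delta> * (R x * (cmod (f x))\<^sup>2))"
   using i2 iR by (intro Bochner_Integration.integrable_diff integrable_mult_right) auto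
  show "integrable lebesgue (\<lambda>x. Re (t x * u2 x * cnj (m x * u2 x)))" by (rule integrable_Re[OF i])
  show "AE x in lebesgue. \<delta> * (cmod (u2 x))\<^sup>2-\<delta> * (R x * (cmod (f x))\<^sup>2)\<le>Re (t x * u2 x * cnj (m x * u2 x))" using ReV R(3)
  proof eventually_elim
   case (elim x)
   have u2: "u2 x = sc x * f x" by (simp add: u2_def f_def mult_ac)
   have tV: "t x * complex_of_real ((\<sigma> x)\<^sup>2) = V x" by (simp add: t_def \<sigma>_sq)
   have "t x * u2 x * cnj (m x * u2 x) = (t x * complex_of_real ((\<sigma> x)\<^sup>2)) * cnj (m x) * (f x * cnj (f x))" by (simp add: u2 power2_eq_square mult_ac)
   also have "\<dots> = (V x * cnj (m x)) * complex_of_real ((cmod (f x))\<^sup>2)" by (simp only: tV complex_norm_square)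
   finally have e: "t x * u2 x * cnj (m x * u2 x) = V x * cnj (m x) * complex_of_real ((cmod (f x))\<^sup>2)" .
   have Rr: "Re (a * complex_of_real r) = Re a * r" for a r by simp
   have "Re (t x * u2 x * cnj (m x * u2 x)) = Re (V x * cnj (m x)) * (cmod (f x))\<^sup>2" unfolding e by (rule Rr)
   moreover have "(\<delta> * cmod (V x)-\<delta> * R x) * (cmod (f x))\<^sup>2\<le>Re (V x * cnj (m x)) * (cmod (f x))\<^sup>2"
    unfolding m_def using Re_V_mult_cnj_m[OF \<delta> elim] by (rule mult_right_mono) simp
   moreover have "(cmod (u2 x))\<^sup>2 = cmod (V x) * (cmod (f x))\<^sup>2" unfolding u2 norm_mult norm_of_real power_mult_distrib power2_abs \<sigma>_sq ..
   ultimately show ?case by (simp add: algebra_simps)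
  qed
 qed
 also have "\<dots> = Re (LINT x|lebesgue. t x * u2 x * cnj (m x * u2 x))" by (rule integral_Re[OF i])
 also have "\<dots> = Re (cinner (emb (\<lambda>x. t x * u2 x)) (emb (\<lambda>x. m x * u2 x)))" by (simp only: cinner_emb[OF st])
 also have "\<dots> = inner (mulop t (emb u2)) (mulop m (emb u2))" by (simp add: mulop_emb[OF bt s2] mulop_emb[OF bm s2])
 finally show ?thesis unfolding D2 f_def t_def[abs_def] m_def[abs_def] .
qed

text \<open>The relative bounds are chosen according to whether a term already carries the factor
  \<delta>: for the derivative of \<Phi> the constant 1 is enough and for \<open>R\<close> the
  constant \<open>1/4\<close>, both being multiplied by \<delta>, whereas for \<omega> it has to be
  \<open>\<delta>/4\<close>. The threshold \<open>Z\<close> collects the constants of the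
  zeroth-order terms.\<close>

lemma form_coercive:
 assumes \<delta>: "0<\<delta>" "\<delta>\<le>1/4"
 shows "\<exists>Z>0. \<forall>U\<in>form_domain. \<forall>z\<ge>Z. \<delta>/4 * (norm U)\<^sup>2\<le>form z U (M \<delta> U)"
proof -
 have d1: "\<bar>\<delta>\<bar>\<le>1" using \<delta> by simp
 note mc = M_components[OF d1]
 obtain C1 where C1: "C1\<ge>0" "AE x in lebesgue. \<bar>\<Phi>' x\<bar>\<le>1 * \<sigma> x + C1" using \<Phi>'_bound[of 1] by auto
 obtain C2 where C2: "C2\<ge>0" "AE x in lebesgue. \<bar>\<omega> x\<bar>\<le>\<delta>/4 * \<sigma> x + C2" using \<omega>_bound[of "\<delta>/4"] \<delta> by auto
 obtain C4 where C4: "C4\<ge>0" "\<And>\<phi>. \<phi>\<in>test_functions\<Longrightarrow>(LINT x|lebesgue. R x * (cmod (rc x * \<phi> x))\<^sup>2)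
 \<le>1/4 * (norm (fst (snd (D \<phi>))))\<^sup>2 + 1/4 * (norm (snd (snd (D \<phi>))))\<^sup>2 + C4 * (norm (fst (D \<phi>)))\<^sup>2" using R_form_bound[of "1/4"] by auto
 define Z where "Z = 2 * (\<delta> * C1 + 2 * C2)\<^sup>2 + \<delta> * C4 + 1"
 have Z: "Z>0" using \<delta> C4(1) by (simp add: Z_def add_nonneg_pos)
 show ?thesis
 proof (intro exI[of _ Z] conjI ballI allI impI Z)
  fix U z assume U: "U\<in>form_domain" and z: "z\<ge>Z"
  interpret form: bounded_bilinear "form z" by (rule bounded_bilinear_form)
  show "\<delta>/4 * (norm U)\<^sup>2\<le>form z U (M \<delta> U)" using U
  proof (rule form_domain_minimal)
   show "closed {U. \<delta>/4 * (norm U)\<^sup>2\<le>form z U (M \<delta> U)}"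
    by (intro closed_Collect_le continuous_intros form.continuous_on bounded_linear.continuous_on[OF clinear_map_bounded_linear[OF clinear_map_M]])
   fix \<phi> :: "real\<Rightarrow>complex" assume \<phi>: "\<phi>\<in>test_functions"
   define U where "U = D \<phi>"
   have U: "U\<in>form_domain" unfolding U_def by (rule D_in_form_domain[OF \<phi>])
   define n0 n1 n2 where "n0 = norm (fst U)" "n1 = norm (fst (snd U))" "n2 = norm (snd (snd U))"
   have nn: "n0\<ge>0" "n1\<ge>0" "n2\<ge>0" by (simp_all add: n0_n1_n2_def)
   define p where "p = mulop (damped \<Phi>') (fst U + snd (snd U))"
   have p: "norm p\<le>n2 + C1 * n0" unfolding p_def n0_n1_n2_def using norm_mulop_form_domain[OF U \<Phi>'_measurable C1(2) _ C1(1)] by simp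
   \<comment> \<open>The part with \<Phi> itself is skew and contributes nothing to the diagonal;
     what remains is the term \<open>p\<close> from the derivative of \<Phi>.\<close>
   have "fst (snd (M \<delta> U)) = fst (snd U) + \<delta> *\<^sub>R (imul (mulop \<Phi>c (fst (snd U))) + imul p)" by (simp add: M_def PH_def p_def imul_add)
   hence "inner (fst (snd U)) (fst (snd (M \<delta> U))) = n1\<^sup>2 + \<delta> * inner (fst (snd U)) (imul p)"
    using inner_imul_mulop_real[OF bdd_\<Phi>] by (simp add: inner_add_right n0_n1_n2_def power2_norm_eq_inner)
   moreover have "inner (fst (snd U)) (imul p)\<ge>- (n1 * (n2 + C1 * n0))"
   proof -
    have "\<bar>inner (fst (snd U)) (imul p)\<bar>\<le>n1 * norm p" using Cauchy_Schwarz_ineq2[of "fst (snd U)" "imul p"] by (simp add: n0_n1_n2_def)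
    also have "\<dots>\<le>n1 * (n2 + C1 * n0)" using p nn by (intro mult_left_mono)
    finally show ?thesis by linarith
   qed
   hence "\<delta> * inner (fst (snd U)) (imul p)\<ge>\<delta> *-(n1 * (n2 + C1 * n0))" using \<delta> by (intro mult_left_mono) auto
   ultimately have i1: "inner (fst (snd U)) (fst (snd (M \<delta> U)))\<ge>n1\<^sup>2-\<delta> * (n1 * (n2 + C1 * n0))" by simp
   define G where "G = M \<delta> U"
   have G: "G\<in>form_domain" unfolding G_def by (rule M_form_domain[OF U])
   have G02: "norm (fst G)\<le>2 * n0" "norm (snd (snd G))\<le>2 * n2" unfolding G_def mc n0_n1_n2_def by (rule norm_mulop_le[OF bdd_m[OF d1]])+
   have i2: "inner (fst (snd U)) (mulop (damped \<omega>) (fst G + snd (snd G)))\<ge>- (n1 * (2 * (\<delta>/4 * n2 + C2 * n0)))"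
   proof -
    have "norm (mulop (damped \<omega>) (fst G + snd (snd G)))\<le>\<delta>/4 * norm (snd (snd G)) + C2 * norm (fst G)"
     by (rule norm_mulop_form_domain[OF G \<omega>_measurable C2(2) _ C2(1)]) (use \<delta> in simp)
    also have "\<dots>\<le>\<delta>/4 * (2 * n2) + C2 * (2 * n0)" using \<delta> C2(1) by (intro add_mono mult_left_mono G02) auto
    finally have "norm (mulop (damped \<omega>) (fst G + snd (snd G)))\<le>2 * (\<delta>/4 * n2 + C2 * n0)" by simp
    hence "n1 * norm (mulop (damped \<omega>) (fst G + snd (snd G)))\<le>n1 * (2 * (\<delta>/4 * n2 + C2 * n0))" using nn by (intro mult_left_mono)
    thus ?thesis using Cauchy_Schwarz_ineq2[of "fst (snd U)" "mulop (damped \<omega>) (fst G + snd (snd G))"] unfolding n0_n1_n2_def by linarith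
   qed
   have i3: "inner (mulop \<tau> (snd (snd U))) (snd (snd G))
   \<ge>\<delta> * n2\<^sup>2-\<delta> * (1/4 * n1\<^sup>2 + 1/4 * n2\<^sup>2 + C4 * n0\<^sup>2)"
   proof -
    have "\<delta> * (LINT x|lebesgue. R x * (cmod (rc x * \<phi> x))\<^sup>2)\<le>\<delta> * (1/4 * n1\<^sup>2 + 1/4 * n2\<^sup>2 + C4 * n0\<^sup>2)"
     unfolding n0_n1_n2_def U_def using \<delta> by (intro mult_left_mono C4(2) \<phi>) auto
    thus ?thesis using potential_form_bound[OF \<phi>, of \<delta>] \<delta> unfolding G_def mc n0_n1_n2_def U_def by linarith
   qed
   have i0: "inner (fst U) (fst G) = n0\<^sup>2" using inner_imul_mulop_real[OF bdd_\<Phi>] by (simp add: G_def M_def PH_def inner_add_right n0_n1_n2_def power2_norm_eq_inner)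
   have "form z U G\<ge>n1\<^sup>2-\<delta> * (n1 * (n2 + C1 * n0))-n1 * (2 * (\<delta>/4 * n2 + C2 * n0))
    + (\<delta> * n2\<^sup>2-\<delta> * (1/4 * n1\<^sup>2 + 1/4 * n2\<^sup>2 + C4 * n0\<^sup>2)) + z * n0\<^sup>2" unfolding form_def i0 using i1 i2 i3 by (simp add: G_def)
   moreover have "(norm U)\<^sup>2 = n0\<^sup>2 + (n1\<^sup>2 + n2\<^sup>2)" by (simp add: norm_triple_sq n0_n1_n2_def)
   ultimately show "\<delta>/4 * (norm (D \<phi>))\<^sup>2\<le>form z (D \<phi>) (M \<delta> (D \<phi>))" using coercivity_arith[OF nn \<delta> z[unfolded Z_def]] unfolding U_def[symmetric] G_def by simp
  qed
 qed
qed

lemma form_imul: "form z (imul U) (imul G) = form z U G"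
proof -
 obtain B where B: "bdd_fun B (damped \<omega>)" using ex_bdd_\<omega> by blast
 show ?thesis unfolding form_def fst_imul snd_imul imul_add[symmetric] clinear_map_imul[OF clinear_map_mulop[OF B]] clinear_map_imul[OF clinear_map_mulop[OF bdd_\<tau>]]
  by simp
qed

end

section \<open>The resolvent by Lax-Milgram\<close>

text \<open>\<open>\<delta>_PH\<close> keeps \<open>M \<delta>\<close> within 1/2 of the identity,
  which makes it invertible on the form domain; \<open>coercive\<close> is coercivity against
  \<open>M \<delta> U\<close> at one fixed shift \<open>z\<close>.\<close>

locale coercive_form = weighted_schroedinger +
 fixes \<delta> z :: real
 assumes \<delta>: "0<\<delta>" "\<delta>\<le>1/4" and \<delta>_PH: "\<And>U. \<delta> * norm (PH U)\<le>norm U/2"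
  and z: "0<z" and coercive: "\<And>U. U\<in>form_domain\<Longrightarrow>\<delta>/4 * (norm U)\<^sup>2\<le>form z U (M \<delta> U)"
begin

sublocale form: bounded_bilinear "form z" by (rule bounded_bilinear_form)

lemma norm_M_le: "norm (M \<delta> U)\<le>2 * norm U"
proof -
 have "norm (M \<delta> U)\<le>norm U + \<delta> * norm (PH U)" using norm_triangle_ineq[of U "\<delta> *\<^sub>R imul (PH U)"] \<delta> by (simp add: M_def)
 thus ?thesis using \<delta>_PH[of U] norm_ge_zero[of U] by linarith
qed

text \<open>Being within 1/2 of the identity, \<open>M \<delta>\<close> makes the inner product
  \<open>inner (M \<delta> U) G\<close> coercive, and Lax-Milgram inverts it inside the form domain.
  Test vectors of the form \<open>M \<delta> G\<close> thus run through the whole form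
  domain.\<close>

lemma M_surj_on:
 assumes F: "F\<in>form_domain"
 shows "\<exists>U\<in>form_domain. M \<delta> U = F"
proof -
 have bb: "bounded_bilinear (\<lambda>U G. inner (M \<delta> U) G)"
  by (rule bounded_bilinear.comp[OF bounded_bilinear_inner clinear_map_bounded_linear[OF clinear_map_M] bounded_linear_ident])
 have co: "inner (M \<delta> U) U\<ge>1/2 * (norm U)\<^sup>2" if "U\<in>form_domain" for U
 proof -
  have "\<bar>inner (imul (PH U)) U\<bar>\<le>norm (PH U) * norm U" using Cauchy_Schwarz_ineq2[of "imul (PH U)" U] by simp
  hence "\<delta> * \<bar>inner (imul (PH U)) U\<bar>\<le>(\<delta> * norm (PH U)) * norm U" using \<delta> by (simp add: mult_left_mono mult.assoc)
  also have "\<dots>\<le>(norm U/2) * norm U" by (intro mult_right_mono \<delta>_PH) simp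
  finally have "\<bar>\<delta> * inner (imul (PH U)) U\<bar>\<le>1/2 * (norm U)\<^sup>2" using \<delta> by (simp add: abs_mult power2_eq_square[of "norm U"])
  moreover have "inner (M \<delta> U) U = (norm U)\<^sup>2 + \<delta> * inner (imul (PH U)) U" by (simp add: M_def inner_add_left power2_norm_eq_inner)
  ultimately show ?thesis by linarith
 qed
 obtain U where U: "U\<in>form_domain" "\<And>G. G\<in>form_domain\<Longrightarrow>inner (M \<delta> U) G = inner F G"
  using Lax_Milgram_on_subspace[OF closed_form_domain subspace_form_domain bb _ co bounded_linear_inner_right[of F]] by auto
 have "M \<delta> U-F\<in>form_domain" by (intro subspace_diff subspace_form_domain M_form_domain U(1) F)
 from U(2)[OF this] have "inner (M \<delta> U-F) (M \<delta> U-F) = 0" by (simp add: inner_diff_left)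
 thus ?thesis using U(1) by auto
qed

lemma form_eq_imp_eq:
 assumes U: "U\<in>form_domain" "U'\<in>form_domain" and eq: "\<And>G. G\<in>form_domain\<Longrightarrow>form z U G = form z U' G"
 shows "U = U'"
proof -
 have d: "U-U'\<in>form_domain" by (intro subspace_diff subspace_form_domain U)
 have "form z (U-U') (M \<delta> (U-U')) = 0" using eq[OF M_form_domain[OF d]] by (simp add: form.diff_left)
 with coercive[OF d] \<delta> have "(norm (U-U'))\<^sup>2\<le>0" by (simp add: mult_le_0_iff)
 thus ?thesis by simp
qed

text \<open>The form is coercive only against twisted vectors, so Lax-Milgram is applied to
  \<open>form z U (M \<delta> G)\<close>; surjectivity of \<open>M \<delta>\<close> then removes the
  twist from the test vectors.\<close>

lemma sol_exists: "\<exists>U. U\<in>form_domain\<and>(\<forall>G\<in>form_domain. form z U G = inner y (fst G))"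
proof -
 have bb: "bounded_bilinear (\<lambda>U G. form z U (M \<delta> G))"
  by (rule bounded_bilinear.comp[OF bounded_bilinear_form bounded_linear_ident clinear_map_bounded_linear[OF clinear_map_M]])
 have bl: "bounded_linear (\<lambda>G. inner y (fst (M \<delta> G)))"
  by (rule bounded_linear_compose[OF bounded_linear_inner_right bounded_linear_compose[OF bounded_linear_fst clinear_map_bounded_linear[OF clinear_map_M]]])
 have "\<delta>/4>0" using \<delta> by simp
 from Lax_Milgram_on_subspace[OF closed_form_domain subspace_form_domain bb this coercive bl]
 obtain U where U: "U\<in>form_domain" "\<And>G. G\<in>form_domain\<Longrightarrow>form z U (M \<delta> G) = inner y (fst (M \<delta> G))" by blast
 have "form z U G = inner y (fst G)" if "G\<in>form_domain" for G using M_surj_on[OF that] U(2) by blast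
 thus ?thesis using U(1) by blast
qed

definition sol :: "l2\<Rightarrow>l2 \<times> l2 \<times> l2" where
 "sol y = (SOME U. U\<in>form_domain\<and>(\<forall>G\<in>form_domain. form z U G = inner y (fst G)))"

text \<open>The resolvent of the operator at the point \<open>- z\<close>, transported to
  \<open>l2\<close> by the unitary \<open>J\<close>.\<close>

definition K :: "l2\<Rightarrow>l2" where "K y = fst (sol y)"

lemma sol: "sol y\<in>form_domain" "G\<in>form_domain\<Longrightarrow>form z (sol y) G = inner y (fst G)" using someI_ex[OF sol_exists[of y]] unfolding sol_def by blast+

lemma sol_eqI:
 assumes "U\<in>form_domain" "\<And>G. G\<in>form_domain\<Longrightarrow>form z U G = inner y (fst G)"
 shows "sol y = U" by (rule form_eq_imp_eq[OF sol(1) assms(1)]) (simp add: sol(2) assms(2))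

lemma norm_sol_sq_le: "\<delta>/4 * (norm (sol y))\<^sup>2\<le>inner y (fst (M \<delta> (sol y)))"
 using coercive[OF sol(1), of y] sol(2)[OF M_form_domain[OF sol(1)[of y], of \<delta>], of y] by simp

lemma norm_sol_le: "norm (sol y)\<le>norm y * (8/\<delta>)"
proof (cases "sol y = 0")
 case False
 have "inner y (fst (M \<delta> (sol y)))\<le>norm y * norm (fst (M \<delta> (sol y)))" by (rule norm_cauchy_schwarz)
 also have "\<dots>\<le>norm y * (2 * norm (sol y))" using norm_fst_le[of "fst (M \<delta> (sol y))" "snd (M \<delta> (sol y))"] norm_M_le[of "sol y"] by (intro mult_left_mono) auto
 finally have "\<delta>/4 * norm (sol y) * norm (sol y)\<le>(2 * norm y) * norm (sol y)" using norm_sol_sq_le[of y] by (simp add: power2_eq_square[of "norm (sol y)"])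
 hence "\<delta>/4 * norm (sol y)\<le>2 * norm y" using False by simp
 thus ?thesis using \<delta> by (simp add: field_simps)
qed (use \<delta> in simp)

lemma clinear_map_sol: "clinear_map sol"
proof (rule clinear_mapI)
 show "bounded_linear sol"
 proof
  show "sol (y + y') = sol y + sol y'" for y y' by (rule sol_eqI) (auto intro!: subspace_add[OF subspace_form_domain] sol(1) simp: form.add_left sol(2) inner_add_left)
  show "sol (r *\<^sub>R y) = r *\<^sub>R sol y" for r y by (rule sol_eqI) (auto intro!: subspace_scale[OF subspace_form_domain] sol(1) simp: form.scaleR_left sol(2))
  show "\<exists>C. \<forall>y. norm (sol y)\<le>norm y * C" using norm_sol_le by blast
 qed
 fix y
 show "sol (imul y) = imul (sol y)"
 proof (rule sol_eqI)
  show "imul (sol y)\<in>form_domain" using csubspace_form_domain sol(1) by (simp add: csubspace_def)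
  fix G assume "G\<in>form_domain"
  hence G: "imul G\<in>form_domain" using csubspace_form_domain by (simp add: csubspace_def)
  \<comment> \<open>Invariance of the real form under \<open>imul\<close> in both arguments plays
    the part of sesquilinearity.\<close>
  have "form z (imul (sol y)) G =-form z (imul (sol y)) (imul (imul G))" by (simp add: form.minus_right)
  also have "\<dots> =-inner y (fst (imul G))" unfolding form_imul sol(2)[OF G] ..
  finally show "form z (imul (sol y)) G = inner (imul y) (fst G)" by (simp add: inner_imul_left)
 qed
qed

lemma clinear_map_K: "clinear_map K" unfolding K_def[abs_def] by (rule clinear_map_compose[OF clinear_map_fst clinear_map_sol])

text \<open>Coercivity with the test vector \<open>M \<delta> (sol y)\<close>, whose first component
  is the multiplier times \<open>K y\<close>. So \<open>K\<close>, twisted by a function close to 1,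
  has its numerical range in the right half-plane: the source of the sector bound.\<close>

lemma inner_K_M_nonneg: "inner y (mulop (m\<^sub>\<Phi> \<delta>) (K y))\<ge>0"
proof -
 have "\<bar>\<delta>\<bar>\<le>1" using \<delta> by simp
 from M_components(1)[OF this, of "sol y"] norm_sol_sq_le[of y] \<delta> show ?thesis
  by (metis (no_types, lifting) K_def divide_nonneg_pos less_imp_le mult_nonneg_nonneg order_trans zero_le_power2 zero_less_numeral)
qed

end

lemma integral_cong_AE_measurable:
 fixes f g :: "real\<Rightarrow>'a::{banach, second_countable_topology}"
 assumes f: "f\<in>borel_measurable lebesgue" and g: "g\<in>borel_measurable lebesgue" and eq: "AE x in lebesgue. f x = g x"
 shows "(LINT x|lebesgue. f x) = (LINT x|lebesgue. g x)" by (rule Bochner_Integration.integral_cong_AE[OF f g eq])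

section \<open>Identification with the distributional operator\<close>

context weighted_schroedinger
begin

lemma w_measurable [measurable]: "w\<in>borel_measurable lebesgue" by (rule continuous_lebesgue_measurable[OF smooth_continuous[OF smooth_w]])

lemma normw_cong_AE:
 fixes f g :: "real\<Rightarrow>complex"
 assumes [measurable]: "f\<in>borel_measurable lebesgue" "g\<in>borel_measurable lebesgue" and eq: "AE x in lebesgue. f x = g x"
 shows "normw w f = normw w g"
proof -
 have "(LINT x|lebesgue. (norm (f x))\<^sup>2 * w x) = (LINT x|lebesgue. (norm (g x))\<^sup>2 * w x)" by (rule integral_cong_AE_measurable) (use eq in \<open>measurable, auto\<close>)
 thus ?thesis by (simp add: normw_def)
qed

text \<open>\<open>wderiv\<close> is a choice, but weak derivatives are unique almost everywhere, so
  it may be replaced by the explicit one; the norm of \<open>Vw\<close> then becomes the product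
  norm of a difference of triples.\<close>

lemma norm_Vw_diff:
 assumes f: "weak_derivative f f'" "sq_int (\<lambda>x. rc x * f x)" "sq_int (\<lambda>x. rc x * f' x)" "sq_int (\<lambda>x. rc x * (sc x * f x))"
  and \<phi>: "\<phi>\<in>test_functions"
 shows "norm_Vw w V (\<lambda>x. f x-\<phi> x) = norm (D \<phi>-triple f f')"
proof -
 have wd: "weak_derivative (\<lambda>x. f x-\<phi> x) (\<lambda>x. f' x-vderiv \<phi> x)" by (rule weak_derivative_diff[OF f(1) weak_derivative_smooth[OF test_function_smooth[OF \<phi>]]])
 hence "weak_derivative (\<lambda>x. f x-\<phi> x) (wderiv (\<lambda>x. f x-\<phi> x))" by (simp only: wderiv_def someI[of "weak_derivative (\<lambda>x. f x-\<phi> x)"])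
 hence m: "wderiv (\<lambda>x. f x-\<phi> x)\<in>borel_measurable lebesgue" "(\<lambda>x. f' x-vderiv \<phi> x)\<in>borel_measurable lebesgue"
  using wd by (auto simp: weak_derivative_def locally_integrable_measurable)
 note s = sq_int_triple[OF \<phi>]
 have d: "rc x * (a-b) = rc x * a-rc x * b" for x a b by (rule right_diff_distrib)
 have "normw w (wderiv (\<lambda>x. f x-\<phi> x)) = normw w (\<lambda>x. f' x-vderiv \<phi> x)" by (rule normw_cong_AE[OF m AE_wderiv[OF wd]])
 also have "\<dots> = norm (J (\<lambda>x. f' x-vderiv \<phi> x))" by (rule normw_eq) (unfold d, intro sq_int_diff f s)
 also have "J (\<lambda>x. f' x-vderiv \<phi> x) = J f'-J (vderiv \<phi>)" by (intro J_diff f s)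
 finally have 1: "normw w (wderiv (\<lambda>x. f x-\<phi> x)) = norm (J (vderiv \<phi>)-J f')" by (simp add: norm_minus_commute)
 have "(\<lambda>x. sqrt (cmod (V x)) *\<^sub>R (f x-\<phi> x)) = (\<lambda>x. sc x * f x-sc x * \<phi> x)" by (simp add: \<sigma>_def scaleR_conv_of_real right_diff_distrib)
 moreover have "normw w (\<lambda>x. sc x * f x-sc x * \<phi> x) = norm (J (\<lambda>x. sc x * f x-sc x * \<phi> x))" by (rule normw_eq) (unfold d, intro sq_int_diff f s)
 moreover have "J (\<lambda>x. sc x * f x-sc x * \<phi> x) = J (\<lambda>x. sc x * f x)-J (\<lambda>x. sc x * \<phi> x)" by (intro J_diff f s)
 ultimately have 2: "normw w (\<lambda>x. sqrt (cmod (V x)) *\<^sub>R (f x-\<phi> x)) = norm (J (\<lambda>x. sc x * \<phi> x)-J (\<lambda>x. sc x * f x))" by (simp add: norm_minus_commute)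
 have "normw w (\<lambda>x. f x-\<phi> x) = norm (J (\<lambda>x. f x-\<phi> x))" by (rule normw_eq) (unfold d, intro sq_int_diff f s)
 also have "J (\<lambda>x. f x-\<phi> x) = J f-J \<phi>" by (intro J_diff f s)
 finally have 3: "normw w (\<lambda>x. f x-\<phi> x) = norm (J \<phi>-J f)" by (simp add: norm_minus_commute)
 have eq: "(norm_Vw w V (\<lambda>x. f x-\<phi> x))\<^sup>2 = (norm (D \<phi>-triple f f'))\<^sup>2" unfolding norm_Vw_def 1 2 3 norm_triple_sq by (simp add: D_def triple_def)
 show ?thesis by (rule power2_eq_imp_eq[OF eq _ norm_ge_zero]) (simp add: norm_Vw_def)
qed

text \<open>The middle component divided by \<rho> is a weak derivative of \<open>f\<close>, and the
  last one is \<sigma> times the first; so an element of the closure is again the triple of an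
  actual function.\<close>

lemma form_domain_triple:
 assumes U: "U\<in>form_domain" and f: "f\<in>borel_measurable lebesgue" "AE x in lebesgue. rc x * f x = rep (fst U) x"
 shows "\<exists>f'. weak_derivative f f'\<and>sq_int (\<lambda>x. rc x * f x)\<and>sq_int (\<lambda>x. rc x * f' x)\<and>sq_int (\<lambda>x. rc x * (sc x * f x))\<and>triple f f' = U"
proof -
 define f' where "f' x = rep (fst (snd U)) x/rc x" for x
 have rcf': "rc x * f' x = rep (fst (snd U)) x" for x by (simp add: f'_def)
 have f'm: "f'\<in>borel_measurable lebesgue" unfolding f'_def using borel_measurable_divide[OF rep_measurable] by measurable
 have "weak_derivative f f'"
 proof (rule weak_derivative_cong_AE[OF form_domain_weak_derivative[OF U] f(1) f'm])
  show "AE x in lebesgue. rep (fst U) x/rc x = f x" using f(2) by eventually_elim (simp add: field_simps)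
 qed (simp add: f'_def)
 moreover have s0: "sq_int (\<lambda>x. rc x * f x)" by (rule sq_int_cong_AE[OF sq_int_rep[of "fst U"]]) (use f in \<open>auto simp: eq_commute\<close>)
 moreover have s1: "sq_int (\<lambda>x. rc x * f' x)" by (simp add: rcf')
 moreover have eq2: "AE x in lebesgue. rep (snd (snd U)) x = rc x * (sc x * f x)" using form_domain_\<sigma>[OF U] f(2)
 proof eventually_elim
  case (elim x)
  show ?case unfolding elim(1) elim(2)[symmetric] by (rule mult.left_commute)
 qed
 moreover have s2: "sq_int (\<lambda>x. rc x * (sc x * f x))" by (rule sq_int_cong_AE[OF sq_int_rep eq2]) (use f(1) in measurable)
 moreover have "triple f f' = U"
 proof -
  have "J f = fst U" unfolding J_def emb_eq_iff[OF s0] by (rule f(2))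
  moreover have "J f' = fst (snd U)" unfolding J_def rcf' by simp
  moreover have "J (\<lambda>x. sc x * f x) = snd (snd U)" unfolding J_def emb_eq_iff[OF s2] using eq2 by eventually_elim simp
  ultimately show ?thesis by (simp add: triple_def prod_eq_iff)
 qed
 ultimately show ?thesis by blast
qed

lemma integrable_L2w_test:
 assumes k: "sq_int (\<lambda>x. rc x * k x)" and \<phi>: "\<phi>\<in>test_functions"
 shows "integrable lebesgue (\<lambda>x. k x * \<phi> x)"
proof -
 have "sq_int (\<lambda>x. 1/rc x * \<phi> x)" by (intro sq_int_test test_function_mult_left smooth_inverse_rc \<phi>)
 from integrable_mult_sq_int[OF k this] show ?thesis by (simp add: mult_ac)
qed

text \<open>Closure in the product space and closure in the norm of \<open>Vw\<close> agree because
  the two last components of a triple are determined by the first. The domain of the operator is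
  thereby expressed through \<open>form_domain\<close>.\<close>

lemma Vw0_iff: "f\<in>Vw0 w V\<longleftrightarrow>f\<in>L2w w\<and>(\<exists>U\<in>form_domain. fst U = J f)"
proof
 assume f: "f\<in>Vw0 w V"
 hence "f\<in>Vw w V" by (simp add: Vw0_def)
 then obtain f' where f': "f\<in>L2w w" "weak_derivative f f'" "(\<lambda>x. sqrt (cmod (V x)) * cmod (f x) + cmod (f' x))\<in>L2w w" unfolding Vw_def by blast
 have fm [measurable]: "f\<in>borel_measurable lebesgue" and s0: "sq_int (\<lambda>x. rc x * f x)" using f'(1) by (auto simp: L2w_iff)
 have f'm [measurable]: "f'\<in>borel_measurable lebesgue" using f'(2) by (auto simp: weak_derivative_def locally_integrable_measurable)
 \<comment> \<open>\<open>Vw\<close> asks for integrability of a sum of two moduli; \<open>h\<close>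
   dominates each summand and thus separates them.\<close>
 define h where "h x = complex_of_real (\<rho> x * (\<sigma> x * cmod (f x) + cmod (f' x)))" for x
 have hn: "cmod (h x) = \<rho> x * (\<sigma> x * cmod (f x) + cmod (f' x))" for x using \<rho>_pos[of x] \<sigma>_nonneg[of x] unfolding h_def norm_of_real by (simp add: add_nonneg_nonneg)
 have hs: "sq_int h" unfolding sq_int_def
 proof
  show "h\<in>borel_measurable lebesgue" unfolding h_def by measurable
  have "integrable lebesgue (\<lambda>x. (\<sigma> x * cmod (f x) + cmod (f' x))\<^sup>2 * w x)" using f'(3) unfolding L2w_def \<sigma>_def by simp
  thus "integrable lebesgue (\<lambda>x. (cmod (h x))\<^sup>2)" unfolding hn by (simp add: power_mult_distrib w_eq mult.commute)
 qed
 have le: "cmod (rc x * f' x)\<le>1 * cmod (h x)" "cmod (rc x * (sc x * f x))\<le>1 * cmod (h x)" for x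
  unfolding hn norm_mult norm_of_real using \<rho>_pos[of x] \<sigma>_nonneg[of x] by (simp_all add: mult_left_mono)
 have s1: "sq_int (\<lambda>x. rc x * f' x)" by (rule sq_int_dominated[OF _ hs AE_I2[OF le(1)]]) measurable
 have s2: "sq_int (\<lambda>x. rc x * (sc x * f x))" by (rule sq_int_dominated[OF _ hs AE_I2[OF le(2)]]) measurable
 have "triple f f'\<in>form_domain" unfolding form_domain_approx
 proof (intro allI impI)
  fix \<epsilon> :: real assume "\<epsilon>>0"
  with f obtain \<phi> where \<phi>: "\<phi>\<in>test_functions" "norm_Vw w V (\<lambda>x. f x-\<phi> x)<\<epsilon>" unfolding Vw0_def by blast
  show "\<exists>\<phi>\<in>test_functions. norm (D \<phi>-triple f f')<\<epsilon>" by (rule bexI[OF _ \<phi>(1)]) (use \<phi>(2) norm_Vw_diff[OF f'(2) s0 s1 s2 \<phi>(1)] in simp)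
 qed
 moreover have "fst (triple f f') = J f" by (simp add: triple_def)
 ultimately show "f\<in>L2w w\<and>(\<exists>U\<in>form_domain. fst U = J f)" using f'(1) by blast
next
 assume "f\<in>L2w w\<and>(\<exists>U\<in>form_domain. fst U = J f)"
 then obtain U where f: "f\<in>L2w w" and U: "U\<in>form_domain" "fst U = J f" by blast
 have fm [measurable]: "f\<in>borel_measurable lebesgue" and s0: "sq_int (\<lambda>x. rc x * f x)" using f by (auto simp: L2w_iff)
 have eq: "AE x in lebesgue. rc x * f x = rep (fst U) x" using U(2)[unfolded J_def] emb_eq_iff[OF s0, of "fst U"] by simp
 obtain f' where f': "weak_derivative f f'" "sq_int (\<lambda>x. rc x * f' x)" "sq_int (\<lambda>x. rc x * (sc x * f x))" "triple f f' = U"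
  using form_domain_triple[OF U(1) fm eq] by blast
 have [measurable]: "f'\<in>borel_measurable lebesgue" using f'(1) by (auto simp: weak_derivative_def locally_integrable_measurable)
 have "(\<lambda>x. sqrt (cmod (V x)) * cmod (f x) + cmod (f' x))\<in>L2w w" unfolding L2w_def
 proof (intro CollectI conjI)
  show "(\<lambda>x. sqrt (cmod (V x)) * cmod (f x) + cmod (f' x))\<in>borel_measurable lebesgue" by measurable
  have "sq_int (\<lambda>x. complex_of_real (cmod (rc x * (sc x * f x))) + complex_of_real (cmod (rc x * f' x)))" by (intro sq_int_add sq_int_norm f')
  moreover have "(cmod (complex_of_real (cmod (rc x * (sc x * f x))) + complex_of_real (cmod (rc x * f' x))))\<^sup>2
    = (norm (sqrt (cmod (V x)) * cmod (f x) + cmod (f' x)))\<^sup>2 * w x" for x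
  proof -
   have "cmod (rc x * (sc x * f x)) + cmod (rc x * f' x) = \<rho> x * (sqrt (cmod (V x)) * cmod (f x) + cmod (f' x))"
    using \<rho>_pos[of x] unfolding norm_mult norm_of_real by (simp add: \<sigma>_def algebra_simps)
   hence "(cmod (complex_of_real (cmod (rc x * (sc x * f x))) + complex_of_real (cmod (rc x * f' x))))\<^sup>2
     = (\<rho> x * (sqrt (cmod (V x)) * cmod (f x) + cmod (f' x)))\<^sup>2" unfolding of_real_add[symmetric] norm_of_real power2_abs by (rule arg_cong)
   thus ?thesis unfolding power_mult_distrib real_norm_def power2_abs w_eq by (simp only: mult.commute)
  qed
  ultimately show "integrable lebesgue (\<lambda>x. (norm (sqrt (cmod (V x)) * cmod (f x) + cmod (f' x)))\<^sup>2 * w x)" by (simp add: sq_int_def)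
 qed
 hence "f\<in>Vw w V" using f f'(1) unfolding Vw_def by blast
 moreover have "\<exists>\<phi>\<in>test_functions. norm_Vw w V (\<lambda>x. f x-\<phi> x)<\<epsilon>" if "\<epsilon>>0" for \<epsilon>
 proof -
  obtain \<phi> where \<phi>: "\<phi>\<in>test_functions" "norm (D \<phi>-U)<\<epsilon>" using U(1)[unfolded form_domain_approx] \<open>\<epsilon> > 0\<close> by blast
  show ?thesis by (rule bexI[OF _ \<phi>(1)]) (use \<phi>(2) norm_Vw_diff[OF f'(1) s0 f'(2,3) \<phi>(1)] f'(4) in simp)
 qed
 ultimately show "f\<in>Vw0 w V" unfolding Vw0_def by blast
qed

text \<open>With \<open>\<phi> = w \<psi>\<close>, the weighted form at \<open>\<psi>\<close> is the distribution \<open>- f'' + V f + z f\<close> at \<open>\<phi>\<close>.\<close>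

lemma form_D:
 assumes wd: "weak_derivative f f'" and s: "sq_int (\<lambda>x. rc x * f x)" "sq_int (\<lambda>x. rc x * f' x)" "sq_int (\<lambda>x. rc x * (sc x * f x))"
  and \<phi>: "\<phi>\<in>test_functions"
 defines "\<psi> \<equiv> \<lambda>x. cnj (\<phi> x)/of_real (w x)"
 shows "\<psi>\<in>test_functions"
  "form z (triple f f') (D \<psi>) =
    Re (- (LINT x|lebesgue. f x * vderiv (vderiv \<phi>) x) + (LINT x|lebesgue. V x * f x * \<phi> x) + of_real z * (LINT x|lebesgue. f x * \<phi> x))"
  "sq_int (\<lambda>x. rc x * h x)\<Longrightarrow>inner (J h) (J \<psi>) = Re (LINT x|lebesgue. h x * \<phi> x)"
proof -
 have siw: "smooth (\<lambda>x. complex_of_real (1/w x))" by (rule smooth_bounded_linear[OF bounded_linear_of_real smooth_inverse_w])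
 have "(\<lambda>x. complex_of_real (1/w x) * cnj (\<phi> x))\<in>test_functions" by (intro test_function_mult_left siw test_function_bounded_linear[OF bounded_linear_cnj] \<phi>)
 thus \<psi>: "\<psi>\<in>test_functions" by (simp add: \<psi>_def)
 have w0: "w x\<noteq>0" for x by (simp add: w_eq)
 have sw: "smooth (\<lambda>x. complex_of_real (w x))" by (rule smooth_bounded_linear[OF bounded_linear_of_real smooth_w])
 have cnj\<phi>: "(\<lambda>x. cnj (\<phi> x)) = (\<lambda>x. of_real (w x) * \<psi> x)" using w0 by (simp add: \<psi>_def)
 have vw: "vderiv (\<lambda>x. complex_of_real (w x)) = (\<lambda>x. of_real (\<omega> x * w x))"
  by (rule vderivI[rule_format]) (use w_deriv has_vector_derivative_of_real has_real_derivative_iff_has_vector_derivative in blast)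
 have "(\<lambda>x. cnj (vderiv \<phi> x)) = vderiv (\<lambda>x. of_real (w x) * \<psi> x)"
  unfolding cnj\<phi>[symmetric] by (rule vderiv_bounded_linear[OF bounded_linear_cnj test_function_smooth[OF \<phi>], symmetric])
 also have "\<dots> = (\<lambda>x. of_real (w x) * vderiv \<psi> x + of_real (\<omega> x * w x) * \<psi> x)" unfolding vderiv_mult[OF sw test_function_smooth[OF \<psi>]] vw ..
 \<comment> \<open>The derivative falling on the weight is the origin of the \<omega>-term of the
   form.\<close>
 finally have cnj\<phi>': "cnj (vderiv \<phi> x) = of_real (w x) * vderiv \<psi> x + of_real (\<omega> x * w x) * \<psi> x" for x by (rule fun_cong)
 have ww: "complex_of_real (w x) = rc x * rc x" for x by (simp add: w_eq power2_eq_square)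
 note t = sq_int_triple[OF \<psi>]
 show J\<psi>: "inner (J h) (J \<psi>) = Re (LINT x|lebesgue. h x * \<phi> x)" if h: "sq_int (\<lambda>x. rc x * h x)" for h
 proof -
  have "inner (J h) (J \<psi>) = Re (cinner (J h) (J \<psi>))" by simp
  also have "cinner (J h) (J \<psi>) = (LINT x|lebesgue. h x * \<phi> x)" unfolding J_def cinner_emb[OF h t(1)]
  proof (intro Bochner_Integration.integral_cong refl)
   fix x
   have "\<phi> x = cnj (of_real (w x) * \<psi> x)" using fun_cong[OF cnj\<phi>, of x] by (metis complex_cnj_cnj)
   thus "rc x * h x * cnj (rc x * \<psi> x) = h x * \<phi> x" by (simp add: ww mult_ac)
  qed
  finally show ?thesis .
 qed
 obtain B where B: "bdd_fun B (damped \<omega>)" using ex_bdd_\<omega> by blast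
 note m = mulop_over_one_plus_\<sigma>_test[OF B \<psi>]
 note s\<omega> = m(1) and \<omega>eq = m(2)
 have "inner (J f') (J (vderiv \<psi>)) + inner (J f') (J (\<lambda>x. of_real (\<omega> x) * \<psi> x)) = inner (J f') (J (\<lambda>x. vderiv \<psi> x + of_real (\<omega> x) * \<psi> x))"
  by (simp add: J_add[OF t(2) s\<omega>] inner_add_right)
 also have "\<dots> = Re (cinner (J f') (J (\<lambda>x. vderiv \<psi> x + of_real (\<omega> x) * \<psi> x)))" by simp
 also have "cinner (J f') (J (\<lambda>x. vderiv \<psi> x + of_real (\<omega> x) * \<psi> x)) = (LINT x|lebesgue. f' x * vderiv \<phi> x)"
 proof -
  have s': "sq_int (\<lambda>x. rc x * (vderiv \<psi> x + of_real (\<omega> x) * \<psi> x))" unfolding distrib_left by (rule sq_int_add[OF t(2) s\<omega>])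
  show ?thesis unfolding J_def cinner_emb[OF s(2) s']
  proof (intro Bochner_Integration.integral_cong refl)
   fix x
   have "vderiv \<phi> x = cnj (of_real (w x) * vderiv \<psi> x + of_real (\<omega> x * w x) * \<psi> x)" unfolding cnj\<phi>'[of x, symmetric] by simp
   thus "rc x * f' x * cnj (rc x * (vderiv \<psi> x + of_real (\<omega> x) * \<psi> x)) = f' x * vderiv \<phi> x" by (simp add: ww algebra_simps)
  qed
 qed
 also have "(LINT x|lebesgue. f' x * vderiv \<phi> x) =-(LINT x|lebesgue. f x * vderiv (vderiv \<phi>) x)" using wd test_function_vderiv[OF \<phi>] by (simp add: weak_derivative_def)
 finally have 1: "inner (J f') (J (vderiv \<psi>)) + inner (J f') (J (\<lambda>x. of_real (\<omega> x) * \<psi> x))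
   = Re (- (LINT x|lebesgue. f x * vderiv (vderiv \<phi>) x))" .
 have "inner (mulop \<tau> (J (\<lambda>x. sc x * f x))) (J (\<lambda>x. sc x * \<psi> x))
  = Re (cinner (mulop \<tau> (J (\<lambda>x. sc x * f x))) (J (\<lambda>x. sc x * \<psi> x)))" by simp
 also have "cinner (mulop \<tau> (J (\<lambda>x. sc x * f x))) (J (\<lambda>x. sc x * \<psi> x)) = (LINT x|lebesgue. V x * f x * \<phi> x)"
  unfolding J_def mulop_emb[OF bdd_\<tau> s(3)] cinner_emb[OF sq_int_mult_bdd[OF bdd_\<tau> s(3)] t(3)]
 proof (intro Bochner_Integration.integral_cong refl)
  fix x
  have p: "\<phi> x = cnj (of_real (w x) * \<psi> x)" using fun_cong[OF cnj\<phi>, of x] by (metis complex_cnj_cnj)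
  have tV: "V x/of_real (cmod (V x)) * (sc x * sc x) = V x"
  proof -
   have "sc x * sc x = complex_of_real (cmod (V x))" using \<sigma>_sq[of x] by (simp flip: of_real_mult add: power2_eq_square)
   thus ?thesis by simp
  qed
  have "V x/of_real (cmod (V x)) * (rc x * (sc x * f x)) * cnj (rc x * (sc x * \<psi> x))
   = (V x/of_real (cmod (V x)) * (sc x * sc x)) * f x * cnj ((rc x * rc x) * \<psi> x)" by (simp add: mult_ac)
  thus "V x/of_real (cmod (V x)) * (rc x * (sc x * f x)) * cnj (rc x * (sc x * \<psi> x)) = V x * f x * \<phi> x" unfolding tV p ww .
 qed
 finally have 2: "inner (mulop \<tau> (J (\<lambda>x. sc x * f x))) (J (\<lambda>x. sc x * \<psi> x)) = Re (LINT x|lebesgue. V x * f x * \<phi> x)" .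
 show "form z (triple f f') (D \<psi>) =
    Re (- (LINT x|lebesgue. f x * vderiv (vderiv \<phi>) x) + (LINT x|lebesgue. V x * f x * \<phi> x) + of_real z * (LINT x|lebesgue. f x * \<phi> x))"
  unfolding form_def triple_def D_def fst_conv snd_conv \<omega>eq 1 2 J\<psi>[OF s(1)] by simp
qed

end

context coercive_form
begin

text \<open>Since \<open>w\<close> is smooth and positive, \<open>\<psi> = cnj \<phi>/w\<close> is a
  bijection of the test functions, so the variational equation tested on the form domain and the
  equation of distributions say the same. This is the link through which the unbounded operator is
  replaced by \<open>K\<close>.\<close>

lemma op_shift_iff:
 "(f, h)\<in>op_shift (schroedinger_op w V) (- of_real z)\<longleftrightarrow>f\<in>L2w w\<and>h\<in>L2w w\<and>J f = K (J h)"
proof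
 assume "(f, h)\<in>op_shift (schroedinger_op w V) (- of_real z)"
 then obtain g where h: "h = (\<lambda>x. g x + of_real z * f x)" and fg: "f\<in>Vw0 w V" "g\<in>L2w w" "schroedinger_eq V f g" unfolding op_shift_def schroedinger_op_def by auto
 from fg(1) obtain U where f: "f\<in>L2w w" and U: "U\<in>form_domain" "fst U = J f" unfolding Vw0_iff by blast
 have fm [measurable]: "f\<in>borel_measurable lebesgue" and s0: "sq_int (\<lambda>x. rc x * f x)" using f by (auto simp: L2w_iff)
 have gm [measurable]: "g\<in>borel_measurable lebesgue" and sg: "sq_int (\<lambda>x. rc x * g x)" using fg(2) by (auto simp: L2w_iff)
 have sh: "sq_int (\<lambda>x. rc x * h x)" using sq_int_add[OF sg sq_int_mult_const[OF s0, of "of_real z"]] by (simp add: h distrib_left mult.left_commute)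
 have hL: "h\<in>L2w w" unfolding L2w_iff by (intro conjI sh) (unfold h, measurable)
 have eq: "AE x in lebesgue. rc x * f x = rep (fst U) x" using U(2)[unfolded J_def] emb_eq_iff[OF s0, of "fst U"] by simp
 obtain f' where f': "weak_derivative f f'" "sq_int (\<lambda>x. rc x * f' x)" "sq_int (\<lambda>x. rc x * (sc x * f x))" "triple f f' = U"
  using form_domain_triple[OF U(1) fm eq] by blast
 have "sol (J h) = U"
 proof (rule sol_eqI[OF U(1)])
  fix G assume "G\<in>form_domain"
  thus "form z U G = inner (J h) (fst G)"
  proof (rule form_domain_minimal)
   show "closed {G. form z U G = inner (J h) (fst G)}" by (intro closed_Collect_eq continuous_intros form.continuous_on)
   fix \<psi> :: "real\<Rightarrow>complex" assume \<psi>: "\<psi>\<in>test_functions"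
   \<comment> \<open>Chosen so that the test function which the form attaches to \<phi> is
     \<psi>.\<close>
   define \<phi> where "\<phi> x = cnj (of_real (w x) * \<psi> x)" for x
   have \<phi>: "\<phi>\<in>test_functions" unfolding \<phi>_def
    by (intro test_function_bounded_linear[OF bounded_linear_cnj] test_function_mult_left smooth_bounded_linear[OF bounded_linear_of_real smooth_w] \<psi>)
   have w0: "w x\<noteq>0" for x by (simp add: w_eq)
   have e: "(\<lambda>x. cnj (\<phi> x)/of_real (w x)) = \<psi>" using w0 by (simp add: \<phi>_def)
   note fd = form_D(2,3)[OF f'(1) s0 f'(2,3) \<phi>, unfolded e f'(4)]
   have "(LINT x|lebesgue. h x * \<phi> x) = (LINT x|lebesgue. g x * \<phi> x) + of_real z * (LINT x|lebesgue. f x * \<phi> x)"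
   proof -
    have "(LINT x|lebesgue. h x * \<phi> x) = (LINT x|lebesgue. g x * \<phi> x + of_real z * (f x * \<phi> x))" by (simp add: h algebra_simps)
    also have "\<dots> = (LINT x|lebesgue. g x * \<phi> x) + (LINT x|lebesgue. of_real z * (f x * \<phi> x))"
     by (intro Bochner_Integration.integral_add integrable_L2w_test sg integrable_mult_right s0 \<phi>)
    finally show ?thesis by simp
   qed
   moreover have "- (LINT x|lebesgue. f x * vderiv (vderiv \<phi>) x) + (LINT x|lebesgue. V x * f x * \<phi> x) = (LINT x|lebesgue. g x * \<phi> x)"
    using fg(3) \<phi> by (simp add: schroedinger_eq_def)
   ultimately have "form z U (D \<psi>) = inner (J h) (J \<psi>)" unfolding fd(1) fd(2)[OF sh] by simp
   thus "form z U (D \<psi>) = inner (J h) (fst (D \<psi>))" by (simp add: D_def triple_def)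
  qed
 qed
 thus "f\<in>L2w w\<and>h\<in>L2w w\<and>J f = K (J h)" using f hL U(2) by (simp add: K_def)
next
 assume "f\<in>L2w w\<and>h\<in>L2w w\<and>J f = K (J h)"
 hence f: "f\<in>L2w w" and h: "h\<in>L2w w" and Jf: "J f = K (J h)" by auto
 define U where "U = sol (J h)"
 have U: "U\<in>form_domain" "fst U = J f" unfolding U_def Jf by (simp_all add: sol(1) K_def)
 define g where "g x = h x-of_real z * f x" for x
 have fm [measurable]: "f\<in>borel_measurable lebesgue" and s0: "sq_int (\<lambda>x. rc x * f x)" using f by (auto simp: L2w_iff)
 have hm [measurable]: "h\<in>borel_measurable lebesgue" and sh: "sq_int (\<lambda>x. rc x * h x)" using h by (auto simp: L2w_iff)
 have eq: "AE x in lebesgue. rc x * f x = rep (fst U) x" using U(2)[unfolded J_def] emb_eq_iff[OF s0, of "fst U"] by simp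
 obtain f' where f': "weak_derivative f f'" "sq_int (\<lambda>x. rc x * f' x)" "sq_int (\<lambda>x. rc x * (sc x * f x))" "triple f f' = U"
  using form_domain_triple[OF U(1) fm eq] by blast
 have gL: "g\<in>L2w w" unfolding L2w_iff
 proof
  show "g\<in>borel_measurable lebesgue" unfolding g_def by measurable
  show "sq_int (\<lambda>x. rc x * g x)" using sq_int_diff[OF sh sq_int_mult_const[OF s0, of "of_real z"]] by (simp add: g_def right_diff_distrib mult.left_commute)
 qed
 have fV: "f\<in>Vw0 w V" unfolding Vw0_iff using f U by blast
 define X where "X \<phi> =-(LINT x|lebesgue. f x * vderiv (vderiv \<phi>) x) + (LINT x|lebesgue. V x * f x * \<phi> x)
  + of_real z * (LINT x|lebesgue. f x * \<phi> x)-(LINT x|lebesgue. h x * \<phi> x)" for \<phi>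
 have ReX: "Re (X \<phi>) = 0" if \<phi>: "\<phi>\<in>test_functions" for \<phi>
 proof -
  note fd = form_D[OF f'(1) s0 f'(2,3) \<phi>, unfolded f'(4)]
  have "form z U (D (\<lambda>x. cnj (\<phi> x)/of_real (w x))) = inner (J h) (J (\<lambda>x. cnj (\<phi> x)/of_real (w x)))"
   unfolding U_def sol(2)[OF D_in_form_domain[OF fd(1)]] by (simp add: D_def triple_def)
  thus ?thesis unfolding fd(2) fd(3)[OF sh] X_def by simp
 qed
 \<comment> \<open>The form records real parts only; as \<open>X\<close> is complex linear in
   \<phi>, testing with \<i> \<phi> supplies the imaginary part.\<close>
 have X0: "X \<phi> = 0" if \<phi>: "\<phi>\<in>test_functions" for \<phi>
 proof (rule complex_eqI)
  show "Re (X \<phi>) = Re 0" using ReX[OF \<phi>] by simp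
  have vi: "vderiv (\<lambda>x. \<i> * k x) = (\<lambda>x. \<i> * vderiv k x)" if "k\<in>test_functions" for k
   by (rule vderiv_bounded_linear[OF bounded_linear_mult_right test_function_smooth[OF that]])
  have "X (\<lambda>x. \<i> * \<phi> x) = \<i> * X \<phi>"
  proof -
   have "vderiv (vderiv (\<lambda>x. \<i> * \<phi> x)) = (\<lambda>x. \<i> * vderiv (vderiv \<phi>) x)" unfolding vi[OF \<phi>] by (rule vi[OF test_function_vderiv[OF \<phi>]])
   moreover have "(LINT x|lebesgue. k x * (\<i> * l x)) = \<i> * (LINT x|lebesgue. k x * l x)" for k l :: "real\<Rightarrow>complex" by (simp add: mult.left_commute)
   ultimately show ?thesis unfolding X_def by (simp add: algebra_simps)
  qed
  with ReX[OF test_function_cmult[OF \<phi>, of \<i>]] have "Re (\<i> * X \<phi>) = 0" by simp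
  thus "Im (X \<phi>) = Im 0" by simp
 qed
 have "schroedinger_eq V f g" unfolding schroedinger_eq_def
 proof
  fix \<phi> :: "real\<Rightarrow>complex" assume \<phi>: "\<phi>\<in>test_functions"
  have "(LINT x|lebesgue. g x * \<phi> x) = (LINT x|lebesgue. h x * \<phi> x-of_real z * (f x * \<phi> x))" by (simp add: g_def algebra_simps)
  also have "\<dots> = (LINT x|lebesgue. h x * \<phi> x)-(LINT x|lebesgue. of_real z * (f x * \<phi> x))"
   by (intro Bochner_Integration.integral_diff integrable_L2w_test sh integrable_mult_right s0 \<phi>)
  finally have e: "(LINT x|lebesgue. g x * \<phi> x) = (LINT x|lebesgue. h x * \<phi> x)-of_real z * (LINT x|lebesgue. f x * \<phi> x)" by simp
  have gen: "a = e" if "a + t-d = 0" "e = d-t" for a t d e :: complex using that by (metis add_diff_cancel_right' eq_iff_diff_eq_0)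
  show "- (LINT x|lebesgue. f x * vderiv (vderiv \<phi>) x) + (LINT x|lebesgue. V x * f x * \<phi> x) = (LINT x|lebesgue. g x * \<phi> x)" by (rule gen[OF X0[OF \<phi>, unfolded X_def] e])
 qed
 hence "(f, g)\<in>schroedinger_op w V" using fV gL by (simp add: schroedinger_op_def)
 moreover have "h = (\<lambda>x. g x-(- of_real z) * f x)" by (simp add: g_def)
 ultimately show "(f, h)\<in>op_shift (schroedinger_op w V) (- of_real z)" unfolding op_shift_def by blast
qed

end

section \<open>Finite-dimensional approximation\<close>

lemma FTC_lebesgue:
 fixes v :: "real\<Rightarrow>complex"
 assumes v: "smooth v" and ab: "a\<le>b"
 shows "(LINT t|lebesgue. indicator {a..b} t *\<^sub>R vderiv v t) = v b-v a"
proof -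
 have cont: "continuous_on UNIV (vderiv v)" by (intro smooth_continuous smooth_vderiv v)
 have "has_bochner_integral lborel (\<lambda>x. indicator {a..b} x *\<^sub>R vderiv v x) (v b-v a)"
 proof (rule has_bochner_integral_FTC_Icc[OF ab])
  show "(v has_vector_derivative vderiv v x) (at x within {a..b})" for x by (rule has_vector_derivative_at_within[OF smooth_has_deriv[OF v]])
  show "continuous_on {a..b} (vderiv v)" by (rule continuous_on_subset[OF cont]) simp
 qed
 moreover have "(LINT t|lebesgue. indicator {a..b} t *\<^sub>R vderiv v t) = (LINT t|lborel. indicator {a..b} t *\<^sub>R vderiv v t)"
 proof (rule integral_completion)
  have [measurable]: "vderiv v\<in>borel_measurable borel" by (rule borel_measurable_continuous_onI[OF cont])
  show "(\<lambda>t. indicator {a..b} t *\<^sub>R vderiv v t)\<in>borel_measurable lborel" by measurable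
 qed
 ultimately show ?thesis by (simp add: has_bochner_integral_integral_eq)
qed

lemma borel_measurable_of_real_indicator:
 assumes "A\<in>sets M"
 shows "(\<lambda>t. complex_of_real (indicator A t))\<in>borel_measurable M"
proof -
 have "(\<lambda>t. complex_of_real (indicator A t)) = indicator A" by (auto simp: indicator_def)
 thus ?thesis using borel_measurable_indicator[OF assms] by simp
qed

text \<open>Cauchy-Schwarz against the indicator of the interval. The derivative stays localised, so
  that the energies of disjoint cells can be added up.\<close>

lemma point_diff_bound:
 fixes v :: "real\<Rightarrow>complex"
 assumes v: "smooth v" and ab: "a\<le>b"
 shows "(cmod (v b-v a))\<^sup>2\<le>(b-a) * (LINT t|lebesgue. indicator {a..b} t * (cmod (vderiv v t))\<^sup>2)"
proof -
 define i where "i t = complex_of_real (indicator {a..b} t)" for t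
 have i2: "(cmod (i t))\<^sup>2 = indicator {a..b} t" for t by (simp add: i_def indicator_def)
 have im: "i\<in>borel_measurable lebesgue" unfolding i_def[abs_def] by (rule borel_measurable_of_real_indicator) simp
 have si: "sq_int i" unfolding sq_int_def i2 using im integrable_indicator_compact[of "{a..b}"] by simp
 have vm: "vderiv v\<in>borel_measurable lebesgue" by (intro continuous_lebesgue_measurable smooth_continuous smooth_vderiv v)
 have iv2: "(cmod (i t * vderiv v t))\<^sup>2 = indicator {a..b} t * (cmod (vderiv v t))\<^sup>2" for t by (simp add: i_def indicator_def)
 have siv: "sq_int (\<lambda>t. i t * vderiv v t)"
 proof (rule sq_int_mult_continuous_bounded_support[of _ _ "\<bar>a\<bar> + \<bar>b\<bar>"])
  show "\<bar>x\<bar>\<le>\<bar>a\<bar> + \<bar>b\<bar>" if "i x * vderiv v x\<noteq>0" for x using that by (auto simp: i_def indicator_def split: if_splits)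
  show "locally_integrable (\<lambda>t. (cmod (i t))\<^sup>2)" unfolding locally_integrable_def set_integrable_def i2
   by (intro allI impI integrable_mult_indicator[unfolded real_scaleR_def] integrable_indicator_compact)
    (auto intro: fmeasurableD lmeasurable_compact)
 qed (intro im smooth_continuous smooth_vderiv v)+
 have "v b-v a = (LINT t|lebesgue. indicator {a..b} t *\<^sub>R vderiv v t)" by (rule FTC_lebesgue[OF v ab, symmetric])
 also have "\<dots> = (LINT t|lebesgue. i t * vderiv v t * cnj (i t))" by (intro Bochner_Integration.integral_cong) (auto simp: i_def indicator_def)
 also have "\<dots> = cinner (emb (\<lambda>t. i t * vderiv v t)) (emb i)" by (rule cinner_emb[OF siv si, symmetric])
 finally have "cmod (v b-v a)\<le>norm (emb (\<lambda>t. i t * vderiv v t)) * norm (emb i)" using norm_cinner_le by metis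
 hence "(cmod (v b-v a))\<^sup>2\<le>(norm (emb (\<lambda>t. i t * vderiv v t)) * norm (emb i))\<^sup>2" by (rule power_mono) simp
 also have "\<dots> = (b-a) * (LINT t|lebesgue. indicator {a..b} t * (cmod (vderiv v t))\<^sup>2)"
  unfolding power_mult_distrib norm_emb_sq[OF siv] norm_emb_sq[OF si] iv2 i2 using ab by simp
 finally show ?thesis .
qed

text \<open>Half-open cells of length 2 L/N, so that every point of \<open>{-L..<L}\<close> lies in
  exactly one of the first \<open>N\<close>.\<close>

definition cell :: "real\<Rightarrow>nat\<Rightarrow>nat\<Rightarrow>real set" where
 "cell L N i = {- L + real i * (2 * L/real N)..<- L + (real i + 1) * (2 * L/real N)}"

lemma indicator_cell:
 assumes "L>0" "N>0" "x\<in>{-L..<L}"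
 shows "\<exists>k<N. \<forall>i. indicator (cell L N i) x = (if i = k then 1 else 0::'a::zero_neq_one)"
proof -
 define h where "h = 2 * L/real N"
 have h: "h>0" using assms by (simp add: h_def)
 define t where "t = (x + L)/h"
 have "real N * h = 2 * L" using assms by (simp add: h_def)
 hence t: "0\<le>t" "t<real N" using assms(3) h by (auto simp: t_def divide_less_eq)
 have x: "x =-L + t * h" using h by (simp add: t_def)
 have in_cell: "x\<in>cell L N i\<longleftrightarrow>real i\<le>t\<and>t<real i + 1" for i unfolding cell_def h_def[symmetric] x using h by auto
 show ?thesis
 proof (intro exI conjI allI)
  show "nat \<lfloor>t\<rfloor><N" using t by linarith
  fix i
  have "x\<in>cell L N i\<longleftrightarrow>i = nat \<lfloor>t\<rfloor>" unfolding in_cell using t by linarith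
  thus "indicator (cell L N i) x = (if i = nat \<lfloor>t\<rfloor> then 1 else 0)" by (auto simp: indicator_def)
 qed
qed

lemma indicator_cell_outside:
 assumes "L>0" "i<N" "x\<notin>{-L..<L}"
 shows "indicator (cell L N i) x = 0"
proof -
 have "real i + 1\<le>real N" using assms by linarith
 hence "(real i + 1) * (2 * L/real N)\<le>real N * (2 * L/real N)" using assms by (intro mult_right_mono) auto
 also have "\<dots> = 2 * L" using assms by simp
 finally have "(real i + 1) * (2 * L/real N)\<le>2 * L" .
 moreover have "0\<le>real i * (2 * L/real N)" using assms by simp
 ultimately have "x\<notin>cell L N i" using assms(3) unfolding cell_def by auto
 thus ?thesis by simp
qed

lemma cell_lmeasurable: "cell L N i\<in>lmeasurable"
proof (rule bounded_set_imp_lmeasurable)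
 show "bounded (cell L N i)" unfolding cell_def by (rule bounded_subset[OF bounded_closed_interval]) (auto intro: less_imp_le)
qed (simp add: cell_def)

text \<open>\<open>y\<close> is orthogonal to the step function \<open>s\<close> that takes the
  value of \<open>v\<close> at the left endpoint of each cell, so \<open>v\<close> may be replaced
  by \<open>v - s\<close>. Inside the interval the error is at most the mesh times the norm of the
  derivative; outside, \<open>s\<close> vanishes and \<open>T\<close> bounds the tail.\<close>

lemma piecewise_constant_approx:
 assumes v: "smooth v" "sq_int v" "sq_int (vderiv v)" and L: "L>0" and N: "N>0" and T: "T\<ge>0"
  and tail: "(LINT x|lebesgue. indicator (- {-L..<L}) x * (cmod (v x))\<^sup>2)\<le>T\<^sup>2"
  and y: "\<And>i. i<N\<Longrightarrow>cinner y (emb (\<lambda>x. of_real (indicator (cell L N i) x))) = 0"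
 shows "cmod (cinner (emb v) y)\<le>(2 * L/real N * norm (emb (vderiv v)) + T) * norm y"
proof -
 define h where "h = 2 * L/real N"
 have h: "h>0" using L N by (simp add: h_def)
 define e where "e i x = complex_of_real (indicator (cell L N i) x)" for i x
 define a where "a i =-L + real i * h" for i
 have em [measurable]: "e i\<in>borel_measurable lebesgue" for i unfolding e_def[abs_def] by (rule borel_measurable_of_real_indicator) (simp add: cell_def)
 have ind_int: "integrable lebesgue (indicator (cell L N i)::real\<Rightarrow>real)" for i using cell_lmeasurable unfolding lmeasurable_iff_integrable .
 have e2: "(cmod (e i x))\<^sup>2 = indicator (cell L N i) x" for i x by (simp add: e_def indicator_def)
 have se: "sq_int (e i)" for i unfolding sq_int_def e2 using em ind_int by simp
 define s where "s x = (\<Sum>i<N. v (a i) * e i x)" for x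
 have sy: "cinner (emb s) y = 0" and ss: "sq_int s"
 proof -
  have "cinner (emb (\<lambda>x. \<Sum>i<n. v (a i) * e i x)) y = 0\<and>sq_int (\<lambda>x. \<Sum>i<n. v (a i) * e i x)" if "n\<le>N" for n using that
  proof (induction n)
   case 0
   thus ?case by (simp add: emb_zero sq_int_zero)
  next
   case (Suc n)
   have se': "sq_int (\<lambda>x. v (a n) * e n x)" by (rule sq_int_mult_const[OF se])
   have "cinner y (emb (e n)) = 0" using y[of n] Suc.prems by (simp add: e_def[abs_def])
   hence "cinner (emb (\<lambda>x. v (a n) * e n x)) y = 0" unfolding emb_cscale[OF se] by (simp add: cinner_eq_0_commute[of "emb (e n)"])
   thus ?case using Suc se' by (simp add: emb_add cinner_add_left sq_int_add)
  qed
  from this[of N] show "cinner (emb s) y = 0" "sq_int s" unfolding s_def[abs_def] by simp_all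
 qed
 define E where "E i = (LINT t|lebesgue. indicator (cell L N i) t * (cmod (vderiv v t))\<^sup>2)" for i
 have iv: "integrable lebesgue (\<lambda>t. indicator (cell L N i) t * (cmod (vderiv v t))\<^sup>2)" for i
  using integrable_mult_indicator[OF _ v(3)[unfolded sq_int_def, THEN conjunct2], of "cell L N i"] by (simp add: cell_def)
 have s_in: "(cmod (v x-s x))\<^sup>2\<le>h * (\<Sum>i<N. indicator (cell L N i) x * E i)" if x: "x\<in>{-L..<L}" for x
 proof -
  obtain k where k: "k<N" "\<And>i. indicator (cell L N i) x = (if i = k then 1 else 0::real)" using indicator_cell[OF L N x] by blast
  have xk: "x\<in>cell L N k" using k(2)[of k] by (simp add: indicator_eq_1_iff)
  hence ak: "a k\<le>x" "x-a k\<le>h" unfolding cell_def a_def h_def[symmetric] by (auto simp: distrib_right)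
  have "s x = v (a k)" unfolding s_def e_def k(2) using k(1) by (simp add: if_distrib[of of_real] if_distrib[of "\<lambda>z. _ * z"] cong: if_cong)
  moreover have "(\<Sum>i<N. indicator (cell L N i) x * E i) = E k" unfolding k(2) using k(1) by (simp add: if_distrib[of "\<lambda>z. z * _"] cong: if_cong)
  moreover have "(cmod (v x-v (a k)))\<^sup>2\<le>h * E k"
  proof -
   have "(cmod (v x-v (a k)))\<^sup>2\<le>(x-a k) * (LINT t|lebesgue. indicator {a k..x} t * (cmod (vderiv v t))\<^sup>2)" by (rule point_diff_bound[OF v(1) ak(1)])
   also have "\<dots>\<le>h * E k"
   proof (rule mult_mono[OF ak(2)])
    have sub: "{a k..x}\<subseteq>cell L N k" using xk unfolding cell_def a_def h_def by auto
    show "(LINT t|lebesgue. indicator {a k..x} t * (cmod (vderiv v t))\<^sup>2)\<le>E k" unfolding E_def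
    proof (rule integral_mono[OF _ iv])
     show "integrable lebesgue (\<lambda>t. indicator {a k..x} t * (cmod (vderiv v t))\<^sup>2)"
      using integrable_mult_indicator[OF _ v(3)[unfolded sq_int_def, THEN conjunct2], of "{a k..x}"] by simp
     show "indicator {a k..x} t * (cmod (vderiv v t))\<^sup>2\<le>indicator (cell L N k) t * (cmod (vderiv v t))\<^sup>2" for t
      using sub by (intro mult_right_mono) (auto simp: indicator_def)
    qed
    show "0\<le>(LINT t|lebesgue. indicator {a k..x} t * (cmod (vderiv v t))\<^sup>2)" by (intro Bochner_Integration.integral_nonneg) simp
   qed (use h in simp)
   finally show ?thesis .
  qed
  ultimately show ?thesis by simp
 qed
 have s_out: "s x = 0" if "x\<notin>{-L..<L}" for x unfolding s_def e_def using indicator_cell_outside[OF L _ that, where 'a = real] by simp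
 have E0: "E i\<ge>0" for i unfolding E_def by (intro Bochner_Integration.integral_nonneg) simp
 have it: "integrable lebesgue (\<lambda>x. indicator (- {-L..<L}) x * (cmod (v x))\<^sup>2)"
  using integrable_mult_indicator[OF _ v(2)[unfolded sq_int_def, THEN conjunct2], of "- {-L..<L}"] by simp
 have isum: "integrable lebesgue (\<lambda>x. h * (\<Sum>i<N. indicator (cell L N i) x * E i))"
  by (intro integrable_mult_right Bochner_Integration.integrable_sum integrable_mult_left ind_int)
 have svs: "sq_int (\<lambda>x. v x-s x)" by (rule sq_int_diff[OF v(2) ss])
 have "(norm (emb (\<lambda>x. v x-s x)))\<^sup>2 = (LINT x|lebesgue. (cmod (v x-s x))\<^sup>2)" by (rule norm_emb_sq[OF svs])
 also have "\<dots>\<le>(LINT x|lebesgue. h * (\<Sum>i<N. indicator (cell L N i) x * E i) + indicator (- {-L..<L}) x * (cmod (v x))\<^sup>2)"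
 proof (rule integral_mono)
  show "integrable lebesgue (\<lambda>x. (cmod (v x-s x))\<^sup>2)" using svs by (simp add: sq_int_def)
  show "integrable lebesgue (\<lambda>x. h * (\<Sum>i<N. indicator (cell L N i) x * E i) + indicator (- {-L..<L}) x * (cmod (v x))\<^sup>2)"
   by (rule Bochner_Integration.integrable_add[OF isum it])
  fix x
  have nn: "0\<le>h * (\<Sum>i<N. indicator (cell L N i) x * E i)" using h E0 by (intro mult_nonneg_nonneg sum_nonneg) auto
  show "(cmod (v x-s x))\<^sup>2\<le>h * (\<Sum>i<N. indicator (cell L N i) x * E i) + indicator (- {-L..<L}) x * (cmod (v x))\<^sup>2"
  proof (cases "x\<in>{-L..<L}")
   case True
   thus ?thesis using s_in[OF True] by (simp add: indicator_def)
  next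
   case False
   hence "indicator (- {-L..<L}) x = (1::real)" by (simp add: indicator_def)
   thus ?thesis using s_out[OF False] nn by simp
  qed
 qed
 also have "\<dots> = (LINT x|lebesgue. h * (\<Sum>i<N. indicator (cell L N i) x * E i)) + (LINT x|lebesgue. indicator (- {-L..<L}) x * (cmod (v x))\<^sup>2)"
  by (rule Bochner_Integration.integral_add[OF isum it])
 \<comment> \<open>One factor \<open>h\<close> stems from the pointwise bound, the other from the
   length of a cell.\<close>
 also have "(LINT x|lebesgue. h * (\<Sum>i<N. indicator (cell L N i) x * E i)) = h * (\<Sum>i<N. h * E i)"
 proof -
  have m: "(LINT x|lebesgue. indicator (cell L N i) x) = h" for i
  proof -
   have "-L + real i * h\<le>- L + (real i + 1) * h" using h by (simp add: algebra_simps)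
   hence "measure lebesgue (cell L N i) = h" unfolding cell_def h_def[symmetric] by (simp add: algebra_simps)
   thus ?thesis by simp
  qed
  have "(LINT x|lebesgue. h * (\<Sum>i<N. indicator (cell L N i) x * E i)) = h * (LINT x|lebesgue. (\<Sum>i<N. indicator (cell L N i) x * E i))" by simp
  also have "(LINT x|lebesgue. (\<Sum>i<N. indicator (cell L N i) x * E i)) = (\<Sum>i<N. LINT x|lebesgue. indicator (cell L N i) x * E i)"
   by (intro Bochner_Integration.integral_sum integrable_mult_left ind_int)
  also have "\<dots> = (\<Sum>i<N. h * E i)" by (simp only: integral_mult_left_zero m)
  finally show ?thesis .
 qed
 finally have le: "(norm (emb (\<lambda>x. v x-s x)))\<^sup>2\<le>h * (\<Sum>i<N. h * E i) + (LINT x|lebesgue. indicator (- {-L..<L}) x * (cmod (v x))\<^sup>2)" .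
 have "h * (\<Sum>i<N. h * E i)\<le>h * (h * (norm (emb (vderiv v)))\<^sup>2)"
 proof -
  have "(\<Sum>i<N. E i) = (LINT t|lebesgue. (\<Sum>i<N. indicator (cell L N i) t * (cmod (vderiv v t))\<^sup>2))"
   unfolding E_def by (intro Bochner_Integration.integral_sum[symmetric] iv)
  also have "\<dots>\<le>(LINT t|lebesgue. (cmod (vderiv v t))\<^sup>2)"
  proof (rule integral_mono)
   show "integrable lebesgue (\<lambda>t. \<Sum>i<N. indicator (cell L N i) t * (cmod (vderiv v t))\<^sup>2)" by (intro Bochner_Integration.integrable_sum iv)
   show "integrable lebesgue (\<lambda>t. (cmod (vderiv v t))\<^sup>2)" using v(3) by (simp add: sq_int_def)
   fix t
   show "(\<Sum>i<N. indicator (cell L N i) t * (cmod (vderiv v t))\<^sup>2)\<le>(cmod (vderiv v t))\<^sup>2"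
   proof (cases "t\<in>{-L..<L}")
    case True
    obtain k where k: "k<N" "\<And>i. indicator (cell L N i) t = (if i = k then 1 else 0::real)" using indicator_cell[OF L N True] by blast
    show ?thesis unfolding k(2) using k(1) by (simp add: if_distrib[of "\<lambda>z. z * _"] cong: if_cong)
   next
    case False
    show ?thesis using indicator_cell_outside[OF L _ False, where 'a = real] by simp
   qed
  qed
  also have "\<dots> = (norm (emb (vderiv v)))\<^sup>2" by (rule norm_emb_sq[OF v(3), symmetric])
  finally have "h * (h * (\<Sum>i<N. E i))\<le>h * (h * (norm (emb (vderiv v)))\<^sup>2)" using h by (intro mult_left_mono) auto
  thus ?thesis by (simp add: sum_distrib_left)
 qed
 with le tail have "(norm (emb (\<lambda>x. v x-s x)))\<^sup>2\<le>h * (h * (norm (emb (vderiv v)))\<^sup>2) + T\<^sup>2" by linarith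
 also have "\<dots>\<le>(h * norm (emb (vderiv v)) + T)\<^sup>2" using h T by (simp add: power2_sum power_mult_distrib power2_eq_square[of h] mult.assoc)
 finally have n: "norm (emb (\<lambda>x. v x-s x))\<le>h * norm (emb (vderiv v)) + T" by (rule power2_le_imp_le) (use h T in simp)
 have "cinner (emb v) y = cinner (emb (\<lambda>x. v x-s x)) y" unfolding emb_diff[OF v(2) ss] cinner_diff_left sy by simp
 hence "cmod (cinner (emb v) y)\<le>norm (emb (\<lambda>x. v x-s x)) * norm y" using norm_cinner_le by simp
 also have "\<dots>\<le>(h * norm (emb (vderiv v)) + T) * norm y" by (intro mult_right_mono n) simp
 finally show ?thesis by (simp add: h_def)
qed

section \<open>Compactness from smallness on subspaces of finite codimension\<close>

text \<open>Along a diagonal subsequence all approximating maps converge, and \<open>T\<close> is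
  close to one of them uniformly on bounded sets.\<close>

lemma compact_map_limit:
 fixes T :: "'a::real_normed_vector\<Rightarrow>'b::{real_normed_vector,complete_space}"
 assumes T: "bounded_linear T" and approx: "\<And>\<epsilon>. \<epsilon>>0\<Longrightarrow>\<exists>S. compact_map S\<and>(\<forall>x. norm (T x-S x)\<le>\<epsilon> * norm (x::'a))"
 shows "compact_map T" unfolding compact_map_def
proof (intro conjI T allI impI)
 fix x :: "nat\<Rightarrow>'a" assume "bounded (range x)"
 then obtain B where B: "B>0" "\<And>n. norm (x n)\<le>B" unfolding bounded_pos by auto
 have "\<exists>S. compact_map S\<and>(\<forall>x. norm (T x-S x)\<le>1/real (Suc n) * norm x)" for n by (rule approx) simp
 then obtain S where S: "\<And>n. compact_map (S n)" "\<And>n x. norm (T x-S n x)\<le>1/real (Suc n) * norm x" by metis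
 interpret subseqs "\<lambda>n s. convergent (\<lambda>k. S n (x (s k)))"
 proof
  fix n and s :: "nat\<Rightarrow>nat" assume "strict_mono s"
  have "bounded (range (\<lambda>k. x (s k)))" by (rule boundedI[of _ B]) (use B(2) in blast)
  with S(1)[of n] obtain l r where "strict_mono (r::nat\<Rightarrow>nat)" "(\<lambda>k. S n (x (s (r k))))\<longlonglongrightarrow>l" by (rule compact_mapD)
  thus "\<exists>r'. strict_mono r'\<and>convergent (\<lambda>k. S n (x ((s\<circ>r') k)))" unfolding convergent_def o_def by blast
 qed
 have conv: "convergent (\<lambda>k. S n (x (diagseq k)))" for n
 proof -
  have "convergent (\<lambda>k. S n (x ((diagseq\<circ>(+) (Suc n)) k)))"
  proof (rule diagseq_holds)
   fix n r s assume "strict_mono (r::nat\<Rightarrow>nat)" "convergent (\<lambda>k. S n (x (s k)))"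
   thus "convergent (\<lambda>k. S n (x ((s\<circ>r) k)))" using convergent_subseq_convergent[of "\<lambda>k. S n (x (s k))" r] by (simp add: o_def)
  qed
  hence "convergent (\<lambda>k. S n (x (diagseq (k + Suc n))))" by (simp add: add.commute)
  thus ?thesis by (rule convergent_ignore_initial_segment[THEN iffD1])
 qed
 have "Cauchy (\<lambda>k. T (x (diagseq k)))"
 proof (rule metric_CauchyI)
  fix e :: real assume e: "e>0"
  obtain n where n: "B/real (Suc n)<e/3"
  proof -
   obtain n where "B/(e/3)<real n" using reals_Archimedean2 by blast
   hence "B<e/3 * real n" using e by (simp add: divide_less_eq mult.commute)
   also have "\<dots>\<le>e/3 * real (Suc n)" using e by simp
   finally have "B/real (Suc n)<e/3" by (simp add: divide_less_eq mult.commute)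
   thus ?thesis using that by blast
  qed
  have Sn: "norm (T (x k)-S n (x k))<e/3" for k
  proof -
   have "norm (T (x k)-S n (x k))\<le>1/real (Suc n) * norm (x k)" by (rule S(2))
   also have "\<dots>\<le>1/real (Suc n) * B" by (intro mult_left_mono B(2)) simp
   also have "1/real (Suc n) * B = B/real (Suc n)" by simp
   also note n
   finally show ?thesis .
  qed
  obtain N where N: "\<And>k l. k\<ge>N\<Longrightarrow>l\<ge>N\<Longrightarrow>dist (S n (x (diagseq k))) (S n (x (diagseq l)))<e/3"
   using convergent_Cauchy[OF conv[of n]] e unfolding Cauchy_def by (metis divide_pos_pos zero_less_numeral)
  show "\<exists>N. \<forall>k\<ge>N. \<forall>l\<ge>N. dist (T (x (diagseq k))) (T (x (diagseq l)))<e"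
  proof (intro exI[of _ N] allI impI)
   fix k l assume kl: "k\<ge>N" "l\<ge>N"
   have "dist (T (x (diagseq k))) (T (x (diagseq l))) \<le>
    norm (T (x (diagseq k))-S n (x (diagseq k))) + dist (S n (x (diagseq k))) (S n (x (diagseq l))) + norm (T (x (diagseq l))-S n (x (diagseq l)))"
    unfolding dist_norm
    using norm_triangle_ineq4[of "T (x (diagseq k))-S n (x (diagseq k)) + (S n (x (diagseq k))-S n (x (diagseq l)))" "T (x (diagseq l))-S n (x (diagseq l))"]
     norm_triangle_ineq[of "T (x (diagseq k))-S n (x (diagseq k))" "S n (x (diagseq k))-S n (x (diagseq l))"] by (simp add: algebra_simps)
   also have "\<dots><e/3 + e/3 + e/3" using Sn[of "diagseq k"] Sn[of "diagseq l"] N[OF kl] by linarith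
   finally show "dist (T (x (diagseq k))) (T (x (diagseq l)))<e" by simp
  qed
 qed
 hence "convergent (\<lambda>k. T (x (diagseq k)))" by (rule Cauchy_convergent)
 then obtain l where "(\<lambda>k. T (x (diagseq k)))\<longlonglongrightarrow>l" unfolding convergent_def by blast
 thus "\<exists>l r. strict_mono r\<and>(\<lambda>n. T (x (r n)))\<longlonglongrightarrow>l" using subseq_diagseq by blast
qed

lemma compact_map_rank_one: "compact_map (\<lambda>x. cinner x a *\<^sub>C b)" unfolding compact_map_def
proof (intro conjI allI impI)
 show "bounded_linear (\<lambda>x. cinner x a *\<^sub>C b)" by (intro bounded_linear_compose[OF cscale.bounded_linear_left bounded_linear_cinner_left])
 fix x :: "nat\<Rightarrow>'a" assume "bounded (range x)"
 hence "bounded ((\<lambda>x. cinner x a) ` range x)" by (rule bounded_linear_image[OF _ bounded_linear_cinner_left])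
 hence "bounded (range (\<lambda>n. cinner (x n) a))" by (simp add: image_image)
 from bounded_imp_convergent_subsequence[OF this] obtain l r where lr: "strict_mono (r::nat\<Rightarrow>nat)" "((\<lambda>n. cinner (x n) a)\<circ>r)\<longlonglongrightarrow>l" by blast
 have "(\<lambda>n. cinner (x (r n)) a *\<^sub>C b)\<longlonglongrightarrow>l *\<^sub>C b" using lr(2) by (intro cscale.tendsto tendsto_const) (simp add: o_def)
 thus "\<exists>l r. strict_mono r\<and>(\<lambda>n. cinner (x (r n)) a *\<^sub>C b)\<longlonglongrightarrow>l" using lr(1) by blast
qed

text \<open>With \<open>P\<close> the projection on the span of the finitely many vectors,
  \<open>T P\<close> has finite rank and differs from \<open>T\<close> by at most \<epsilon> in
  norm.\<close>

lemma compact_map_small_on_finite_codimension: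
 fixes T :: "'a::complex_hilbert\<Rightarrow>'b::{real_normed_vector,complete_space}"
 assumes T: "bounded_linear T" and small: "\<And>\<epsilon>. \<epsilon>>0\<Longrightarrow>\<exists>N::nat. \<exists>e::nat\<Rightarrow>'a. \<forall>x. (\<forall>i<N. cinner x (e i) = 0)\<longrightarrow>norm (T x)\<le>\<epsilon> * norm x"
 shows "compact_map T"
proof (rule compact_map_limit[OF T])
 fix \<epsilon> :: real assume \<epsilon>: "\<epsilon>>0"
 obtain N and e :: "nat\<Rightarrow>'a" where e: "\<And>x. (\<forall>i<N. cinner x (e i) = 0)\<Longrightarrow>norm (T x)\<le>\<epsilon> * norm x" using small[OF \<epsilon>] by blast
 obtain k and f :: "nat\<Rightarrow>'a" where f: "\<forall>i<k. \<forall>j<k. cinner (f i) (f j) = (if i = j then 1 else 0)"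
  "\<And>x. (\<forall>i<k. cinner x (f i) = 0)\<Longrightarrow>(\<forall>i<N. cinner x (e i) = 0)" using ex_orthonormal_same_annihilator[of N e] by blast
 define P where "P x = (\<Sum>i<k. cinner x (f i) *\<^sub>C f i)" for x
 note P = orthonormal_projection[of k f, OF f(1), folded P_def]
 have "compact_map (\<lambda>x. \<Sum>i<n. cinner x (f i) *\<^sub>C f i)" for n
 proof (induction n)
  case 0
  show ?case by (auto simp: compact_map_def intro: strict_mono_id[unfolded id_def])
 next
  case (Suc n)
  show ?case unfolding sum.lessThan_Suc by (rule compact_map_add[OF Suc compact_map_rank_one])
 qed
 hence cP: "compact_map P" unfolding P_def[abs_def] .
 show "\<exists>S. compact_map S\<and>(\<forall>x. norm (T x-S x)\<le>\<epsilon> * norm x)"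
 proof (intro exI[of _ "\<lambda>x. T (P x)"] conjI allI)
  show "compact_map (\<lambda>x. T (P x))" by (rule compact_map_comp_left[OF T cP])
  fix x
  have "norm (T x-T (P x)) = norm (T (x-P x))" by (simp add: linear_diff[OF bounded_linear.linear[OF T]])
  also have "\<dots>\<le>\<epsilon> * norm (x-P x)" by (rule e, rule f(2)) (simp add: P(2))
  also have "\<dots>\<le>\<epsilon> * norm x" using \<epsilon> P(3) by (intro mult_left_mono) auto
  finally show "norm (T x-T (P x))\<le>\<epsilon> * norm x" .
 qed
qed

section \<open>Approximation numbers of the form domain and of the resolvent\<close>

context weighted_schroedinger
begin

lemma norm_components_le:
 fixes U :: "l2 \<times> l2 \<times> l2"
 shows "norm (fst U)\<le>norm U" "norm (fst (snd U))\<le>norm U" "norm (snd (snd U))\<le>norm U"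
proof -
 have "norm (snd U)\<le>norm U" using norm_snd_le[of "snd U" "fst U"] by simp
 thus "norm (fst U)\<le>norm U" "norm (fst (snd U))\<le>norm U" "norm (snd (snd U))\<le>norm U"
  using norm_fst_le[of "fst U" "snd U"] norm_fst_le[of "fst (snd U)" "snd (snd U)"] norm_snd_le[of "snd (snd U)" "fst (snd U)"] by simp_all
qed

text \<open>The function \<rho> \<phi> has derivative \<rho> times that of \<phi> plus (\<omega>/2)
  \<rho> \<phi>. Hence unweighted approximation applies to it, at the cost of the bound on
  \<omega>.\<close>

lemma ex_norm_vderiv_le:
 "\<exists>B\<ge>0. \<forall>\<phi>\<in>test_functions. norm (emb (vderiv (\<lambda>x. rc x * \<phi> x)))\<le>B * norm (D \<phi>)"
proof -
 obtain C where C: "C\<ge>0" "AE x in lebesgue. \<bar>\<omega> x\<bar>\<le>1 * \<sigma> x + C" using \<omega>_bound[of 1] by auto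
 have B: "bdd_fun (1 + C) (damped \<omega>)" by (rule bdd_over_one_plus_\<sigma>[OF \<omega>_measurable C(2) _ C(1)]) simp
 show ?thesis
 proof (intro exI[of _ "2 + C"] conjI ballI)
  fix \<phi> :: "real\<Rightarrow>complex" assume \<phi>: "\<phi>\<in>test_functions"
  note t = sq_int_triple[OF \<phi>]
  note m = mulop_over_one_plus_\<sigma>_test[OF B \<phi>]
  have vr: "vderiv rc = (\<lambda>x. of_real (\<omega> x/2 * \<rho> x))"
   by (rule vderivI[rule_format]) (use \<rho>_deriv has_vector_derivative_of_real has_real_derivative_iff_has_vector_derivative in blast)
  have "vderiv (\<lambda>x. rc x * \<phi> x) = (\<lambda>x. rc x * vderiv \<phi> x + 1/2 * (rc x * (of_real (\<omega> x) * \<phi> x)))"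
   unfolding vderiv_mult[OF smooth_rc test_function_smooth[OF \<phi>]] vr by (simp add: mult_ac)
  hence "emb (vderiv (\<lambda>x. rc x * \<phi> x)) = J (vderiv \<phi>) + (1/2) *\<^sub>C J (\<lambda>x. of_real (\<omega> x) * \<phi> x)"
   unfolding J_def by (simp only: emb_add[OF t(2) sq_int_mult_const[OF m(1)]] emb_cscale[OF m(1)])
  hence "norm (emb (vderiv (\<lambda>x. rc x * \<phi> x)))\<le>norm (fst (snd (D \<phi>))) + 1/2 * norm (J (\<lambda>x. of_real (\<omega> x) * \<phi> x))"
   using norm_triangle_ineq[of "J (vderiv \<phi>)" "(1/2) *\<^sub>C J (\<lambda>x. of_real (\<omega> x) * \<phi> x)"] by (simp add: D_def triple_def)
  also have "J (\<lambda>x. of_real (\<omega> x) * \<phi> x) = mulop (damped \<omega>) (fst (D \<phi>) + snd (snd (D \<phi>)))" unfolding m(2)[symmetric] by (simp add: D_def triple_def)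
  also have "norm \<dots>\<le>1 * norm (snd (snd (D \<phi>))) + C * norm (fst (D \<phi>))" by (rule norm_mulop_form_domain[OF D_in_form_domain[OF \<phi>] \<omega>_measurable C(2) _ C(1)]) simp
  also have "\<dots>\<le>1 * norm (D \<phi>) + C * norm (D \<phi>)" by (intro add_mono mult_left_mono norm_components_le C(1)) simp
  finally have "norm (emb (vderiv (\<lambda>x. rc x * \<phi> x)))\<le>norm (fst (snd (D \<phi>))) + 1/2 * (1 * norm (D \<phi>) + C * norm (D \<phi>))" by simp
  also have "\<dots>\<le>(2 + C) * norm (D \<phi>)"
  proof -
   have "a + 1/2 * (1 * n + p)\<le>2 * n + p" if "a\<le>n" "0\<le>p" "0\<le>n" for a n p :: real using that by (simp add: add_divide_distrib)
   from this[OF norm_components_le(2) mult_nonneg_nonneg[OF C(1) norm_ge_zero] norm_ge_zero]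
   show ?thesis unfolding distrib_right .
  qed
  finally show "norm (emb (vderiv (\<lambda>x. rc x * \<phi> x)))\<le>(2 + C) * norm (D \<phi>)" .
 qed (use C in simp)
qed

text \<open>Off the interval \<open>cmod (V x) + 1\<close> is at least
  \<open>c * L powr \<gamma>\<close>, so the mass there is paid by the third component together with
  the first.\<close>

lemma tail_bound:
 assumes \<phi>: "\<phi>\<in>test_functions" and L: "L>0"
 shows "(LINT x|lebesgue. indicator (- {-L..<L}) x * (cmod (rc x * \<phi> x))\<^sup>2)\<le>(norm (D \<phi>)/sqrt (c * L powr \<gamma>))\<^sup>2"
proof -
 note t = sq_int_triple[OF \<phi>]
 have cL: "c * L powr \<gamma>>0" using c L by simp
 have i: "integrable lebesgue (\<lambda>x. (cmod (rc x * \<phi> x))\<^sup>2)" "integrable lebesgue (\<lambda>x. (cmod (rc x * (sc x * \<phi> x)))\<^sup>2)" using t by (simp_all add: sq_int_def)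
 have ii: "integrable lebesgue (\<lambda>x. ((cmod (rc x * (sc x * \<phi> x)))\<^sup>2 + (cmod (rc x * \<phi> x))\<^sup>2)/(c * L powr \<gamma>))"
  by (intro integrable_divide Bochner_Integration.integrable_add i)
 have "(LINT x|lebesgue. indicator (- {-L..<L}) x * (cmod (rc x * \<phi> x))\<^sup>2)
 \<le>(LINT x|lebesgue. ((cmod (rc x * (sc x * \<phi> x)))\<^sup>2 + (cmod (rc x * \<phi> x))\<^sup>2)/(c * L powr \<gamma>))"
 proof (rule integral_mono_AE[OF _ ii])
  show "integrable lebesgue (\<lambda>x. indicator (- {-L..<L}) x * (cmod (rc x * \<phi> x))\<^sup>2)" using integrable_mult_indicator[OF _ i(1), of "- {-L..<L}"] by simp
  show "AE x in lebesgue. indicator (- {-L..<L}) x * (cmod (rc x * \<phi> x))\<^sup>2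
  \<le>((cmod (rc x * (sc x * \<phi> x)))\<^sup>2 + (cmod (rc x * \<phi> x))\<^sup>2)/(c * L powr \<gamma>)" using Vlow
  proof eventually_elim
   case (elim x)
   have s: "(cmod (rc x * (sc x * \<phi> x)))\<^sup>2 = cmod (V x) * (cmod (rc x * \<phi> x))\<^sup>2"
    unfolding norm_mult norm_of_real power_mult_distrib power2_abs \<sigma>_sq by (simp only: mult_ac)
   show ?case
   proof (cases "x\<in>{-L..<L}")
    case True
    thus ?thesis using cL by simp
   next
    case False
    hence "L\<le>\<bar>x\<bar>" by auto
    also have "\<dots>\<le>japanese_bracket x" by (rule abs_le_japanese_bracket)
    finally have "c * L powr \<gamma>\<le>c * japanese_bracket x powr \<gamma>" using L \<gamma> c by (intro mult_left_mono powr_mono2) auto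
    with elim have "c * L powr \<gamma> * (cmod (rc x * \<phi> x))\<^sup>2\<le>(cmod (V x) + 1) * (cmod (rc x * \<phi> x))\<^sup>2" by (intro mult_right_mono) auto
    moreover have "indicator (- {-L..<L}) x = (1::real)" using False by simp
    ultimately show ?thesis unfolding s using cL by (simp add: pos_le_divide_eq algebra_simps)
   qed
  qed
 qed
 also have "\<dots> = ((norm (snd (snd (D \<phi>))))\<^sup>2 + (norm (fst (D \<phi>)))\<^sup>2)/(c * L powr \<gamma>)"
  by (simp add: Bochner_Integration.integral_add[OF i(2,1)] D_def triple_def J_def norm_emb_sq t)
 also have "\<dots>\<le>(norm (D \<phi>))\<^sup>2/(c * L powr \<gamma>)" using cL by (intro divide_right_mono) (auto simp: norm_triple_sq)
 also have "\<dots> = (norm (D \<phi>)/sqrt (c * L powr \<gamma>))\<^sup>2" using cL by (simp add: power_divide)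
 finally show ?thesis .
qed

definition \<beta> :: real where "\<beta> = \<gamma>/(\<gamma> + 2)"

text \<open>The length of the interval balances two errors: the mesh contributes L/N, the tail
  L^(-\<gamma>/2). They agree for L = N^(2/(\<gamma> + 2)), both being N^(-\<gamma>/(\<gamma> + 2)),
  which is the origin of \<beta>.\<close>

lemma form_domain_approximation_numbers:
 "\<exists>C>0. \<forall>N::nat\<ge>1. \<exists>e::nat\<Rightarrow>l2. \<forall>U\<in>form_domain. \<forall>y. (\<forall>i<N. cinner y (e i) = 0) \<longrightarrow>
   cmod (cinner (fst U) y)\<le>C * real N powr (- \<beta>) * norm U * norm y"
proof -
 obtain B where B: "B\<ge>0" "\<And>\<phi>. \<phi>\<in>test_functions\<Longrightarrow>norm (emb (vderiv (\<lambda>x. rc x * \<phi> x)))\<le>B * norm (D \<phi>)" using ex_norm_vderiv_le by blast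
 define C where "C = 2 * B + 1/sqrt c"
 have C: "C>0" using B(1) c by (simp add: C_def add_nonneg_pos)
 have g2: "\<gamma> + 2>0" using \<gamma> by simp
 show ?thesis
 proof (intro exI[of _ C] conjI C allI impI)
  fix N :: nat assume N: "N\<ge>1"
  define L where "L = real N powr (2/(\<gamma> + 2))"
  have L: "L>0" using N by (simp add: L_def)
  have LN: "2 * L/real N = 2 * real N powr (- \<beta>)"
  proof -
   have "L/real N = real N powr (2/(\<gamma> + 2)-1)" using N by (simp add: L_def powr_diff)
   also have "2/(\<gamma> + 2)-1 =-\<beta>" using g2 by (simp add: \<beta>_def field_simps)
   finally show ?thesis by simp
  qed
  have Lg: "1/sqrt (c * L powr \<gamma>) = 1/sqrt c * real N powr (- \<beta>)"
  proof -
   have "L powr \<gamma> = real N powr (2 * \<beta>)" by (simp add: L_def \<beta>_def powr_powr)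
   also have "\<dots> = (real N powr \<beta>)\<^sup>2" using N by (simp add: powr_powr powr_power mult.commute)
   finally have "sqrt (c * L powr \<gamma>) = sqrt c * real N powr \<beta>" by (simp add: real_sqrt_mult)
   thus ?thesis by (simp add: powr_minus field_simps)
  qed
  define e where "e i = emb (\<lambda>x. complex_of_real (indicator (cell L N i) x))" for i
  show "\<exists>e::nat\<Rightarrow>l2. \<forall>U\<in>form_domain. \<forall>y. (\<forall>i<N. cinner y (e i) = 0) \<longrightarrow>
    cmod (cinner (fst U) y)\<le>C * real N powr (- \<beta>) * norm U * norm y"
  proof (intro exI[of _ e] ballI allI impI)
   fix U y assume U: "U\<in>form_domain" and y: "\<forall>i<N. cinner y (e i) = 0"
   show "cmod (cinner (fst U) y)\<le>C * real N powr (- \<beta>) * norm U * norm y" using U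
   proof (rule form_domain_minimal)
    show "closed {U::l2 \<times> l2 \<times> l2. cmod (cinner (fst U) y)\<le>C * real N powr (- \<beta>) * norm U * norm y}"
     by (intro closed_Collect_le continuous_intros bounded_linear.continuous_on[OF bounded_linear_cinner_left])
    fix \<phi> :: "real\<Rightarrow>complex" assume \<phi>: "\<phi>\<in>test_functions"
    define v where "v x = rc x * \<phi> x" for x
    have vt: "v\<in>test_functions" unfolding v_def by (rule test_function_mult_left[OF smooth_rc \<phi>])
    have "cmod (cinner (emb v) y)\<le>(2 * L/real N * norm (emb (vderiv v)) + norm (D \<phi>)/sqrt (c * L powr \<gamma>)) * norm y"
    proof (rule piecewise_constant_approx)
     show "smooth v" "sq_int v" "sq_int (vderiv v)" using vt by (simp_all add: test_function_smooth sq_int_test test_function_vderiv)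
     show "(LINT x|lebesgue. indicator (- {-L..<L}) x * (cmod (v x))\<^sup>2)\<le>(norm (D \<phi>)/sqrt (c * L powr \<gamma>))\<^sup>2" unfolding v_def by (rule tail_bound[OF \<phi> L])
    qed (use L N c y in \<open>auto simp: e_def\<close>)
    also have "2 * L/real N * norm (emb (vderiv v)) + norm (D \<phi>)/sqrt (c * L powr \<gamma>)\<le>C * real N powr (- \<beta>) * norm (D \<phi>)"
    proof -
     have "2 * L/real N * norm (emb (vderiv v))\<le>2 * L/real N * (B * norm (D \<phi>))" unfolding v_def using L by (intro mult_left_mono B(2) \<phi>) simp
     moreover have "norm (D \<phi>)/sqrt (c * L powr \<gamma>) = (1/sqrt (c * L powr \<gamma>)) * norm (D \<phi>)" by simp
     ultimately show ?thesis unfolding LN Lg C_def by (simp add: algebra_simps)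
    qed
    finally have "cmod (cinner (emb v) y)\<le>C * real N powr (- \<beta>) * norm (D \<phi>) * norm y" by (simp add: mult_right_mono)
    thus "cmod (cinner (fst (D \<phi>)) y)\<le>C * real N powr (- \<beta>) * norm (D \<phi>) * norm y" by (simp add: D_def triple_def J_def v_def[abs_def])
   qed
  qed
 qed
qed

lemma J_test_total:
 assumes n: "\<And>\<phi>. \<phi>\<in>test_functions\<Longrightarrow>inner (J \<phi>) n = 0"
 shows "n = 0"
proof -
 have "AE x in lebesgue. rc x * cnj (rep n x) = 0"
 proof (rule fundamental_lemma_complex)
  have "locally_integrable (\<lambda>x. cnj (rep n x) * rc x)"
   by (intro locally_integrable_mult_continuous sq_int_locally_integrable sq_int_cnj sq_int_rep continuous_intros \<rho>_continuous)
  thus "locally_integrable (\<lambda>x. rc x * cnj (rep n x))" by (simp add: mult.commute)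
  fix \<phi> :: "real\<Rightarrow>complex" assume \<phi>: "\<phi>\<in>test_functions"
  have "J (\<lambda>x. \<i> * \<phi> x) = imul (J \<phi>)" using J_cscale[OF sq_int_\<rho>_test[OF \<phi>], of \<i>] by (simp add: cscale_ii)
  hence "inner (imul (J \<phi>)) n = 0" using n[OF test_function_cmult[OF \<phi>, of \<i>]] by simp
  from inner_zero_imp_cinner_zero[OF n[OF \<phi>] this] have "cinner (J \<phi>) (emb (rep n)) = 0" by simp
  thus "(LINT x|lebesgue. rc x * cnj (rep n x) * \<phi> x) = 0" unfolding J_def cinner_emb[OF sq_int_\<rho>_test[OF \<phi>] sq_int_rep] by (simp add: mult_ac)
 qed
 hence "AE x in lebesgue. rep n x = rep 0 x" using AE_rep_zero by eventually_elim simp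
 thus ?thesis by (rule l2_eqI)
qed

text \<open>The third component is \<sigma> times the first, and the second divided by \<rho> is a
  weak derivative of the first divided by \<rho>; both vanish with it.\<close>

lemma form_domain_fst_eq_0:
 assumes U: "U\<in>form_domain" and 0: "fst U = 0"
 shows "U = 0"
proof -
 have z: "AE x in lebesgue. rep (fst U) x = 0" unfolding 0 by (rule AE_rep_zero)
 have "AE x in lebesgue. rep (snd (snd U)) x = rep 0 x" using form_domain_\<sigma>[OF U] z AE_rep_zero by eventually_elim simp
 hence 2: "snd (snd U) = 0" by (rule l2_eqI)
 have wd: "weak_derivative (\<lambda>x. 0) (\<lambda>x. rep (fst (snd U)) x/rc x)"
 proof (rule weak_derivative_cong_AE[OF form_domain_weak_derivative[OF U]])
  show "AE x in lebesgue. rep (fst U) x/rc x = 0" using z by eventually_elim simp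
  show "(\<lambda>x. rep (fst (snd U)) x/rc x)\<in>borel_measurable lebesgue"
   using form_domain_weak_derivative[OF U] by (auto simp: weak_derivative_def locally_integrable_measurable)
 qed simp_all
 have "weak_derivative (\<lambda>x. 0::complex) (\<lambda>x. 0)" using sq_int_locally_integrable[OF sq_int_zero] by (simp add: weak_derivative_def)
 from weak_derivative_unique[OF wd this] AE_rep_zero
 have "AE x in lebesgue. rep (fst (snd U)) x = rep 0 x" by eventually_elim simp
 hence "fst (snd U) = 0" by (rule l2_eqI)
 with 0 2 show ?thesis by (simp add: prod_eq_iff)
qed

end

context coercive_form
begin

text \<open>The adjoint problem is solved by Lax-Milgram with the arguments of the twisted form
  exchanged: some \<open>G\<close> satisfies
  \<open>form z U (M \<delta> G) = inner (fst U) n\<close> for all \<open>U\<close>. Inserting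
  \<open>sol x\<close> shows that the first component of \<open>M \<delta> G\<close> vanishes, hence
  \<open>M \<delta> G = 0\<close>, and \<open>n\<close> is orthogonal to every
  \<open>J \<phi>\<close>.\<close>

lemma K_dense_range:
 assumes n: "\<And>x. inner (K x) n = 0"
 shows "n = 0"
proof -
 have bb: "bounded_bilinear (\<lambda>G U. form z U (M \<delta> G))"
  by (rule bounded_bilinear.flip[OF bounded_bilinear.comp[OF bounded_bilinear_form bounded_linear_ident clinear_map_bounded_linear[OF clinear_map_M]]])
 have "\<delta>/4>0" using \<delta> by simp
 from Lax_Milgram_on_subspace[OF closed_form_domain subspace_form_domain bb this coercive
   bounded_linear_compose[OF bounded_linear_inner_left bounded_linear_fst, of n]]
 obtain G where G: "G\<in>form_domain" "\<And>U. U\<in>form_domain\<Longrightarrow>form z U (M \<delta> G) = inner (fst U) n" by blast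
 have MG: "M \<delta> G\<in>form_domain" by (rule M_form_domain[OF G(1)])
 have "inner x (fst (M \<delta> G)) = 0" for x using sol(2)[OF MG, of x] G(2)[OF sol(1), of x] n[of x] by (simp add: K_def)
 from this[of "fst (M \<delta> G)"] have "fst (M \<delta> G) = 0" by simp
 hence MG0: "M \<delta> G = 0" by (rule form_domain_fst_eq_0[OF MG])
 show ?thesis
 proof (rule J_test_total)
  fix \<phi> :: "real\<Rightarrow>complex" assume "\<phi>\<in>test_functions"
  from G(2)[OF D_in_form_domain[OF this]] MG0 show "inner (J \<phi>) n = 0" by (simp add: form.zero_right D_def triple_def)
 qed
qed

text \<open>The norm bound with exponent \<beta> serves compactness. The bilinear bound, with
  \<open>y\<close> constrained too, has the doubled exponent on which completeness rests.\<close>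

definition K_small :: "real\<Rightarrow>nat\<Rightarrow>(nat\<Rightarrow>l2)\<Rightarrow>l2\<Rightarrow>bool" where
 "K_small C N e x\<longleftrightarrow>norm (K x)\<le>C * real N powr (- \<beta>) * norm x \<and>
   (\<forall>y. (\<forall>i<N. cinner y (e i) = 0)\<longrightarrow>cmod (cinner (K x) y)\<le>C * real N powr (- (2 * \<beta>)) * norm x * norm y)"

text \<open>The approximation estimate for the form domain is used twice: against the datum
  \<open>x\<close> it improves the energy estimate to a bound of \<open>sol x\<close> by
  N^(-\<beta>) times the norm of \<open>x\<close>, and against \<open>y\<close> it supplies a second
  factor N^(-\<beta>).\<close>

lemma K_approximation_numbers:
 "\<exists>C>0. \<forall>N\<ge>1. \<exists>e. \<forall>x. (\<forall>i<N. cinner x (e i) = 0)\<longrightarrow>K_small C N e x"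
proof -
 obtain C where C: "C>0" "\<And>N::nat. N\<ge>1\<Longrightarrow>\<exists>e::nat\<Rightarrow>l2. \<forall>U\<in>form_domain. \<forall>y. (\<forall>i<N. cinner y (e i) = 0) \<longrightarrow>
   cmod (cinner (fst U) y)\<le>C * real N powr (- \<beta>) * norm U * norm y" using form_domain_approximation_numbers by blast
 define C' where "C' = max (8 * C/\<delta>) (C * (8 * C/\<delta>))"
 show ?thesis
 proof (intro exI[of _ C'] conjI allI impI)
  show "C'>0" using C(1) \<delta> by (simp add: C'_def less_max_iff_disj)
  fix N :: nat assume N: "N\<ge>1"
  obtain e :: "nat\<Rightarrow>l2" where e: "\<And>U y. U\<in>form_domain\<Longrightarrow>(\<forall>i<N. cinner y (e i) = 0) \<Longrightarrow>
   cmod (cinner (fst U) y)\<le>C * real N powr (- \<beta>) * norm U * norm y" using C(2)[OF N] by blast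
  define p where "p = real N powr (- \<beta>)"
  have p: "p>0" using N by (simp add: p_def)
  have sol_le: "norm (sol x)\<le>8 * C/\<delta> * p * norm x" if x: "\<forall>i<N. cinner x (e i) = 0" for x
  proof (cases "sol x = 0")
   case True
   thus ?thesis using C(1) \<delta> p by simp
  next
   case False
   have "inner x (fst (M \<delta> (sol x)))\<le>cmod (cinner (fst (M \<delta> (sol x))) x)" using complex_Re_le_cmod[of "cinner (fst (M \<delta> (sol x))) x"] by (simp add: inner_commute)
   also have "\<dots>\<le>C * p * norm (M \<delta> (sol x)) * norm x" unfolding p_def by (rule e[OF M_form_domain[OF sol(1)] x])
   also have "\<dots>\<le>C * p * (2 * norm (sol x)) * norm x" using C(1) p by (intro mult_right_mono mult_left_mono norm_M_le) auto
   finally have "\<delta>/4 * (norm (sol x))\<^sup>2\<le>C * p * (2 * norm (sol x)) * norm x" using norm_sol_sq_le[of x] by linarith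
   hence "(\<delta>/4 * norm (sol x)) * norm (sol x)\<le>(2 * C * p * norm x) * norm (sol x)" by (simp add: power2_eq_square[of "norm (sol x)"] mult_ac)
   hence "\<delta>/4 * norm (sol x)\<le>2 * C * p * norm x" using False by simp
   thus ?thesis using \<delta> by (simp add: field_simps)
  qed
  show "\<exists>e. \<forall>x. (\<forall>i<N. cinner x (e i) = 0)\<longrightarrow>K_small C' N e x" unfolding K_small_def
  proof (intro exI[of _ e] allI impI conjI)
   fix x assume x: "\<forall>i<N. cinner x (e i) = 0"
   have "norm (K x)\<le>norm (sol x)" unfolding K_def by (rule norm_components_le)
   also note sol_le[OF x]
   also have "8 * C/\<delta> * p * norm x\<le>C' * p * norm x" using p by (intro mult_right_mono) (auto simp: C'_def)
   finally show "norm (K x)\<le>C' * real N powr (- \<beta>) * norm x" by (simp add: p_def)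
   fix y assume y: "\<forall>i<N. cinner y (e i) = 0"
   have "cmod (cinner (K x) y)\<le>C * p * norm (sol x) * norm y" unfolding K_def p_def by (rule e[OF sol(1) y])
   also have "\<dots>\<le>C * p * (8 * C/\<delta> * p * norm x) * norm y" using C(1) p sol_le[OF x] by (intro mult_right_mono mult_left_mono) auto
   also have "\<dots> = (C * (8 * C/\<delta>)) * (p * p) * norm x * norm y" by (simp add: mult_ac)
   also have "\<dots>\<le>C' * (p * p) * norm x * norm y" using p by (intro mult_right_mono) (auto simp: C'_def)
   also have "p * p = real N powr (- (2 * \<beta>))" by (simp add: p_def flip: powr_add)
   finally show "cmod (cinner (K x) y)\<le>C' * real N powr (- (2 * \<beta>)) * norm x * norm y" .
  qed
 qed
qed

lemma compact_map_K: "compact_map K"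
proof (rule compact_map_small_on_finite_codimension[OF clinear_map_bounded_linear[OF clinear_map_K]])
 fix \<epsilon> :: real assume \<epsilon>: "\<epsilon>>0"
 obtain C where C: "C>0" "\<forall>N\<ge>1. \<exists>e. \<forall>x. (\<forall>i<N. cinner x (e i) = 0)\<longrightarrow>K_small C N e x" using K_approximation_numbers by blast
 have "\<beta>>0" using \<gamma> by (simp add: \<beta>_def)
 hence "((\<lambda>N::nat. C * real N powr (- \<beta>))\<longlongrightarrow>0) at_top" by real_asymp
 hence "eventually (\<lambda>N. C * real N powr (- \<beta>)<\<epsilon>) at_top" using \<epsilon> by (rule order_tendstoD(2))
 then obtain N0 where N0: "\<And>N. N\<ge>N0\<Longrightarrow>C * real N powr (- \<beta>)<\<epsilon>" unfolding eventually_at_top_linorder by blast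
 define N where "N = max N0 1"
 have "N\<ge>1" by (simp add: N_def)
 with C(2) obtain e :: "nat\<Rightarrow>l2" where "\<forall>x. (\<forall>i<N. cinner x (e i) = 0)\<longrightarrow>K_small C N e x" by blast
 hence e: "norm (K x)\<le>C * real N powr (- \<beta>) * norm x" if "\<forall>i<N. cinner x (e i) = 0" for x using that unfolding K_small_def by blast
 have "norm (K x)\<le>\<epsilon> * norm x" if "\<forall>i<N. cinner x (e i) = 0" for x
 proof -
  have "C * real N powr (- \<beta>) * norm x\<le>\<epsilon> * norm x" using N0[of N] by (intro mult_right_mono) (auto simp: N_def)
  with e[OF that] show ?thesis by linarith
 qed
 thus "\<exists>N::nat. \<exists>e::nat\<Rightarrow>l2. \<forall>x. (\<forall>i<N. cinner x (e i) = 0)\<longrightarrow>norm (K x)\<le>\<epsilon> * norm x" by blast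
qed

end

section \<open>Root functions\<close>

text \<open>A chain of the unbounded operator runs through preimages under \<open>K\<close>, so root
  vectors must lie in the range of \<open>K\<close> with a preimage that is again a root vector.
  From \<open>B x = K y'\<close> and \<open>x = B x + \<zeta> K x\<close> the preimage is
  \<open>y' + \<zeta> x\<close>; it lies in every kernel that contains \<open>x\<close>, hence
  chains do not get longer.\<close>

lemma root_vector_preimage:
 fixes K :: "'a::complex_hilbert\<Rightarrow>'a"
 assumes K: "clinear_map K" and B: "clinear_map B" "\<And>x. B x = x-\<zeta> *\<^sub>C K x"
 shows "(B ^^ j) x = 0\<Longrightarrow>\<exists>y. x = K y\<and>(\<forall>m. (B ^^ m) x = 0\<longrightarrow>(B ^^ m) y = 0)"
proof (induction j arbitrary: x)
 case 0
 have "K 0 = 0" "\<And>m. (B ^^ m) 0 = 0" using clinear_map_cscale[OF K, of 0 0] clinear_map_cscale[OF clinear_map_funpow[OF B(1)], of _ 0 0] by simp_all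
 with 0 show ?case by (intro exI[of _ 0]) simp
next
 case (Suc j)
 have "(B ^^ j) (B x) = 0" using Suc.prems by (simp add: funpow_swap1)
 from Suc.IH[OF this] obtain y' where y': "B x = K y'" "\<And>m. (B ^^ m) (B x) = 0\<Longrightarrow>(B ^^ m) y' = 0" by blast
 have add: "L (u + v) = L u + L v" if "clinear_map L" for L :: "'a\<Rightarrow>'a" and u v using that by (simp add: clinear_map_def linear_add bounded_linear.linear)
 show ?case
 proof (intro exI[of _ "y' + \<zeta> *\<^sub>C x"] conjI allI impI)
  have "x = B x + \<zeta> *\<^sub>C K x" using B(2)[of x] by simp
  also have "\<dots> = K (y' + \<zeta> *\<^sub>C x)" unfolding y'(1) add[OF K] clinear_map_cscale[OF K] ..
  finally show "x = K (y' + \<zeta> *\<^sub>C x)" .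
  fix m assume m: "(B ^^ m) x = 0"
  have "(B ^^ m) (B x) = B ((B ^^ m) x)" by (simp add: funpow_swap1)
  also have "\<dots> = 0" using clinear_map_cscale[OF B(1), of 0 0] by (simp add: m)
  finally have "(B ^^ m) y' = 0" by (rule y'(2))
  thus "(B ^^ m) (y' + \<zeta> *\<^sub>C x) = 0" unfolding add[OF clinear_map_funpow[OF B(1)]] clinear_map_cscale[OF clinear_map_funpow[OF B(1)]] by (simp add: m)
 qed
qed

lemma linear_span_add:
 assumes "f\<in>linear_span S" "g\<in>linear_span S"
 shows "(\<lambda>x. f x + g x)\<in>linear_span S"
proof -
 from assms obtain n m :: nat and a b u v where f: "f = (\<lambda>x. \<Sum>i<n. a i * u i x)" "\<forall>i<n. u i\<in>S"
  and g: "g = (\<lambda>x. \<Sum>i<m. b i * v i x)" "\<forall>i<m. v i\<in>S" unfolding linear_span_def by blast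
 define c where "c i = (if i<n then a i else b (i-n))" for i
 define t where "t i = (if i<n then u i else v (i-n))" for i
 have "(\<Sum>i<n + k. c i * t i x) = f x + (\<Sum>i<k. b i * v i x)" for k x by (induction k) (simp_all add: f(1) c_def t_def add.assoc)
 hence "(\<lambda>x. f x + g x) = (\<lambda>x. \<Sum>i<n + m. c i * t i x)" unfolding g(1) by simp
 moreover have "\<forall>i<n + m. t i\<in>S" using f(2) g(2) by (simp add: t_def)
 ultimately show ?thesis unfolding linear_span_def by (intro CollectI exI[of _ "n + m"] exI[of _ c] exI[of _ t]) simp
qed

lemma linear_span_cmult:
 assumes "f\<in>linear_span S"
 shows "(\<lambda>x. c * f x)\<in>linear_span S"
proof -
 from assms obtain n :: nat and a u where f: "f = (\<lambda>x. \<Sum>i<n. a i * u i x)" "\<forall>i<n. u i\<in>S" unfolding linear_span_def by blast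
 have "(\<lambda>x. c * f x) = (\<lambda>x. \<Sum>i<n. (c * a i) * u i x)" by (simp add: f(1) sum_distrib_left mult.assoc)
 thus ?thesis using f(2) unfolding linear_span_def by (intro CollectI exI[of _ n] exI[of _ "\<lambda>i. c * a i"] exI[of _ u]) simp
qed

lemma linear_span_base: "f\<in>S\<Longrightarrow>f\<in>linear_span S" unfolding linear_span_def by (intro CollectI exI[of _ "1::nat"] exI[of _ "\<lambda>_. 1"] exI[of _ "\<lambda>_. f"]) simp

context weighted_schroedinger
begin

lemma L2w_add: "f\<in>L2w w\<Longrightarrow>g\<in>L2w w\<Longrightarrow>(\<lambda>x. f x + g x::complex)\<in>L2w w" unfolding L2w_iff distrib_left by (intro conjI sq_int_add borel_measurable_add) blast+

lemma L2w_cmult: "f\<in>L2w w\<Longrightarrow>(\<lambda>x. a * f x::complex)\<in>L2w w" unfolding L2w_iff using sq_int_mult_const[of "\<lambda>x. rc x * f x" a] by (auto simp: mult.left_commute)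

lemma L2w_zero: "(\<lambda>x. 0::complex)\<in>L2w w" unfolding L2w_iff using sq_int_zero by simp

lemma linear_span_L2w:
 assumes S: "S\<subseteq>L2w w"
 shows "linear_span S\<subseteq>L2w w"
proof
 fix f assume "f\<in>linear_span S"
 then obtain n :: nat and a u where f: "f = (\<lambda>x. \<Sum>i<n. a i * u i x)" "\<forall>i<n. u i\<in>S" unfolding linear_span_def by blast
 have "(\<lambda>x. \<Sum>i<m. a i * u i x)\<in>L2w w" if "m\<le>n" for m using that
 proof (induction m)
  case (Suc m)
  have "u m\<in>L2w w" using f(2) S Suc.prems by auto
  with Suc show ?case unfolding sum.lessThan_Suc by (intro L2w_add L2w_cmult) auto
 qed (simp add: L2w_zero)
 thus "f\<in>L2w w" unfolding f(1) by blast
qed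

definition Jinv :: "l2\<Rightarrow>real\<Rightarrow>complex" where "Jinv u = (\<lambda>x. rep u x/rc x)"

lemma rc_Jinv: "rc x * Jinv u x = rep u x" by (simp add: Jinv_def)

lemma Jinv_L2w: "Jinv u\<in>L2w w" unfolding L2w_iff
proof
 show "Jinv u\<in>borel_measurable lebesgue" unfolding Jinv_def
  using locally_integrable_measurable[OF locally_integrable_mult_continuous[OF locally_integrable_rep smooth_continuous[OF smooth_inverse_rc]], of u] by simp
 show "sq_int (\<lambda>x. rc x * Jinv u x)" by (simp only: rc_Jinv sq_int_rep)
qed

lemma J_Jinv [simp]: "J (Jinv u) = u" unfolding J_def rc_Jinv by (rule emb_rep)

lemma J_eq_iff:
 assumes "f\<in>L2w w" "g\<in>L2w w"
 shows "J f = J g\<longleftrightarrow>(AE x in lebesgue. f x = g x)"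
proof -
 have s: "sq_int (\<lambda>x. rc x * f x)" "sq_int (\<lambda>x. rc x * g x)" using assms by (auto simp: L2w_iff)
 have "J f = J g\<longleftrightarrow>(AE x in lebesgue. rc x * f x = rep (J g) x)" unfolding J_def[of f] by (rule emb_eq_iff[OF s(1)])
 also have "\<dots>\<longleftrightarrow>(AE x in lebesgue. f x = g x)"
 proof -
  have "AE x in lebesgue. (rc x * f x = rep (J g) x) = (f x = g x)" using AE_rep_emb[OF s(2)] unfolding J_def by eventually_elim simp
  thus ?thesis by (rule eventually_subst)
 qed
 finally show ?thesis .
qed

lemma J_zero: "J (\<lambda>x. 0) = 0" unfolding J_def by (simp add: emb_zero)

lemma J_add': "f\<in>L2w w\<Longrightarrow>g\<in>L2w w\<Longrightarrow>J (\<lambda>x. f x + g x) = J f + J g" by (simp add: L2w_iff J_add)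

lemma J_cscale': "f\<in>L2w w\<Longrightarrow>J (\<lambda>x. a * f x) = a *\<^sub>C J f" by (simp add: L2w_iff J_cscale)

lemma normw_eq': "f\<in>L2w w\<Longrightarrow>normw w f = norm (J f)" by (simp add: L2w_iff normw_eq)

lemma normw_diff:
 assumes "f\<in>L2w w" "g\<in>L2w w"
 shows "normw w (\<lambda>x. f x-g x) = norm (J f-J g)"
proof -
 have s: "sq_int (\<lambda>x. rc x * f x)" "sq_int (\<lambda>x. rc x * g x)" using assms by (auto simp: L2w_iff)
 have "normw w (\<lambda>x. f x-g x) = norm (J (\<lambda>x. f x-g x))" by (rule normw_eq) (unfold right_diff_distrib, rule sq_int_diff[OF s])
 thus ?thesis by (simp only: J_diff[OF s])
qed

lemma dense_in_L2wI:
 assumes S: "S\<subseteq>L2w w" and add: "\<And>f g. f\<in>S\<Longrightarrow>g\<in>S\<Longrightarrow>(\<lambda>x. f x + g x)\<in>S"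
  and scale: "\<And>f a. f\<in>S\<Longrightarrow>(\<lambda>x. complex_of_real a * f x)\<in>S" and ne: "S\<noteq>{}"
  and total: "\<And>n. (\<And>f. f\<in>S\<Longrightarrow>inner (J f) n = 0)\<Longrightarrow>n = 0"
 shows "dense_in_L2w w S" unfolding dense_in_L2w_def
proof (intro conjI S ballI allI impI)
 fix f :: "real\<Rightarrow>complex" and \<epsilon> :: real assume f: "f\<in>L2w w" and \<epsilon>: "\<epsilon>>0"
 have sc: "a *\<^sub>R J g\<in>J ` S" if "g\<in>S" for g a
 proof -
  have "a *\<^sub>R J g = J (\<lambda>x. complex_of_real a * g x)" using that S by (subst J_cscale') (auto simp: cscale_of_real)
  thus ?thesis using scale[OF that] by simp
 qed
 have sub: "subspace (J ` S)"
 proof (rule subspaceI)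
  obtain g where "g\<in>S" using ne by blast
  from sc[OF this, of 0] show "0\<in>J ` S" by simp
  show "x + y\<in>J ` S" if "x\<in>J ` S" "y\<in>J ` S" for x y
  proof -
   from that(1) obtain g where g: "x = J g" "g\<in>S" by (rule imageE)
   from that(2) obtain h where h: "y = J h" "h\<in>S" by (rule imageE)
   from g h have "x + y = J (\<lambda>x. g x + h x)" using S by (subst J_add') auto
   thus ?thesis using add[OF g(2) h(2)] by simp
  qed
  show "a *\<^sub>R x\<in>J ` S" if "x\<in>J ` S" for a x
  proof -
   from that obtain g where "x = J g" "g\<in>S" by (rule imageE)
   with sc[of g a] show ?thesis by simp
  qed
 qed
 have "J f\<in>closure (J ` S)"
 proof (rule orthogonal_complement_criterion[OF sub])
  fix g assume "\<And>v. v\<in>J ` S\<Longrightarrow>inner v g = 0"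
  hence "g = 0" by (intro total) blast
  thus "inner (J f) g = 0" by simp
 qed
 then obtain y where "y\<in>J ` S" "dist y (J f)<\<epsilon>" using \<epsilon> unfolding closure_approachable by blast
 then obtain g where g: "g\<in>S" "norm (J f-J g)<\<epsilon>" by (auto simp: dist_norm norm_minus_commute)
 thus "\<exists>g\<in>S. normw w (\<lambda>x. f x-g x)<\<epsilon>" using S f by (intro bexI[of _ g]) (auto simp: normw_diff)
qed

end

section \<open>The spectrum of the operator expressed through \<open>K\<close>\<close>

context coercive_form
begin

abbreviation T :: op_graph where "T \<equiv> schroedinger_op w V"

text \<open>Solving for the shift at \<open>- z\<close>: T f - \<mu> f = h means (T + z) f = h +
  (\<mu> + z) f. Every spectral question about the operator becomes one about the single compact map
  \<open>K\<close>.\<close>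

lemma op_shift_T_iff:
 "(f, h)\<in>op_shift T \<mu>\<longleftrightarrow>f\<in>L2w w\<and>h\<in>L2w w\<and>J f = K (J h + (\<mu> + of_real z) *\<^sub>C J f)"
proof -
 define h' where "h' x = h x + (\<mu> + of_real z) * f x" for x
 have "(f, h)\<in>op_shift T \<mu>\<longleftrightarrow>(f, h')\<in>op_shift T (- of_real z)"
 proof
  assume "(f, h)\<in>op_shift T \<mu>"
  then obtain g where g: "(f, g)\<in>T" "h = (\<lambda>x. g x-\<mu> * f x)" unfolding op_shift_def by blast
  have "h' = (\<lambda>x. g x-(- of_real z) * f x)" by (simp add: h'_def[abs_def] g(2) algebra_simps)
  thus "(f, h')\<in>op_shift T (- of_real z)" using g(1) unfolding op_shift_def by blast
 next
  assume "(f, h')\<in>op_shift T (- of_real z)"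
  then obtain g where g: "(f, g)\<in>T" "h' = (\<lambda>x. g x-(- of_real z) * f x)" unfolding op_shift_def by blast
  have "h x = g x-\<mu> * f x" for x using fun_cong[OF g(2), of x] by (simp add: h'_def algebra_simps)
  thus "(f, h)\<in>op_shift T \<mu>" using g(1) unfolding op_shift_def by blast
 qed
 also have "\<dots>\<longleftrightarrow>f\<in>L2w w\<and>h'\<in>L2w w\<and>J f = K (J h')" by (rule op_shift_iff)
 also have "\<dots>\<longleftrightarrow>f\<in>L2w w\<and>h\<in>L2w w\<and>J f = K (J h + (\<mu> + of_real z) *\<^sub>C J f)"
 proof (cases "f\<in>L2w w")
  case True
  have "h'\<in>L2w w\<longleftrightarrow>h\<in>L2w w"
  proof
   assume "h'\<in>L2w w"
   hence "(\<lambda>x. h' x + (- (\<mu> + of_real z)) * f x)\<in>L2w w" by (intro L2w_add L2w_cmult True)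
   moreover have "(\<lambda>x. h' x + (- (\<mu> + of_real z)) * f x) = h" by (simp add: h'_def fun_eq_iff algebra_simps)
   ultimately show "h\<in>L2w w" by simp
  next
   assume "h\<in>L2w w"
   thus "h'\<in>L2w w" unfolding h'_def by (intro L2w_add L2w_cmult True)
  qed
  moreover have "J h' = J h + (\<mu> + of_real z) *\<^sub>C J f" if "h\<in>L2w w" unfolding h'_def using that True by (simp add: J_add' J_cscale' L2w_cmult)
  ultimately show ?thesis by auto
 qed simp
 finally show ?thesis .
qed

text \<open>The last nonzero vector of the chain x, B x, B (B x), ... is annihilated by
  \<open>B\<close>, and \<open>v = K (\<zeta> v)\<close> identifies it as an eigenvector for
  \<open>\<zeta> - z\<close>.\<close>

lemma root_vector_eigenvalue:
 assumes x: "((\<lambda>x. x-\<zeta> *\<^sub>C K x) ^^ j) x = 0" "x\<noteq>0"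
 shows "\<zeta>-of_real z\<in>eigenvalues T"
proof -
 define B where "B = (\<lambda>x. x-\<zeta> *\<^sub>C K x)"
 have "\<exists>v. v\<noteq>0\<and>B v = 0" using x unfolding B_def[symmetric]
 proof (induction j arbitrary: x)
  case (Suc j)
  show ?case
  proof (cases "B x = 0")
   case False
   have "(B ^^ j) (B x) = 0" using Suc.prems(1) by (simp add: funpow_swap1)
   from Suc.IH[OF this False] show ?thesis .
  qed (use Suc.prems in blast)
 qed simp
 then obtain v where v: "v\<noteq>0" "v-\<zeta> *\<^sub>C K v = 0" unfolding B_def by blast
 have "v = K (\<zeta> *\<^sub>C v)" using v(2) by (simp add: clinear_map_cscale[OF clinear_map_K])
 hence "(Jinv v, \<lambda>x. 0)\<in>op_shift T (\<zeta>-of_real z)" unfolding op_shift_T_iff by (simp add: Jinv_L2w L2w_zero J_zero)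
 moreover have "\<not> (AE x in lebesgue. Jinv v x = 0)" using J_eq_iff[OF Jinv_L2w[of v] L2w_zero] v(1) by (simp add: J_zero)
 ultimately show ?thesis unfolding eigenvalues_def by (intro CollectI exI[of _ "Jinv v"] exI[of _ "\<lambda>x. 0"]) simp
qed

text \<open>\<open>B (J f) = K y\<close> says that the operator minus \<open>\<zeta> - z\<close>
  maps \<open>f\<close> to \<open>Jinv y\<close>. One step of its chain thus passes from
  \<open>f\<close> to \<open>Jinv y\<close>, and the choice of preimage keeps \<open>y\<close> in
  the kernel of \<open>B ^^ j\<close>.\<close>

lemma root_vector_chain:
 assumes "((\<lambda>x. x-\<zeta> *\<^sub>C K x) ^^ j) (J f) = 0" "f\<in>L2w w"
 shows "\<exists>h. (f, h)\<in>op_shift T (\<zeta>-of_real z) ^^ j\<and>(AE x in lebesgue. h x = 0)" using assms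
proof (induction j arbitrary: f)
 case 0
 have "AE x in lebesgue. f x = 0" using 0 J_eq_iff[OF 0(2) L2w_zero] by (simp add: J_zero)
 thus ?case by (intro exI[of _ f]) simp
next
 case (Suc j)
 define B where "B = (\<lambda>x. x-\<zeta> *\<^sub>C K x)"
 have B: "clinear_map B" unfolding B_def by (rule clinear_map_ident_minus_cscale[OF clinear_map_K])
 have "(B ^^ j) (B (J f)) = 0" using Suc.prems(1) by (simp add: funpow_swap1 B_def[symmetric])
 moreover from root_vector_preimage[OF clinear_map_K B _ this] obtain y where
  y: "B (J f) = K y" "\<forall>m. (B ^^ m) (B (J f)) = 0\<longrightarrow>(B ^^ m) y = 0" unfolding B_def by blast
 ultimately have By: "(B ^^ j) (J (Jinv y)) = 0" by simp
 from Suc.IH[OF this[unfolded B_def] Jinv_L2w] obtain h where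
  h: "(Jinv y, h)\<in>op_shift T (\<zeta>-of_real z) ^^ j" "AE x in lebesgue. h x = 0" by blast
 have "J f = K y + \<zeta> *\<^sub>C K (J f)" using y(1) by (simp add: B_def algebra_simps)
 also have "\<dots> = K (y + \<zeta> *\<^sub>C J f)"
  by (simp add: clinear_map_cscale[OF clinear_map_K] linear_add[OF bounded_linear.linear[OF clinear_map_bounded_linear[OF clinear_map_K]]])
 finally have "(f, Jinv y)\<in>op_shift T (\<zeta>-of_real z)" unfolding op_shift_T_iff using Suc.prems(2) by (simp add: Jinv_L2w)
 from relpow_Suc_I2[OF this h(1)] h(2) show ?case by blast
qed

lemma root_functions_L2w: "root_functions T\<subseteq>L2w w"
proof
 fix f assume "f\<in>root_functions T"
 then obtain \<mu> k h where f: "\<not> (AE x in lebesgue. f x = 0)" "(f, h)\<in>op_shift T \<mu> ^^ k" "AE x in lebesgue. h x = 0" unfolding root_functions_def by blast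
 show "f\<in>L2w w"
 proof (cases k)
  case 0
  thus ?thesis using f by simp
 next
  case (Suc n)
  then obtain g where "(f, g)\<in>op_shift T \<mu>" using f(2) by (auto elim: relpow_E2)
  thus ?thesis by (simp add: op_shift_T_iff)
 qed
qed

lemma dense_Domain: "dense_in_L2w w (Domain T)"
proof -
 have iff: "f\<in>Domain T\<longleftrightarrow>f\<in>L2w w\<and>(\<exists>y. J f = K y)" for f
 proof
  assume "f\<in>Domain T"
  then obtain g where "(f, g)\<in>T" by blast
  hence "(f, \<lambda>x. g x-0 * f x)\<in>op_shift T 0" unfolding op_shift_def by blast
  thus "f\<in>L2w w\<and>(\<exists>y. J f = K y)" unfolding op_shift_T_iff by blast
 next
  assume "f\<in>L2w w\<and>(\<exists>y. J f = K y)"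
  then obtain y where f: "f\<in>L2w w" "J f = K y" by blast
  hence "(f, Jinv y)\<in>op_shift T (- of_real z)" unfolding op_shift_T_iff by (simp add: Jinv_L2w)
  thus "f\<in>Domain T" unfolding op_shift_def by blast
 qed
 have lin: "linear K" by (intro bounded_linear.linear clinear_map_bounded_linear clinear_map_K)
 show ?thesis
 proof (rule dense_in_L2wI)
  show "Domain T\<subseteq>L2w w" by (intro subsetI) (simp only: iff)
  show "(\<lambda>x. f x + g x)\<in>Domain T" if fg: "f\<in>Domain T" "g\<in>Domain T" for f g
  proof -
   obtain y y' where y: "f\<in>L2w w" "J f = K y" "g\<in>L2w w" "J g = K y'" using fg unfolding iff by blast
   hence "J (\<lambda>x. f x + g x) = K (y + y')" by (simp add: J_add' linear_add[OF lin])
   thus ?thesis unfolding iff by (intro conjI L2w_add y exI)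
  qed
  show "(\<lambda>x. complex_of_real a * f x)\<in>Domain T" if f: "f\<in>Domain T" for f a
  proof -
   obtain y where y: "f\<in>L2w w" "J f = K y" using f unfolding iff by blast
   hence "J (\<lambda>x. complex_of_real a * f x) = K (complex_of_real a *\<^sub>C y)" by (simp add: J_cscale' clinear_map_cscale[OF clinear_map_K])
   thus ?thesis unfolding iff by (intro conjI L2w_cmult y exI)
  qed
  have KD: "Jinv (K x)\<in>Domain T" for x unfolding iff J_Jinv using Jinv_L2w by blast
  thus "Domain T\<noteq>{}" by blast
  fix n assume n: "\<And>f. f\<in>Domain T\<Longrightarrow>inner (J f) n = 0"
  have "inner (K x) n = 0" for x using n[OF KD[of x]] by simp
  thus "n = 0" by (rule K_dense_range)
 qed
qed

lemma resolvent_iff: "(g, f)\<in>resolvent T \<mu>\<longleftrightarrow>f\<in>L2w w\<and>g\<in>L2w w\<and>J f = K (J g + (\<mu> + of_real z) *\<^sub>C J f)" unfolding resolvent_def by (simp add: op_shift_T_iff)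

text \<open>At any \<mu> in the resolvent set, \<open>J f\<close> is \<open>K\<close> applied to
  \<open>J g + (\<mu> + z) J f\<close>. This argument is bounded, by the boundedness contained in
  the definition of the resolvent set, so compactness of \<open>K\<close> carries over.\<close>

lemma compact_resolvent: "has_compact_resolvent w T" unfolding has_compact_resolvent_def
proof
 obtain C where C: "C>0" "\<And>x. norm (K x)\<le>norm x * C" using bounded_linear.pos_bounded[OF clinear_map_bounded_linear[OF clinear_map_K]] by blast
 have iff: "(g, f)\<in>resolvent T (- of_real z)\<longleftrightarrow>f\<in>L2w w\<and>g\<in>L2w w\<and>J f = K (J g)" for f g unfolding resolvent_iff by simp
 have "- of_real z\<in>resolvent_set w T" unfolding resolvent_set_def
 proof (intro CollectI conjI allI impI)
  show "Domain (resolvent T (- of_real z)) = L2w w"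
  proof (intro equalityI subsetI)
   fix g :: "real\<Rightarrow>complex" assume g: "g\<in>L2w w"
   have "(g, Jinv (K (J g)))\<in>resolvent T (- of_real z)" unfolding iff using g by (simp add: Jinv_L2w)
   thus "g\<in>Domain (resolvent T (- of_real z))" by blast
  next
   fix g :: "real\<Rightarrow>complex" assume "g\<in>Domain (resolvent T (- of_real z))"
   then obtain f where "(g, f)\<in>resolvent T (- of_real z)" by blast
   thus "g\<in>L2w w" unfolding iff by blast
  qed
  show "AE x in lebesgue. f x = h x" if "(g, f)\<in>resolvent T (- of_real z)\<and>(g, h)\<in>resolvent T (- of_real z)" for g f h
  proof -
   have f: "f\<in>L2w w" "h\<in>L2w w" "J f = J h" using that unfolding iff by auto
   thus ?thesis using J_eq_iff by blast
  qed
  show "\<exists>C. \<forall>(g, f)\<in>resolvent T (- of_real z). normw w f\<le>C * normw w g"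
  proof (intro exI[of _ C] ballI, clarify)
   fix g f assume "(g, f)\<in>resolvent T (- of_real z)"
   hence "f\<in>L2w w" "g\<in>L2w w" "J f = K (J g)" unfolding iff by auto
   thus "normw w f\<le>C * normw w g" using C(2)[of "J g"] by (simp add: normw_eq' mult.commute)
  qed
 qed
 thus "resolvent_set w T\<noteq>{}" by blast
 show "\<forall>\<mu>\<in>resolvent_set w T. compact_op w (resolvent T \<mu>)" unfolding compact_op_def
 proof (intro ballI allI impI)
  fix \<mu> and g f :: "nat\<Rightarrow>real\<Rightarrow>complex" and b :: real
  assume \<mu>: "\<mu>\<in>resolvent_set w T" and gf: "\<forall>n. (g n, f n)\<in>resolvent T \<mu>\<and>normw w (g n)\<le>b"
  obtain C1 where C1: "\<forall>(g, f)\<in>resolvent T \<mu>. normw w f\<le>C1 * normw w g" using \<mu> unfolding resolvent_set_def by blast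
  have gfL: "f n\<in>L2w w" "g n\<in>L2w w" "J (f n) = K (J (g n) + (\<mu> + of_real z) *\<^sub>C J (f n))" for n using gf unfolding resolvent_iff by blast+
  have gb: "norm (J (g n))\<le>b" for n using gf gfL(2)[of n] by (simp add: normw_eq'[symmetric])
  have fb: "norm (J (f n))\<le>\<bar>C1\<bar> * b" for n
  proof -
   have "norm (J (f n))\<le>C1 * norm (J (g n))" using C1 gf gfL[of n] by (auto simp: normw_eq'[symmetric])
   also have "\<dots>\<le>\<bar>C1\<bar> * b" using gb[of n] by (intro mult_mono) auto
   finally show ?thesis .
  qed
  define y where "y n = J (g n) + (\<mu> + of_real z) *\<^sub>C J (f n)" for n
  have "norm (y n)\<le>b + cmod (\<mu> + of_real z) * (\<bar>C1\<bar> * b)" for n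
  proof -
   have "norm (y n)\<le>norm (J (g n)) + cmod (\<mu> + of_real z) * norm (J (f n))" unfolding y_def by (rule order_trans[OF norm_triangle_ineq]) simp
   thus ?thesis using gb[of n] mult_left_mono[OF fb[of n], of "cmod (\<mu> + of_real z)"] by simp
  qed
  hence "bounded (range y)" by (intro boundedI) blast
  with compact_map_K obtain l and r :: "nat\<Rightarrow>nat" where lr: "strict_mono r" "(\<lambda>n. K (y (r n)))\<longlonglongrightarrow>l" by (rule compact_mapD)
  show "\<exists>h\<in>L2w w. \<exists>r::nat\<Rightarrow>nat. strict_mono r\<and>(\<lambda>n. normw w (\<lambda>x. f (r n) x-h x))\<longlonglongrightarrow>0"
  proof (intro bexI[of _ "Jinv l"] exI[of _ r] conjI lr(1) Jinv_L2w)
   have "normw w (\<lambda>x. f (r n) x-Jinv l x) = norm (K (y (r n))-l)" for n unfolding normw_diff[OF gfL(1) Jinv_L2w] J_Jinv y_def using gfL(3)[of "r n"] by metis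
   thus "(\<lambda>n. normw w (\<lambda>x. f (r n) x-Jinv l x))\<longlonglongrightarrow>0" using tendsto_norm_zero[OF LIM_zero[OF lr(2)]] by simp
  qed
 qed
qed

text \<open>The vector x - \<zeta> K' x is paired with y = x/cnj m, for which (K' x, y) = (y, m K y)
  has nonnegative real part. A rotation that takes \<zeta> to the negative axis makes this term
  favourable, and (a x, y) keeps a positive share of the square of the norm because \<open>m\<close>
  is within \<delta> of 1.\<close>

lemma adjoint_sector_bound:
 assumes K': "clinear_map K'" "\<And>x y. inner (K x) y = inner x (K' y)"
  and b: "pi/2<b" "b<pi" "2 * \<delta>\<le>- cos b" and \<zeta>: "\<bar>Arg \<zeta>\<bar>\<ge>b" "\<zeta>\<noteq>0"
 shows "- cos b/4 * norm x\<le>norm (x-\<zeta> *\<^sub>C K' x)"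
proof -
 define m where "m t = 1 + \<i> * complex_of_real (\<delta> * \<Phi> t)" for t
 have \<delta>1: "\<bar>\<delta>\<bar>\<le>1" using \<delta> by simp
 have bm: "bdd_fun 2 m" unfolding m_def by (rule bdd_m[OF \<delta>1])
 have Rem: "Re (m t) = 1" "Im (m t) = \<delta> * \<Phi> t" for t by (simp_all add: m_def)
 have m0: "m t\<noteq>0" for t using Rem(1)[of t] by auto
 have m1: "cmod (m t)\<ge>1" for t using complex_Re_le_cmod[of "m t"] Rem(1)[of t] by simp
 have mm: "m\<in>borel_measurable lebesgue" using bm by (simp add: bdd_fun_def)
 have bcm: "bdd_fun 2 (\<lambda>t. cnj (m t))" using bm unfolding bdd_fun_def complex_mod_cnj by (intro conjI borel_measurable_cnj) auto
 have binv: "bdd_fun 1 (\<lambda>t. 1/cnj (m t))" unfolding bdd_fun_def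
 proof (intro conjI AE_I2)
  show "(\<lambda>t. 1/cnj (m t))\<in>borel_measurable lebesgue" using mm by measurable
  show "cmod (1/cnj (m t))\<le>1" for t using m1[of t] by (simp add: norm_divide divide_le_eq)
 qed
 define y where "y = mulop (\<lambda>t. 1/cnj (m t)) x"
 have xy: "x = mulop (\<lambda>t. cnj (m t)) y"
 proof (rule l2_eqI)
  show "AE t in lebesgue. rep x t = rep (mulop (\<lambda>t. cnj (m t)) y) t" using AE_rep_mulop[OF bcm, of y] AE_rep_mulop[OF binv, of x]
  proof eventually_elim
   case (elim t)
   show ?case unfolding elim(1) unfolding y_def elim(2) using m0[of t] by simp
  qed
 qed
 have pos: "inner (K' x) y\<ge>0"
 proof -
  have "inner (K' x) y = inner x (K y)" by (metis K'(2) inner_commute)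
  also have "\<dots> = inner y (mulop m (K y))" unfolding xy[symmetric] using inner_mulop_cnj[OF bm, of y "K y"] by (simp add: xy[symmetric])
  finally show ?thesis using inner_K_M_nonneg[of y] by (simp add: m_def[abs_def])
 qed
 \<comment> \<open>The unimodular factor that turns \<zeta> into \<open>- cmod \<zeta>\<close>; its
   real part is \<open>- cos (Arg \<zeta>)\<close>.\<close>
 define a where "a =-cnj \<zeta>/of_real (cmod \<zeta>)"
 have cz: "cmod \<zeta>>0" using \<zeta>(2) by simp
 have a1: "cmod a = 1" using cz by (simp add: a_def norm_divide)
 have a\<zeta>: "a * \<zeta> =-complex_of_real (cmod \<zeta>)"
 proof -
  have "cnj \<zeta> * \<zeta> = complex_of_real (cmod \<zeta>) * complex_of_real (cmod \<zeta>)" using complex_norm_square[of \<zeta>] by (simp add: power2_eq_square mult.commute)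
  thus ?thesis using cz by (simp add: a_def)
 qed
 \<comment> \<open>Between \<open>b\<close> and pi the cosine decreases, so it is at most
   \<open>cos b\<close>, which is negative.\<close>
 have Rea: "Re a\<ge>- cos b"
 proof -
  have "Re \<zeta> = cmod \<zeta> * cos (Arg \<zeta>)" using Arg_eq[OF \<zeta>(2)] by (metis Re_rcis rcis_cmod_Arg)
  also have "cos (Arg \<zeta>) = cos \<bar>Arg \<zeta>\<bar>" by simp
  also have "cmod \<zeta> * cos \<bar>Arg \<zeta>\<bar>\<le>cmod \<zeta> * cos b" using \<zeta>(1) b mpi_less_Arg[of \<zeta>] Arg_le_pi[of \<zeta>] cz by (intro mult_left_mono cos_monotone_0_pi_le) auto
  finally show ?thesis using cz by (simp add: a_def field_simps)
 qed
 have Rexy: "inner (a *\<^sub>C x) y\<ge>- cos b/4 * (norm x)\<^sup>2"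
 proof -
  have s: "sq_int (\<lambda>t. a * rep x t)" "sq_int (\<lambda>t. 1/cnj (m t) * rep x t)" by (rule sq_int_mult_const[OF sq_int_rep], rule sq_int_mult_bdd[OF binv sq_int_rep])
  have i: "integrable lebesgue (\<lambda>t. a * rep x t * cnj (1/cnj (m t) * rep x t))" by (rule integrable_mult_cnj_sq_int[OF s])
  have ptw: "- cos b/4 * (cmod (rep x t))\<^sup>2\<le>Re (a * rep x t * cnj (1/cnj (m t) * rep x t))" for t
  proof -
   have "a * rep x t * cnj (1/cnj (m t) * rep x t) = (a/m t) * (rep x t * cnj (rep x t))" by (simp add: mult_ac)
   also have "rep x t * cnj (rep x t) = complex_of_real ((cmod (rep x t))\<^sup>2)" by (rule complex_norm_square[symmetric])
   finally have eq: "a * rep x t * cnj (1/cnj (m t) * rep x t) = (a/m t) * complex_of_real ((cmod (rep x t))\<^sup>2)" .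
   have Rr: "Re (v * complex_of_real r) = Re v * r" for v r by simp
   have "Re (a/m t)\<ge>- cos b/4"
   proof -
    have d: "\<bar>\<delta> * \<Phi> t\<bar>\<le>\<delta>" using \<delta> \<Phi>(1)[of t] by (simp add: abs_mult mult_left_le)
    have "(\<delta> * \<Phi> t)\<^sup>2\<le>\<delta>\<^sup>2" using d by (metis abs_le_square_iff abs_of_pos \<delta>(1))
    also have "\<dots>\<le>1" using \<delta> by (simp add: power_le_one)
    finally have d2: "(\<delta> * \<Phi> t)\<^sup>2\<le>1" .
    have "\<bar>Im a\<bar>\<le>1" using abs_Im_le_cmod[of a] a1 by simp
    hence "\<bar>Im a * (\<delta> * \<Phi> t)\<bar>\<le>1 * \<delta>" unfolding abs_mult[of "Im a"] by (rule mult_mono[OF _ d]) auto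
    \<comment> \<open>\<open>2 * \<delta> \<le> - cos b\<close> leaves half of
      \<open>- cos b\<close> in the numerator, and the denominator is at most 2, whence the
      quarter.\<close>
    hence num: "Re a + Im a * (\<delta> * \<Phi> t)\<ge>- cos b/2" using Rea b(3) by linarith
    have cb: "- cos b>0" using \<delta> b(3) by linarith
    have "- cos b/4 = (- cos b/2)/2" by simp
    also have "\<dots>\<le>(Re a + Im a * (\<delta> * \<Phi> t))/(1 + (\<delta> * \<Phi> t)\<^sup>2)" using num d2 cb by (intro frac_le) (auto simp: add_pos_nonneg)
    also have "\<dots> = Re (a/m t)" by (simp add: Re_divide Rem)
    finally show ?thesis .
   qed
   thus ?thesis unfolding eq Rr by (rule mult_right_mono) simp
  qed
  have "- cos b/4 * (norm x)\<^sup>2 = (LINT t|lebesgue.-cos b/4 * (cmod (rep x t))\<^sup>2)" by (simp add: norm_l2_sq)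
  also have "\<dots>\<le>(LINT t|lebesgue. Re (a * rep x t * cnj (1/cnj (m t) * rep x t)))"
  proof (rule integral_mono[OF _ integrable_Re[OF i] ptw])
   show "integrable lebesgue (\<lambda>t.-cos b/4 * (cmod (rep x t))\<^sup>2)" using sq_int_rep[of x] unfolding sq_int_def by (intro integrable_mult_right) auto
  qed
  also have "\<dots> = Re (LINT t|lebesgue. a * rep x t * cnj (1/cnj (m t) * rep x t))" by (rule integral_Re[OF i])
  also have "\<dots> = Re (cinner (emb (\<lambda>t. a * rep x t)) (emb (\<lambda>t. 1/cnj (m t) * rep x t)))" by (simp only: cinner_emb[OF s])
  also have "\<dots> = inner (a *\<^sub>C x) y" unfolding emb_cscale[OF sq_int_rep] emb_rep y_def mulop_def by (rule Re_cinner)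
  finally show ?thesis .
 qed
 have "a *\<^sub>C (x-\<zeta> *\<^sub>C K' x) = a *\<^sub>C x + cmod \<zeta> *\<^sub>R K' x" unfolding cscale.diff_right cscale_cscale a\<zeta> by (simp add: cscale_minus_left cscale_of_real)
 hence "inner (a *\<^sub>C (x-\<zeta> *\<^sub>C K' x)) y = inner (a *\<^sub>C x) y + cmod \<zeta> * inner (K' x) y" by (simp add: inner_add_left)
 hence "- cos b/4 * (norm x)\<^sup>2\<le>inner (a *\<^sub>C (x-\<zeta> *\<^sub>C K' x)) y" using Rexy mult_nonneg_nonneg[OF less_imp_le[OF cz] pos] by linarith
 also have "\<dots>\<le>norm (a *\<^sub>C (x-\<zeta> *\<^sub>C K' x)) * norm y" by (rule norm_cauchy_schwarz)
 also have "\<dots>\<le>norm (x-\<zeta> *\<^sub>C K' x) * norm x" using norm_mulop_le[OF binv, of x] by (simp add: a1 y_def mult_left_mono)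
 finally have le: "(- cos b/4 * norm x) * norm x\<le>norm (x-\<zeta> *\<^sub>C K' x) * norm x" by (simp add: power2_eq_square[of "norm x"])
 show ?thesis
 proof (cases "x = 0")
  case False
  with le show ?thesis by (simp only: mult_le_cancel_right) simp
 qed simp
qed

text \<open>\<open>b/(2 * \<beta>) < pi/2\<close> is the Phragmen-Lindelof condition for the
  exponent \<open>q = 2 * \<beta>\<close>, and \<open>2 * \<delta> \<le> - cos b\<close> is what the
  sector bound asks of the multiplier.\<close>

theorem root_functions_dense:
 assumes b: "pi/2<b" "b<pi" "b/(2 * \<beta>)<pi/2" "2 * \<delta>\<le>- cos b"
 shows "dense_in_L2w w (linear_span (root_functions T))"
proof (rule dense_in_L2wI)
 show "linear_span (root_functions T)\<subseteq>L2w w" by (rule linear_span_L2w[OF root_functions_L2w])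
 have "(\<lambda>x. 0)\<in>linear_span (root_functions T)" unfolding linear_span_def by (intro CollectI exI[of _ "0::nat"]) auto
 thus "linear_span (root_functions T)\<noteq>{}" by blast
 fix n assume n: "\<And>f. f\<in>linear_span (root_functions T)\<Longrightarrow>inner (J f) n = 0"
 \<comment> \<open>A nonzero vector annihilated by a power of \<open>1 - \<zeta> K\<close> comes,
   through \<open>Jinv\<close>, from a root function, so \<open>n\<close> is orthogonal to
   it.\<close>
 have n': "inner n x = 0" if x: "((\<lambda>x. x-\<zeta> *\<^sub>C K x) ^^ j) x = 0" for \<zeta> j x
 proof (cases "x = 0")
  case False
  from x have xJ: "((\<lambda>x. x-\<zeta> *\<^sub>C K x) ^^ j) (J (Jinv x)) = 0" by simp
  have "\<not> (AE t in lebesgue. Jinv x t = 0)" using J_eq_iff[OF Jinv_L2w[of x] L2w_zero] False by (simp add: J_zero)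
  with root_vector_eigenvalue[OF x False] root_vector_chain[OF xJ Jinv_L2w]
  have "Jinv x\<in>root_functions T" unfolding root_functions_def by blast
  from n[OF linear_span_base[OF this]] show ?thesis by (simp add: inner_commute)
 qed simp
 obtain K' where K': "clinear_map K'" "\<And>x y. inner (K x) y = inner x (K' y)" using ex_clinear_adjoint[OF clinear_map_K] by blast
 obtain C where C: "C>0" "\<forall>N\<ge>1. \<exists>e. \<forall>x. (\<forall>i<N. cinner x (e i) = 0)\<longrightarrow>K_small C N e x" using K_approximation_numbers by blast
 have cb: "- cos b/4>0" using b(4) \<delta> by linarith
 show "n = 0"
 proof (rule orthogonal_root_vectors_eq_0[OF clinear_map_K compact_map_K K_dense_range K'(1,2) _ C(1) _ _ b(2,3) cb])
  show "1<2 * \<beta>" using \<gamma> by (simp add: \<beta>_def field_simps)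
  show "0<b" using b(1) pi_gt_zero by linarith
  show "\<exists>e::nat\<Rightarrow>l2. \<forall>x y. (\<forall>i<N. cinner x (e i) = 0)\<longrightarrow>(\<forall>i<N. cinner y (e i) = 0) \<longrightarrow>
    cmod (cinner (K x) y)\<le>C * real N powr (- (2 * \<beta>)) * norm x * norm y" if N: "N\<ge>1" for N
  proof -
   from C(2) N obtain e :: "nat\<Rightarrow>l2" where e: "\<forall>x. (\<forall>i<N. cinner x (e i) = 0)\<longrightarrow>K_small C N e x" by blast
   show ?thesis
   proof (intro exI[of _ e] allI impI)
    fix x y assume x: "\<forall>i<N. cinner x (e i) = 0" and y: "\<forall>i<N. cinner y (e i) = 0"
    from e x have "K_small C N e x" by blast
    with y show "cmod (cinner (K x) y)\<le>C * real N powr (- (2 * \<beta>)) * norm x * norm y" unfolding K_small_def by blast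
   qed
  qed
  show "- cos b/4 * norm x\<le>norm (x-\<zeta> *\<^sub>C K' x)" if "b\<le>\<bar>Arg \<zeta>\<bar>" "\<zeta>\<noteq>0" for x \<zeta> by (rule adjoint_sector_bound[OF K'(1,2) b(1,2,4) that])
 qed (use n' in auto)
qed (auto intro: linear_span_add linear_span_cmult)

end

section \<open>Choice of the angle, the multiplier and the shift\<close>

theorem proposition4p1:
  fixes \<gamma> \<alpha> c :: real
    and V :: "real \<Rightarrow> complex"
    and w \<Phi> \<Phi>' R :: "real \<Rightarrow> real"
  assumes "\<gamma> > 2"
    and "locally_square_integrable V"
    and "AE x in lebesgue. Re (V x) \<ge> 0"
    and "c > 0"
    and "AE x in lebesgue. cmod (V x) + 1 \<ge> c * japanese_bracket x powr \<gamma>"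
    and "0 < \<alpha>" and "\<alpha> < 1 + \<gamma> / 2"
    and "w = (\<lambda>x. exp (japanese_bracket x powr \<alpha>)) \<or>
         w = (\<lambda>x. exp (- (japanese_bracket x powr \<alpha>)))"
    and "\<forall>x. \<Phi> x \<in> {-1..1}"
    and "weak_derivative \<Phi> \<Phi>'"
    and "\<forall>\<epsilon>>0. \<exists>C\<ge>0. AE x in lebesgue. \<bar>\<Phi>' x\<bar> \<le> \<epsilon> * sqrt (cmod (V x)) + C"
    and "locally_integrable R"
    and "AE x in lebesgue. R x \<ge> 0"
    and "AE x in lebesgue. \<Phi> x * Im (V x) \<ge> \<bar>Im (V x)\<bar> - R x"
    and "\<forall>\<epsilon>>0. \<exists>C\<ge>0. \<forall>f\<in>(test_functions :: (real \<Rightarrow> complex) set).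
           (normw w (\<lambda>x. sqrt (R x) *\<^sub>R f x))\<^sup>2
             \<le> \<epsilon> * (normw w (vderiv f))\<^sup>2
               + \<epsilon> * (normw w (\<lambda>x. sqrt (cmod (V x)) *\<^sub>R f x))\<^sup>2
               + C * (normw w f)\<^sup>2"
  shows "dense_in_L2w w (Domain (schroedinger_op w V)) \<and>
         has_compact_resolvent w (schroedinger_op w V) \<and>
         dense_in_L2w w (linear_span (root_functions (schroedinger_op w V)))"
proof -
  obtain s :: real where s: "\<bar>s\<bar> = 1" "w = (\<lambda>x. exp (s * japanese_bracket x powr \<alpha>))"
  proof -
    from assms(8) show ?thesis
    proof
      assume "w = (\<lambda>x. exp (japanese_bracket x powr \<alpha>))"
      thus ?thesis by (intro that[of 1]) simp_all
    next
      assume "w = (\<lambda>x. exp (- (japanese_bracket x powr \<alpha>)))"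
      thus ?thesis by (intro that[of "-1"]) simp_all
    qed
  qed
  interpret weighted_schroedinger \<gamma> \<alpha> c s V w \<Phi> \<Phi>' R
    by unfold_locales (use assms s in \<open>auto simp: abs_le_iff\<close>)
  \<comment> \<open>The half-angle \<open>b\<close> has to exceed pi/2 for the sector bound and to
    stay below pi and below \<open>2 * \<beta>\<close> times pi/2 for Phragmen-Lindelof. There is
    room because \<gamma> > 2 means \<open>2 * \<beta> > 1\<close>.\<close>
  define \<eta> where "\<eta> = min (1 / 2) ((2 * \<beta> - 1) / 2)"
  define b where "b = pi / 2 * (1 + \<eta>)"
  have \<beta>: "2 * \<beta> > 1" using \<gamma> by (simp add: \<beta>_def field_simps)
  have \<eta>: "0 < \<eta>" "\<eta> \<le> 1 / 2" "1 + \<eta> < 2 * \<beta>" using \<beta> by (simp_all add: \<eta>_def min_def field_simps)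
  have "pi / 2 * 1 < b" unfolding b_def using \<eta> by (intro mult_strict_left_mono) auto
  hence b1: "pi / 2 < b" by simp
  have "b < pi / 2 * 2" unfolding b_def using \<eta> by (intro mult_strict_left_mono) auto
  hence b2: "b < pi" by simp
  have "b < pi / 2 * (2 * \<beta>)" unfolding b_def using \<eta> by (intro mult_strict_left_mono) auto
  hence b3: "b / (2 * \<beta>) < pi / 2" using \<beta> by (simp add: divide_less_eq)
  have "cos b < cos (pi / 2)" using b1 b2 by (intro cos_monotone_0_pi) auto
  hence cb: "- cos b > 0" by simp
  obtain B where B: "B > 0" "\<And>U. norm (PH U) \<le> norm U * B"
    using bounded_linear.pos_bounded[OF clinear_map_bounded_linear[OF clinear_map_PH]] by blast
  \<comment> \<open>The three bounds serve, in this order, the coercivity estimate, the surjectivity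
    of \<open>M \<delta>\<close> and the sector bound.\<close>
  define \<delta> where "\<delta> = min (1 / 4) (min (1 / (2 * B)) (- cos b / 2))"
  have "\<delta> \<le> 1 / (2 * B)" "\<delta> \<le> - cos b / 2" unfolding \<delta>_def by (intro min.coboundedI2 min.cobounded1 min.cobounded2)+
  moreover have "0 < \<delta>" "\<delta> \<le> 1 / 4" using B(1) cb by (simp_all add: \<delta>_def)
  ultimately have \<delta>': "0 < \<delta>" "\<delta> \<le> 1 / 4" "\<delta> \<le> 1 / (2 * B)" "2 * \<delta> \<le> - cos b" by linarith+
  \<comment> \<open>The shift comes last, since the threshold of the coercivity estimate depends on
    \<delta>.\<close>
  obtain z where z: "z > 0" "\<And>U. U \<in> form_domain \<Longrightarrow> \<delta> / 4 * (norm U)\<^sup>2 \<le> form z U (M \<delta> U)"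
    using form_coercive[OF \<delta>'(1,2)] by blast
  have \<delta>PH: "\<delta> * norm (PH U) \<le> norm U / 2" for U
  proof -
    have "\<delta> * norm (PH U) \<le> 1 / (2 * B) * (norm U * B)" using \<delta>' B by (intro mult_mono) auto
    thus ?thesis using B(1) by simp
  qed
  interpret coercive_form \<gamma> \<alpha> c s V w \<Phi> \<Phi>' R \<delta> z
    by unfold_locales (use \<delta>' \<delta>PH z in auto)
  show ?thesis by (intro conjI dense_Domain compact_resolvent root_functions_dense[OF b1 b2 b3 \<delta>'(4)])
qed

end
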